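(* Let $d\ge 3$ and let $K$ be an algebraically closed field of characteristic $p$, where $p=0$ or $p>d$. Let $X_d\subset\mathbb{P}^3(K)$ be a smooth surface of degree $d$, and let $\ell(X_d)$ denote the number of lines contained in $X_d$. Then $$\ell(X_d)\le 11d^2-30d+18 .$$ *)

theory Defs
  imports "HOL-Computational_Algebra.Polynomial"
begin

text \<open>Points of K^4 are 4-tuples. A homogeneous form of degree d in x0..x3 is given
by a coefficient function on exponent vectors (i,j,k,l); only the exponents with
i+j+k+l = d are used.\<close>

type_synonym 'a pt4 = "'a \<times> 'a \<times> 'a \<times> 'a"
type_synonym 'a form4 = "nat \<times> nat \<times> nat \<times> nat \<Rightarrow> 'a"

definition mons :: "nat \<Rightarrow> (nat \<times> nat \<times> nat \<times> nat) set" where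
  "mons d = {(i,j,k,l). i + j + k + l = d}"

definition monom_eval :: "nat \<times> nat \<times> nat \<times> nat \<Rightarrow> 'a::comm_ring_1 pt4 \<Rightarrow> 'a" where
  "monom_eval m x = (case m of (i,j,k,l) \<Rightarrow> case x of (x0,x1,x2,x3) \<Rightarrow>
      x0 ^ i * x1 ^ j * x2 ^ k * x3 ^ l)"

definition form_eval :: "nat \<Rightarrow> 'a::comm_ring_1 form4 \<Rightarrow> 'a pt4 \<Rightarrow> 'a" where
  "form_eval d c x = (\<Sum>m\<in>mons d. c m * monom_eval m x)"

definition pderiv0 :: "nat \<Rightarrow> 'a::comm_ring_1 form4 \<Rightarrow> 'a form4" where
  "pderiv0 d c = (\<lambda>(i,j,k,l). of_nat (Suc i) * c (Suc i, j, k, l))"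
definition pderiv1 :: "nat \<Rightarrow> 'a::comm_ring_1 form4 \<Rightarrow> 'a form4" where
  "pderiv1 d c = (\<lambda>(i,j,k,l). of_nat (Suc j) * c (i, Suc j, k, l))"
definition pderiv2 :: "nat \<Rightarrow> 'a::comm_ring_1 form4 \<Rightarrow> 'a form4" where
  "pderiv2 d c = (\<lambda>(i,j,k,l). of_nat (Suc k) * c (i, j, Suc k, l))"
definition pderiv3 :: "nat \<Rightarrow> 'a::comm_ring_1 form4 \<Rightarrow> 'a form4" where
  "pderiv3 d c = (\<lambda>(i,j,k,l). of_nat (Suc l) * c (i, j, k, Suc l))"

definition smooth_surface :: "nat \<Rightarrow> 'a::comm_ring_1 form4 \<Rightarrow> bool" where
  "smooth_surface d c \<longleftrightarrow>
     (\<exists>m\<in>mons d. c m \<noteq> 0) \<and>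
     (\<forall>x. x \<noteq> (0,0,0,0) \<longrightarrow>
        \<not> (form_eval d c x = 0 \<and>
            form_eval (d - 1) (pderiv0 d c) x = 0 \<and>
            form_eval (d - 1) (pderiv1 d c) x = 0 \<and>
            form_eval (d - 1) (pderiv2 d c) x = 0 \<and>
            form_eval (d - 1) (pderiv3 d c) x = 0))"

definition lincomb :: "'a::comm_ring_1 \<Rightarrow> 'a pt4 \<Rightarrow> 'a \<Rightarrow> 'a pt4 \<Rightarrow> 'a pt4" where
  "lincomb a u b v = (case u of (u0,u1,u2,u3) \<Rightarrow> case v of (v0,v1,v2,v3) \<Rightarrow>
     (a*u0 + b*v0, a*u1 + b*v1, a*u2 + b*v2, a*u3 + b*v3))"

text \<open>A line of P^3 is represented by the corresponding 2-dimensional linear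
subspace of K^4, i.e. the span of two linearly independent vectors.\<close>
definition proj_line :: "'a::comm_ring_1 pt4 set \<Rightarrow> bool" where
  "proj_line L \<longleftrightarrow> (\<exists>u v. (\<forall>a b. lincomb a u b v = (0,0,0,0) \<longrightarrow> a = 0 \<and> b = 0) \<and>
                          L = {lincomb a u b v | a b. True})"

definition lines_on :: "nat \<Rightarrow> 'a::comm_ring_1 form4 \<Rightarrow> 'a pt4 set set" where
  "lines_on d c = {L. proj_line L \<and> (\<forall>x\<in>L. form_eval d c x = 0)}"

end

theory Submission
  imports Defs "HOL-Analysis.Determinants" "Berlekamp_Zassenhaus.Unique_Factorization_Poly" "Jordan_Normal_Form.Determinant"
begin

text \<open>
A line on the surface has contact of infinite order, so all lines lie on the flecnodal divisor, cut out by Clebsch's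
form Phi of degree 11d - 24. Call a line of the second kind if the other asymptotic direction is also flecnodal
along it: then the flecnodal divisor contains it with multiplicity at least two, whereas Phi does not vanish on the whole
surface as soon as one line is of the first kind. The multiplicities are counted by intersecting with a generic quadric
through a chain of three lines l1, l3, l2 with l1, l2 skew and l3 meeting both. Such a quadric is a product of two
projective lines, where Bezout bounds the common zeros of the equation of the surface and Phi, once their factors along
the chain have been removed; a line of the surface meeting none (one) of the l_i contributes two (one) points.

If the l_i are three lines of the first kind, each of which meets at most 8d - 14 others (Segre), this is exactly the
bound 11d^2 - 30d + 18. If there is no such chain, intersections with generic quadrics and with quadrics through two skew
lines show that a surface with more lines would have three skew lines of the second kind having far more than d + 1
common transversals on the surface. If all lines are of the second kind, a form of degree 8d - 14 replaces Phi.
\<close>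

text \<open>The classical argument counts intersections with multiplicity and moves quadrics into
  general position; here both are reduced to polynomials in one or two variables. Multiplicity two
  becomes a first-order statement: the derivative of the flecnodal form vanishes on the tangent
  plane at almost every point of the line. It is read off by evaluating the form at a point over the
  dual numbers, which is why the frame identities are proved over arbitrary commutative rings. That
  the form does not vanish on the whole surface is also decided along one line: its transverse
  derivative there is, up to a nonzero factor, \<open>schw\<close> times \<open>W\<close>, whereas a
  multiple of the prime equation has zero derivative on tangent vectors. Most nondegeneracy claims
  rest on one rigidity fact, \<open>NLS\<close>: the normal bundle of a line in a smooth surface of
  degree d is O(2-d), without sections for d at least 3. It excludes planes and rulings inside the
  surface, moving families of lines, and linear fields of directions that stay tangent to the
  surface along a line without lying in it.\<close>

no_notation vec_index (infixl "$" 100)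
hide_const (open) Matrix.vec Determinant.det Polynomial.content Matrix.row Matrix.col
  Divisibility.irreducible Divisibility.prime Coset.order

section \<open>Forms and their polarised derivatives\<close>

lemmas cart_eq = Finite_Cartesian_Product.vec_eq_iff

definition ev :: "nat \<Rightarrow> 'a::comm_ring_1 form4 \<Rightarrow> 'a^4 \<Rightarrow> 'a" where
  "ev d c x = form_eval d c (x$1, x$2, x$3, x$4)"

definition pd :: "4 \<Rightarrow> 'a::comm_ring_1 form4 \<Rightarrow> 'a form4" where
  "pd i c = (if i = 1 then pderiv0 0 c else if i = 2 then pderiv1 0 c
     else if i = 3 then pderiv2 0 c else pderiv3 0 c)"

text \<open>\<open>form_eval\<close> sees only exponents of total degree d, but formal derivatives
  shift exponents. With zero coefficients elsewhere the truncated degree \<open>d - 1\<close> is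
  harmless at d = 0: all derivatives of a constant form vanish.\<close>

definition supp4 :: "nat \<Rightarrow> 'a::comm_ring_1 form4 \<Rightarrow> bool" where
  "supp4 d c \<longleftrightarrow> (\<forall>m. m \<notin> mons d \<longrightarrow> c m = 0)"

text \<open>Iterated directional derivatives at x, kept multilinear and free of factorials, so that
  the Leibniz and Euler rules hold over every commutative ring.\<close>

definition D1 :: "nat \<Rightarrow> 'a::comm_ring_1 form4 \<Rightarrow> 'a^4 \<Rightarrow> 'a^4 \<Rightarrow> 'a" where
  "D1 d c x v = (\<Sum>i\<in>UNIV. v$i * ev (d - 1) (pd i c) x)"
definition D2 :: "nat \<Rightarrow> 'a::comm_ring_1 form4 \<Rightarrow> 'a^4 \<Rightarrow> 'a^4 \<Rightarrow> 'a^4 \<Rightarrow> 'a" where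
  "D2 d c x v w = (\<Sum>i\<in>UNIV. v$i * D1 (d - 1) (pd i c) x w)"
definition D3 :: "nat \<Rightarrow> 'a::comm_ring_1 form4 \<Rightarrow> 'a^4 \<Rightarrow> 'a^4 \<Rightarrow> 'a^4 \<Rightarrow> 'a^4 \<Rightarrow> 'a" where
  "D3 d c x u v w = (\<Sum>i\<in>UNIV. u$i * D2 (d - 1) (pd i c) x v w)"
definition D4 :: "nat \<Rightarrow> 'a::comm_ring_1 form4 \<Rightarrow> 'a^4 \<Rightarrow> 'a^4 \<Rightarrow> 'a^4 \<Rightarrow> 'a^4 \<Rightarrow> 'a^4 \<Rightarrow> 'a" where
  "D4 d c x t u v w = (\<Sum>i\<in>UNIV. t$i * D3 (d - 1) (pd i c) x u v w)"

lemma finite_mons [simp]: "finite (mons d)"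
proof (rule finite_subset)
  show "mons d \<subseteq> {..d} \<times> {..d} \<times> {..d} \<times> {..d}" by (auto simp: mons_def)
qed auto

lemma pd_commute: "pd i (pd j c) = pd j (pd i c)"
  by (auto simp: pd_def pderiv0_def pderiv1_def pderiv2_def pderiv3_def fun_eq_iff)

lemma supp4_pd: "supp4 d c \<Longrightarrow> supp4 (d - 1) (pd i c)"
  by (cases d) (auto simp: supp4_def mons_def pd_def pderiv0_def pderiv1_def pderiv2_def pderiv3_def)

text \<open>Raising one exponent matches the derivative of the coefficients with the derivative of
  the monomials; the monomials outside the image have exponent 0 and are killed by the factor
  \<open>of_nat i\<close>.\<close>

lemma shift0: assumes "supp4 d c"
  shows "(\<Sum>(i,j,k,l)\<in>mons d. c (i,j,k,l) * (of_nat i * x0^(i-1) * x1^j * x2^k * x3^l))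
       = form_eval (d - 1) (pderiv0 d' c) (x0,x1,x2,x3)"
proof (cases d)
  case 0
  then show ?thesis using assms by (auto simp: mons_def form_eval_def pderiv0_def supp4_def)
next
  case (Suc n)
  let ?s = "\<lambda>(i,j,k,l). (Suc i,j,k,l)"
  have "form_eval (d - 1) (pderiv0 d' c) (x0,x1,x2,x3)
     = (\<Sum>(i,j,k,l)\<in>?s ` mons n. c (i,j,k,l) * (of_nat i * x0^(i-1) * x1^j * x2^k * x3^l))"
    by (subst sum.reindex) (auto simp: inj_on_def form_eval_def Suc pderiv0_def monom_eval_def algebra_simps split_def intro!: sum.cong)
  also have "\<dots> = (\<Sum>(i,j,k,l)\<in>mons d. c (i,j,k,l) * (of_nat i * x0^(i-1) * x1^j * x2^k * x3^l))"
  proof (rule sum.mono_neutral_left)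
    show "\<forall>i\<in>mons d - ?s ` mons n. (case i of (i, j, k, l) \<Rightarrow> c (i, j, k, l) * (of_nat i * x0 ^ (i - 1) * x1 ^ j * x2 ^ k * x3 ^ l)) = 0"
    proof
      fix m assume "m \<in> mons d - ?s ` mons n"
      moreover obtain i j k l where m: "m = (i,j,k,l)" by (cases m) auto
      ultimately have "i = 0" by (cases i) (auto simp: mons_def Suc image_iff)
      then show "(case m of (i, j, k, l) \<Rightarrow> c (i, j, k, l) * (of_nat i * x0 ^ (i - 1) * x1 ^ j * x2 ^ k * x3 ^ l)) = 0"
        using m by simp
    qed
  qed (simp, auto simp: mons_def Suc)
  finally show ?thesis by simp
qed

lemma shift1: assumes "supp4 d c"
  shows "(\<Sum>(i,j,k,l)\<in>mons d. c (i,j,k,l) * (of_nat j * x0^i * x1^(j-1) * x2^k * x3^l))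
       = form_eval (d - 1) (pderiv1 d' c) (x0,x1,x2,x3)"
proof (cases d)
  case 0
  then show ?thesis using assms by (auto simp: mons_def form_eval_def pderiv1_def supp4_def)
next
  case (Suc n)
  let ?s = "\<lambda>(i,j,k,l). (i,Suc j,k,l)"
  have "form_eval (d - 1) (pderiv1 d' c) (x0,x1,x2,x3)
     = (\<Sum>(i,j,k,l)\<in>?s ` mons n. c (i,j,k,l) * (of_nat j * x0^i * x1^(j-1) * x2^k * x3^l))"
    by (subst sum.reindex) (auto simp: inj_on_def form_eval_def Suc pderiv1_def monom_eval_def algebra_simps split_def intro!: sum.cong)
  also have "\<dots> = (\<Sum>(i,j,k,l)\<in>mons d. c (i,j,k,l) * (of_nat j * x0^i * x1^(j-1) * x2^k * x3^l))"
  proof (rule sum.mono_neutral_left)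
    show "\<forall>i\<in>mons d - ?s ` mons n. (case i of (i, j, k, l) \<Rightarrow> c (i, j, k, l) * (of_nat j * x0 ^ i * x1 ^ (j-1) * x2 ^ k * x3 ^ l)) = 0"
    proof
      fix m assume "m \<in> mons d - ?s ` mons n"
      moreover obtain i j k l where m: "m = (i,j,k,l)" by (cases m) auto
      ultimately have "j = 0" by (cases j) (auto simp: mons_def Suc image_iff)
      then show "(case m of (i, j, k, l) \<Rightarrow> c (i, j, k, l) * (of_nat j * x0 ^ i * x1 ^ (j-1) * x2 ^ k * x3 ^ l)) = 0"
        using m by simp
    qed
  qed (simp, auto simp: mons_def Suc)
  finally show ?thesis by simp
qed

lemma shift2: assumes "supp4 d c"
  shows "(\<Sum>(i,j,k,l)\<in>mons d. c (i,j,k,l) * (of_nat k * x0^i * x1^j * x2^(k-1) * x3^l))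
       = form_eval (d - 1) (pderiv2 d' c) (x0,x1,x2,x3)"
proof (cases d)
  case 0
  then show ?thesis using assms by (auto simp: mons_def form_eval_def pderiv2_def supp4_def)
next
  case (Suc n)
  let ?s = "\<lambda>(i,j,k,l). (i,j,Suc k,l)"
  have "form_eval (d - 1) (pderiv2 d' c) (x0,x1,x2,x3)
     = (\<Sum>(i,j,k,l)\<in>?s ` mons n. c (i,j,k,l) * (of_nat k * x0^i * x1^j * x2^(k-1) * x3^l))"
    by (subst sum.reindex) (auto simp: inj_on_def form_eval_def Suc pderiv2_def monom_eval_def algebra_simps split_def intro!: sum.cong)
  also have "\<dots> = (\<Sum>(i,j,k,l)\<in>mons d. c (i,j,k,l) * (of_nat k * x0^i * x1^j * x2^(k-1) * x3^l))"
  proof (rule sum.mono_neutral_left)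
    show "\<forall>i\<in>mons d - ?s ` mons n. (case i of (i, j, k, l) \<Rightarrow> c (i, j, k, l) * (of_nat k * x0 ^ i * x1 ^ j * x2 ^ (k-1) * x3 ^ l)) = 0"
    proof
      fix m assume "m \<in> mons d - ?s ` mons n"
      moreover obtain i j k l where m: "m = (i,j,k,l)" by (cases m) auto
      ultimately have "k = 0" by (cases k) (auto simp: mons_def Suc image_iff)
      then show "(case m of (i, j, k, l) \<Rightarrow> c (i, j, k, l) * (of_nat k * x0 ^ i * x1 ^ j * x2 ^ (k-1) * x3 ^ l)) = 0"
        using m by simp
    qed
  qed (simp, auto simp: mons_def Suc)
  finally show ?thesis by simp
qed

lemma shift3: assumes "supp4 d c"
  shows "(\<Sum>(i,j,k,l)\<in>mons d. c (i,j,k,l) * (of_nat l * x0^i * x1^j * x2^k * x3^(l-1)))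
       = form_eval (d - 1) (pderiv3 d' c) (x0,x1,x2,x3)"
proof (cases d)
  case 0
  then show ?thesis using assms by (auto simp: mons_def form_eval_def pderiv3_def supp4_def)
next
  case (Suc n)
  let ?s = "\<lambda>(i,j,k,l). (i,j,k,Suc l)"
  have "form_eval (d - 1) (pderiv3 d' c) (x0,x1,x2,x3)
     = (\<Sum>(i,j,k,l)\<in>?s ` mons n. c (i,j,k,l) * (of_nat l * x0^i * x1^j * x2^k * x3^(l-1)))"
    by (subst sum.reindex) (auto simp: inj_on_def form_eval_def Suc pderiv3_def monom_eval_def algebra_simps split_def intro!: sum.cong)
  also have "\<dots> = (\<Sum>(i,j,k,l)\<in>mons d. c (i,j,k,l) * (of_nat l * x0^i * x1^j * x2^k * x3^(l-1)))"
  proof (rule sum.mono_neutral_left)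
    show "\<forall>i\<in>mons d - ?s ` mons n. (case i of (i, j, k, l) \<Rightarrow> c (i, j, k, l) * (of_nat l * x0 ^ i * x1 ^ j * x2 ^ k * x3 ^ (l-1))) = 0"
    proof
      fix m assume "m \<in> mons d - ?s ` mons n"
      moreover obtain i j k l where m: "m = (i,j,k,l)" by (cases m) auto
      ultimately have "l = 0" by (cases l) (auto simp: mons_def Suc image_iff)
      then show "(case m of (i, j, k, l) \<Rightarrow> c (i, j, k, l) * (of_nat l * x0 ^ i * x1 ^ j * x2 ^ k * x3 ^ (l-1))) = 0"
        using m by simp
    qed
  qed (simp, auto simp: mons_def Suc)
  finally show ?thesis by simp
qed

lemma ev_shift: assumes "supp4 d c"
  shows "D1 d c x v = (\<Sum>(i,j,k,l)\<in>mons d. c (i,j,k,l) *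
    (v$1 * (of_nat i * (x$1)^(i-1) * (x$2)^j * (x$3)^k * (x$4)^l)
   + v$2 * (of_nat j * (x$1)^i * (x$2)^(j-1) * (x$3)^k * (x$4)^l)
   + v$3 * (of_nat k * (x$1)^i * (x$2)^j * (x$3)^(k-1) * (x$4)^l)
   + v$4 * (of_nat l * (x$1)^i * (x$2)^j * (x$3)^k * (x$4)^(l-1))))"
  unfolding D1_def sum_4 ev_def pd_def
  using shift0[OF assms, where d'=0, symmetric] shift1[OF assms, where d'=0, symmetric]
    shift2[OF assms, where d'=0, symmetric] shift3[OF assms, where d'=0, symmetric]
  by (simp add: sum_distrib_left sum.distrib[symmetric] split_def algebra_simps)

section \<open>The chain rule for derivations that kill the coefficients\<close>

definition derivation :: "('a::comm_ring_1 \<Rightarrow> 'a) \<Rightarrow> bool" where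
  "derivation \<delta> \<longleftrightarrow> (\<forall>a b. \<delta> (a + b) = \<delta> a + \<delta> b) \<and> (\<forall>a b. \<delta> (a * b) = a * \<delta> b + \<delta> a * b)"

definition mapv :: "('a \<Rightarrow> 'b) \<Rightarrow> 'a^4 \<Rightarrow> 'b^4" where "mapv h x = (\<chi> i. h (x$i))"
lemma mapv_nth [simp]: "mapv h x $ i = h (x$i)" by (simp add: mapv_def)

context
  fixes \<delta> :: "'a::comm_ring_1 \<Rightarrow> 'a" assumes der: "derivation \<delta>"
begin

lemma der_add: "\<delta> (a + b) = \<delta> a + \<delta> b" and der_mult: "\<delta> (a * b) = a * \<delta> b + \<delta> a * b"
  using der by (auto simp: derivation_def)
lemma der_0: "\<delta> 0 = 0" using der_add[of 0 0] by simp
lemma der_1: "\<delta> 1 = 0" using der_mult[of 1 1] by simp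
lemma der_of_nat: "\<delta> (of_nat n) = 0" by (induction n) (auto simp: der_0 der_1 der_add)
lemma der_sum: "\<delta> (sum f A) = (\<Sum>i\<in>A. \<delta> (f i))"
  by (induction A rule: infinite_finite_induct) (auto simp: der_0 der_add)
lemma der_power: "\<delta> (a ^ n) = of_nat n * a ^ (n - 1) * \<delta> a"
proof (induction n)
  case (Suc n)
  then show ?case by (cases n) (auto simp: der_mult der_1 algebra_simps)
qed (simp add: der_1)

text \<open>Stated for an arbitrary derivation, it serves polynomials over K and over K[s] alike.
  Differentiating again adds one argument \<open>mapv \<delta> x\<close> and the Leibniz terms of
  the other arguments.\<close>

lemma ev_deriv:
  assumes "supp4 d c" "\<And>m. \<delta> (c m) = 0"
  shows "\<delta> (ev d c x) = D1 d c x (mapv \<delta> x)"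
  unfolding ev_shift[OF assms(1)] unfolding ev_def form_eval_def der_sum
  by (rule sum.cong) (auto simp: monom_eval_def der_mult der_power assms(2) algebra_simps)

lemma pd_const: assumes "\<And>m. \<delta> (c m) = 0" shows "\<delta> (pd i c m) = 0"
  using assms der_of_nat by (cases m) (auto simp: pd_def pderiv0_def pderiv1_def pderiv2_def pderiv3_def der_mult der_add der_1)

lemma D1_deriv:
  assumes "supp4 d c" "\<And>m. \<delta> (c m) = 0"
  shows "\<delta> (D1 d c x v) = D2 d c x v (mapv \<delta> x) + D1 d c x (mapv \<delta> v)"
  unfolding D1_def[of d] D2_def der_sum
  by (simp add: der_mult ev_deriv[OF supp4_pd[OF assms(1)] pd_const[OF assms(2)]] sum.distrib del: One_nat_def)

lemma D2_deriv:
  assumes "supp4 d c" "\<And>m. \<delta> (c m) = 0"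
  shows "\<delta> (D2 d c x v w) = D3 d c x v w (mapv \<delta> x) + D2 d c x (mapv \<delta> v) w + D2 d c x v (mapv \<delta> w)"
  unfolding D2_def[of d] D3_def der_sum
  by (simp add: der_mult D1_deriv[OF supp4_pd[OF assms(1)] pd_const[OF assms(2)]] sum.distrib algebra_simps del: One_nat_def)

lemma D3_deriv:
  assumes "supp4 d c" "\<And>m. \<delta> (c m) = 0"
  shows "\<delta> (D3 d c x u v w) = D4 d c x u v w (mapv \<delta> x) + D3 d c x (mapv \<delta> u) v w
     + D3 d c x u (mapv \<delta> v) w + D3 d c x u v (mapv \<delta> w)"
  unfolding D3_def[of d] D4_def der_sum
  by (simp add: der_mult D2_deriv[OF supp4_pd[OF assms(1)] pd_const[OF assms(2)]] sum.distrib algebra_simps del: One_nat_def)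
end

section \<open>Linearity, symmetry and Euler's identities\<close>

lemma D1_add: "D1 d c x (v + w) = D1 d c x v + D1 d c x w"
  and D1_scale: "D1 d c x (a *s v) = a * D1 d c x v"
  and D1_diff: "D1 d c x (v - w) = D1 d c x v - D1 d c x w"
  and D1_0: "D1 d c x 0 = 0"
  by (simp_all add: D1_def sum.distrib sum_subtractf sum_distrib_left algebra_simps)

lemma D2_addl: "D2 d c x (v + v') w = D2 d c x v w + D2 d c x v' w"
  and D2_scalel: "D2 d c x (a *s v) w = a * D2 d c x v w"
  and D2_diffl: "D2 d c x (v - v') w = D2 d c x v w - D2 d c x v' w"
  by (simp_all add: D2_def sum.distrib sum_subtractf sum_distrib_left algebra_simps)

lemma D2_expand: "D2 d c x v w = (\<Sum>i\<in>UNIV. \<Sum>j\<in>UNIV. v$i * w$j * ev (d-2) (pd j (pd i c)) x)"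
  by (simp add: D2_def D1_def sum_distrib_left mult.assoc numeral_2_eq_2)

lemma D2_sym: "D2 d c x v w = D2 d c x w v"
  unfolding D2_expand by (subst sum.swap) (simp add: pd_commute mult.commute)

lemma D2_addr: "D2 d c x w (v + v') = D2 d c x w v + D2 d c x w v'"
  and D2_scaler: "D2 d c x w (a *s v) = a * D2 d c x w v"
  and D2_diffr: "D2 d c x w (v - v') = D2 d c x w v - D2 d c x w v'"
  using D2_addl D2_scalel D2_diffl D2_sym by metis+

lemma D3_expand: "D3 d c x u v w = (\<Sum>i\<in>UNIV. \<Sum>j\<in>UNIV. \<Sum>k\<in>UNIV. u$i * v$j * w$k * ev (d-3) (pd k (pd j (pd i c))) x)"
  by (simp add: D3_def D2_expand sum_distrib_left mult.assoc numeral_3_eq_3)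

lemma D3_sym23: "D3 d c x u v w = D3 d c x u w v"
  by (simp add: D3_def D2_sym[of _ _ _ v])
lemma D3_sym12: "D3 d c x u v w = D3 d c x v u w"
  unfolding D3_expand by (subst sum.swap) (simp add: pd_commute mult.commute mult.left_commute)
lemma D3_sym13: "D3 d c x u v w = D3 d c x w v u"
  using D3_sym12 D3_sym23 by metis

lemma D3_add1: "D3 d c x (v + v') w t = D3 d c x v w t + D3 d c x v' w t"
  and D3_scale1: "D3 d c x (a *s v) w t = a * D3 d c x v w t"
  and D3_diff1: "D3 d c x (v - v') w t = D3 d c x v w t - D3 d c x v' w t"
  by (simp_all add: D3_def sum.distrib sum_subtractf sum_distrib_left algebra_simps)
lemma D3_add2: "D3 d c x w (v + v') t = D3 d c x w v t + D3 d c x w v' t"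
  and D3_scale2: "D3 d c x w (a *s v) t = a * D3 d c x w v t"
  and D3_diff2: "D3 d c x w (v - v') t = D3 d c x w v t - D3 d c x w v' t"
  using D3_add1 D3_scale1 D3_diff1 D3_sym12 by metis+
lemma D3_add3: "D3 d c x w t (v + v') = D3 d c x w t v + D3 d c x w t v'"
  and D3_scale3: "D3 d c x w t (a *s v) = a * D3 d c x w t v"
  and D3_diff3: "D3 d c x w t (v - v') = D3 d c x w t v - D3 d c x w t v'"
  using D3_add1 D3_scale1 D3_diff1 D3_sym13 by metis+

lemma D4_swap1: "D4 d c x t u v w = D4 d c x u t v w"
  unfolding D4_def D3_def sum_distrib_left by (subst sum.swap) (simp add: pd_commute mult.commute mult.left_commute)
lemma D4_sym23: "D4 d c x t u v w = D4 d c x t v u w"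
  by (simp add: D4_def D3_sym12[of _ _ _ u])
lemma D4_sym34: "D4 d c x t u v w = D4 d c x t u w v"
  by (simp add: D4_def D3_sym23[of _ _ _ _ v])
lemma D4_scale1: "D4 d c x (a *s v) w t s = a * D4 d c x v w t s"
  and D4_diff1: "D4 d c x (v - v') w t s = D4 d c x v w t s - D4 d c x v' w t s"
  by (simp_all add: D4_def sum.distrib sum_subtractf sum_distrib_left algebra_simps)

lemmas D_lin = D1_add D1_scale D1_diff D2_addl D2_scalel D2_diffl D2_addr D2_scaler D2_diffr
  D3_add1 D3_scale1 D3_diff1 D3_add2 D3_scale2 D3_diff2 D3_add3 D3_scale3 D3_diff3

lemma ev_scale: "ev d c (a *s x) = a ^ d * ev d c x"
  unfolding ev_def form_eval_def sum_distrib_left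
  by (rule sum.cong) (auto simp: mons_def monom_eval_def power_mult_distrib power_add algebra_simps)

lemma pow_euler: "x * (of_nat i * x ^ (i - 1)) = of_nat i * (x::'a::comm_ring_1) ^ i"
  by (cases i) (auto simp: algebra_simps)

text \<open>Monomial by monomial: each variable restores the exponent that its derivative lowered,
  and the exponents add up to d.\<close>

lemma Euler1: assumes "supp4 d c" shows "D1 d c x x = of_nat d * ev d c x"
proof -
  have eq: "x1 * (of_nat i * x1 ^ (i - 1) * a) = of_nat i * x1 ^ i * a" for x1 a :: 'a and i
    using pow_euler[of x1 i] by (metis mult.assoc)
  show ?thesis unfolding ev_shift[OF assms] unfolding ev_def form_eval_def sum_distrib_left
  proof (rule sum.cong, simp, clarify)
    fix i j k l assume "(i,j,k,l) \<in> mons d"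
    then have d: "(of_nat d::'a) = of_nat i + of_nat j + of_nat k + of_nat l" by (auto simp: mons_def)
    have "x$1 * (of_nat i * (x$1)^(i-1) * (x$2)^j * (x$3)^k * (x$4)^l)
   + x$2 * (of_nat j * (x$1)^i * (x$2)^(j-1) * (x$3)^k * (x$4)^l)
   + x$3 * (of_nat k * (x$1)^i * (x$2)^j * (x$3)^(k-1) * (x$4)^l)
   + x$4 * (of_nat l * (x$1)^i * (x$2)^j * (x$3)^k * (x$4)^(l-1))
    = (of_nat i + of_nat j + of_nat k + of_nat l) * ((x$1)^i * (x$2)^j * (x$3)^k * (x$4)^l)"
      using eq[of "x$1" i "(x$2)^j * (x$3)^k * (x$4)^l"] eq[of "x$2" j "(x$1)^i * (x$3)^k * (x$4)^l"]
        eq[of "x$3" k "(x$1)^i * (x$2)^j * (x$4)^l"] eq[of "x$4" l "(x$1)^i * (x$2)^j * (x$3)^k"]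
      by (simp add: algebra_simps)
    then show "c (i, j, k, l) * (x$1 * (of_nat i * (x$1)^(i-1) * (x$2)^j * (x$3)^k * (x$4)^l)
   + x$2 * (of_nat j * (x$1)^i * (x$2)^(j-1) * (x$3)^k * (x$4)^l)
   + x$3 * (of_nat k * (x$1)^i * (x$2)^j * (x$3)^(k-1) * (x$4)^l)
   + x$4 * (of_nat l * (x$1)^i * (x$2)^j * (x$3)^k * (x$4)^(l-1))) =
       of_nat d * (c (i, j, k, l) * monom_eval (i, j, k, l) (x $ 1, x $ 2, x $ 3, x $ 4))"
      unfolding d by (simp add: monom_eval_def mult.assoc mult.left_commute)
  qed
qed

lemma Euler2: assumes "supp4 d c" shows "D2 d c x v x = of_nat (d - 1) * D1 d c x v"
  unfolding D2_def D1_def[of d] Euler1[OF supp4_pd[OF assms]] sum_distrib_left by (simp add: algebra_simps)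
lemma Euler3: assumes "supp4 d c" shows "D3 d c x v w x = of_nat (d - 2) * D2 d c x v w"
  unfolding D3_def D2_def[of d] Euler2[OF supp4_pd[OF assms]] sum_distrib_left
  by (simp add: algebra_simps numeral_2_eq_2)

text \<open>Everything built from a form is polynomial in coefficients and coordinates, hence
  commutes with ring homomorphisms. Those used later are evaluation of polynomials, truncation to
  dual numbers and the real part of a dual number.\<close>

lemma (in comm_ring_hom) ev_hom: "hom (ev d c x) = ev d (\<lambda>m. hom (c m)) (mapv hom x)"
  unfolding ev_def form_eval_def hom_sum
  by (rule sum.cong) (auto simp: monom_eval_def hom_distribs)
lemma (in comm_ring_hom) pd_hom: "(\<lambda>m. hom (pd i c m)) = pd i (\<lambda>m. hom (c m))"
  by (auto simp: pd_def pderiv0_def pderiv1_def pderiv2_def pderiv3_def hom_distribs fun_eq_iff)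
lemma (in comm_ring_hom) D1_hom: "hom (D1 d c x v) = D1 d (\<lambda>m. hom (c m)) (mapv hom x) (mapv hom v)"
  by (simp add: D1_def hom_distribs ev_hom pd_hom)
lemma (in comm_ring_hom) D2_hom: "hom (D2 d c x v w) = D2 d (\<lambda>m. hom (c m)) (mapv hom x) (mapv hom v) (mapv hom w)"
  by (simp add: D2_def hom_distribs D1_hom pd_hom)
lemma (in comm_ring_hom) D3_hom: "hom (D3 d c x u v w) = D3 d (\<lambda>m. hom (c m)) (mapv hom x) (mapv hom u) (mapv hom v) (mapv hom w)"
  by (simp add: D3_def hom_distribs D2_hom pd_hom)
lemma (in comm_ring_hom) D4_hom: "hom (D4 d c x t u v w) = D4 d (\<lambda>m. hom (c m)) (mapv hom x) (mapv hom t) (mapv hom u) (mapv hom v) (mapv hom w)"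
  by (simp add: D4_def hom_distribs D3_hom pd_hom)
lemma (in comm_ring_hom) supp4_hom: "supp4 d c \<Longrightarrow> supp4 d (\<lambda>m. hom (c m))"
  by (auto simp: supp4_def)

section \<open>Forms restricted to a parametrised line\<close>

lemma const_hom: "comm_ring_hom (\<lambda>a::'a::comm_ring_1. [:a:])" by unfold_locales auto
lemma poly_eval_hom: "comm_ring_hom (\<lambda>p. poly p (a::'a::comm_ring_1))" by unfold_locales auto

abbreviation cl :: "'a::comm_ring_1 form4 \<Rightarrow> 'a poly form4" where "cl c \<equiv> (\<lambda>m. [:c m:])"
abbreviation cv :: "'a::comm_ring_1^4 \<Rightarrow> 'a poly^4" where "cv \<equiv> mapv (\<lambda>a. [:a:])"
definition lin :: "'a::comm_ring_1^4 \<Rightarrow> 'a^4 \<Rightarrow> 'a poly^4" where "lin e f = (\<chi> i. [:e$i, f$i:])"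

lemma lin_nth [simp]: "lin e f $ i = [:e$i, f$i:]" by (simp add: lin_def)
lemma mapv_lin [simp]: "mapv (\<lambda>p. poly p a) (lin e f) = e + a *s f"
  by (simp add: cart_eq)
lemma mapv_cv [simp]: "mapv (\<lambda>p. poly p a) (cv x) = x" by (simp add: cart_eq)
lemma mapv_smult [simp]: "mapv (\<lambda>p. poly p a) (q *s x) = poly q a *s mapv (\<lambda>p. poly p a) x" by (simp add: cart_eq)
lemma mapv_plus [simp]: "mapv (\<lambda>p. poly p a) (x + y) = mapv (\<lambda>p. poly p a) x + mapv (\<lambda>p. poly p a) y" by (simp add: cart_eq)
lemma mapv_minus [simp]: "mapv (\<lambda>p. poly p (a::'a::comm_ring_1)) (x - y) = mapv (\<lambda>p. poly p a) x - mapv (\<lambda>p. poly p a) y" by (simp add: cart_eq)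

lemma poly_ev: "poly (ev d (cl c) X) a = ev d c (mapv (\<lambda>p. poly p a) X)"
  using comm_ring_hom.ev_hom[OF poly_eval_hom[of a], of d "cl c" X] by simp
lemma poly_D1: "poly (D1 d (cl c) X V) a = D1 d c (mapv (\<lambda>p. poly p a) X) (mapv (\<lambda>p. poly p a) V)"
  using comm_ring_hom.D1_hom[OF poly_eval_hom[of a], of d "cl c" X V] by simp
lemma poly_D2: "poly (D2 d (cl c) X V W) a = D2 d c (mapv (\<lambda>p. poly p a) X) (mapv (\<lambda>p. poly p a) V) (mapv (\<lambda>p. poly p a) W)"
  using comm_ring_hom.D2_hom[OF poly_eval_hom[of a], of d "cl c" X V W] by simp
lemma poly_D3: "poly (D3 d (cl c) X U V W) a = D3 d c (mapv (\<lambda>p. poly p a) X) (mapv (\<lambda>p. poly p a) U) (mapv (\<lambda>p. poly p a) V) (mapv (\<lambda>p. poly p a) W)"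
  using comm_ring_hom.D3_hom[OF poly_eval_hom[of a], of d "cl c" X U V W] by simp
lemma poly_D4: "poly (D4 d (cl c) X T U V W) a = D4 d c (mapv (\<lambda>p. poly p a) X) (mapv (\<lambda>p. poly p a) T) (mapv (\<lambda>p. poly p a) U) (mapv (\<lambda>p. poly p a) V) (mapv (\<lambda>p. poly p a) W)"
  using comm_ring_hom.D4_hom[OF poly_eval_hom[of a], of d "cl c" X T U V W] by simp

lemma derivation_pderiv: "derivation (pderiv :: 'a::idom poly \<Rightarrow> _)"
  by (auto simp: derivation_def pderiv_add pderiv_mult algebra_simps)
lemma supp4_cl: "supp4 d c \<Longrightarrow> supp4 d (cl c)" by (auto simp: supp4_def)
lemma mapv_pderiv_lin [simp]: "mapv pderiv (lin e f) = cv (f::'a::idom^4)"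
  by (simp add: cart_eq pderiv_pCons)
lemma mapv_pderiv_cv [simp]: "mapv pderiv (cv f) = (0::'a::idom poly^4)"
  by (simp add: cart_eq pderiv_pCons)

text \<open>The coefficient \<open>a\<close> may be zero, so that leading coefficients can be tracked through cancellations.\<close>
definition dc :: "nat \<Rightarrow> 'a::comm_ring_1 poly \<Rightarrow> 'a \<Rightarrow> bool" where
  "dc n p a \<longleftrightarrow> degree p \<le> n \<and> coeff p n = a"

lemma dc_mult: assumes "dc m p a" "dc n q b" shows "dc (m + n) (p * q) (a * b)"
proof -
  have "degree (p * q) \<le> m + n" using assms degree_mult_le[of p q] by (auto simp: dc_def)
  moreover have "coeff (p * q) (m + n) = (\<Sum>i\<le>m+n. coeff p i * coeff q (m + n - i))" by (simp add: coeff_mult)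
  moreover have "(\<Sum>i\<le>m+n. coeff p i * coeff q (m + n - i)) = (\<Sum>i\<in>{m}. coeff p i * coeff q (m + n - i))"
  proof (rule sum.mono_neutral_right)
    have "coeff p i * coeff q (m + n - i) = 0" if "i \<noteq> m" for i
    proof (rule ccontr)
      assume "coeff p i * coeff q (m + n - i) \<noteq> 0"
      then have "coeff p i \<noteq> 0" "coeff q (m + n - i) \<noteq> 0" by auto
      then have "i \<le> m" "m + n - i \<le> n" using assms le_degree unfolding dc_def by (meson order_trans)+
      then show False using \<open>i \<noteq> m\<close> by auto
    qed
    then show "\<forall>i\<in>{..m + n} - {m}. coeff p i * coeff q (m + n - i) = 0" by auto
  qed auto
  ultimately show ?thesis using assms by (auto simp: dc_def)
qed
lemma dc_power: "dc m p a \<Longrightarrow> dc (m * k) (p ^ k) (a ^ k)"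
  by (induction k) (auto simp: dc_def[of 0] dc_mult[of m p a "m * _"])
lemma dc_sum: "(\<And>i. i \<in> A \<Longrightarrow> dc n (f i) (g i)) \<Longrightarrow> dc n (sum f A) (sum g A)"
  unfolding dc_def coeff_sum by (cases "finite A") (auto intro!: degree_sum_le sum.cong)
lemma dc_const: "dc 0 [:a:] a" by (simp add: dc_def)
lemma dc_add: "dc n p a \<Longrightarrow> dc n q b \<Longrightarrow> dc n (p + q) (a + b)" by (auto simp: dc_def degree_add_le)
lemma dc_diff: "dc n p a \<Longrightarrow> dc n q b \<Longrightarrow> dc n (p - q) (a - b)" by (auto simp: dc_def degree_diff_le)

text \<open>The vector f of top coefficients is the point at infinity of the line, so the
  coefficient of t^d records the value of the form there, zero or not.\<close>

lemma dc_ev: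
  assumes "\<And>i. dc 1 (X$i) (f$i)"
  shows "dc d (ev d (cl c) X) (ev d c f)"
  unfolding ev_def form_eval_def
proof (rule dc_sum)
  fix m assume "m \<in> mons d"
  then obtain i j k l where m: "m = (i,j,k,l)" and d: "d = i + j + k + l" by (cases m) (auto simp: mons_def)
  have "dc (0 + (i + j + k + l)) ([:c m:] * ((X$1)^i * (X$2)^j * (X$3)^k * (X$4)^l)) (c m * ((f$1)^i * (f$2)^j * (f$3)^k * (f$4)^l))"
    using dc_power[OF assms[of 1], of i] dc_power[OF assms[of 2], of j] dc_power[OF assms[of 3], of k] dc_power[OF assms[of 4], of l]
    by (intro dc_mult dc_const) auto
  then show "dc d ([:c m:] * monom_eval m (X$1, X$2, X$3, X$4)) (c m * monom_eval m (f$1, f$2, f$3, f$4))"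
    using m d by (simp add: monom_eval_def)
qed
lemma dc_ev_lin: "dc d (ev d (cl c) (lin e f)) (ev d c f)"
  by (rule dc_ev) (auto simp: dc_def)

lemma pd_cl: "pd i (cl c) = cl (pd i c)"
  using comm_ring_hom.pd_hom[OF const_hom, of i c] by simp

lemma dc_D1_lin: "dc (d - 1) (D1 d (cl c) (lin e f) (cv v)) (D1 d c f v)"
  unfolding D1_def pd_cl
  by (rule dc_sum) (use dc_mult[OF dc_const dc_ev_lin] in simp)
lemma dc_D2_lin: "dc (d - 2) (D2 d (cl c) (lin e f) (cv v) (cv w)) (D2 d c f v w)"
  unfolding D2_def pd_cl
  by (rule dc_sum) (use dc_mult[OF dc_const dc_D1_lin[of "d-1"]] in \<open>simp add: numeral_2_eq_2\<close>)

section \<open>Clebsch's flecnodal form\<close>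

definition hess :: "nat \<Rightarrow> 'a::comm_ring_1 form4 \<Rightarrow> 'a^4 \<Rightarrow> 'a^4^4" where
  "hess d c x = (\<chi> i j. ev (d-2) (pd j (pd i c)) x)"

text \<open>A cofactor as the determinant with row i replaced by a unit vector. No row is deleted,
  and Laplace expansion becomes linearity of the determinant in that row.\<close>

definition cof :: "'a::comm_ring_1^4^4 \<Rightarrow> 4 \<Rightarrow> 4 \<Rightarrow> 'a" where
  "cof M i j = Determinants.det (\<chi> k. if k = i then axis j 1 else M$k)"

lemma cof_expand: "(\<Sum>j\<in>UNIV. M$k$j * cof M i j) = (if k = i then Determinants.det M else 0)"
proof -
  have row: "M$k = (\<Sum>j\<in>UNIV. M$k$j *s axis j 1)" by (simp add: basis_expansion)
  have "(\<Sum>j\<in>UNIV. M$k$j * cof M i j)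
     = (\<Sum>j\<in>UNIV. Determinants.det (\<chi> l. if l = i then M$k$j *s axis j 1 else M$l))"
    unfolding cof_def by (simp add: det_row_mul)
  also have "\<dots> = Determinants.det (\<chi> l. if l = i then (\<Sum>j\<in>UNIV. M$k$j *s axis j 1) else M$l)"
    using det_linear_row_sum[of "UNIV::4 set" i "\<lambda>_ j. M$k$j *s axis j 1" "\<lambda>l. M$l"] by simp
  also have "\<dots> = Determinants.det (\<chi> l. if l = i then M$k else M$l)" by (simp only: row[symmetric])
  also have "\<dots> = (if k = i then Determinants.det M else 0)"
  proof (cases "k = i")
    case True
    then have "(\<chi> l. if l = i then M$k else M$l) = M" by (simp add: cart_eq)
    then show ?thesis using True by simp
  next
    case False
    then show ?thesis by (auto intro!: Determinants.det_identical_rows[of i k] simp: Finite_Cartesian_Product.row_def cart_eq)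
  qed
  finally show ?thesis .
qed

text \<open>Row l of \<open>G ** M\<close> is a unit vector. Expanding it against the cofactors of
  row i leaves only the term k = i, whose Laplace sum is the determinant.\<close>

lemma cof_mult_inverse: assumes "G ** M = Finite_Cartesian_Product.mat 1" shows "cof M i l = Determinants.det M * G$l$i"
proof -
  have "cof M i l = (\<Sum>j\<in>UNIV. (Finite_Cartesian_Product.mat 1 :: 'a^4^4)$l$j * cof M i j)"
    by (simp add: Finite_Cartesian_Product.mat_def if_distrib[of "\<lambda>x. x * _"] sum.delta' cong: if_cong)
  also have "\<dots> = (\<Sum>j\<in>UNIV. (\<Sum>k\<in>UNIV. G$l$k * M$k$j) * cof M i j)"
    using assms by (simp add: matrix_matrix_mult_def cart_eq)
  also have "\<dots> = (\<Sum>k\<in>UNIV. G$l$k * (\<Sum>j\<in>UNIV. M$k$j * cof M i j))"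
    unfolding sum_distrib_left sum_distrib_right by (subst sum.swap) (simp add: mult.assoc)
  also have "\<dots> = Determinants.det M * G$l$i"
    unfolding cof_expand by (simp add: if_distrib[of "\<lambda>x. _ * x"] mult.commute cong: if_cong)
  finally show ?thesis .
qed

text \<open>The determinants of N and P are mutually inverse, so the adjugate of P times det N is a
  right inverse of P, and it coincides with the left inverse N.\<close>

lemma left_inverse_right: fixes N P :: "'a::comm_ring_1^4^4" assumes "N ** P = (Finite_Cartesian_Product.mat 1 :: 'a::comm_ring_1^4^4)"
  shows "P ** N = Finite_Cartesian_Product.mat 1"
proof -
  have dd: "Determinants.det N * Determinants.det P = 1"
    using det_mul[of N P] assms by simp
  define C where "C = (\<chi> i l. Determinants.det N * cof P l i)"
  have "(P ** C)$k$i = (if k = i then 1 else 0)" for k i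
  proof -
    have "(P ** C)$k$i = Determinants.det N * (\<Sum>j\<in>UNIV. P$k$j * cof P i j)"
      by (simp add: matrix_matrix_mult_def C_def sum_distrib_left algebra_simps)
    then show ?thesis unfolding cof_expand by (simp add: dd)
  qed
  then have PC: "P ** C = Finite_Cartesian_Product.mat 1" by (simp add: cart_eq Finite_Cartesian_Product.mat_def)
  have "N = N ** (P ** C)" using PC by (simp add: matrix_mul_rid)
  also have "\<dots> = C" using assms by (simp add: matrix_mul_assoc matrix_mul_lid)
  finally show ?thesis using PC by simp
qed

definition Ct :: "nat \<Rightarrow> 'a::comm_ring_1 form4 \<Rightarrow> 'a^4 \<Rightarrow> 4 \<Rightarrow> 4 \<Rightarrow> 4 \<Rightarrow> 'a" where
  "Ct d c x i j k = ev (d-3) (pd k (pd j (pd i c))) x"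
definition con :: "(4 \<Rightarrow> 4 \<Rightarrow> 'a::comm_ring_1) \<Rightarrow> (4 \<Rightarrow> 4 \<Rightarrow> 'a) \<Rightarrow> 'a" where
  "con A f = (\<Sum>i\<in>UNIV. \<Sum>l\<in>UNIV. A i l * f i l)"
text \<open>The trace of the cubic form of third derivatives with respect to the cofactor matrix; a
  covector.\<close>

definition kap :: "nat \<Rightarrow> 'a::comm_ring_1 form4 \<Rightarrow> 'a^4 \<Rightarrow> 4 \<Rightarrow> 'a" where
  "kap d c x i = con (cof (hess d c x)) (\<lambda>j k. Ct d c x i j k)"
text \<open>In a frame of the tangent plane made of the two asymptotic directions v1, v2 this contraction
is a nonzero multiple of D3(v1,v1,v1) D3(v2,v2,v2) (\<open>Phi_frame\<close>), so that it vanishes where some line has contact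
of order at least four.\<close>
definition Phi :: "nat \<Rightarrow> 'a::comm_ring_1 form4 \<Rightarrow> 'a^4 \<Rightarrow> 'a" where
  "Phi d c x = 4 * con (cof (hess d c x)) (\<lambda>i l. con (cof (hess d c x)) (\<lambda>j m. con (cof (hess d c x))
       (\<lambda>k n. Ct d c x i j k * Ct d c x l m n)))
     - 3 * con (cof (hess d c x)) (\<lambda>i l. kap d c x i * kap d c x l)"
text \<open>The trace-free part of the cubic of third derivatives: a multiple of the quadratic form
  is subtracted so that, on tangent vectors, only the pure cubes of the two asymptotic coordinates
  remain (\<open>Rv_frame\<close>).\<close>

definition Rv :: "nat \<Rightarrow> 'a::comm_ring_1 form4 \<Rightarrow> 'a^4 \<Rightarrow> 'a^4 \<Rightarrow> 'a" where
  "Rv d c x v = 4 * Determinants.det (hess d c x) * D3 d c x v v v - 3 * D2 d c x v v * (\<Sum>i\<in>UNIV. kap d c x i * v$i)"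

text \<open>Pairs each vector of the frame x, b, v1, v2 with the only one not orthogonal to it under
  the Hessian.\<close>

definition star :: "4 \<Rightarrow> 4" where "star r = (if r = 1 then 2 else if r = 2 then 1 else if r = 3 then 4 else 3)"
lemma star_simps [simp]: "star 1 = 2" "star 2 = 1" "star 3 = 4" "star 4 = 3" by (simp_all add: star_def)

text \<open>The origin of the constants 4 and 3 in \<open>Phi\<close>. The unwanted products, with
  \<open>T 2 3 4\<close> and with \<open>T 3 3 4 * T 3 4 4\<close>, come with coefficients 48 and 24
  in the first line and 16 and 8 in the sum that is multiplied by 3. The values of T with an index 1
  are those forced by Euler's identity.\<close>

lemma frame_calc:
  fixes T :: "4 \<Rightarrow> 4 \<Rightarrow> 4 \<Rightarrow> 'a::comm_ring_1" and g :: "4 \<Rightarrow> 'a"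
  assumes sym: "\<And>r s t. T r s t = T s r t" "\<And>r s t. T r s t = T r t s"
    and vals: "T 1 1 1 = 0" "T 1 1 2 = e * h" "T 1 1 3 = 0" "T 1 1 4 = 0" "T 1 2 2 = 0" "T 1 2 3 = 0" "T 1 2 4 = 0"
      "T 1 3 3 = 0" "T 1 4 4 = 0" "T 1 3 4 = e * k"
    and h: "h' * h = 1" and k: "k' * k = 1"
    and g: "g 1 = h'" "g 2 = h'" "g 3 = k'" "g 4 = k'"
  shows "4 * (\<Sum>t\<in>UNIV. g t * (\<Sum>s\<in>UNIV. g s * (\<Sum>r\<in>UNIV. g r * (T r s t * T (star r) (star s) (star t)))))
    - 3 * (\<Sum>s\<in>UNIV. g s * ((\<Sum>r\<in>UNIV. g r * T s r (star r)) * (\<Sum>r\<in>UNIV. g r * T (star s) r (star r))))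
    = 8 * k'^3 * T 3 3 3 * T 4 4 4"
proof -
  have p: "T 1 2 1 = T 1 1 2" "T 1 3 1 = T 1 1 3" "T 1 3 2 = T 1 2 3" "T 1 4 1 = T 1 1 4" "T 1 4 2 = T 1 2 4" "T 1 4 3 = T 1 3 4" "T 2 1 1 = T 1 1 2" "T 2 1 2 = T 1 2 2" "T 2 1 3 = T 1 2 3" "T 2 1 4 = T 1 2 4" "T 2 2 1 = T 1 2 2" "T 2 3 1 = T 1 2 3" "T 2 3 2 = T 2 2 3" "T 2 4 1 = T 1 2 4" "T 2 4 2 = T 2 2 4" "T 2 4 3 = T 2 3 4" "T 3 1 1 = T 1 1 3" "T 3 1 2 = T 1 2 3" "T 3 1 3 = T 1 3 3" "T 3 1 4 = T 1 3 4" "T 3 2 1 = T 1 2 3" "T 3 2 2 = T 2 2 3" "T 3 2 3 = T 2 3 3" "T 3 2 4 = T 2 3 4" "T 3 3 1 = T 1 3 3" "T 3 3 2 = T 2 3 3" "T 3 4 1 = T 1 3 4" "T 3 4 2 = T 2 3 4" "T 3 4 3 = T 3 3 4" "T 4 1 1 = T 1 1 4" "T 4 1 2 = T 1 2 4" "T 4 1 3 = T 1 3 4" "T 4 1 4 = T 1 4 4" "T 4 2 1 = T 1 2 4" "T 4 2 2 = T 2 2 4" "T 4 2 3 = T 2 3 4" "T 4 2 4 = T 2 4 4" "T 4 3 1 = T 1 3 4" "T 4 3 2 = T 2 3 4" "T 4 3 3 = T 3 3 4" "T 4 3 4 = T 3 4 4" "T 4 4 1 = T 1 4 4" "T 4 4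 2 = T 2 4 4" "T 4 4 3 = T 3 4 4"
    using sym by metis+
  have a1: "h' * (e * h) = e" using h by (metis mult.assoc mult.commute mult.right_neutral)
  have a2: "k' * (e * k) = e" using k by (metis mult.assoc mult.commute mult.right_neutral)
  have "4 * (\<Sum>t\<in>UNIV. g t * (\<Sum>s\<in>UNIV. g s * (\<Sum>r\<in>UNIV. g r * (T r s t * T (star r) (star s) (star t)))))
    = 48 * h' * k' * (k' * (e * k)) * T 2 3 4 + 8 * k'^3 * T 3 3 3 * T 4 4 4 + 24 * k'^3 * T 3 3 4 * T 3 4 4"
    unfolding sum_4 star_simps g by (simp only: p vals) (simp add: algebra_simps power3_eq_cube)
  moreover define KK where "KK s = (\<Sum>r\<in>UNIV. g r * T s r (star r))" for s
  have K: "KK 1 = 2 * (h' * (e * h)) + 2 * (k' * (e * k))"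
    "KK 2 = 2 * h' * (T 1 2 2) + 2 * k' * T 2 3 4"
    "KK 3 = 2 * h' * (T 1 2 3) + 2 * k' * T 3 3 4"
    "KK 4 = 2 * h' * (T 1 2 4) + 2 * k' * T 3 4 4"
    unfolding KK_def sum_4 star_simps g by (simp_all only: p vals) (simp_all add: algebra_simps)
  have "(\<Sum>s\<in>UNIV. g s * (KK s * KK (star s)))
    = 16 * h' * k' * e * T 2 3 4 + 8 * k'^3 * T 3 3 4 * T 3 4 4"
    unfolding sum_4 star_simps K a1 a2 g vals by (simp add: algebra_simps power3_eq_cube)
  ultimately show ?thesis unfolding a2 KK_def[symmetric] by (simp add: algebra_simps)
qed

section \<open>A hyperbolic frame of the Hessian at a point of the surface\<close>

context
  fixes d :: nat and c :: "'a::comm_ring_1 form4" and x b v1 v2 :: "'a^4" and h' k' :: 'a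
  assumes sup: "supp4 d c" and F0: "ev d c x = 0"
    and t1: "D1 d c x v1 = 0" and t2: "D1 d c x v2 = 0"
    and i1: "D2 d c x v1 v1 = 0" and i2: "D2 d c x v2 v2 = 0"
    and k: "k' * D2 d c x v1 v2 = 1" and h: "h' * D2 d c x x b = 1"
    and bb: "D2 d c x b b = 0" and b1: "D2 d c x b v1 = 0" and b2: "D2 d c x b v2 = 0"
begin

lemma fr_x: "D2 d c x x v1 = 0" "D2 d c x x v2 = 0" "D2 d c x x x = 0"
  using Euler2[OF sup, of x] t1 t2 D2_sym[of d c x] Euler1[OF sup, of x] F0 by auto

definition fa :: "4 \<Rightarrow> 'a^4" where "fa r = (if r = 1 then x else if r = 2 then b else if r = 3 then v1 else v2)"
definition fg :: "4 \<Rightarrow> 'a" where "fg r = (if r = 1 \<or> r = 2 then h' else k')"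
lemma fa_simps: "fa 1 = x" "fa 2 = b" "fa 3 = v1" "fa 4 = v2" "fg 1 = h'" "fg 2 = h'" "fg 3 = k'" "fg 4 = k'"
  by (simp_all add: fa_def fg_def)

lemma fr_orth: "fg r * D2 d c x (fa (star r)) (fa s) = (if r = s then 1 else 0)"
  using exhaust_4[of r] exhaust_4[of s] fr_x h k i1 i2 bb b1 b2
  by (auto simp: fa_simps D2_sym[of d c x b x] D2_sym[of d c x v1 x] D2_sym[of d c x v2 x] D2_sym[of d c x v1 b] D2_sym[of d c x v2 b]
     D2_sym[of d c x v2 v1])

definition fG :: "'a^4^4" where "fG = (\<chi> i j. \<Sum>r\<in>UNIV. fg r * (fa r$i * fa (star r)$j))"

lemma fG_sym: "fG$i$j = fG$j$i"
  by (simp add: fG_def sum_4 fa_simps algebra_simps)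

text \<open>Orthogonality makes N a left inverse of the frame matrix P. It is then a right inverse
  as well, and \<open>P ** N\<close> is the claimed product, so the Hessian is inverted in closed
  form.\<close>

lemma fG_hess: "fG ** hess d c x = Finite_Cartesian_Product.mat 1"
proof -
  define P :: "'a^4^4" where "P = (\<chi> i r. fa r$i)"
  define N :: "'a^4^4" where "N = (\<chi> r j. fg r * (\<Sum>i\<in>UNIV. fa (star r)$i * hess d c x$i$j))"
  have D2h: "D2 d c x v w = (\<Sum>j\<in>UNIV. (\<Sum>i\<in>UNIV. v$i * hess d c x$i$j) * w$j)" for v w
    unfolding D2_expand sum_distrib_right by (subst sum.swap) (simp add: hess_def algebra_simps)
  have "(N ** P)$r$s = fg r * D2 d c x (fa (star r)) (fa s)" for r s
    unfolding D2h N_def P_def matrix_matrix_mult_def by (subst sum_distrib_left) (simp add: mult.assoc)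
  then have "N ** P = Finite_Cartesian_Product.mat 1" by (simp add: cart_eq Finite_Cartesian_Product.mat_def fr_orth)
  then have "P ** N = Finite_Cartesian_Product.mat 1" by (rule left_inverse_right)
  moreover have "P ** N = fG ** hess d c x"
    unfolding P_def N_def fG_def matrix_matrix_mult_def cart_eq
    by (auto simp: sum_distrib_left sum_distrib_right algebra_simps intro: sum.swap)
  ultimately show ?thesis by simp
qed

text \<open>Coordinates are read off by pairing with the dual frame vectors. The b-coordinate is a
  multiple of D2(x,v) = (d-1) D1(v), which vanishes for tangent v.\<close>

lemma fr_decomp: assumes "D1 d c x v = 0"
  shows "v = (k' * D2 d c x v2 v) *s v1 + (k' * D2 d c x v1 v) *s v2 + (h' * D2 d c x b v) *s x"
proof -
  have x0: "D2 d c x x v = 0" using Euler2[OF sup, of x v] assms D2_sym[of d c x x v] by simp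
  have "v = (fG ** hess d c x) *v v" unfolding fG_hess by simp
  also have "\<dots> = fG *v (hess d c x *v v)" by (simp add: matrix_vector_mul_assoc)
  finally have v: "v = fG *v (hess d c x *v v)" .
  have h: "(\<Sum>j\<in>UNIV. y$j * (hess d c x *v v)$j) = D2 d c x y v" for y
    unfolding D2_expand by (simp add: matrix_vector_mult_def hess_def sum_distrib_left algebra_simps)
  have "v$i = (\<Sum>r\<in>UNIV. fg r * fa r$i * D2 d c x (fa (star r)) v)" for i
  proof -
    have "v$i = (\<Sum>j\<in>UNIV. fG$i$j * (hess d c x *v v)$j)" by (subst v) (simp add: matrix_vector_mult_def)
    also have "\<dots> = (\<Sum>j\<in>UNIV. \<Sum>r\<in>UNIV. fg r * fa r$i * (fa (star r)$j * (hess d c x *v v)$j))"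
      by (simp add: fG_def sum_distrib_right mult.assoc)
    also have "\<dots> = (\<Sum>r\<in>UNIV. \<Sum>j\<in>UNIV. fg r * fa r$i * (fa (star r)$j * (hess d c x *v v)$j))" by (rule sum.swap)
    finally show ?thesis by (simp add: sum_distrib_left[symmetric] h)
  qed
  then show ?thesis by (simp add: cart_eq sum_4 fa_simps x0 algebra_simps)
qed

lemma fr_cof: "cof (hess d c x) i l = Determinants.det (hess d c x) * (\<Sum>r\<in>UNIV. fg r * (fa r$i * fa (star r)$l))"
  using cof_mult_inverse[OF fG_hess, of i l] fG_sym[of l i] by (simp add: fG_def)

lemma fr_det_unit: "\<exists>z. z * Determinants.det (hess d c x) = 1"
  using det_mul[of fG "hess d c x"] fG_hess by (intro exI[of _ "Determinants.det fG"]) simp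

lemma con_gen: "con (cof (hess d c x)) f = Determinants.det (hess d c x) *
   (\<Sum>r\<in>UNIV. fg r * (\<Sum>i\<in>UNIV. \<Sum>l\<in>UNIV. fa r$i * fa (star r)$l * f i l))"
proof -
  have "con (cof (hess d c x)) f = Determinants.det (hess d c x) *
     (\<Sum>i\<in>UNIV. \<Sum>l\<in>UNIV. \<Sum>r\<in>UNIV. fg r * (fa r$i * fa (star r)$l * f i l))"
    unfolding con_def fr_cof by (simp add: sum_distrib_left sum_distrib_right mult.assoc)
  also have "(\<Sum>i\<in>UNIV. \<Sum>l\<in>UNIV. \<Sum>r\<in>UNIV. fg r * (fa r$i * fa (star r)$l * f i l))
     = (\<Sum>i\<in>UNIV. \<Sum>r\<in>UNIV. \<Sum>l\<in>UNIV. fg r * (fa r$i * fa (star r)$l * f i l))"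
    by (rule sum.cong[OF refl]) (rule sum.swap)
  also have "\<dots> = (\<Sum>r\<in>UNIV. \<Sum>i\<in>UNIV. \<Sum>l\<in>UNIV. fg r * (fa r$i * fa (star r)$l * f i l))" by (rule sum.swap)
  finally show ?thesis by (simp add: sum_distrib_left)
qed

lemma con_prod: "con (cof (hess d c x)) (\<lambda>i l. p i * q l) = Determinants.det (hess d c x) *
   (\<Sum>r\<in>UNIV. fg r * ((\<Sum>i\<in>UNIV. fa r$i * p i) * (\<Sum>l\<in>UNIV. fa (star r)$l * q l)))"
  unfolding con_gen sum_product by (simp add: algebra_simps)

lemma con_lin: "con A (\<lambda>i l. u * (\<Sum>t\<in>S. w t * f t i l)) = u * (\<Sum>t\<in>S. w t * con A (f t))"
proof -
  have "con A (\<lambda>i l. u * (\<Sum>t\<in>S. w t * f t i l)) = (\<Sum>i\<in>UNIV. \<Sum>l\<in>UNIV. \<Sum>t\<in>S. u * (w t * (A i l * f t i l)))"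
    unfolding con_def by (simp add: sum_distrib_left algebra_simps)
  also have "\<dots> = (\<Sum>i\<in>UNIV. \<Sum>t\<in>S. \<Sum>l\<in>UNIV. u * (w t * (A i l * f t i l)))"
    by (rule sum.cong[OF refl]) (rule sum.swap)
  also have "\<dots> = (\<Sum>t\<in>S. \<Sum>i\<in>UNIV. \<Sum>l\<in>UNIV. u * (w t * (A i l * f t i l)))" by (rule sum.swap)
  finally show ?thesis unfolding con_def by (simp add: sum_distrib_left)
qed

lemma D3_Ct: "D3 d c x u v w = (\<Sum>i\<in>UNIV. u$i * (\<Sum>j\<in>UNIV. v$j * (\<Sum>k\<in>UNIV. w$k * Ct d c x i j k)))"
  unfolding D3_expand Ct_def by (simp add: sum_distrib_left mult.assoc)

lemma fr_kap: "(\<Sum>i\<in>UNIV. u$i * kap d c x i) = Determinants.det (hess d c x) * (\<Sum>r\<in>UNIV. fg r * D3 d c x u (fa r) (fa (star r)))"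
proof -
  have "(\<Sum>i\<in>UNIV. u$i * kap d c x i) = Determinants.det (hess d c x) * (\<Sum>i\<in>UNIV. \<Sum>r\<in>UNIV. fg r *
     (u$i * (\<Sum>j\<in>UNIV. \<Sum>k\<in>UNIV. fa r$j * fa (star r)$k * Ct d c x i j k)))"
    unfolding kap_def con_gen by (simp add: sum_distrib_left algebra_simps)
  also have "(\<Sum>i\<in>UNIV. \<Sum>r\<in>UNIV. fg r * (u$i * (\<Sum>j\<in>UNIV. \<Sum>k\<in>UNIV. fa r$j * fa (star r)$k * Ct d c x i j k)))
    = (\<Sum>r\<in>UNIV. \<Sum>i\<in>UNIV. fg r * (u$i * (\<Sum>j\<in>UNIV. \<Sum>k\<in>UNIV. fa r$j * fa (star r)$k * Ct d c x i j k)))" by (rule sum.swap)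
  finally show ?thesis unfolding D3_Ct by (simp add: sum_distrib_left mult.assoc)
qed

lemma D3_x: "D3 d c x x v w = of_nat (d - 2) * D2 d c x v w"
  using Euler3[OF sup, of x w v] D3_sym13[of d c x x v w] D2_sym by metis

text \<open>Each contraction with the cofactor matrix is a frame sum times the determinant, and both
  summands of \<open>Phi\<close> involve three of them; the rest is \<open>frame_calc\<close> with e
  = d - 2, the Euler factor of third derivatives towards x.\<close>

theorem Phi_frame: "Phi d c x = 8 * (Determinants.det (hess d c x) * k')^3 * D3 d c x v1 v1 v1 * D3 d c x v2 v2 v2"
proof -
  let ?H = "Determinants.det (hess d c x)" let ?A = "cof (hess d c x)"
  define T where "T r s t = D3 d c x (fa r) (fa s) (fa t)" for r s t
  have s1: "con ?A (\<lambda>k n. Ct d c x i j k * Ct d c x l m n) = ?H * (\<Sum>t\<in>UNIV. fg t *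
     ((\<Sum>k\<in>UNIV. fa t$k * Ct d c x i j k) * (\<Sum>n\<in>UNIV. fa (star t)$n * Ct d c x l m n)))" for i j l m
    by (rule con_prod)
  have s2: "con ?A (\<lambda>j m. con ?A (\<lambda>k n. Ct d c x i j k * Ct d c x l m n)) = ?H * (\<Sum>t\<in>UNIV. fg t * (?H * (\<Sum>s\<in>UNIV. fg s *
     ((\<Sum>j\<in>UNIV. fa s$j * (\<Sum>k\<in>UNIV. fa t$k * Ct d c x i j k)) * (\<Sum>m\<in>UNIV. fa (star s)$m * (\<Sum>n\<in>UNIV. fa (star t)$n * Ct d c x l m n))))))" for i l
    unfolding s1 con_lin con_prod ..
  have s3: "con ?A (\<lambda>i l. con ?A (\<lambda>j m. con ?A (\<lambda>k n. Ct d c x i j k * Ct d c x l m n))) =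
     ?H * (\<Sum>t\<in>UNIV. fg t * (?H * (\<Sum>s\<in>UNIV. fg s * (?H * (\<Sum>r\<in>UNIV. fg r * (T r s t * T (star r) (star s) (star t)))))))"
    unfolding s2 con_lin con_prod T_def D3_Ct ..
  have k1: "(\<Sum>i\<in>UNIV. fa s$i * kap d c x i) = ?H * (\<Sum>r\<in>UNIV. fg r * T s r (star r))" for s
    unfolding fr_kap T_def ..
  have s4: "con ?A (\<lambda>i l. kap d c x i * kap d c x l) = ?H * (\<Sum>s\<in>UNIV. fg s *
     ((?H * (\<Sum>r\<in>UNIV. fg r * T s r (star r))) * (?H * (\<Sum>r\<in>UNIV. fg r * T (star s) r (star r)))))"
    unfolding con_prod k1 ..
  have calc: "4 * (\<Sum>t\<in>UNIV. fg t * (\<Sum>s\<in>UNIV. fg s * (\<Sum>r\<in>UNIV. fg r * (T r s t * T (star r) (star s) (star t)))))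
    - 3 * (\<Sum>s\<in>UNIV. fg s * ((\<Sum>r\<in>UNIV. fg r * T s r (star r)) * (\<Sum>r\<in>UNIV. fg r * T (star s) r (star r))))
    = 8 * k'^3 * T 3 3 3 * T 4 4 4"
  proof (rule frame_calc[where e="of_nat (d-2)" and h="D2 d c x x b" and k="D2 d c x v1 v2" and h'=h'])
    show "T r s t = T s r t" "T r s t = T r t s" for r s t
      unfolding T_def by (rule D3_sym12, rule D3_sym23)
  qed (simp_all add: T_def fa_simps D3_x fr_x i1 i2 bb b1 b2 h k)
  have "Phi d c x = ?H^3 * (4 * (\<Sum>t\<in>UNIV. fg t * (\<Sum>s\<in>UNIV. fg s * (\<Sum>r\<in>UNIV. fg r * (T r s t * T (star r) (star s) (star t)))))
    - 3 * (\<Sum>s\<in>UNIV. fg s * ((\<Sum>r\<in>UNIV. fg r * T s r (star r)) * (\<Sum>r\<in>UNIV. fg r * T (star s) r (star r)))))"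
    unfolding Phi_def s3 s4 right_diff_distrib
    by (simp add: sum_distrib_left power3_eq_cube algebra_simps)
  then have "Phi d c x = ?H^3 * (8 * k'^3 * T 3 3 3 * T 4 4 4)" unfolding calc .
  then show ?thesis unfolding T_def fa_simps by (simp add: power_mult_distrib algebra_simps)
qed

text \<open>The mixed terms of D3(v,v,v) all carry the factor \<alpha>\<beta>, as does D2(v,v) =
  2\<alpha>\<beta> D2(v1,v2). The trace of v supplies the cofactor, and the coefficients 4 and 3 of
  \<open>Rv\<close> make the two cancel.\<close>

theorem Rv_frame: assumes v: "v = \<alpha> *s v1 + \<beta> *s v2 + \<pi> *s x"
  shows "Rv d c x v = 4 * Determinants.det (hess d c x) * (\<alpha>^3 * D3 d c x v1 v1 v1 + \<beta>^3 * D3 d c x v2 v2 v2)"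
proof -
  let ?H = "Determinants.det (hess d c x)" let ?e = "of_nat (d - 2) :: 'a"
  let ?k = "D2 d c x v1 v2" let ?h = "D2 d c x x b"
  define p q where "p = D3 d c x v1 v1 v2" and "q = D3 d c x v1 v2 v2"
  have e3: "D3 d c x u w x = ?e * D2 d c x u w" "D3 d c x u x w = ?e * D2 d c x u w" for u w
    using D3_x D3_sym12 D3_sym13 D3_sym23 D2_sym by metis+
  have ss: "D3 d c x v1 v2 v1 = p" "D3 d c x v2 v1 v1 = p" "D3 d c x v2 v1 v2 = q" "D3 d c x v2 v2 v1 = q"
     unfolding p_def q_def using D3_sym12 D3_sym13 D3_sym23 by metis+
  have D2v: "D2 d c x v v = 2 * \<alpha> * \<beta> * ?k"
    unfolding v D_lin by (simp add: fr_x i1 i2 D2_sym[of d c x v1 x] D2_sym[of d c x v2 x] D2_sym[of d c x v2 v1] algebra_simps)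
  have D3v: "D3 d c x v v v = \<alpha>^3 * D3 d c x v1 v1 v1 + \<beta>^3 * D3 d c x v2 v2 v2 + 3 * \<alpha>^2 * \<beta> * p + 3 * \<alpha> * \<beta>^2 * q + 6 * \<alpha> * \<beta> * \<pi> * ?e * ?k"
    unfolding v D_lin ss e3 D3_x
    by (simp add: p_def[symmetric] q_def[symmetric] fr_x i1 i2 D2_sym[of d c x v1 x] D2_sym[of d c x v2 x] D2_sym[of d c x v2 v1] algebra_simps power2_eq_square power3_eq_cube)
  have "(\<Sum>i\<in>UNIV. kap d c x i * v$i) = ?H * (2 * h' * D3 d c x v x b + 2 * k' * D3 d c x v v1 v2)"
    using fr_kap[of v] by (simp add: mult.commute[of "kap d c x _"] sum_4 fa_simps D3_sym23[of d c x v b x] D3_sym23[of d c x v v2 v1] algebra_simps)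
  also have "\<dots> = ?H * (2 * ?e * \<pi> * (h' * ?h) + 2 * ?e * \<pi> * (k' * ?k) + 2 * k' * (\<alpha> * p + \<beta> * q))"
    unfolding v D_lin ss e3 D3_x by (simp add: p_def[symmetric] q_def[symmetric] D2_sym[of d c x v1 b] D2_sym[of d c x v2 b] b1 b2 algebra_simps)
  also have "\<dots> = ?H * (4 * ?e * \<pi> + 2 * k' * (\<alpha> * p + \<beta> * q))" unfolding h k by (simp add: algebra_simps)
  finally have kk: "(\<Sum>i\<in>UNIV. kap d c x i * v$i) = \<dots>" .
  have "2 * \<alpha> * \<beta> * ?k * (?H * (4 * ?e * \<pi> + 2 * k' * (\<alpha> * p + \<beta> * q)))
    = ?H * (8 * \<alpha> * \<beta> * ?e * \<pi> * ?k + 4 * \<alpha> * \<beta> * (k' * ?k) * (\<alpha> * p + \<beta> * q))" by (simp add: algebra_simps)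
  also have "\<dots> = ?H * (8 * \<alpha> * \<beta> * ?e * \<pi> * ?k + 4 * \<alpha> * \<beta> * (\<alpha> * p + \<beta> * q))" unfolding k by simp
  finally have m: "2 * \<alpha> * \<beta> * ?k * (?H * (4 * ?e * \<pi> + 2 * k' * (\<alpha> * p + \<beta> * q))) = \<dots>" .
  show ?thesis unfolding Rv_def kk D2v D3v using arg_cong[OF m, of "\<lambda>z. 3 * z"]
    by (simp only: mult.assoc) (simp add: algebra_simps power2_eq_square)
qed

end

text \<open>Gram-Schmidt: remove from b0 its components along v1 and v2, then add a multiple of the
  isotropic vector x to make the result isotropic. Only the last step divides by 2.\<close>

lemma frame_exists:
  fixes d :: nat and c :: "'a::comm_ring_1 form4"
  assumes sup: "supp4 d c" and F0: "ev d c x = 0"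
    and t1: "D1 d c x v1 = 0" and t2: "D1 d c x v2 = 0"
    and i1: "D2 d c x v1 v1 = 0" and i2: "D2 d c x v2 v2 = 0"
    and k: "k' * D2 d c x v1 v2 = 1" and h: "h' * D2 d c x x b0 = 1" and two: "two' * 2 = (1::'a)"
  obtains b where "h' * D2 d c x x b = 1" "D2 d c x b b = 0" "D2 d c x b v1 = 0" "D2 d c x b v2 = 0"
proof -
  have fx: "D2 d c x x v1 = 0" "D2 d c x x v2 = 0" "D2 d c x x x = 0"
    using Euler2[OF sup, of x] t1 t2 D2_sym[of d c x] Euler1[OF sup, of x] F0 by auto
  have fx': "D2 d c x v1 x = 0" "D2 d c x v2 x = 0" using fx D2_sym by metis+
  have k2: "k' * D2 d c x v2 v1 = 1" using k D2_sym by metis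
  define b1 where "b1 = b0 - (k' * D2 d c x b0 v2) *s v1 - (k' * D2 d c x b0 v1) *s v2"
  define s where "s = - (two' * h' * D2 d c x b1 b1)"
  define b where "b = b1 + s *s x"
  have kk: "k' * a * D2 d c x v1 v2 = a" "k' * a * D2 d c x v2 v1 = a" for a
    using k k2 by (metis mult.assoc mult.commute mult.right_neutral)+
  have 1: "D2 d c x b1 v1 = 0" "D2 d c x b1 v2 = 0"
    unfolding b1_def D_lin i1 i2 kk by simp_all
  have xb: "D2 d c x x b1 = D2 d c x x b0" unfolding b1_def D_lin by (simp add: fx)
  have h1: "h' * D2 d c x x b = 1" unfolding b_def D_lin xb by (simp add: fx h)
  have "D2 d c x b b = D2 d c x b1 b1 + 2 * s * D2 d c x x b0"
    unfolding b_def D_lin by (simp add: fx xb D2_sym[of d c x b1 x] algebra_simps)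
  also have "\<dots> = D2 d c x b1 b1 - (two' * 2) * (h' * D2 d c x x b0) * D2 d c x b1 b1" unfolding s_def by (simp add: algebra_simps)
  finally have h2: "D2 d c x b b = 0" unfolding two h by simp
  have h3: "D2 d c x b v1 = 0" "D2 d c x b v2 = 0"
    unfolding b_def D_lin 1 by (simp_all add: fx)
  show ?thesis using that h1 h2 h3 by blast
qed

section \<open>Polynomials in one variable\<close>

definition good_char :: "'a::alg_closed_field itself \<Rightarrow> nat \<Rightarrow> bool" where
  "good_char _ d \<longleftrightarrow> CHAR('a) = 0 \<or> CHAR('a) > d"

lemma good_char_of_nat: "good_char TYPE('a::alg_closed_field) d \<Longrightarrow> 0 < k \<Longrightarrow> k \<le> d \<Longrightarrow> (of_nat k :: 'a) \<noteq> 0"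
  by (auto simp: good_char_def of_nat_eq_0_iff_char_dvd dest: dvd_imp_le)

text \<open>Over a finite field the product of all X - a, increased by 1, has positive degree and no
  root.\<close>

lemma infinite_alg_closed: "infinite (UNIV :: 'a::alg_closed_field set)"
proof
  assume fin: "finite (UNIV :: 'a set)"
  define p :: "'a poly" where "p = (\<Prod>a\<in>UNIV. [:-a, 1:])"
  have "degree p = card (UNIV :: 'a set)" unfolding p_def by (subst degree_prod_eq_sum_degree) auto
  then have "degree p > 0" using fin by (simp add: card_gt_0_iff)
  then have "degree (p + 1) > 0" by (simp add: degree_add_eq_left)
  then obtain x where "poly (p + 1) x = 0" using alg_closed_imp_poly_has_root by blast
  moreover have "poly p x = 0" using fin by (auto simp: p_def poly_prod)
  ultimately show False by simp
qed

lemma poly_zero_cofinite: fixes p :: "'a::alg_closed_field poly"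
  assumes "finite S" "\<And>x. x \<notin> S \<Longrightarrow> poly p x = 0" shows "p = 0"
proof (rule ccontr)
  assume "p \<noteq> 0"
  then have "finite {x. poly p x = 0}" by (rule poly_roots_finite)
  moreover have "UNIV \<subseteq> S \<union> {x. poly p x = 0}" using assms(2) by auto
  ultimately show False using infinite_alg_closed assms(1) by (meson finite_UnI infinite_super)
qed
lemma poly_all_zero: fixes p :: "'a::alg_closed_field poly" assumes "\<And>x. poly p x = 0" shows "p = 0"
  using poly_zero_cofinite[of "{}"] assms by auto

lemma exists_nonroot: fixes p :: "'a::alg_closed_field poly" assumes "p \<noteq> 0" "finite S"
  obtains x where "poly p x \<noteq> 0" "x \<notin> S"
  using poly_zero_cofinite[of S p] assms by blast

text \<open>Coprimality in terms of roots: A splits into linear factors, and each of them divides C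
  because it cannot divide B.\<close>

lemma dvd_of_no_common_root:
  fixes A B C :: "'a::alg_closed_field poly"
  assumes "A \<noteq> 0" "A dvd C * B" "\<And>r. poly A r = 0 \<Longrightarrow> poly B r \<noteq> 0"
  shows "A dvd C"
  using assms
proof (induction "degree A" arbitrary: A C)
  case 0
  then show ?case by (metis is_unit_iff_degree unit_imp_dvd)
next
  case (Suc n)
  then obtain r where r: "poly A r = 0" using alg_closed_imp_poly_has_root[of A] by auto
  then obtain A' where A': "A = [:-r,1:] * A'" by (auto simp: poly_eq_0_iff_dvd)
  have "poly (C * B) r = 0" using Suc.prems(2) r unfolding poly_eq_0_iff_dvd by (rule dvd_trans[rotated])
  then have "poly C r = 0" using Suc.prems(3)[OF r] by simp
  then obtain C' where C': "C = [:-r,1:] * C'" by (auto simp: poly_eq_0_iff_dvd)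
  have ne: "A' \<noteq> 0" using A' Suc.prems by auto
  have "degree ([:-r,1:] * A') = degree [:-r,1:] + degree A'" by (rule degree_mult_eq) (use ne in auto)
  then have "degree A = Suc (degree A')" unfolding A'[symmetric] by simp
  then have "n = degree A'" using Suc by simp
  moreover have "A' dvd C' * B" using Suc.prems(2) unfolding A' C' mult.assoc
    by (simp add: dvd_mult_cancel_left del: mult_pCons_left)
  moreover have "poly B s \<noteq> 0" if "poly A' s = 0" for s using Suc.prems(3)[of s] that A' by simp
  ultimately have "A' dvd C'" using Suc.hyps(1) ne by blast
  then show ?case unfolding A' C' by (rule mult_dvd_mono[OF dvd_refl])
qed

lemma power_root_cancel: fixes f g :: "'a::field poly"
  assumes "[:-r,1:]^m dvd f * g" "poly f r \<noteq> 0" shows "[:-r,1:]^m dvd g"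
  using assms(1)
proof (induction m arbitrary: g)
  case (Suc m)
  then have "[:-r,1:] dvd f * g" by (metis dvd_mult_left power_Suc)
  then have "poly (f * g) r = 0" by (simp only: poly_eq_0_iff_dvd)
  then have "poly g r = 0" using assms(2) by simp
  then obtain g' where g': "g = [:-r,1:] * g'" by (auto simp: poly_eq_0_iff_dvd)
  have "[:-r,1:] * [:-r,1:]^m dvd [:-r,1:] * (f * g')" using Suc.prems unfolding g' power_Suc by (simp only: mult.left_commute)
  then have "[:-r,1:]^m dvd f * g'" by (simp add: dvd_mult_cancel_left del: mult_pCons_left)
  then have "[:-r,1:]^m dvd g'" by (rule Suc.IH)
  then show ?case unfolding g' power_Suc by (rule mult_dvd_mono[OF dvd_refl])
qed simp

text \<open>The operator (X - r) d/dX preserves the order of vanishing at r, so local expansions can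
  be differentiated without the exponent m - 1.\<close>

lemma q_pderiv_pow: "[:-r,1:] * pderiv ([:-r,1:]^m * Z) = [:-r,1:]^m * (of_nat m * Z + [:-r,1:] * pderiv Z)"
  for Z :: "'a::idom poly"
proof -
  have "[:-r,1:] * pderiv ([:-r,1:]^m) = of_nat m * [:-r,1:]^m"
  proof (cases m)
    case (Suc n)
    have "pderiv ([:-r,1:]^Suc n) = of_nat (Suc n) * [:-r,1:]^n" by (simp only: pderiv_power_Suc) (simp add: pderiv_pCons of_nat_poly)
    then show ?thesis unfolding Suc by (simp only: power_Suc mult.left_commute)
  qed (simp add: pderiv_1)
  then have "[:-r,1:] * pderiv ([:-r,1:]^m) * Z = of_nat m * [:-r,1:]^m * Z" by simp
  then show ?thesis unfolding pderiv_mult distrib_left by (simp only: algebra_simps)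
qed

text \<open>For A and B the transverse derivatives along a line, the ratio A/B is the Gauss map
  restricted to the line, and the zeros of the Wronskian are its ramification points.\<close>

definition wron :: "'a::idom poly \<Rightarrow> 'a poly \<Rightarrow> 'a poly" where "wron A B = B * pderiv A - A * pderiv B"
text \<open>A Schwarzian of B/A: it measures how the asymptotic direction along a line bends when the point leaves the line.\<close>
definition schw :: "'a::idom poly \<Rightarrow> 'a poly \<Rightarrow> 'a poly" where
  "schw A B = 2 * wron A B * pderiv (pderiv (wron A B))
     + 4 * wron A B * (pderiv B * pderiv (pderiv A) - pderiv A * pderiv (pderiv B)) - 3 * (pderiv (wron A B))^2"

lemma pderiv_wron: "pderiv (wron A B) = B * pderiv (pderiv A) - A * pderiv (pderiv B)"
  by (simp add: wron_def pderiv_diff pderiv_mult algebra_simps)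

lemma wron_swap: "wron B A = - wron A B" by (simp add: wron_def)
lemma schw_swap: "schw B A = schw A B"
  unfolding schw_def wron_swap[of B A] by (simp add: pderiv_minus algebra_simps)

text \<open>If the derivative vanished then B A'' = A B''. Having no common root, A divides A'' and
  B divides B'', so both second derivatives are 0 for degree reasons. But one of the coefficients of
  degree d - 1 is nonzero, and (d-1)(d-2) is invertible.\<close>

lemma wron_nonconst:
  fixes A B :: "'a::alg_closed_field poly"
  assumes d: "d \<ge> 3" and ch: "good_char TYPE('a) d"
    and ncr: "\<And>r. poly A r = 0 \<Longrightarrow> poly B r \<noteq> 0"
    and top: "coeff A (d-1) \<noteq> 0 \<or> coeff B (d-1) \<noteq> 0"
  shows "pderiv (wron A B) \<noteq> 0"
proof
  assume "pderiv (wron A B) = 0"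
  then have eq: "B * pderiv (pderiv A) = A * pderiv (pderiv B)" unfolding pderiv_wron by simp
  have dd: "pderiv (pderiv P) = 0" if "P dvd pderiv (pderiv P)" for P :: "'a poly"
  proof (rule ccontr)
    assume n: "pderiv (pderiv P) \<noteq> 0"
    then have "degree P \<le> degree (pderiv (pderiv P))" using that dvd_imp_degree_le by blast
    moreover have "degree (pderiv (pderiv P)) \<le> degree P - 1 - 1" by (meson degree_pderiv_le diff_le_mono order_trans)
    ultimately have "degree P = 0" by linarith
    then show False using n by (metis pderiv_0 pderiv_pCons degree_eq_zeroE pCons_0_0 add_0)
  qed
  have z: "coeff P (d-1) = 0" if "pderiv (pderiv P) = 0" for P :: "'a poly"
  proof -
    have "coeff (pderiv (pderiv P)) (d - 3) = of_nat (d-2) * (of_nat (d-1) * coeff P (d-1))"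
      using d by (simp add: coeff_pderiv Suc_diff_Suc numeral_2_eq_2 numeral_3_eq_3)
    then show ?thesis using that good_char_of_nat[OF ch, of "d-2"] good_char_of_nat[OF ch, of "d-1"] d by auto
  qed
  have "pderiv (pderiv A) = 0"
  proof (cases "A = 0")
    case False
    have "A dvd pderiv (pderiv A) * B" using eq by (metis dvd_triv_left mult.commute)
    then show ?thesis using dvd_of_no_common_root[OF False] ncr dd by blast
  qed (simp add: pderiv_0)
  moreover have "pderiv (pderiv B) = 0"
  proof (cases "B = 0")
    case False
    have "B dvd pderiv (pderiv B) * A" using eq by (metis dvd_triv_left mult.commute)
    then show ?thesis using dvd_of_no_common_root[OF False] ncr dd by blast
  qed (simp add: pderiv_0)
  ultimately show False using z top by auto
qed

text \<open>Subtracting a multiple of B from A changes neither the Wronskian nor the Schwarzian, so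
  A may be replaced by C vanishing at r, to order m + 1 say. Then the Wronskian has order m, and the
  leading local coefficient of the Schwarzian is -m(m+2) times a nonzero square. The degree bound
  keeps m + 2 within d, hence nonzero in K. All derivatives are multiplied by q = X - r to avoid
  negative exponents.\<close>

lemma schw_local:
  fixes A B :: "'a::alg_closed_field poly"
  assumes d: "d \<ge> 3" and ch: "good_char TYPE('a) d"
    and deg: "degree A \<le> d-1" "degree B \<le> d-1"
    and Br: "poly B r \<noteq> 0" and ur: "poly (wron A B) r = 0" and u0: "wron A B \<noteq> 0"
  shows "schw A B \<noteq> 0"
proof
  assume S0: "schw A B = 0"
  define q where "q = [:-r,1:]"
  define C where "C = A - smult (poly A r / poly B r) B"
  have Cd: "degree C \<le> d - 1" unfolding C_def using deg by (meson degree_diff_le degree_smult_le order_trans)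
  have u: "wron A B = wron C B" unfolding C_def wron_def by (simp add: pderiv_diff pderiv_smult algebra_simps)
  have k1: "pderiv B * pderiv (pderiv A) - pderiv A * pderiv (pderiv B)
     = pderiv B * pderiv (pderiv C) - pderiv C * pderiv (pderiv B)"
    unfolding C_def by (simp add: pderiv_diff pderiv_smult algebra_simps)
  have C0: "C \<noteq> 0" using u0 unfolding u by (auto simp: wron_def pderiv_0)
  have Cr: "poly C r = 0" using Br by (simp add: C_def)
  obtain E where E: "C = q ^ order r C * E" and Er: "\<not> q dvd E"
    using order_decomp[OF C0, of r] unfolding q_def by blast
  have Er': "poly E r \<noteq> 0" using Er by (simp add: q_def poly_eq_0_iff_dvd)
  define k where "k = order r C"
  have k1': "k \<ge> 1" using order_root[of C r] C0 Cr unfolding k_def by auto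
  have kd: "k \<le> d - 1" using order_degree[OF C0, of r] Cd unfolding k_def by auto
  obtain m where m: "k = Suc m" using k1' by (cases k) auto
  have Ck: "C = q ^ k * E" using E k_def by simp
  define E1 where "E1 = of_nat k * E + q * pderiv E"
  have qC': "q * pderiv C = q ^ k * E1" unfolding Ck E1_def q_def by (rule q_pderiv_pow)
  have q0: "q \<noteq> 0" by (simp add: q_def)
  have qr: "poly q r = 0" by (simp add: q_def)
  have C'm: "pderiv C = q ^ m * E1" using qC' q0 unfolding m power_Suc mult.assoc by simp
  define U where "U = B * E1 - q * E * pderiv B"
  have "wron A B = B * (q ^ m * E1) - C * pderiv B" unfolding u by (simp only: wron_def C'm)
  also have "\<dots> = q ^ m * U" unfolding U_def by (subst Ck) (simp add: m algebra_simps)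
  finally have uU: "wron A B = q ^ m * U" .
  have Ur: "poly U r = of_nat k * poly E r * poly B r" unfolding U_def E1_def by (simp add: qr of_nat_poly algebra_simps)
  have knz: "(of_nat k :: 'a) \<noteq> 0" using good_char_of_nat[OF ch, of k] k1' kd by auto
  have Unz: "poly U r \<noteq> 0" using Ur knz Er' Br by simp
  have m1: "m \<ge> 1"
  proof (rule ccontr)
    assume "\<not> m \<ge> 1"
    then have "m = 0" by simp
    then have "wron A B = U" using uU by simp
    then show False using ur Unz by simp
  qed
  define Z where "Z = of_nat m * U + q * pderiv U"
  have u1: "q * pderiv (wron A B) = q ^ m * Z" unfolding uU Z_def q_def by (rule q_pderiv_pow)
  have "q * pderiv (q * pderiv (wron A B)) = q ^ m * (of_nat m * Z + q * pderiv Z)" unfolding u1 unfolding q_def by (rule q_pderiv_pow)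
  moreover have pq: "pderiv q = 1" by (simp add: q_def pderiv_pCons)
  ultimately have u2: "q * (q * pderiv (pderiv (wron A B))) = q ^ m * (of_nat m * Z + q * pderiv Z) - q ^ m * Z"
    using u1 unfolding pderiv_mult pq by (simp add: algebra_simps)
  have "q * pderiv (q * pderiv C) = q ^ k * (of_nat k * E1 + q * pderiv E1)" unfolding qC' unfolding q_def by (rule q_pderiv_pow)
  then have C2: "q * (q * pderiv (pderiv C)) = q ^ k * (of_nat k * E1 + q * pderiv E1) - q ^ k * E1"
    using qC' unfolding pderiv_mult pq by (simp add: algebra_simps)
  define Y where "Y = pderiv B * (of_nat k * E1 + q * pderiv E1 - E1) - q * E1 * pderiv (pderiv B)"
  have K: "q * (q * (pderiv B * pderiv (pderiv A) - pderiv A * pderiv (pderiv B))) = q ^ m * (q * Y)"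
  proof -
    have "q * (q * (pderiv B * pderiv (pderiv C) - pderiv C * pderiv (pderiv B)))
      = pderiv B * (q * (q * pderiv (pderiv C))) - q * (q * pderiv C) * pderiv (pderiv B)" by (simp add: algebra_simps)
    also have "\<dots> = q ^ m * (q * Y)" unfolding C2 qC' Y_def m by (simp add: algebra_simps)
    finally show ?thesis unfolding k1 .
  qed
  have "q * (q * schw A B) = 2 * wron A B * (q * (q * pderiv (pderiv (wron A B))))
     + 4 * wron A B * (q * (q * (pderiv B * pderiv (pderiv A) - pderiv A * pderiv (pderiv B)))) - 3 * (q * pderiv (wron A B))^2"
    unfolding schw_def by (simp add: algebra_simps power2_eq_square)
  also have "\<dots> = (q^m)^2 * (2 * U * (of_nat m * Z + q * pderiv Z - Z) + 4 * U * (q * Y) - 3 * Z^2)"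
    unfolding u1 u2 K unfolding uU by (simp add: algebra_simps power2_eq_square)
  finally have "2 * U * (of_nat m * Z + q * pderiv Z - Z) + 4 * U * (q * Y) - 3 * Z^2 = 0"
    using S0 q0 by simp
  then have "poly (2 * U * (of_nat m * Z + q * pderiv Z - Z) + 4 * U * (q * Y) - 3 * Z^2) r = 0" by simp
  \<comment> \<open>The contributions 2m(m-1) and -3 m^2 add up to -m(m+2); every other term
    contains q and vanishes at r.\<close>
  then have "- (of_nat m * (of_nat m + 2) * (poly U r)^2) = 0"
    unfolding Z_def by (simp add: qr of_nat_poly algebra_simps power2_eq_square)
  then have "of_nat m * (of_nat m + 2) * (poly U r)^2 = 0" by (simp only: neg_equal_0_iff_equal)
  moreover have "(of_nat m :: 'a) \<noteq> 0" using good_char_of_nat[OF ch, of m] m1 m kd by auto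
  moreover have "(of_nat m + 2 :: 'a) \<noteq> 0" using good_char_of_nat[OF ch, of "m+2"] m kd d by (simp add: add.commute)
  ultimately show False using Unz by simp
qed

text \<open>The Wronskian is not constant, hence has a root r. A and B enter symmetrically, and one
  of them is nonzero at r.\<close>

lemma schw_nonzero:
  fixes A B :: "'a::alg_closed_field poly"
  assumes d: "d \<ge> 3" and ch: "good_char TYPE('a) d"
    and deg: "degree A \<le> d-1" "degree B \<le> d-1"
    and ncr: "\<And>r. poly A r = 0 \<Longrightarrow> poly B r \<noteq> 0"
    and top: "coeff A (d-1) \<noteq> 0 \<or> coeff B (d-1) \<noteq> 0"
  shows "schw A B \<noteq> 0"
proof -
  have n: "pderiv (wron A B) \<noteq> 0" by (rule wron_nonconst[OF d ch ncr top])
  then have u0: "wron A B \<noteq> 0" by (auto simp: pderiv_0)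
  have "degree (wron A B) > 0" using n by (metis degree_eq_zeroE gr0I pderiv_pCons pderiv_0 pCons_0_0 add_0)
  then obtain r where r: "poly (wron A B) r = 0" using alg_closed_imp_poly_has_root by blast
  show ?thesis
  proof (cases "poly B r = 0")
    case False
    then show ?thesis using schw_local[OF d ch deg False r u0] by simp
  next
    case True
    then have "poly A r \<noteq> 0" using ncr by auto
    then show ?thesis using schw_local[OF d ch deg(2,1), of r] r u0 by (simp add: wron_swap[of A B] schw_swap[of A B])
  qed
qed

section \<open>Lines\<close>

definition indep2 :: "'a::field^4 \<Rightarrow> 'a^4 \<Rightarrow> bool" where
  "indep2 a b \<longleftrightarrow> (\<forall>s t. s *s a + t *s b = 0 \<longrightarrow> s = 0 \<and> t = 0)"
definition sp :: "'a::field^4 \<Rightarrow> 'a^4 \<Rightarrow> ('a^4) set" where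
  "sp a b = {s *s a + t *s b |s t. True}"
definition basis4 :: "'a::field^4 \<Rightarrow> 'a^4 \<Rightarrow> 'a^4 \<Rightarrow> 'a^4 \<Rightarrow> bool" where
  "basis4 e f g h \<longleftrightarrow> (\<forall>x. \<exists>a b p q. x = a *s e + b *s f + p *s g + q *s h) \<and>
     (\<forall>a b p q. a *s e + b *s f + p *s g + q *s h = 0 \<longrightarrow> a = 0 \<and> b = 0 \<and> p = 0 \<and> q = 0)"
definition smooth4 :: "nat \<Rightarrow> 'a::field form4 \<Rightarrow> bool" where
  "smooth4 d c \<longleftrightarrow> (\<forall>x. x \<noteq> 0 \<longrightarrow> ev d c x = 0 \<longrightarrow> (\<exists>v. D1 d c x v \<noteq> 0))"

lemma basis4_extend: assumes "indep2 e f" obtains g h where "basis4 e f g h"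
proof -
  have ef: "e \<noteq> f"
  proof
    assume "e = f" then have "1 *s e + (-1) *s f = 0" by (simp add: cart_eq)
    then show False using assms unfolding indep2_def by (metis zero_neq_one)
  qed
  have ind: "vec.independent {e,f}"
  proof (rule vec.independent_if_scalars_zero)
    fix u x assume s: "(\<Sum>x\<in>{e,f}. u x *s x) = 0" and x: "x \<in> {e,f}"
    have "u e *s e + u f *s f = 0" using s ef by simp
    then have "u e = 0 \<and> u f = 0" using assms by (simp add: indep2_def)
    then show "u x = 0" using x by auto
  qed simp
  obtain B where B: "{e,f} \<subseteq> B" "vec.independent B" "vec.span B = (UNIV::('a^4) set)"
    using vec.maximal_independent_subset_extend[OF _ ind, of UNIV] by (metis subset_UNIV top.extremum_uniqueI)
  have "card B = vec.dim (UNIV::('a^4) set)" using B by (metis vec.dim_eq_card vec.span_UNIV)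
  also have "\<dots> = 4" by (simp add: vec.dim_UNIV vec.dimension_def card_cart_basis)
  finally have card: "card B = 4" .
  then have finB: "finite B" by (metis card.infinite zero_neq_numeral)
  have "card (B - {e,f}) = 2" using card B(1) ef finB by (subst card_Diff_subset) auto
  then obtain g h where gh: "B - {e,f} = {g,h}" "g \<noteq> h" by (meson card_2_iff)
  have Beq: "B = {e,f,g,h}" using gh B(1) by blast
  have ne: "e \<noteq> g" "e \<noteq> h" "f \<noteq> g" "f \<noteq> h" using gh by auto
  have sum: "(\<Sum>x\<in>B. u x *s x) = u e *s e + u f *s f + u g *s g + u h *s h" for u
    unfolding Beq using ne ef gh(2) by (simp add: add.assoc)
  have "basis4 e f g h" unfolding basis4_def
  proof (intro conjI allI impI)
    fix x
    have "x \<in> vec.span B" using B by simp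
    then obtain u where "x = (\<Sum>v\<in>B. u v *s v)" unfolding vec.span_finite[OF finB] by auto
    then show "\<exists>a b p q. x = a *s e + b *s f + p *s g + q *s h" unfolding sum by blast
  next
    fix a b p q assume z: "a *s e + b *s f + p *s g + q *s h = 0"
    define u where "u x = (if x = e then a else if x = f then b else if x = g then p else q)" for x
    have "(\<Sum>x\<in>B. u x *s x) = 0" unfolding sum using z ne ef gh(2) by (simp add: u_def)
    then have "\<forall>x\<in>B. u x = 0" using B(2) finB vec.independentD by blast
    then have "u e = 0" "u f = 0" "u g = 0" "u h = 0" unfolding Beq by auto
    then show "a = 0" "b = 0" "p = 0" "q = 0" using ne ef gh(2) by (auto simp: u_def split: if_splits)
  qed
  then show ?thesis using that by blast
qed

section \<open>A line on a smooth surface\<close>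

locale surf =
  fixes d :: nat and c :: "'a::alg_closed_field form4"
  assumes sup: "supp4 d c" and d3: "d \<ge> 3" and ch: "good_char TYPE('a) d" and sm: "smooth4 d c"
begin
lemma nat_nz: "0 < k \<Longrightarrow> k \<le> d \<Longrightarrow> (of_nat k :: 'a) \<noteq> 0" by (rule good_char_of_nat[OF ch])
lemma two_nz: "(2::'a) \<noteq> 0" using nat_nz[of 2] d3 by simp
lemma three_nz: "(3::'a) \<noteq> 0" using nat_nz[of 3] d3 by simp
end

text \<open>Segre's lines of the second kind: at every point the asymptotic direction v other than the line itself
also has contact of order at least four.\<close>
definition second_kind :: "nat \<Rightarrow> 'a::field form4 \<Rightarrow> ('a^4) set \<Rightarrow> bool" where
  "second_kind d c L \<longleftrightarrow> (\<forall>p\<in>L. \<forall>y\<in>L. \<forall>v. D1 d c p v = 0 \<and> D2 d c p v v = 0 \<and> D2 d c p y v \<noteq> 0 \<longrightarrow> D3 d c p v v v = 0)"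

locale lsurf = surf d c for d :: nat and c :: "'a::alg_closed_field form4" +
  fixes e f g1 g2 :: "'a^4"
  assumes bas: "basis4 e f g1 g2" and on: "\<And>s t. ev d c (s *s e + t *s f) = 0"
begin

definition X where "X = lin e f"
text \<open>A and B are the derivatives of the equation in two transverse directions along the line:
  the tangent plane as a function of the point. By smoothness they have no common zero
  (\<open>ncr\<close>), nor one at infinity (\<open>topAB\<close>).\<close>

definition A where "A = D1 d (cl c) X (cv g1)"
definition B where "B = D1 d (cl c) X (cv g2)"
definition u where "u = wron A B"
text \<open>A tangent vector transverse to the line at every point, since A and B have no common
  zero.\<close>

definition tau where "tau = B *s cv g1 - A *s cv g2"
definition w2 where "w2 = D2 d (cl c) X tau tau"
definition om where "om = D3 d (cl c) X tau tau (cv f)"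
definition sg where "sg = D3 d (cl c) X tau tau tau"
text \<open>2 u tau - w2 f is the second asymptotic direction along the line, and its third derivative is 2 u W; hence W = 0
for lines of the second kind, and W of degree at most 8d - 14 has a root wherever the line meets another one.\<close>
definition W where "W = 3 * w2^2 * pderiv u - 6 * u * w2 * om + 4 * u^2 * sg"
definition V2 where "V2 = (2 * u) *s tau - w2 *s cv f"

lemmas supc = supp4_cl[OF sup]
lemma clconst: "pderiv (cl c m) = 0" by (simp add: pderiv_pCons)
lemmas ch_ev = ev_deriv[OF derivation_pderiv supc clconst]
lemmas ch_D1 = D1_deriv[OF derivation_pderiv supc clconst]
lemmas ch_D2 = D2_deriv[OF derivation_pderiv supc clconst]
lemmas ch_D3 = D3_deriv[OF derivation_pderiv supc clconst]

lemma D0: "D1 d q x 0 = 0" "D2 d q x 0 v = 0" "D2 d q x v 0 = 0" "D3 d q x 0 v w = 0" "D3 d q x v 0 w = 0" "D3 d q x v w 0 = 0"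
  by (simp_all add: D1_def D2_def D3_def)

lemma evX: "ev d (cl c) X = 0"
proof (rule poly_all_zero)
  fix z show "poly (ev d (cl c) X) z = 0" unfolding poly_ev X_def mapv_lin using on[of 1 z] by simp
qed
lemma pX: "mapv pderiv X = cv f" by (simp add: X_def)
lemma D1f: "D1 d (cl c) X (cv f) = 0" using ch_ev[of X] by (simp add: evX pX pderiv_0)
lemma X_split: "X = cv e + [:0,1:] *s cv f" by (simp add: X_def cart_eq)
lemma D1X: "D1 d (cl c) X X = 0" using Euler1[OF supc, of X] evX by simp
lemma D1e: "D1 d (cl c) X (cv e) = 0"
proof -
  have "D1 d (cl c) X X = D1 d (cl c) X (cv e) + [:0,1:] * D1 d (cl c) X (cv f)" by (subst (2) X_split) (simp only: D_lin)
  then show ?thesis using D1X D1f by simp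
qed
lemma D2ff: "D2 d (cl c) X (cv f) (cv f) = 0"
  using ch_D1[of X "cv f"] by (simp add: D1f pX pderiv_0 D0)
lemma D3fff: "D3 d (cl c) X (cv f) (cv f) (cv f) = 0"
  using ch_D2[of X "cv f" "cv f"] by (simp add: D2ff pX pderiv_0 D0)
lemma dA: "pderiv A = D2 d (cl c) X (cv g1) (cv f)" and dB: "pderiv B = D2 d (cl c) X (cv g2) (cv f)"
  unfolding A_def B_def ch_D1 pX by (simp_all add: D0)
lemma ddA: "pderiv (pderiv A) = D3 d (cl c) X (cv g1) (cv f) (cv f)" and ddB: "pderiv (pderiv B) = D3 d (cl c) X (cv g2) (cv f) (cv f)"
  unfolding dA dB ch_D2 pX by (simp_all add: D0)
lemma dddA: "pderiv (pderiv (pderiv A)) = D4 d (cl c) X (cv g1) (cv f) (cv f) (cv f)" and dddB: "pderiv (pderiv (pderiv B)) = D4 d (cl c) X (cv g2) (cv f) (cv f) (cv f)"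
  unfolding ddA ddB ch_D3 pX by (simp_all add: D0)

lemma u_eq: "u = B * pderiv A - A * pderiv B" by (simp add: u_def wron_def)
lemma du: "pderiv u = B * pderiv (pderiv A) - A * pderiv (pderiv B)" by (simp add: u_def pderiv_wron)

lemma D1tau: "D1 d (cl c) X tau = 0" unfolding tau_def D_lin A_def[symmetric] B_def[symmetric] by simp
lemma D2tauf: "D2 d (cl c) X tau (cv f) = u" unfolding tau_def D_lin dA[symmetric] dB[symmetric] u_eq by simp
lemma D2ftau: "D2 d (cl c) X (cv f) tau = u" using D2tauf D2_sym by metis
lemma D3tauff: "D3 d (cl c) X tau (cv f) (cv f) = pderiv u" unfolding tau_def D_lin ddA[symmetric] ddB[symmetric] du by simp
lemma D1V2: "D1 d (cl c) X V2 = 0" unfolding V2_def D_lin D1tau D1f by simp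
lemma D2fV2: "D2 d (cl c) X (cv f) V2 = 2 * u^2" unfolding V2_def D_lin D2ftau D2ff by (simp add: power2_eq_square)
lemma D2V2: "D2 d (cl c) X V2 V2 = 0"
  unfolding V2_def D_lin D2ftau D2tauf D2ff w2_def[symmetric] by (simp add: algebra_simps)
lemma D3V2: "D3 d (cl c) X V2 V2 V2 = 2 * u * W"
proof -
  have s: "D3 d (cl c) X tau (cv f) tau = om" "D3 d (cl c) X (cv f) tau tau = om"
    "D3 d (cl c) X (cv f) tau (cv f) = pderiv u" "D3 d (cl c) X (cv f) (cv f) tau = pderiv u"
    unfolding om_def using D3_sym12 D3_sym23 D3_sym13 D3tauff by metis+
  show ?thesis unfolding V2_def D_lin s D3tauff D3fff om_def[symmetric] sg_def[symmetric] W_def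
    by (simp add: algebra_simps power2_eq_square)
qed

definition pz where "pz z = e + z *s f"
definition tz where "tz z = poly B z *s g1 - poly A z *s g2"
definition v2 where "v2 z = (2 * poly u z) *s tz z - poly w2 z *s f"

lemma mX: "mapv (\<lambda>p. poly p z) X = pz z" by (simp add: X_def pz_def)
lemma mtau: "mapv (\<lambda>p. poly p z) tau = tz z" by (simp add: tau_def tz_def)
lemma mV2: "mapv (\<lambda>p. poly p z) V2 = v2 z" by (simp add: V2_def v2_def mtau)

lemma ev_pz: "ev d c (pz z) = 0" using on[of 1 z] by (simp add: pz_def)
lemma A_val: "D1 d c (pz z) g1 = poly A z" and B_val: "D1 d c (pz z) g2 = poly B z"
  by (simp_all add: A_def B_def poly_D1 mX)
lemma D1_pz: "D1 d c (pz z) e = 0" "D1 d c (pz z) f = 0" "D1 d c (pz z) (tz z) = 0" "D1 d c (pz z) (v2 z) = 0"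
  using arg_cong[OF D1e, of "\<lambda>p. poly p z"] arg_cong[OF D1f, of "\<lambda>p. poly p z"] arg_cong[OF D1tau, of "\<lambda>p. poly p z"] arg_cong[OF D1V2, of "\<lambda>p. poly p z"]
  by (simp_all add: poly_D1 mX mtau mV2)
lemma D2_pz: "D2 d c (pz z) f f = 0" "D2 d c (pz z) f (tz z) = poly u z" "D2 d c (pz z) f (v2 z) = 2 * (poly u z)^2"
  "D2 d c (pz z) (v2 z) (v2 z) = 0" "D2 d c (pz z) (tz z) (tz z) = poly w2 z"
  using arg_cong[OF D2ff, of "\<lambda>p. poly p z"] arg_cong[OF D2ftau, of "\<lambda>p. poly p z"] arg_cong[OF D2fV2, of "\<lambda>p. poly p z"]
    arg_cong[OF D2V2, of "\<lambda>p. poly p z"] arg_cong[OF w2_def, of "\<lambda>p. poly p z"]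
  by (simp_all add: poly_D2 mX mtau mV2)
lemma D3_pz: "D3 d c (pz z) f f f = 0" "D3 d c (pz z) (v2 z) (v2 z) (v2 z) = 2 * poly u z * poly W z"
  "D3 d c (pz z) (tz z) f f = poly (pderiv u) z"  "D3 d c (pz z) (tz z) (tz z) f = poly om z" "D3 d c (pz z) (tz z) (tz z) (tz z) = poly sg z"
  using arg_cong[OF D3fff, of "\<lambda>p. poly p z"] arg_cong[OF D3V2, of "\<lambda>p. poly p z"] arg_cong[OF D3tauff, of "\<lambda>p. poly p z"]
    arg_cong[OF om_def, of "\<lambda>p. poly p z"] arg_cong[OF sg_def, of "\<lambda>p. poly p z"]
  by (simp_all add: poly_D3 mX mtau mV2)

lemma bas_span: obtains a b p q where "x = a *s e + b *s f + p *s g1 + q *s g2" using bas unfolding basis4_def by meson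
lemma bas_ind: "a *s e + b *s f + p *s g1 + q *s g2 = 0 \<Longrightarrow> a = 0 \<and> b = 0 \<and> p = 0 \<and> q = 0" using bas unfolding basis4_def by blast

lemma pz_nz: "pz z \<noteq> 0" using bas_ind[of 1 z 0 0] by (auto simp: pz_def)
lemma f_nz: "f \<noteq> 0" using bas_ind[of 0 1 0 0] by auto

lemma ncr: "poly A z = 0 \<Longrightarrow> poly B z \<noteq> 0"
proof
  assume "poly A z = 0" "poly B z = 0"
  then have "D1 d c (pz z) v = 0" for v by (rule_tac x=v in bas_span) (simp add: D_lin D1_pz A_val B_val)
  then show False using sm pz_nz ev_pz unfolding smooth4_def by blast
qed
lemma dcA: "dc (d-1) A (D1 d c f g1)" and dcB: "dc (d-1) B (D1 d c f g2)"
  unfolding A_def B_def X_def by (rule dc_D1_lin)+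
lemma degA: "degree A \<le> d - 1" and degB: "degree B \<le> d - 1" using dcA dcB by (auto simp: dc_def)
lemma D1_f: "D1 d c f e = 0" "D1 d c f f = 0"
  using dc_D1_lin[of d c e f e] dc_D1_lin[of d c e f f] D1e D1f unfolding X_def by (auto simp: dc_def)
lemma ev_f: "ev d c f = 0" using on[of 0 1] by simp
text \<open>Smoothness at f, the point of the line that the parameter z misses: there the transverse
  derivatives are the coefficients of degree d - 1.\<close>

lemma topAB: "coeff A (d-1) \<noteq> 0 \<or> coeff B (d-1) \<noteq> 0"
proof (rule ccontr)
  assume "\<not> ?thesis"
  then have z: "D1 d c f g1 = 0" "D1 d c f g2 = 0" using dcA dcB by (auto simp: dc_def)
  have "D1 d c f v = 0" for v by (rule_tac x=v in bas_span) (simp add: D_lin D1_f z)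
  then show False using sm f_nz ev_f unfolding smooth4_def by blast
qed

lemma du_nz: "pderiv u \<noteq> 0" unfolding u_def by (rule wron_nonconst[OF d3 ch ncr topAB])
lemma u_nz: "u \<noteq> 0" using du_nz by (auto simp: pderiv_0)
lemma schw_nz: "schw A B \<noteq> 0" by (rule schw_nonzero[OF d3 ch degA degB ncr topAB])

text \<open>One of A and B has degree at least 2 and no root in common with the other, so it would
  divide a nonzero polynomial of degree at most 1.\<close>

lemma lin_syz: assumes "degree a \<le> 1" "degree b \<le> 1" "a * A + b * B = 0" shows "a = 0 \<and> b = 0"
proof -
  have main: "q = 0" if "degree P \<ge> 2" "P dvd q * Q" "degree q \<le> 1" "\<And>r. poly P r = 0 \<Longrightarrow> poly Q r \<noteq> 0" for P Q q :: "'a poly"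
  proof -
    have "P \<noteq> 0" using that(1) by auto
    then have "P dvd q" using dvd_of_no_common_root that by blast
    then show ?thesis using that dvd_imp_degree_le by (metis Suc_1 not_less_eq_eq order_trans One_nat_def)
  qed
  have eq: "a * A = - (b * B)" using assms(3) by (simp add: eq_neg_iff_add_eq_0)
  show ?thesis
  proof (cases "degree A \<ge> 2")
    case True
    have "A dvd b * B" using eq by (metis dvd_minus_iff dvd_triv_right)
    then have "b = 0" using main[OF True] assms(2) ncr by blast
    then have "a * A = 0" using eq by simp
    then show ?thesis using \<open>b = 0\<close> True by auto
  next
    case False
    then have cA: "coeff A (d-1) = 0" using d3 by (intro coeff_eq_0) simp
    then have "coeff B (d-1) \<noteq> 0" using topAB by auto
    then have B2: "degree B \<ge> 2" using le_degree[of B "d-1"] d3 by linarith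
    have "B dvd a * A" using eq by (metis dvd_minus_iff dvd_triv_right)
    then have "a = 0" using main[OF B2] assms(1) ncr by blast
    then have "b * B = 0" using eq by simp
    then show ?thesis using \<open>a = 0\<close> B2 by auto
  qed
qed

text \<open>Rigidity of the line. Modulo the line, the field y0 + t y1 is a section of its normal
  bundle in space, O(1)+O(1); tangency to the surface places it in the normal bundle O(2-d) in the
  surface, which has no sections for d at least 3. In coordinates this is a linear syzygy of A and
  B.\<close>

theorem NLS: assumes "\<And>t. t \<notin> S \<Longrightarrow> D1 d c (pz t) (y0 + t *s y1) = 0" "finite S"
  shows "y0 \<in> sp e f" "y1 \<in> sp e f"
proof -
  obtain a0 b0 p0 q0 where y0: "y0 = a0 *s e + b0 *s f + p0 *s g1 + q0 *s g2" by (rule bas_span)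
  obtain a1 b1 p1 q1 where y1: "y1 = a1 *s e + b1 *s f + p1 *s g1 + q1 *s g2" by (rule bas_span)
  have "[:p0,p1:] * A + [:q0,q1:] * B = 0"
  proof (rule poly_zero_cofinite[OF assms(2)])
    fix t assume "t \<notin> S"
    from assms(1)[OF this] show "poly ([:p0,p1:] * A + [:q0,q1:] * B) t = 0"
      unfolding y0 y1 D_lin by (simp add: D1_pz A_val B_val algebra_simps)
  qed
  then have "[:p0,p1:] = 0 \<and> [:q0,q1:] = 0" by (intro lin_syz) auto
  then show "y0 \<in> sp e f" "y1 \<in> sp e f" unfolding y0 y1 sp_def by auto
qed

lemma tangent_decomp: assumes "D1 d c (pz z) v = 0" "poly u z \<noteq> 0"
  obtains \<alpha> \<beta> \<pi> where "v = \<alpha> *s f + \<beta> *s v2 z + \<pi> *s pz z"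
proof -
  obtain a b p q where v: "v = a *s e + b *s f + p *s g1 + q *s g2" by (rule bas_span)
  have eq: "p * poly A z + q * poly B z = 0" using assms(1) unfolding v D_lin by (simp add: D1_pz A_val B_val)
  obtain l where l: "p = l * poly B z" "q = - (l * poly A z)"
  proof (cases "poly B z = 0")
    case False
    have "q = - (p / poly B z * poly A z)" using eq False by (simp add: field_simps eq_neg_iff_add_eq_0)
    then show ?thesis using that[of "p / poly B z"] False by simp
  next
    case True
    then have "poly A z \<noteq> 0" using ncr by blast
    then show ?thesis using that[of "- q / poly A z"] eq True by simp
  qed
  have n: "2 * poly u z \<noteq> 0" using assms(2) two_nz by simp
  have t: "l *s tz z = (l / (2 * poly u z)) *s v2 z + (l / (2 * poly u z) * poly w2 z) *s f"
    using n by (simp add: v2_def cart_eq field_simps)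
  have "v = (b - a * z) *s f + l *s tz z + a *s pz z"
    unfolding v l by (simp add: pz_def tz_def cart_eq algebra_simps)
  also have "\<dots> = (b - a * z + l / (2 * poly u z) * poly w2 z) *s f + (l / (2 * poly u z)) *s v2 z + a *s pz z"
    unfolding t by (simp add: cart_eq algebra_simps)
  finally show ?thesis using that by blast
qed

lemma pz_in: "pz z \<in> sp e f" unfolding pz_def sp_def by (metis (mono_tags, lifting) mem_Collect_eq vector_smult_lid)
lemma f_in: "f \<in> sp e f" unfolding sp_def by (metis (mono_tags, lifting) mem_Collect_eq vector_smult_lid vector_smult_lzero add_0)

lemma sec_W: assumes "second_kind d c (sp e f)" shows "W = 0"
proof (rule poly_zero_cofinite)
  show "finite {z. poly u z = 0}" by (rule poly_roots_finite[OF u_nz])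
  fix z assume "z \<notin> {z. poly u z = 0}"
  then have n: "poly u z \<noteq> 0" by simp
  have "D3 d c (pz z) (v2 z) (v2 z) (v2 z) = 0"
    using assms pz_in f_in D1_pz(4) D2_pz(3,4) n two_nz unfolding second_kind_def by (metis mult_eq_0_iff power_eq_0_iff)
  then show "poly W z = 0" unfolding D3_pz using n two_nz by simp
qed

text \<open>Where u(z) is nonzero, an asymptotic direction other than the line is \<beta> v2 + \<pi>
  pz, and its third derivative is \<beta>^3 times 2uW. Where u(z) = 0, the direction f is orthogonal
  to the whole tangent plane, which contradicts the assumption on y.\<close>

lemma not_sec_W:
  assumes "p = pz z" "y \<in> sp e f" "D1 d c p v = 0" "D2 d c p v v = 0" "D2 d c p y v \<noteq> 0" "D3 d c p v v v \<noteq> 0"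
  shows "W \<noteq> 0"
proof
  assume W0: "W = 0"
  obtain s t where y: "y = s *s e + t *s f" using assms(2) unfolding sp_def by blast
  have y': "y = s *s pz z + (t - s * z) *s f" unfolding y pz_def by (simp add: cart_eq algebra_simps)
  have pv: "D2 d c (pz z) (pz z) w = of_nat (d - 1) * D1 d c (pz z) w" for w using Euler2[OF sup] D2_sym by metis
  have fv: "D2 d c (pz z) f v \<noteq> 0" using assms(3,5) unfolding assms(1) y' D_lin pv by auto
  obtain a b p q where v: "v = a *s e + b *s f + p *s g1 + q *s g2" by (rule bas_span)
  show False
  proof (cases "poly u z = 0")
    case False
    obtain \<alpha> \<beta> \<pi> where vv: "v = \<alpha> *s f + \<beta> *s v2 z + \<pi> *s pz z" using tangent_decomp[OF _ False] assms(1,3) by metis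
    have D2s: "D2 d c (pz z) (v2 z) f = 2 * (poly u z)^2" using D2_pz(3) D2_sym by metis
    have "D2 d c (pz z) f v = \<beta> * (2 * (poly u z)^2)" unfolding vv D_lin D2_pz by (simp add: Euler2[OF sup] pv D1_pz)
    then have bn: "\<beta> \<noteq> 0" using fv by auto
    have pq: "D1 d c (pz z) (pz z) = 0" using Euler1[OF sup, of "pz z"] ev_pz by simp
    have pp: "D2 d c (pz z) (pz z) (pz z) = 0" unfolding pv using Euler1[OF sup, of "pz z"] ev_pz by simp
    have "D2 d c (pz z) v v = \<alpha> * \<beta> * (4 * (poly u z)^2)" unfolding vv D_lin D2_pz D2s
      by (simp add: Euler2[OF sup] pv D1_pz pq algebra_simps)
    moreover have "(4::'a) \<noteq> 0" using two_nz by (metis mult_2 mult_eq_0_iff numeral_Bit0)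
    ultimately have "\<alpha> = 0" using assms(1,4) bn False by simp
    then have vb: "v = \<beta> *s v2 z + \<pi> *s pz z" using vv by simp
    have e3: "D3 d c (pz z) u' w (pz z) = of_nat (d-2) * D2 d c (pz z) u' w" for u' w by (rule Euler3[OF sup])
    have e3': "D3 d c (pz z) u' (pz z) w = of_nat (d-2) * D2 d c (pz z) u' w" "D3 d c (pz z) (pz z) u' w = of_nat (d-2) * D2 d c (pz z) u' w" for u' w
      using e3 D3_sym23 D3_sym13 D2_sym by metis+
    have "D3 d c (pz z) v v v = 0" unfolding vb D_lin e3 e3' D3_pz W0 pp D2_pz
      by (simp add: Euler2[OF sup] pv D1_pz pq)
    then show False using assms(1,6) by simp
  next
    case True
    have eq: "p * poly A z + q * poly B z = 0" using assms(3) unfolding assms(1) v D_lin by (simp add: D1_pz A_val B_val)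
    have "D2 d c (pz z) f v = p * poly (pderiv A) z + q * poly (pderiv B) z"
    proof -
      have f1: "D2 d c (pz z) f g1 = poly (pderiv A) z" "D2 d c (pz z) f g2 = poly (pderiv B) z"
        unfolding dA dB poly_D2 mX by (simp_all add: D2_sym[of d c _ f])
      have f2: "D2 d c (pz z) f (pz z) = 0" using Euler2[OF sup, of "pz z" f] D1_pz by simp
      have "D2 d c (pz z) f e = 0" using f2 D2_pz(1) by (simp add: pz_def D_lin)
      then show ?thesis unfolding v D_lin f1 D2_pz by simp
    qed
    also have "\<dots> = 0"
    proof -
      have "poly B z * poly (pderiv A) z = poly A z * poly (pderiv B) z" using True by (simp add: u_eq)
      then have "poly B z * (p * poly (pderiv A) z + q * poly (pderiv B) z) = (p * poly A z + q * poly B z) * poly (pderiv B) z"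
        "poly A z * (p * poly (pderiv A) z + q * poly (pderiv B) z) = (p * poly A z + q * poly B z) * poly (pderiv A) z"
        by (simp_all add: algebra_simps)
      then show ?thesis unfolding eq using ncr[of z] by auto
    qed
    finally show False using fv by simp
  qed
qed

end

section \<open>Dual numbers\<close>

text \<open>K[\<epsilon>] with \<epsilon>^2 = 0. A polynomial identity evaluated at p + \<epsilon> w
  yields the derivative at p in the direction w as its imaginary part; this is how
  \<open>Phi\<close> is differentiated off the line without expanding it.\<close>

datatype 'a dual = Dual (re: 'a) (im: 'a)

instantiation dual :: (comm_ring_1) comm_ring_1
begin
definition "0 = Dual 0 0"
definition "1 = Dual 1 0"
definition "x + y = Dual (re x + re y) (im x + im y)"
definition "x - y = Dual (re x - re y) (im x - im y)"
definition "- x = Dual (- re x) (- im x)"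
definition "x * y = Dual (re x * re y) (re x * im y + im x * re y)"
instance
  by standard (auto simp: zero_dual_def one_dual_def plus_dual_def minus_dual_def uminus_dual_def times_dual_def algebra_simps)
end

lemma dual_sel [simp]: "re 0 = 0" "im 0 = 0" "re 1 = 1" "im 1 = 0" "re (x + y) = re x + re y" "im (x + y) = im x + im y"
  "re (x - y) = re x - re y" "im (x - y) = im x - im y" "re (- x) = - re x" "im (- x) = - im x"
  "re (x * y) = re x * re y" "im (x * y) = re x * im y + im x * re y"
  by (simp_all add: zero_dual_def one_dual_def plus_dual_def minus_dual_def uminus_dual_def times_dual_def)

lemma dual_unit: assumes "re (x::'a::field dual) \<noteq> 0"
  shows "Dual (1 / re x) (- im x / (re x)^2) * x = 1"
  using assms by (simp add: dual.expand times_dual_def one_dual_def power2_eq_square)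

lemma hom_const_dual: "comm_ring_hom (\<lambda>a::'a::comm_ring_1. Dual a 0)"
  by unfold_locales (auto simp: zero_dual_def one_dual_def plus_dual_def times_dual_def)
lemma hom_re: "comm_ring_hom (re :: 'a::comm_ring_1 dual \<Rightarrow> 'a)" by unfold_locales auto
lemma hom_poly_dual: "comm_ring_hom (\<lambda>p::'a::comm_ring_1 poly. Dual (coeff p 0) (coeff p 1))"
  by unfold_locales (auto simp: zero_dual_def one_dual_def plus_dual_def times_dual_def coeff_mult)

definition dv :: "'a^4 \<Rightarrow> 'a^4 \<Rightarrow> 'a dual^4" where "dv p w = (\<chi> i. Dual (p$i) (w$i))"
lemma dv_nth [simp]: "dv p w $ i = Dual (p$i) (w$i)" by (simp add: dv_def)
abbreviation dl :: "'a::comm_ring_1 form4 \<Rightarrow> 'a dual form4" where "dl c \<equiv> (\<lambda>m. Dual (c m) 0)"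
lemma mapv_lin_dual: "mapv (\<lambda>p. Dual (coeff p 0) (coeff p 1)) (lin p w) = dv p w"
  by (simp add: cart_eq)
lemma mapv_re_dv [simp]: "mapv re (dv p w) = p" by (simp add: cart_eq)

lemma coeff1: "coeff q 1 = poly (pderiv q) (0::'a::idom)" by (simp add: poly_0_coeff_0 coeff_pderiv)
lemma coeff0: "coeff q 0 = poly q (0::'a::idom)" by (simp add: poly_0_coeff_0)

lemma mapv_lin_dual': "mapv (\<lambda>p. Dual (poly p 0) (poly (pderiv p) 0)) (lin p w) = dv p (w::'a::idom^4)"
  by (simp add: cart_eq pderiv_pCons)

context fixes d :: nat and c :: "'a::idom form4" assumes sup: "supp4 d c" begin

lemma clc: "pderiv (cl c m) = 0" by (simp add: pderiv_pCons)

text \<open>Truncation after the linear term turns values on p + t w into values at p + \<epsilon>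
  w, so the imaginary part is a derivative at t = 0, given by the chain rule. The next three lemmas
  add the Leibniz terms of moving arguments.\<close>

lemma ev_dual: "ev d (dl c) (dv p w) = Dual (ev d c p) (D1 d c p w)"
  using comm_ring_hom.ev_hom[OF hom_poly_dual, of d "cl c" "lin p w"]
  unfolding coeff0 coeff1 mapv_lin_dual' ev_deriv[OF derivation_pderiv supp4_cl[OF sup] clc]
  by (simp add: poly_ev poly_D1)
lemma D1_dual: "D1 d (dl c) (dv p w) (dv v v') = Dual (D1 d c p v) (D2 d c p v w + D1 d c p v')"
  using comm_ring_hom.D1_hom[OF hom_poly_dual, of d "cl c" "lin p w" "lin v v'"]
  unfolding coeff0 coeff1 mapv_lin_dual' D1_deriv[OF derivation_pderiv supp4_cl[OF sup] clc]
  by (simp add: poly_D1 poly_D2)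
lemma D2_dual: "D2 d (dl c) (dv p w) (dv v v') (dv y y') = Dual (D2 d c p v y) (D3 d c p v y w + D2 d c p v' y + D2 d c p v y')"
  using comm_ring_hom.D2_hom[OF hom_poly_dual, of d "cl c" "lin p w" "lin v v'" "lin y y'"]
  unfolding coeff0 coeff1 mapv_lin_dual' D2_deriv[OF derivation_pderiv supp4_cl[OF sup] clc]
  by (simp add: poly_D2 poly_D3)
lemma D3_dual: "D3 d (dl c) (dv p w) (dv v v') (dv y y') (dv t t') = Dual (D3 d c p v y t)
   (D4 d c p v y t w + D3 d c p v' y t + D3 d c p v y' t + D3 d c p v y t')"
  using comm_ring_hom.D3_hom[OF hom_poly_dual, of d "cl c" "lin p w" "lin v v'" "lin y y'" "lin t t'"]
  unfolding coeff0 coeff1 mapv_lin_dual' D3_deriv[OF derivation_pderiv supp4_cl[OF sup] clc]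
  by (simp add: poly_D3 poly_D4)
end

lemma (in comm_ring_hom) hom_prod': "hom (prod f A) = (\<Prod>i\<in>A. hom (f i))"
  by (induction A rule: infinite_finite_induct) (auto simp: hom_distribs)
lemma (in comm_ring_hom) det4_hom: "hom (Determinants.det (M::'a^4^4)) = Determinants.det (\<chi> i j. hom (M$i$j))"
  unfolding Determinants.det_def by (simp add: hom_sum hom_mult hom_of_int hom_prod')
lemma (in comm_ring_hom) hess_hom: "(\<chi> i j. hom (hess d c x $ i $ j)) = hess d (\<lambda>m. hom (c m)) (mapv hom x)"
  by (simp add: hess_def cart_eq ev_hom pd_hom)
lemma (in comm_ring_hom) cof_hom: "hom (cof M i j) = cof (\<chi> i j. hom (M$i$j)) i j"
  unfolding cof_def det4_hom by (rule arg_cong[of _ _ Determinants.det]) (auto simp: cart_eq axis_def)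
lemma (in comm_ring_hom) Ct_hom: "hom (Ct d c x i j k) = Ct d (\<lambda>m. hom (c m)) (mapv hom x) i j k"
  by (simp add: Ct_def ev_hom pd_hom)
lemma (in comm_ring_hom) con_hom: "hom (con A f) = con (\<lambda>i j. hom (A i j)) (\<lambda>i j. hom (f i j))"
  by (simp add: con_def hom_distribs)
lemma (in comm_ring_hom) kap_hom: "hom (kap d c x i) = kap d (\<lambda>m. hom (c m)) (mapv hom x) i"
  by (simp add: kap_def con_hom cof_hom hess_hom Ct_hom)
lemma (in comm_ring_hom) Phi_hom: "hom (Phi d c x) = Phi d (\<lambda>m. hom (c m)) (mapv hom x)"
proof -
  have "hom 4 = 4" "hom 3 = 3" using hom_of_nat[of 4] hom_of_nat[of 3] by simp_all
  then show ?thesis by (simp add: Phi_def hom_minus hom_mult con_hom cof_hom hess_hom Ct_hom kap_hom)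
qed
lemma (in comm_ring_hom) Rv_hom: "hom (Rv d c x v) = Rv d (\<lambda>m. hom (c m)) (mapv hom x) (mapv hom v)"
proof -
  have "hom 4 = 4" "hom 3 = 3" using hom_of_nat[of 4] hom_of_nat[of 3] by simp_all
  then show ?thesis by (simp add: Rv_def hom_minus hom_mult det4_hom hess_hom D2_hom D3_hom kap_hom hom_sum)
qed

section \<open>Forms as functions\<close>

text \<open>Degrees of determinants and contractions are tracked on functions; a coefficient form is
  extracted only where one is needed.\<close>

definition is_form :: "nat \<Rightarrow> ('a::comm_ring_1^4 \<Rightarrow> 'a) \<Rightarrow> bool" where
  "is_form n F \<longleftrightarrow> (\<exists>g. supp4 n g \<and> (\<forall>x. F x = ev n g x))"

lemma ev_restrict: "ev n (\<lambda>m. if m \<in> mons n then g m else 0) x = ev n g x"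
  unfolding ev_def form_eval_def by (rule sum.cong) auto
lemma is_formI: "(\<And>x. F x = ev n g x) \<Longrightarrow> is_form n F"
  unfolding is_form_def by (rule exI[of _ "\<lambda>m. if m \<in> mons n then g m else 0"]) (auto simp: ev_restrict supp4_def)
lemma is_form_ev: "is_form n (ev n g)" by (rule is_formI) simp

lemma is_form_add: assumes "is_form n F" "is_form n G" shows "is_form n (\<lambda>x. F x + G x)"
proof -
  obtain f g where "\<And>x. F x = ev n f x" "\<And>x. G x = ev n g x" using assms unfolding is_form_def by blast
  then show ?thesis by (intro is_formI[where g="\<lambda>m. f m + g m"]) (simp add: ev_def form_eval_def sum.distrib algebra_simps)
qed
lemma is_form_0: "is_form n (\<lambda>x. 0)" by (rule is_formI[where g="\<lambda>m. 0"]) (simp add: ev_def form_eval_def)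
lemma is_form_cmul: assumes "is_form n F" shows "is_form n (\<lambda>x. a * F x)"
proof -
  obtain f where "\<And>x. F x = ev n f x" using assms unfolding is_form_def by blast
  then show ?thesis by (intro is_formI[where g="\<lambda>m. a * f m"]) (simp add: ev_def form_eval_def sum_distrib_left algebra_simps)
qed
lemma is_form_diff: assumes "is_form n F" "is_form n G" shows "is_form n (\<lambda>x. F x - G x)"
  using is_form_add[OF assms(1) is_form_cmul[OF assms(2), of "-1"]] by simp
lemma is_form_sum: "(\<And>i. i \<in> A \<Longrightarrow> is_form n (F i)) \<Longrightarrow> is_form n (\<lambda>x. \<Sum>i\<in>A. F i x)"
  by (induction A rule: infinite_finite_induct) (auto simp: is_form_0 is_form_add)

definition addm :: "nat \<times> nat \<times> nat \<times> nat \<Rightarrow> nat \<times> nat \<times> nat \<times> nat \<Rightarrow> nat \<times> nat \<times> nat \<times> nat" where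
  "addm a b = (case a of (i,j,k,l) \<Rightarrow> case b of (i',j',k',l') \<Rightarrow> (i+i',j+j',k+k',l+l'))"

lemma is_form_mult: assumes "is_form m F" "is_form n G" shows "is_form (m + n) (\<lambda>x. F x * G x)"
proof -
  obtain f g where fg: "\<And>x. F x = ev m f x" "\<And>x. G x = ev n g x" using assms unfolding is_form_def by blast
  define h where "h q = (\<Sum>a\<in>mons m. \<Sum>b\<in>mons n. if q = addm a b then f a * g b else 0)" for q
  show ?thesis
  proof (rule is_formI[where g=h])
    fix x :: "'a^4"
    let ?t = "(x$1,x$2,x$3,x$4)"
    have "ev (m+n) h x = (\<Sum>q\<in>mons (m+n). \<Sum>a\<in>mons m. \<Sum>b\<in>mons n. if q = addm a b then f a * g b * monom_eval q ?t else 0)"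
      unfolding ev_def form_eval_def h_def sum_distrib_right by (intro sum.cong refl) auto
    also have "\<dots> = (\<Sum>a\<in>mons m. \<Sum>q\<in>mons (m+n). \<Sum>b\<in>mons n. if q = addm a b then f a * g b * monom_eval q ?t else 0)" by (rule sum.swap)
    also have "\<dots> = (\<Sum>a\<in>mons m. \<Sum>b\<in>mons n. \<Sum>q\<in>mons (m+n). if q = addm a b then f a * g b * monom_eval q ?t else 0)"
      by (rule sum.cong[OF refl]) (rule sum.swap)
    also have "\<dots> = (\<Sum>a\<in>mons m. \<Sum>b\<in>mons n. f a * g b * monom_eval (addm a b) ?t)"
    proof (intro sum.cong refl)
      fix a b assume ab: "a \<in> mons m" "b \<in> mons n"
      then have "addm a b \<in> mons (m+n)" by (auto simp: mons_def addm_def)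
      then show "(\<Sum>q\<in>mons (m+n). if q = addm a b then f a * g b * monom_eval q ?t else 0) = f a * g b * monom_eval (addm a b) ?t"
        by (simp add: sum.delta)
    qed
    also have "\<dots> = (\<Sum>a\<in>mons m. \<Sum>b\<in>mons n. (f a * monom_eval a ?t) * (g b * monom_eval b ?t))"
      by (intro sum.cong refl) (auto simp: monom_eval_def addm_def power_add algebra_simps split: prod.splits)
    also have "\<dots> = F x * G x" unfolding fg ev_def form_eval_def sum_product ..
    finally show "F x * G x = ev (m+n) h x" by simp
  qed
qed

lemma is_form_const: "is_form 0 (\<lambda>x. a)"
  by (rule is_formI[where g="\<lambda>m. a"]) (simp add: ev_def form_eval_def mons_def monom_eval_def)
lemma is_form_prod: "finite A \<Longrightarrow> (\<And>i. i \<in> A \<Longrightarrow> is_form (n i) (F i)) \<Longrightarrow> is_form (\<Sum>i\<in>A. n i) (\<lambda>x. \<Prod>i\<in>A. F i x)"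
  by (induction A rule: finite_induct) (auto simp: is_form_const is_form_mult)
lemma is_form_power: "is_form n F \<Longrightarrow> is_form (k * n) (\<lambda>x. F x ^ k)"
  by (induction k) (auto simp: is_form_const is_form_mult)
lemma is_form_coord: "is_form 1 (\<lambda>x. x $ i)"
proof (rule is_formI[where g="\<lambda>m. if (i = 1 \<and> m = (1,0,0,0)) \<or> (i = 2 \<and> m = (0,1,0,0)) \<or> (i = 3 \<and> m = (0,0,1,0)) \<or> (i = 4 \<and> m = (0,0,0,1)) then 1 else 0"])
  fix x :: "'a^4"
  have m1: "mons 1 = {(1,0,0,0),(0,1,0,0),(0,0,1,0),(0,0,0,1)}" by (auto simp: mons_def)
  show "x $ i = ev 1 (\<lambda>m. if (i = 1 \<and> m = (1,0,0,0)) \<or> (i = 2 \<and> m = (0,1,0,0)) \<or> (i = 3 \<and> m = (0,0,1,0)) \<or> (i = 4 \<and> m = (0,0,0,1)) then 1 else 0) x"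
    unfolding ev_def form_eval_def m1 using exhaust_4[of i] by (auto simp: monom_eval_def)
qed

lemma is_form_comp: assumes "\<And>i. is_form 1 (\<lambda>x. Y x $ i)" shows "is_form n (\<lambda>x. ev n g (Y x))"
  unfolding ev_def form_eval_def
proof (rule is_form_sum)
  fix m assume "m \<in> mons n"
  then obtain i j k l where m: "m = (i,j,k,l)" "n = i + j + k + l" by (cases m) (auto simp: mons_def)
  have "is_form (i*1 + j*1 + k*1 + l*1) (\<lambda>x. Y x$1^i * Y x$2^j * Y x$3^k * Y x$4^l)"
    by (intro is_form_mult is_form_power assms)
  then show "is_form n (\<lambda>x. g m * monom_eval m (Y x$1, Y x$2, Y x$3, Y x$4))"
    using m by (auto simp: monom_eval_def intro: is_form_cmul)
qed

lemma is_form_det: assumes "\<And>k l. is_form (n k) (\<lambda>x. M x $ k $ l)"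
  shows "is_form (\<Sum>k\<in>UNIV. n k) (\<lambda>x. Determinants.det (M x :: 'a::comm_ring_1^4^4))"
  unfolding Determinants.det_def by (intro is_form_sum is_form_cmul is_form_prod assms) auto
lemma is_form_hess: "is_form (d-2) (\<lambda>x. hess d c x $ i $ j)" unfolding hess_def by (simp add: is_form_ev)
lemma is_form_deth: "is_form (4*(d-2)) (\<lambda>x. Determinants.det (hess d c x))"
proof -
  have "is_form (\<Sum>k\<in>(UNIV::4 set). d-2) (\<lambda>x. Determinants.det (hess d c x))" by (intro is_form_det is_form_hess)
  then show ?thesis by simp
qed
lemma is_form_cof: "is_form (3*(d-2)) (\<lambda>x. cof (hess d c x) i j)"
proof -
  have "is_form (\<Sum>k\<in>(UNIV::4 set). if k = i then 0 else d-2) (\<lambda>x. cof (hess d c x) i j)"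
    unfolding cof_def by (intro is_form_det) (auto simp: is_form_const is_form_hess[unfolded One_nat_def])
  moreover have "(\<Sum>k\<in>(UNIV::4 set). if k = i then 0 else d-2) = 3*(d-2)" using exhaust_4[of i] by (auto simp: sum_4)
  ultimately show ?thesis by simp
qed
lemma is_form_Ct: "is_form (d-3) (\<lambda>x. Ct d c x i j k)" unfolding Ct_def by (simp add: is_form_ev)
lemma is_form_con: "(\<And>i l. is_form n (\<lambda>x. f x i l)) \<Longrightarrow> is_form (3*(d-2) + n) (\<lambda>x. con (cof (hess d c x)) (f x))"
  unfolding con_def by (intro is_form_sum is_form_mult is_form_cof)
lemma is_form_kap: "is_form (3*(d-2) + (d-3)) (\<lambda>x. kap d c x i)"
  unfolding kap_def by (intro is_form_con is_form_Ct)
text \<open>In both summands there are three cofactors of degree 3(d-2) and two third derivatives of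
  degree d-3, in all 9(d-2) + 2(d-3) = 11d - 24.\<close>

lemma is_form_Phi: assumes "d \<ge> 3" shows "is_form (11*d - 24) (Phi d c)"
proof -
  have 1: "11*d-24 = 3*(d-2) + (3*(d-2) + (3*(d-2) + ((d-3)+(d-3))))" using assms by simp
  have 2: "11*d-24 = 3*(d-2) + ((3*(d-2) + (d-3)) + (3*(d-2) + (d-3)))" using assms by simp
  have "is_form (11*d-24) (\<lambda>x. 4 * con (cof (hess d c x)) (\<lambda>i l. con (cof (hess d c x)) (\<lambda>j m. con (cof (hess d c x))
       (\<lambda>k n. Ct d c x i j k * Ct d c x l m n))))"
    unfolding 1 by (intro is_form_cmul is_form_con is_form_mult is_form_Ct)
  moreover have "is_form (11*d-24) (\<lambda>x. 3 * con (cof (hess d c x)) (\<lambda>i l. kap d c x i * kap d c x l))"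
    unfolding 2 by (intro is_form_cmul is_form_con is_form_mult is_form_kap)
  ultimately show ?thesis unfolding Phi_def using is_form_diff by blast
qed
lemma is_form_D1: "is_form (d-1) (\<lambda>x. D1 d c x v)"
  unfolding D1_def by (intro is_form_sum is_form_cmul is_form_ev)

text \<open>Replaces Phi, which may vanish on the whole surface when every line is of the second kind.\<close>
definition Rf :: "nat \<Rightarrow> 'a::comm_ring_1 form4 \<Rightarrow> 'a^4 \<Rightarrow> 'a^4 \<Rightarrow> 'a^4 \<Rightarrow> 'a" where
  "Rf d c e g x = Rv d c x (D1 d c x g *s e - D1 d c x e *s g)"

text \<open>The vector D1(g) e - D1(e) g is tangent at every point and has coordinates of degree d -
  1. Inserted into \<open>Rv\<close> it gives 4(d-2) + 3(d-1) + (d-3) = 8d - 14 in the first term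
  and the same degree in the second.\<close>

lemma is_form_Rf: assumes "d \<ge> 3" shows "is_form (8*d - 14) (Rf d c e g)"
proof -
  define v where "v x = D1 d c x g *s e - D1 d c x e *s g" for x
  have v: "is_form (d-1) (\<lambda>x. v x $ i)" for i
    unfolding v_def by (auto simp: mult.commute[of _ "e$i"] mult.commute[of _ "g$i"] intro!: is_form_diff is_form_cmul is_form_D1[unfolded One_nat_def])
  have 1: "8*d-14 = 4*(d-2) + ((d-1)+(d-1)+(d-1)+(d-3))" using assms by simp
  have 2: "8*d-14 = ((d-1)+(d-1)+(d-2)) + ((3*(d-2) + (d-3)) + (d-1))" using assms by simp
  have a: "is_form (8*d-14) (\<lambda>x. 4 * (Determinants.det (hess d c x) * D3 d c x (v x) (v x) (v x)))"
    unfolding 1 D3_expand by (intro is_form_cmul is_form_mult is_form_deth is_form_sum v is_form_ev)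
  have b: "is_form (8*d-14) (\<lambda>x. 3 * (D2 d c x (v x) (v x) * (\<Sum>i\<in>UNIV. kap d c x i * v x $ i)))"
    unfolding 2 D2_expand by (intro is_form_cmul is_form_mult is_form_kap is_form_sum v is_form_ev)
  show ?thesis unfolding Rf_def Rv_def v_def[symmetric] using is_form_diff[OF a b] by (simp add: mult.assoc)
qed

lemma poly_fun_eqI: fixes p q :: "'a::alg_closed_field poly" assumes "\<And>x. poly p x = poly q x" shows "p = q"
  using poly_all_zero[of "p - q"] assms by simp

section \<open>The flecnodal form along a line\<close>

context lsurf begin

lemma pt_vals: "D2 d c (pz z) f g1 = poly (pderiv A) z" "D2 d c (pz z) f g2 = poly (pderiv B) z"
  "D3 d c (pz z) f f g1 = poly (pderiv (pderiv A)) z" "D3 d c (pz z) f f g2 = poly (pderiv (pderiv B)) z"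
  "D4 d c (pz z) f f f (a *s g1 - b *s g2) = a * poly (pderiv (pderiv (pderiv A))) z - b * poly (pderiv (pderiv (pderiv B))) z"
proof -
  show "D2 d c (pz z) f g1 = poly (pderiv A) z" "D2 d c (pz z) f g2 = poly (pderiv B) z"
    unfolding dA dB poly_D2 mX by (simp_all add: D2_sym[of d c _ f])
  show "D3 d c (pz z) f f g1 = poly (pderiv (pderiv A)) z" "D3 d c (pz z) f f g2 = poly (pderiv (pderiv B)) z"
    unfolding ddA ddB poly_D3 mX using D3_sym13[of d c "pz z"] by simp_all
  have "D4 d c (pz z) f f f (a *s g1 - b *s g2) = D4 d c (pz z) (a *s g1 - b *s g2) f f f"
    by (metis D4_swap1 D4_sym23 D4_sym34)
  also have "\<dots> = a * D4 d c (pz z) g1 f f f - b * D4 d c (pz z) g2 f f f" by (simp add: D4_diff1 D4_scale1)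
  finally show "D4 d c (pz z) f f f (a *s g1 - b *s g2) = a * poly (pderiv (pderiv (pderiv A))) z - b * poly (pderiv (pderiv (pderiv B))) z"
    unfolding dddA dddB poly_D4 mX by simp
qed

lemma double_neg: "2 * t = - q \<Longrightarrow> q + t + t = (0::'a)"
  by (metis add.assoc add.right_inverse mult_2)

lemma exists_transversal: obtains g where "g = g1 \<or> g = g2" "D1 d c (pz z) g \<noteq> 0"
  using ncr[of z] A_val B_val by metis

text \<open>The point pz moves off the line to first order in the tangent direction tz. Both
  asymptotic directions are followed: f becomes f + \<epsilon> \<eta> and v2 becomes v2 + \<epsilon>
  y. The third derivative in the bent direction f + \<epsilon> \<eta> is \<epsilon> s, and s is the
  Schwarzian divided by 2u.\<close>

lemma dual_frame:
  assumes n: "poly u z \<noteq> 0"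
  obtains \<eta> y b h' k' s where
    "ev d (dl c) (dv (pz z) (tz z)) = 0"
    "D1 d (dl c) (dv (pz z) (tz z)) (dv f \<eta>) = 0" "D1 d (dl c) (dv (pz z) (tz z)) (dv (v2 z) y) = 0"
    "D2 d (dl c) (dv (pz z) (tz z)) (dv f \<eta>) (dv f \<eta>) = 0" "D2 d (dl c) (dv (pz z) (tz z)) (dv (v2 z) y) (dv (v2 z) y) = 0"
    "k' * D2 d (dl c) (dv (pz z) (tz z)) (dv f \<eta>) (dv (v2 z) y) = 1"
    "h' * D2 d (dl c) (dv (pz z) (tz z)) (dv (pz z) (tz z)) b = 1"
    "D2 d (dl c) (dv (pz z) (tz z)) b b = 0" "D2 d (dl c) (dv (pz z) (tz z)) b (dv f \<eta>) = 0"
    "D2 d (dl c) (dv (pz z) (tz z)) b (dv (v2 z) y) = 0"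
    "D3 d (dl c) (dv (pz z) (tz z)) (dv f \<eta>) (dv f \<eta>) (dv f \<eta>) = Dual 0 s"
    "s * (2 * poly u z) = poly (schw A B) z"
proof -
  let ?x = "dv (pz z) (tz z)"
  note dd = ev_dual[OF sup] D1_dual[OF sup] D2_dual[OF sup] D3_dual[OF sup]
  define a b0 a1 b1 a2 b2 a3 b3 where ab: "a = poly A z" "b0 = poly B z" "a1 = poly (pderiv A) z" "b1 = poly (pderiv B) z"
    "a2 = poly (pderiv (pderiv A)) z" "b2 = poly (pderiv (pderiv B)) z"
    "a3 = poly (pderiv (pderiv (pderiv A))) z" "b3 = poly (pderiv (pderiv (pderiv B))) z"
  define u0 u1 where u01: "u0 = b0 * a1 - a * b1" "u1 = b0 * a2 - a * b2"
  have u0: "poly u z = u0" unfolding u_eq u01 ab by simp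
  have u1: "poly (pderiv u) z = u1" unfolding du u01 ab by simp
  have n0: "u0 \<noteq> 0" using n u0 by simp
  \<comment> \<open>\<eta> must satisfy two linear equations, tangency and isotropy to first order
    (\<open>e0\<close> and \<open>e1\<close>). Their determinant is u up to sign, and r is the
    multiple of (B, -A) that has to be subtracted from (B', -A').\<close>
  define r where "r = u1 / (2 * u0)"
  define \<eta>2 \<eta>3 where eta: "\<eta>2 = b1 - r * b0" "\<eta>3 = - a1 + r * a"
  define \<eta> where "\<eta> = \<eta>2 *s g1 + \<eta>3 *s g2"
  have nn: "2 * u0 \<noteq> 0" using n0 two_nz by simp
  have r: "r * (2 * u0) = u1" unfolding r_def using nn by simp
  have e0: "u0 + (\<eta>2 * a + \<eta>3 * b0) = 0" unfolding eta u01 by (simp add: algebra_simps)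
  have e1: "2 * (\<eta>2 * a1 + \<eta>3 * b1) = - u1"
  proof -
    have "2 * (\<eta>2 * a1 + \<eta>3 * b1) = - (r * (2 * u0))" unfolding eta u01(1) by (simp add: algebra_simps)
    then show ?thesis unfolding r .
  qed
  define s where "s = b0 * a3 - a * b3 + 3 * (\<eta>2 * a2 + \<eta>3 * b2)"
  have ppu: "poly (pderiv (pderiv u)) z = b0 * a3 - a * b3 + b1 * a2 - a1 * b2"
    unfolding du by (simp add: pderiv_diff pderiv_mult ab algebra_simps)
  have sch: "s * (2 * u0) = poly (schw A B) z"
  proof -
    have sc: "poly (schw A B) z = 2 * u0 * (b0 * a3 - a * b3 + b1 * a2 - a1 * b2) + 4 * u0 * (b1 * a2 - a1 * b2) - 3 * u1^2"
      unfolding schw_def u_def[symmetric] by (simp only: poly_diff poly_add poly_mult poly_power u0 u1 ppu ab[symmetric]) simp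
    have "3 * (\<eta>2 * a2 + \<eta>3 * b2) * (2 * u0) = 6 * u0 * (b1 * a2 - a1 * b2) - 3 * (r * (2 * u0)) * (b0 * a2 - a * b2)"
      unfolding eta by (simp add: algebra_simps)
    then have m2: "3 * (\<eta>2 * a2 + \<eta>3 * b2) * (2 * u0) = 6 * u0 * (b1 * a2 - a1 * b2) - 3 * u1 * u1" unfolding r u01(2) .
    have "s * (2 * u0) = 2 * u0 * (b0 * a3 - a * b3) + 3 * (\<eta>2 * a2 + \<eta>3 * b2) * (2 * u0)" unfolding s_def by (simp add: algebra_simps)
    also have "\<dots> = 2 * u0 * (b0 * a3 - a * b3) + (6 * u0 * (b1 * a2 - a1 * b2) - 3 * u1 * u1)" unfolding m2 ..
    finally show ?thesis unfolding sc by (simp add: algebra_simps power2_eq_square)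
  qed
  have tzD: "D2 d c (pz z) f (tz z) = u0" using D2_pz(2) u0 by simp
  have D1eta: "D1 d c (pz z) \<eta> = \<eta>2 * a + \<eta>3 * b0" unfolding \<eta>_def D_lin A_val B_val ab by simp
  have D2eta: "D2 d c (pz z) f \<eta> = \<eta>2 * a1 + \<eta>3 * b1" unfolding \<eta>_def D_lin pt_vals ab by simp
  have D3eta: "D3 d c (pz z) f f \<eta> = \<eta>2 * a2 + \<eta>3 * b2" unfolding \<eta>_def D_lin pt_vals ab by simp
  have D4t: "D4 d c (pz z) f f f (tz z) = b0 * a3 - a * b3" unfolding tz_def pt_vals ab ..
  have D3fft: "D3 d c (pz z) f f (tz z) = u1" using D3_pz(3)[of z] D3_sym13 u1 by metis
  have c1: "ev d (dl c) ?x = 0" unfolding dd ev_pz D1_pz by (simp add: zero_dual_def)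
  have c2: "D1 d (dl c) ?x (dv f \<eta>) = 0" unfolding dd D1_pz tzD D1eta e0 by (simp add: zero_dual_def)
  have c4: "D2 d (dl c) ?x (dv f \<eta>) (dv f \<eta>) = 0"
    unfolding dd D2_pz D3fft D2eta D2_sym[of d c _ \<eta> f] double_neg[OF e1] by (simp add: zero_dual_def)
  have c11: "D3 d (dl c) ?x (dv f \<eta>) (dv f \<eta>) (dv f \<eta>) = Dual 0 s"
    unfolding dd D3_pz D4t D3_sym13[of d c _ \<eta> f f] D3_sym23[of d c _ f \<eta> f] D3eta s_def by (simp add: algebra_simps)
  obtain g where g: "g = g1 \<or> g = g2" "D1 d c (pz z) g \<noteq> 0" by (rule exists_transversal)
  \<comment> \<open>\<mu> restores tangency of v2 + \<epsilon> y and l its isotropy; they divide by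
    D1(g) and by D2(v2,f) = 2 u^2.\<close>
  define \<mu> where "\<mu> = - D2 d c (pz z) (v2 z) (tz z) / D1 d c (pz z) g"
  define l where "l = - (D3 d c (pz z) (v2 z) (v2 z) (tz z) / 2 + \<mu> * D2 d c (pz z) (v2 z) g) / (2 * u0^2)"
  define y where "y = l *s f + \<mu> *s g"
  have D1y: "D1 d c (pz z) y = - D2 d c (pz z) (v2 z) (tz z)" unfolding y_def D_lin D1_pz \<mu>_def using g by simp
  have v2f: "D2 d c (pz z) (v2 z) f = 2 * u0^2" using D2_pz(3)[of z] u0 D2_sym by metis
  have nu: "2 * u0^2 \<noteq> 0" using n0 two_nz by simp
  have D2y: "2 * D2 d c (pz z) (v2 z) y = - D3 d c (pz z) (v2 z) (v2 z) (tz z)"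
  proof -
    have "l * (2 * u0^2) = - (D3 d c (pz z) (v2 z) (v2 z) (tz z) / 2 + \<mu> * D2 d c (pz z) (v2 z) g)" unfolding l_def using nu by simp
    then have "D2 d c (pz z) (v2 z) y = - (D3 d c (pz z) (v2 z) (v2 z) (tz z) / 2)" unfolding y_def D_lin v2f by simp
    then show ?thesis using two_nz by simp
  qed
  have c3: "D1 d (dl c) ?x (dv (v2 z) y) = 0" unfolding dd D1_pz D1y by (simp add: zero_dual_def)
  have c5: "D2 d (dl c) ?x (dv (v2 z) y) (dv (v2 z) y) = 0"
    unfolding dd D2_pz D2_sym[of d c _ y "v2 z"] double_neg[OF D2y] by (simp add: zero_dual_def)
  define k where "k = D2 d (dl c) ?x (dv f \<eta>) (dv (v2 z) y)"
  have rk: "re k = 2 * u0^2" unfolding k_def dd D2_pz u0 by simp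
  then obtain k' where k': "k' * k = 1" using dual_unit[of k] nu by metis
  define h where "h = D2 d (dl c) ?x ?x (dv g 0)"
  have "re h = of_nat (d-1) * D1 d c (pz z) g" unfolding h_def dd using Euler2[OF sup, of "pz z" g] D2_sym[of d c "pz z" "pz z" g] by simp
  then have "re h \<noteq> 0" using g nat_nz[of "d-1"] d3 by simp
  then obtain h' where h': "h' * h = 1" using dual_unit[of h] by metis
  have two: "Dual (1/2) 0 * 2 = (1::'a dual)"
  proof -
    have "(2::'a dual) = Dual 2 0" unfolding one_add_one[symmetric] by (simp add: plus_dual_def one_dual_def)
    then show ?thesis using two_nz by (simp only: times_dual_def one_dual_def dual.sel) simp
  qed
  have supd: "supp4 d (dl c)" by (rule comm_ring_hom.supp4_hom[OF hom_const_dual sup])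
  obtain b where "h' * D2 d (dl c) ?x ?x b = 1" "D2 d (dl c) ?x b b = 0" "D2 d (dl c) ?x b (dv f \<eta>) = 0" "D2 d (dl c) ?x b (dv (v2 z) y) = 0"
    using frame_exists[OF supd c1 c2 c3 c4 c5 k'[unfolded k_def] h'[unfolded h_def] two] by metis
  then show ?thesis using that[OF c1 c2 c3 c4 c5 k'[unfolded k_def] _ _ _ _ c11] sch u0 by metis
qed

lemma supd: "supp4 d (dl c)" by (rule comm_ring_hom.supp4_hom[OF hom_const_dual sup])
lemma eight_nz: "(8::'a) \<noteq> 0"
proof -
  have "(8::'a) = 2 * 2 * 2" by simp
  then show ?thesis using two_nz by (metis mult_eq_0_iff)
qed
lemma four_nz: "(4::'a) \<noteq> 0"
proof -
  have "(4::'a) = 2 * 2" by simp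
  then show ?thesis using two_nz by (metis mult_eq_0_iff)
qed
lemma re_num: "re (8::'a dual) = 8" "re (4::'a dual) = 4"
proof -
  have "re (of_nat n :: 'a dual) = of_nat n" for n by (induction n) auto
  from this[of 8] this[of 4] show "re (8::'a dual) = 8" "re (4::'a dual) = 4" by simp_all
qed

lemma unit_re: "a * b = (1::'a dual) \<Longrightarrow> re a \<noteq> 0" "a * b = (1::'a dual) \<Longrightarrow> re b \<noteq> 0"
  by (metis dual_sel(3,11) mult_zero_left mult_zero_right zero_neq_one)+

text \<open>In \<open>Phi_frame\<close> the factor of the bent line direction is purely imaginary,
  so of the other factor only the real part 2uW matters; its 2u turns s into the Schwarzian.\<close>

lemma Phi_dual:
  assumes n: "poly u z \<noteq> 0"
  obtains \<rho> where "\<rho> \<noteq> 0" "Phi d (dl c) (dv (pz z) (tz z)) = Dual 0 (\<rho> * poly (schw A B) z * poly W z)"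
proof -
  let ?x = "dv (pz z) (tz z)"
  obtain \<eta> y b h' k' s where fr: 
    "ev d (dl c) ?x = 0"
    "D1 d (dl c) ?x (dv f \<eta>) = 0" "D1 d (dl c) ?x (dv (v2 z) y) = 0"
    "D2 d (dl c) ?x (dv f \<eta>) (dv f \<eta>) = 0" "D2 d (dl c) ?x (dv (v2 z) y) (dv (v2 z) y) = 0"
    "k' * D2 d (dl c) ?x (dv f \<eta>) (dv (v2 z) y) = 1"
    "h' * D2 d (dl c) ?x ?x b = 1"
    "D2 d (dl c) ?x b b = 0" "D2 d (dl c) ?x b (dv f \<eta>) = 0"
    "D2 d (dl c) ?x b (dv (v2 z) y) = 0"
    and s: "D3 d (dl c) ?x (dv f \<eta>) (dv f \<eta>) (dv f \<eta>) = Dual 0 s" "s * (2 * poly u z) = poly (schw A B) z"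
    by (rule dual_frame[OF n])
  let ?H = "Determinants.det (hess d (dl c) ?x)"
  have P: "Phi d (dl c) ?x = 8 * (?H * k')^3 * Dual 0 s * D3 d (dl c) ?x (dv (v2 z) y) (dv (v2 z) y) (dv (v2 z) y)"
    using Phi_frame[OF supd fr] s by simp
  obtain q where q: "q * ?H = 1" using fr_det_unit[OF supd fr] by blast
  have r3: "re (D3 d (dl c) ?x (dv (v2 z) y) (dv (v2 z) y) (dv (v2 z) y)) = 2 * poly u z * poly W z"
    unfolding D3_dual[OF sup] D3_pz by simp
  define T where "T = 8 * (?H * k')^3"
  have rT: "re T \<noteq> 0" unfolding T_def
    using unit_re(2)[OF q] unit_re(1)[OF fr(6)] eight_nz re_num by (simp add: power3_eq_cube)
  have "Phi d (dl c) ?x = Dual 0 (re T * s * (2 * poly u z * poly W z))"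
    unfolding P T_def[symmetric] by (rule dual.expand) (simp add: r3)
  also have "re T * s * (2 * poly u z * poly W z) = re T * poly (schw A B) z * poly W z" unfolding s(2)[symmetric] by (simp add: algebra_simps)
  finally show ?thesis using that rT by blast
qed

text \<open>On the line D1(e) = 0, so the tangent vector used by \<open>Rf\<close> is a multiple of
  e there and has no component along v2, only along f. Of the two cubes in \<open>Rv_frame\<close>
  the one with the Schwarzian survives.\<close>

lemma Rf_dual:
  assumes n: "poly u z \<noteq> 0" and z: "z \<noteq> 0" and g: "D1 d c (pz z) g \<noteq> 0"
  obtains \<rho> where "\<rho> \<noteq> 0" "Rf d (dl c) (dv e 0) (dv g 0) (dv (pz z) (tz z)) = Dual 0 (\<rho> * poly (schw A B) z)"
proof -
  let ?x = "dv (pz z) (tz z)"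
  obtain \<eta> y b h' k' s where fr: 
    "ev d (dl c) ?x = 0"
    "D1 d (dl c) ?x (dv f \<eta>) = 0" "D1 d (dl c) ?x (dv (v2 z) y) = 0"
    "D2 d (dl c) ?x (dv f \<eta>) (dv f \<eta>) = 0" "D2 d (dl c) ?x (dv (v2 z) y) (dv (v2 z) y) = 0"
    "k' * D2 d (dl c) ?x (dv f \<eta>) (dv (v2 z) y) = 1"
    "h' * D2 d (dl c) ?x ?x b = 1"
    "D2 d (dl c) ?x b b = 0" "D2 d (dl c) ?x b (dv f \<eta>) = 0"
    "D2 d (dl c) ?x b (dv (v2 z) y) = 0"
    and s: "D3 d (dl c) ?x (dv f \<eta>) (dv f \<eta>) (dv f \<eta>) = Dual 0 s" "s * (2 * poly u z) = poly (schw A B) z"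
    by (rule dual_frame[OF n])
  let ?H = "Determinants.det (hess d (dl c) ?x)"
  obtain q where q: "q * ?H = 1" using fr_det_unit[OF supd fr] by blast
  define v where "v = D1 d (dl c) ?x (dv g 0) *s dv e 0 - D1 d (dl c) ?x (dv e 0) *s dv g 0"
  have tv: "D1 d (dl c) ?x v = 0" unfolding v_def D_lin by (simp add: mult.commute)
  define \<alpha> \<beta> where "\<alpha> = k' * D2 d (dl c) ?x (dv (v2 z) y) v" and "\<beta> = k' * D2 d (dl c) ?x (dv f \<eta>) v"
  have dec: "v = \<alpha> *s dv f \<eta> + \<beta> *s dv (v2 z) y + (h' * D2 d (dl c) ?x b v) *s ?x"
    using fr_decomp[OF supd fr tv] unfolding \<alpha>_def \<beta>_def .
  have ve: "mapv re v = D1 d c (pz z) g *s e" unfolding v_def D1_dual[OF sup] D1_pz by (simp add: cart_eq)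
  have re2: "re (D2 d (dl c) ?x (dv p p') v) = D1 d c (pz z) g * D2 d c (pz z) p e" for p p'
    using comm_ring_hom.D2_hom[OF hom_re, of d "dl c" ?x "dv p p'" v] ve by (simp add: D_lin)
  \<comment> \<open>The component of e along f is -z; this is where z must be nonzero.\<close>
  have e: "e = pz z - z *s f" by (simp add: pz_def)
  have e2: "D2 d c (pz z) p e = of_nat (d-1) * D1 d c (pz z) p - z * D2 d c (pz z) p f" for p
    using Euler2[OF sup, of "pz z" p] by (subst (2) e) (simp add: D_lin)
  have "re \<beta> = 0" unfolding \<beta>_def by (simp add: re2 e2 D1_pz D2_pz)
  \<comment> \<open>\<beta> is a multiple of \<epsilon>, so its cube vanishes although \<beta>
    itself need not.\<close>
  then have b3: "\<beta>^3 = 0" by (simp add: power3_eq_cube dual.expand zero_dual_def)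
  have "re \<alpha> = re k' * (D1 d c (pz z) g * (- z * (2 * (poly u z)^2)))"
    unfolding \<alpha>_def by (simp add: re2 e2 D1_pz D2_sym[of d c _ "v2 z" f] D2_pz)
  then have ra: "re \<alpha> \<noteq> 0" using unit_re(1)[OF fr(6)] g z n two_nz by simp
  have R: "Rf d (dl c) (dv e 0) (dv g 0) ?x = 4 * ?H * (\<alpha>^3 * Dual 0 s)"
    unfolding Rf_def v_def[symmetric] Rv_frame[OF supd fr dec] b3 s by simp
  define T where "T = 4 * ?H * \<alpha>^3"
  have rT: "re T \<noteq> 0" unfolding T_def using unit_re(2)[OF q] ra four_nz re_num by (simp add: power3_eq_cube)
  have "Rf d (dl c) (dv e 0) (dv g 0) ?x = Dual 0 (re T * s)"
    unfolding R mult.assoc[symmetric] T_def[symmetric] by (rule dual.expand) simp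
  moreover have "re T * s = re T / (2 * poly u z) * poly (schw A B) z" unfolding s(2)[symmetric] using n two_nz by simp
  ultimately show ?thesis using that[of "re T / (2 * poly u z)"] rT n two_nz by simp
qed

text \<open>On a line of the second kind the cubes of both asymptotic directions vanish, D3(f,f,f)
  because the line lies on the surface and D3(v2,v2,v2) = 2uW because W = 0.\<close>

lemma Rv_zero:
  assumes n: "poly u z \<noteq> 0" and W0: "W = 0" and v: "D1 d c (pz z) v = 0"
  shows "Rv d c (pz z) v = 0"
proof -
  obtain g where g: "g = g1 \<or> g = g2" "D1 d c (pz z) g \<noteq> 0" by (rule exists_transversal)
  define k' where "k' = 1 / (2 * (poly u z)^2)"
  have k: "k' * D2 d c (pz z) f (v2 z) = 1" unfolding k'_def D2_pz using n two_nz by simp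
  define h' where "h' = 1 / (of_nat (d-1) * D1 d c (pz z) g)"
  have "D2 d c (pz z) (pz z) g = of_nat (d-1) * D1 d c (pz z) g" using Euler2[OF sup] D2_sym by metis
  moreover have "of_nat (d-1) * D1 d c (pz z) g \<noteq> 0" using g nat_nz[of "d-1"] d3 by simp
  ultimately have h: "h' * D2 d c (pz z) (pz z) g = 1" unfolding h'_def by simp
  have two: "(1/2) * 2 = (1::'a)" using two_nz by simp
  obtain b where b: "h' * D2 d c (pz z) (pz z) b = 1" "D2 d c (pz z) b b = 0" "D2 d c (pz z) b f = 0" "D2 d c (pz z) b (v2 z) = 0"
    using frame_exists[OF sup ev_pz D1_pz(2,4) D2_pz(1,4) k h two] by metis
  note fr = sup ev_pz D1_pz(2,4) D2_pz(1,4) k b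
  show ?thesis using Rv_frame[OF fr fr_decomp[OF fr v]] by (simp add: D3_pz W0)
qed

lemma form_line_D1:
  assumes sp: "supp4 n \<phi>" and z: "\<And>s t. ev n \<phi> (s *s e + t *s f) = 0"
  shows "D1 n \<phi> (pz z) e = 0" "D1 n \<phi> (pz z) f = 0"
proof -
  have e0: "ev n (cl \<phi>) X = 0" by (rule poly_all_zero) (use z[of 1] in \<open>simp add: poly_ev mX pz_def\<close>)
  have f0: "D1 n (cl \<phi>) X (cv f) = 0" using ev_deriv[OF derivation_pderiv supp4_cl[OF sp], of X] by (simp add: e0 pX pderiv_0 pderiv_pCons)
  then have "poly (D1 n (cl \<phi>) X (cv f)) z = 0" by simp
  then show f1: "D1 n \<phi> (pz z) f = 0" unfolding poly_D1 mX mapv_cv .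
  have "D1 n \<phi> (pz z) (pz z) = 0" using Euler1[OF sp, of "pz z"] z[of 1 z] by (simp add: pz_def)
  then show "D1 n \<phi> (pz z) e = 0" using f1 by (subst (asm) (2) pz_def) (simp add: D_lin)
qed

lemma form_zero_on_line:
  assumes fin: "finite S" and z: "\<And>z. z \<notin> S \<Longrightarrow> ev n \<phi> (pz z) = 0"
  shows "ev n \<phi> (s *s e + t *s f) = 0"
proof -
  have e0: "ev n (cl \<phi>) X = 0" by (rule poly_zero_cofinite[OF fin]) (simp add: poly_ev mX z)
  then have "poly (ev n (cl \<phi>) X) z = 0" for z by simp
  then have pz0: "ev n \<phi> (pz z) = 0" for z unfolding poly_ev mX .
  have f0: "ev n \<phi> f = 0" using dc_ev_lin[of n \<phi> e f] e0 unfolding X_def by (simp add: dc_def)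
  show ?thesis
  proof (cases "s = 0")
    case True then show ?thesis using f0 by (simp add: ev_scale)
  next
    case False
    then have "s *s e + t *s f = s *s pz (t / s)" by (simp add: pz_def cart_eq algebra_simps)
    then show ?thesis using pz0 by (simp add: ev_scale)
  qed
qed

lemma tangent_cases: assumes "D1 d c (pz z) v = 0"
  obtains a b l where "v = a *s e + b *s f + l *s tz z"
proof -
  obtain a b p q where v: "v = a *s e + b *s f + p *s g1 + q *s g2" by (rule bas_span)
  have eq: "p * poly A z + q * poly B z = 0" using assms unfolding v D_lin by (simp add: D1_pz A_val B_val)
  obtain l where l: "p = l * poly B z" "q = - (l * poly A z)"
  proof (cases "poly B z = 0")
    case False
    have "q = - (p / poly B z * poly A z)" using eq False by (simp add: field_simps eq_neg_iff_add_eq_0)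
    then show ?thesis using that[of "p / poly B z"] False by simp
  next
    case True
    then have "poly A z \<noteq> 0" using ncr by blast
    then show ?thesis using that[of "- q / poly A z"] eq True by simp
  qed
  have "v = a *s e + b *s f + l *s tz z" unfolding v l tz_def by (simp add: cart_eq algebra_simps)
  then show ?thesis using that by blast
qed

context
  fixes n \<phi> assumes n_sup: "supp4 n \<phi>" and phi: "\<And>x. Phi d c x = ev n \<phi> x"
begin

text \<open>The equality of \<open>Phi\<close> with the form is given only at points of K. As K is
  infinite it holds as an identity of polynomials in the parameter of p + t w, and such identities
  can be truncated to dual numbers.\<close>

lemma phi_dual: "ev n (dl \<phi>) (dv p w) = Phi d (dl c) (dv p w)"
proof -
  have "ev n (cl \<phi>) (lin p w) = Phi d (cl c) (lin p w)"
  proof (rule poly_fun_eqI)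
    fix t
    have "poly (Phi d (cl c) (lin p w)) t = Phi d c (p + t *s w)"
      using comm_ring_hom.Phi_hom[OF poly_eval_hom[of t], of d "cl c" "lin p w"] by simp
    then show "poly (ev n (cl \<phi>) (lin p w)) t = poly (Phi d (cl c) (lin p w)) t" by (simp add: poly_ev phi)
  qed
  from arg_cong[OF this, of "\<lambda>p. Dual (coeff p 0) (coeff p 1)"] show ?thesis
    unfolding comm_ring_hom.ev_hom[OF hom_poly_dual] comm_ring_hom.Phi_hom[OF hom_poly_dual] mapv_lin_dual by simp
qed

lemma phi_val: assumes "poly u z \<noteq> 0"
  obtains \<rho> where "\<rho> \<noteq> 0" "ev n \<phi> (pz z) = 0" "D1 n \<phi> (pz z) (tz z) = \<rho> * poly (schw A B) z * poly W z"
  using Phi_dual[OF assms] phi_dual[of "pz z" "tz z"] unfolding ev_dual[OF n_sup] by (metis dual.inject)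

theorem phi_line: "ev n \<phi> (s *s e + t *s f) = 0"
  by (rule form_zero_on_line[OF poly_roots_finite[OF u_nz]]) (use phi_val in blast)

text \<open>The tangent plane is spanned by e, f and tz: the derivative vanishes on e and f because
  the form vanishes on the line, and on tz because of the factor W. This is multiplicity two as it
  is used later.\<close>

theorem phi_tangent: assumes "W = 0" "poly u z \<noteq> 0" "D1 d c (pz z) w = 0" shows "D1 n \<phi> (pz z) w = 0"
proof -
  obtain a b l where w: "w = a *s e + b *s f + l *s tz z" using tangent_cases[OF assms(3)] by blast
  have "D1 n \<phi> (pz z) (tz z) = 0" using phi_val[OF assms(2)] assms(1) by (metis mult_zero_right poly_0)
  then show ?thesis unfolding w D_lin using form_line_D1[OF n_sup phi_line] by simp
qed

text \<open>The product of u, the Schwarzian and W has finitely many roots; at any other point the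
  transverse derivative is nonzero.\<close>

theorem phi_witness: assumes "W \<noteq> 0" "finite S"
  obtains z where "z \<notin> S" "D1 n \<phi> (pz z) (tz z) \<noteq> 0" "D1 d c (pz z) (tz z) = 0"
proof -
  have "u * schw A B * W \<noteq> 0" using u_nz schw_nz assms by simp
  then obtain z where z: "poly (u * schw A B * W) z \<noteq> 0" "z \<notin> S" using exists_nonroot assms(2) by blast
  then have "poly u z \<noteq> 0" by simp
  then obtain \<rho> where "\<rho> \<noteq> 0" "D1 n \<phi> (pz z) (tz z) = \<rho> * poly (schw A B) z * poly W z" using phi_val by blast
  then show ?thesis using that[of z] z D1_pz(3) by simp
qed
end

context
  fixes n \<psi> a g assumes n_sup: "supp4 n \<psi>" and psi: "\<And>x. Rf d c a g x = ev n \<psi> x"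
begin

theorem psi_line: assumes "W = 0" shows "ev n \<psi> (s *s e + t *s f) = 0"
proof (rule form_zero_on_line[OF poly_roots_finite[OF u_nz]])
  fix z assume "z \<notin> {x. poly u x = 0}"
  then have n: "poly u z \<noteq> 0" by simp
  show "ev n \<psi> (pz z) = 0" unfolding psi[symmetric] Rf_def
    by (rule Rv_zero[OF n assms]) (simp add: D_lin mult.commute)
qed

lemma psi_dual: "ev n (dl \<psi>) (dv p w) = Rf d (dl c) (dv a 0) (dv g 0) (dv p w)"
proof -
  have "ev n (cl \<psi>) (lin p w) = Rf d (cl c) (cv a) (cv g) (lin p w)"
  proof (rule poly_fun_eqI)
    fix t
    have m: "mapv (\<lambda>p. poly p t) (D1 d (cl c) (lin p w) (cv g) *s cv a - D1 d (cl c) (lin p w) (cv a) *s cv g)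
       = D1 d c (p + t *s w) g *s a - D1 d c (p + t *s w) a *s g" by (simp add: poly_D1)
    have "poly (Rf d (cl c) (cv a) (cv g) (lin p w)) t = Rf d c a g (p + t *s w)"
      unfolding Rf_def using comm_ring_hom.Rv_hom[OF poly_eval_hom[of t], of d "cl c" "lin p w"] m by simp
    then show "poly (ev n (cl \<psi>) (lin p w)) t = poly (Rf d (cl c) (cv a) (cv g) (lin p w)) t" by (simp add: poly_ev psi)
  qed
  note eq = arg_cong[OF this, of "\<lambda>p. Dual (coeff p 0) (coeff p 1)"]
  interpret h: comm_ring_hom "\<lambda>p::'a poly. Dual (coeff p 0) (coeff p 1)" by (rule hom_poly_dual)
  have cvd: "mapv (\<lambda>p. Dual (coeff p 0) (coeff p 1)) (cv y) = dv y 0" for y :: "'a^4" by (simp add: cart_eq)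
  have hc: "(\<lambda>m. Dual (coeff (cl c m) 0) (coeff (cl c m) 1)) = dl c" "(\<lambda>m. Dual (coeff (cl \<psi> m) 0) (coeff (cl \<psi> m) 1)) = dl \<psi>" by simp_all
  have m: "mapv (\<lambda>p. Dual (coeff p 0) (coeff p 1)) (D1 d (cl c) (lin p w) (cv g) *s cv a - D1 d (cl c) (lin p w) (cv a) *s cv g)
     = D1 d (dl c) (dv p w) (dv g 0) *s dv a 0 - D1 d (dl c) (dv p w) (dv a 0) *s dv g 0" (is "?l = ?r")
  proof -
    have "?l = Dual (coeff (D1 d (cl c) (lin p w) (cv g)) 0) (coeff (D1 d (cl c) (lin p w) (cv g)) 1) *s mapv (\<lambda>p. Dual (coeff p 0) (coeff p 1)) (cv a)
      - Dual (coeff (D1 d (cl c) (lin p w) (cv a)) 0) (coeff (D1 d (cl c) (lin p w) (cv a)) 1) *s mapv (\<lambda>p. Dual (coeff p 0) (coeff p 1)) (cv g)"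
      unfolding cart_eq by (simp add: times_dual_def minus_dual_def mult.commute)
    then show ?thesis unfolding h.D1_hom mapv_lin_dual cvd hc .
  qed
  show ?thesis using eq unfolding Rf_def h.ev_hom h.Rv_hom mapv_lin_dual m hc .
qed
end

theorem psi_witness: assumes n_sup: "supp4 n \<psi>" and psi: "\<And>x. Rf d c e g x = ev n \<psi> x"
    and g: "D1 d (cl c) X (cv g) \<noteq> 0" and fin: "finite S"
  obtains z where "z \<notin> S" "D1 n \<psi> (pz z) (tz z) \<noteq> 0" "D1 d c (pz z) (tz z) = 0"
proof -
  have "u * schw A B * D1 d (cl c) X (cv g) \<noteq> 0" using u_nz schw_nz g by simp
  then obtain z where z: "poly (u * schw A B * D1 d (cl c) X (cv g)) z \<noteq> 0" "z \<notin> insert 0 S" using exists_nonroot fin by (metis finite_insert)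
  then have n: "poly u z \<noteq> 0" "z \<noteq> 0" "D1 d c (pz z) g \<noteq> 0" by (auto simp: poly_D1 mX)
  obtain \<rho> where r: "\<rho> \<noteq> 0" "Rf d (dl c) (dv e 0) (dv g 0) (dv (pz z) (tz z)) = Dual 0 (\<rho> * poly (schw A B) z)"
    by (rule Rf_dual[OF n])
  then have "D1 n \<psi> (pz z) (tz z) = \<rho> * poly (schw A B) z"
    using psi_dual[OF n_sup psi, of "pz z" "tz z"] unfolding ev_dual[OF n_sup] by simp
  then show ?thesis using that[of z] z r D1_pz(3) by simp
qed

end

section \<open>Bezout on the product of two projective lines\<close>

definition srow :: "nat \<Rightarrow> 'a::comm_ring_1 poly \<Rightarrow> 'a poly \<Rightarrow> nat \<Rightarrow> 'a poly" where
  "srow b G H i = (if i < b then monom 1 i * G else monom 1 (i - b) * H)"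
definition sylv :: "nat \<Rightarrow> nat \<Rightarrow> 'a::comm_ring_1 poly \<Rightarrow> 'a poly \<Rightarrow> 'a mat" where
  "sylv a b G H = Matrix.mat (a + b) (a + b) (\<lambda>(i,j). coeff (srow b G H i) j)"

lemma srow_degree: assumes "degree G \<le> a" "degree H \<le> b" "i < a + b"
  shows "degree (srow b G H i) < a + b"
proof -
  have "degree (monom 1 k * P) \<le> k + degree P" for k and P :: "'a poly"
    by (meson add_mono degree_monom_le degree_mult_le le_refl order_trans)
  from this[of i G] this[of "i - b" H] show ?thesis using assms unfolding srow_def by (cases "i < b") auto
qed

lemma coeff_monom_mult': "coeff (monom 1 i * (G::'a::comm_ring_1 poly)) j = (if i \<le> j then coeff G (j - i) else 0)"
  by (simp add: coeff_monom_mult)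

text \<open>Of the rows, b are shifts of G with entries of degree at most m, and a are shifts of H
  with entries of degree at most n.\<close>

lemma sylv_det_degree:
  fixes G H :: "'a::idom poly poly"
  assumes "\<And>j. degree (coeff G j) \<le> m" "\<And>j. degree (coeff H j) \<le> n"
  shows "degree (Determinant.det (sylv a b G H)) \<le> b * m + a * n"
proof -
  let ?S = "sylv a b G H"
  have car: "?S \<in> carrier_mat (a+b) (a+b)" by (simp add: sylv_def)
  have e: "degree (?S $$ (i,j)) \<le> (if i < b then m else n)" if "i < a + b" "j < a + b" for i j
    using that assms by (auto simp: sylv_def srow_def coeff_monom_mult')
  have s: "(\<Sum>i=0..<a+b. if i < b then m else n) = b * m + a * n"
  proof -
    have "(\<Sum>i=0..<a+b. if i < b then m else n) = (\<Sum>i=0..<b. if i < b then m else n) + (\<Sum>i=b..<a+b. if i < b then m else n)"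
      by (rule sum.atLeastLessThan_concat[symmetric]) auto
    then show ?thesis by simp
  qed
  show ?thesis unfolding det_def'[OF car]
  proof (rule degree_sum_le)
    fix p assume "p \<in> {p. p permutes {0..<a+b}}"
    then have p: "p permutes {0..<a+b}" by simp
    have sg: "degree (signof p * q) \<le> degree q" for q :: "'a poly" by (simp add: sign_def)
    have "degree (\<Prod>i=0..<a+b. ?S $$ (i, p i)) \<le> (\<Sum>i=0..<a+b. degree (?S $$ (i, p i)))"
      using degree_prod_sum_le[of "{0..<a+b}" "\<lambda>i. ?S $$ (i, p i)"] by (simp add: o_def)
    also have "\<dots> \<le> (\<Sum>i=0..<a+b. if i < b then m else n)"
      using p by (intro sum_mono e) (auto simp: permutes_in_image)
    finally show "degree (signof p * (\<Prod>i=0..<a+b. ?S $$ (i, p i))) \<le> b * m + a * n" using sg s by (metis order_trans)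
  qed (simp add: finite_permutations)
qed

lemma poly_eval_sum: "degree p < D \<Longrightarrow> poly p x = (\<Sum>r=0..<D. coeff p r * x ^ r)"
  for x :: "'a::comm_ring_1"
  by (subst poly_altdef, rule sum.mono_neutral_left) (auto simp: coeff_eq_0)

lemma poly_map_eval: "poly (map_poly (\<lambda>p. poly p x) P) (poly Q x) = poly (poly P Q) (x::'a::comm_ring_1)"
  by (induction P) (auto simp: map_poly_pCons)

text \<open>A row relation is an identity F G + K H = 0 with deg K < a = deg G. Without common roots
  G divides K, so K = 0 and then F = 0.\<close>

lemma sylv_nonsing:
  fixes G H :: "'a::alg_closed_field poly"
  assumes dG: "degree G \<le> a" "coeff G a \<noteq> 0" and dH: "degree H \<le> b"
    and ncr: "\<And>r. poly G r = 0 \<Longrightarrow> poly H r \<noteq> 0"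
  shows "Determinant.det (sylv a b G H) \<noteq> 0"
proof
  let ?S = "sylv a b G H" let ?D = "a + b"
  assume "Determinant.det ?S = 0"
  moreover have car: "?S \<in> carrier_mat ?D ?D" by (simp add: sylv_def)
  ultimately have "Determinant.det (transpose_mat ?S) = 0" by (simp add: Determinant.det_transpose)
  then obtain v where v: "v \<in> carrier_vec ?D" "v \<noteq> 0\<^sub>v ?D" "transpose_mat ?S *\<^sub>v v = 0\<^sub>v ?D"
    using det_0_iff_vec_prod_zero[of "transpose_mat ?S" ?D] car by auto
  define w where "w i = vec_index v i" for i
  define P where "P = (\<Sum>i=0..<?D. smult (w i) (srow b G H i))"
  have "P = 0"
  proof (rule poly_eqI)
    fix j
    show "coeff P j = coeff 0 j"
    proof (cases "j < ?D")
      case True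
      have "vec_index (transpose_mat ?S *\<^sub>v v) j = (\<Sum>i=0..<?D. coeff (srow b G H i) j * w i)"
        using True v(1) by (auto simp: scalar_prod_def w_def sylv_def)
      then show ?thesis using v(3) True by (simp add: P_def coeff_sum mult.commute)
    next
      case False
      then show ?thesis unfolding P_def coeff_sum
        using srow_degree[OF dG(1) dH] by (auto intro!: sum.neutral coeff_eq_0) (meson leI order_less_le_trans)
    qed
  qed
  define F where "F = (\<Sum>i=0..<b. monom (w i) i)"
  define K where "K = (\<Sum>i=0..<a. monom (w (b + i)) i)"
  have sp: "(\<Sum>i=0..<?D. g i) = (\<Sum>i=0..<b. g i) + (\<Sum>i=0..<a. g (b + i))" for g :: "nat \<Rightarrow> 'a poly"
  proof -
    have "(\<Sum>i=0..<?D. g i) = (\<Sum>i=0..<b. g i) + (\<Sum>i=b..<?D. g i)" by (rule sum.atLeastLessThan_concat[symmetric]) auto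
    also have "(\<Sum>i=b..<?D. g i) = (\<Sum>i=0..<a. g (b + i))"
      using sum.shift_bounds_nat_ivl[of g 0 b a] by (simp add: add.commute)
    finally show ?thesis .
  qed
  have sm: "smult c (monom 1 i * Q) = monom c i * Q" for c i and Q :: "'a poly"
    by (metis mult_smult_left smult_monom mult.right_neutral)
  have "P = F * G + K * H"
    unfolding P_def sp F_def K_def sum_distrib_right by (simp add: srow_def sm)
  then have eq: "F * G = - (K * H)" using \<open>P = 0\<close> by (simp add: eq_neg_iff_add_eq_0)
  have G0: "G \<noteq> 0" using dG by auto
  have K0: "K = 0"
  proof (cases "a = 0")
    case True then show ?thesis by (simp add: K_def)
  next
    case False
    have "G dvd K * H" using eq by (metis dvd_minus_iff dvd_triv_right)
    then have "G dvd K" using dvd_of_no_common_root[OF G0] ncr by blast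
    moreover have "degree K < a" unfolding K_def using False
      by (intro degree_sum_less) (auto simp: degree_monom_le intro: le_less_trans[OF degree_monom_le])
    moreover have "degree G = a" using dG le_degree by (metis le_antisym)
    ultimately show ?thesis using dvd_imp_degree_le by (metis not_less)
  qed
  then have F0: "F = 0" using eq G0 by simp
  have "w i = 0" if "i < ?D" for i
  proof (cases "i < b")
    case True
    have "coeff F i = w i" using True unfolding F_def coeff_sum by (simp add: sum.delta')
    then show ?thesis using F0 by simp
  next
    case False
    then have "i - b < a" "b + (i - b) = i" using that by auto
    then have "coeff K (i - b) = w i" unfolding K_def coeff_sum by (simp add: sum.delta')
    then show ?thesis using K0 by simp
  qed
  then have "v = 0\<^sub>v ?D" using v(1) by (intro eq_vecI) (auto simp: w_def)
  then show False using v by simp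
qed

lemma sylv_eval: "Determinant.det (sylv a b (map_poly (\<lambda>p. poly p x) G) (map_poly (\<lambda>p. poly p x) H))
   = poly (Determinant.det (sylv a b G H)) (x::'a::idom)"
proof -
  have "map_mat (\<lambda>p. poly p x) (sylv a b G H) = sylv a b (map_poly (\<lambda>p. poly p x) G) (map_poly (\<lambda>p. poly p x) H)"
    by (rule eq_matI) (auto simp: sylv_def srow_def coeff_monom_mult' coeff_map_poly)
  then show ?thesis using comm_ring_hom.hom_det[OF poly_eval_hom[of x], of "sylv a b G H"] by simp
qed

text \<open>Multiplying the Sylvester matrix by the powers of Y j makes column j consist of
  multiples of G(Y j) and H(Y j), all divisible by (X-x)^(m j). The determinant collects these
  powers, and the multiplier is invertible at x because the values Y j (x) are distinct.\<close>

lemma sylv_fibre: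
  fixes G H :: "'a::alg_closed_field poly poly"
  assumes dG: "degree G \<le> a" and dH: "degree H \<le> b"
    and k: "k \<le> a + b"
    and dv: "\<And>j. j < k \<Longrightarrow> [:-x,1:]^m j dvd poly G (Y j)" "\<And>j. j < k \<Longrightarrow> [:-x,1:]^m j dvd poly H (Y j)"
    and inj: "inj_on (\<lambda>j. poly (Y j) x) {0..<k}"
  shows "[:-x,1:]^(\<Sum>j=0..<k. m j) dvd Determinant.det (sylv a b G H)"
proof -
  let ?S = "sylv a b G H" let ?D = "a + b" let ?q = "[:-x,1:]"
  \<comment> \<open>Vandermonde columns in the first k places, completed by columns of the
    identity.\<close>
  define V where "V = Matrix.mat ?D ?D (\<lambda>(r,j). if j < k then Y j ^ r else if r = j then 1 else 0)"
  have cS: "?S \<in> carrier_mat ?D ?D" and cV: "V \<in> carrier_mat ?D ?D" by (simp_all add: sylv_def V_def)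
  define cd where "cd j = (if j < k then ?q ^ m j else 1)" for j
  have ent: "cd j dvd (?S * V) $$ (i,j)" if ij: "i < ?D" "j < ?D" for i j
  proof (cases "j < k")
    case True
    have "(?S * V) $$ (i,j) = (\<Sum>r=0..<?D. coeff (srow b G H i) r * Y j ^ r)"
      using ij True by (auto simp: sylv_def V_def scalar_prod_def)
    also have "\<dots> = poly (srow b G H i) (Y j)" using poly_eval_sum[OF srow_degree[OF dG dH ij(1)]] by simp
    finally show ?thesis using dv[OF True] True by (auto simp: cd_def srow_def)
  qed (simp add: cd_def)
  have cSV: "?S * V \<in> carrier_mat ?D ?D" using cS cV by simp
  have "(\<Prod>j=0..<?D. cd j) dvd Determinant.det (?S * V)" unfolding det_def'[OF cSV]
  proof (rule dvd_sum)
    fix p assume "p \<in> {p. p permutes {0..<?D}}"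
    then have p: "p permutes {0..<?D}" by simp
    have "(\<Prod>j=0..<?D. cd j) = (\<Prod>i=0..<?D. cd (p i))" using prod.permute[OF p, of cd] by (simp add: o_def)
    also have "\<dots> dvd (\<Prod>i=0..<?D. (?S * V) $$ (i, p i))" using p by (intro prod_dvd_prod ent) (auto simp: permutes_in_image)
    finally show "(\<Prod>j=0..<?D. cd j) dvd signof p * (\<Prod>i=0..<?D. (?S * V) $$ (i, p i))" by simp
  qed
  moreover have "(\<Prod>j=0..<?D. cd j) = ?q ^ (\<Sum>j=0..<k. m j)"
  proof -
    have "(\<Prod>j=0..<?D. cd j) = (\<Prod>j=0..<k. cd j)" by (rule prod.mono_neutral_right) (use k in \<open>auto simp: cd_def\<close>)
    also have "\<dots> = (\<Prod>j=0..<k. ?q ^ m j)" by (rule prod.cong) (auto simp: cd_def)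
    finally show ?thesis by (simp add: power_sum)
  qed
  ultimately have dd: "?q ^ (\<Sum>j=0..<k. m j) dvd Determinant.det V * Determinant.det ?S"
    using det_mult[OF cS cV] by (simp add: mult.commute)
  have "poly (Determinant.det V) x \<noteq> 0"
  proof
    assume "poly (Determinant.det V) x = 0"
    define V0 where "V0 = map_mat (\<lambda>p. poly p x) V"
    have c0: "V0 \<in> carrier_mat ?D ?D" using cV by (simp add: V0_def)
    have "Determinant.det V0 = 0" using comm_ring_hom.hom_det[OF poly_eval_hom[of x], of V] \<open>poly (Determinant.det V) x = 0\<close> by (simp add: V0_def)
    then have "Determinant.det (transpose_mat V0) = 0" using c0 by (simp add: Determinant.det_transpose)
    then obtain v where v: "v \<in> carrier_vec ?D" "v \<noteq> 0\<^sub>v ?D" "transpose_mat V0 *\<^sub>v v = 0\<^sub>v ?D"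
      using det_0_iff_vec_prod_zero[of "transpose_mat V0" ?D] c0 by auto
    have row: "(\<Sum>r=0..<?D. V0 $$ (r,j) * vec_index v r) = 0" if "j < ?D" for j
    proof -
      have "vec_index (transpose_mat V0 *\<^sub>v v) j = (\<Sum>r=0..<?D. V0 $$ (r,j) * vec_index v r)"
        using that v(1) c0 by (auto simp: scalar_prod_def)
      then show ?thesis using v(3) that by simp
    qed
    have big: "vec_index v j = 0" if "k \<le> j" "j < ?D" for j
    proof -
      have "(\<Sum>r=0..<?D. V0 $$ (r,j) * vec_index v r) = (\<Sum>r=0..<?D. if r = j then vec_index v r else 0)"
        using that by (intro sum.cong) (auto simp: V0_def V_def)
      then show ?thesis using row[OF that(2)] that by (simp add: sum.delta')
    qed
    \<comment> \<open>A relation among the rows of V at x has zero entries from k on, by the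
      identity columns; the remaining entries are the coefficients of a polynomial of degree below k
      with k distinct roots.\<close>
    define p where "p = (\<Sum>r=0..<k. monom (vec_index v r) r)"
    have cp: "coeff p r = (if r < k then vec_index v r else 0)" for r unfolding p_def coeff_sum by (simp add: sum.delta')
    have "poly p (poly (Y j) x) = 0" if "j < k" for j
    proof -
      have "(\<Sum>r=0..<?D. V0 $$ (r,j) * vec_index v r) = (\<Sum>r=0..<?D. vec_index v r * poly (Y j) x ^ r)"
        using that k by (intro sum.cong) (auto simp: V0_def V_def)
      also have "\<dots> = (\<Sum>r=0..<k. vec_index v r * poly (Y j) x ^ r)"
        using k big by (intro sum.mono_neutral_right) auto
      also have "\<dots> = poly p (poly (Y j) x)" unfolding p_def by (simp add: poly_sum poly_monom)
      finally show ?thesis using row[of j] that k by simp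
    qed
    then have sub: "(\<lambda>j. poly (Y j) x) ` {0..<k} \<subseteq> {t. poly p t = 0}" by auto
    have "p = 0"
    proof (rule ccontr)
      assume "p \<noteq> 0"
      then have "card ((\<lambda>j. poly (Y j) x) ` {0..<k}) \<le> card {t. poly p t = 0}" using sub poly_roots_finite by (intro card_mono)
      also have "\<dots> \<le> degree p" by (rule card_poly_roots_bound[OF \<open>p \<noteq> 0\<close>])
      finally have "k \<le> degree p" using card_image[OF inj] by simp
      then have "coeff p (degree p) = 0" using cp by simp
      then show False using \<open>p \<noteq> 0\<close> by simp
    qed
    then have "vec_index v r = 0" if "r < ?D" for r using cp[of r] big[of r] that by (cases "r < k") auto
    then have "v = 0\<^sub>v ?D" using v(1) by (intro eq_vecI) auto
    then show False using v by simp
  qed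
  then show ?thesis using power_root_cancel[OF dd] by blast
qed

lemma sum_mult_le_degree:
  fixes R :: "'a::field poly"
  assumes "finite Z" "R \<noteq> 0" "\<And>x. x \<in> Z \<Longrightarrow> [:-x,1:]^M x dvd R"
  shows "(\<Sum>x\<in>Z. M x) \<le> degree R"
  using assms
proof (induction Z arbitrary: R rule: finite_induct)
  case (insert x Z)
  then obtain R' where R': "R = [:-x,1:]^M x * R'" by (meson dvdE insertI1)
  have ne: "R' \<noteq> 0" using R' insert.prems by auto
  have "[:-y,1:]^M y dvd R'" if "y \<in> Z" for y
  proof (rule power_root_cancel)
    show "[:-y,1:]^M y dvd [:-x,1:]^M x * R'" using insert.prems that R' by auto
    show "poly ([:-x,1:]^M x) y \<noteq> 0" using that insert.hyps by auto
  qed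
  then have "(\<Sum>x\<in>Z. M x) \<le> degree R'" using insert.IH ne by blast
  moreover have "degree R = M x + degree R'" unfolding R' using ne by (subst degree_mult_eq) (auto simp: degree_power_eq)
  ultimately show ?case using insert.hyps by simp
qed simp

text \<open>Two curves of bidegrees (m,a) and (n,b) meet in at most a n + b m points. A multiplicity
  is certified by a branch y = Y(x) on which both equations vanish to that order. The fibre over x0
  carries no common point, which keeps the resultant nonzero; \<open>nz\<close> says that G contains
  no fibre through a listed point, which bounds the number of points in a fibre by a.\<close>

theorem bezout_bidegree:
  fixes G H :: "'a::alg_closed_field poly poly"
  assumes dG: "degree G \<le> a" and dH: "degree H \<le> b"
    and mG: "\<And>j. degree (coeff G j) \<le> m" and nH: "\<And>j. degree (coeff H j) \<le> n"
    and x0: "poly (coeff G a) x0 \<noteq> 0"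
    and ncr: "\<And>y. poly (poly G [:y:]) x0 = 0 \<Longrightarrow> poly (poly H [:y:]) x0 \<noteq> 0"
    and fin: "finite I"
    and dvG: "\<And>i. i \<in> I \<Longrightarrow> [:-xi i,1:]^mu i dvd poly G (Y i)"
    and dvH: "\<And>i. i \<in> I \<Longrightarrow> [:-xi i,1:]^mu i dvd poly H (Y i)"
    and mu: "\<And>i. i \<in> I \<Longrightarrow> mu i \<ge> 1"
    and nz: "\<And>i. i \<in> I \<Longrightarrow> map_poly (\<lambda>p. poly p (xi i)) G \<noteq> 0"
    and inj: "inj_on (\<lambda>i. (xi i, poly (Y i) (xi i))) I"
  shows "(\<Sum>i\<in>I. mu i) \<le> a * n + b * m"
proof -
  define R where "R = Determinant.det (sylv a b G H)"
  have evm: "poly (map_poly (\<lambda>p. poly p x) P) y = poly (poly P [:y:]) x" for P :: "'a poly poly" and x y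
  proof -
    show ?thesis using poly_map_eval[of x P "[:y:]"] by simp
  qed
  have "R \<noteq> 0"
  proof
    assume "R = 0"
    then have "Determinant.det (sylv a b (map_poly (\<lambda>p. poly p x0) G) (map_poly (\<lambda>p. poly p x0) H)) = 0"
      unfolding sylv_eval R_def by simp
    moreover have "Determinant.det (sylv a b (map_poly (\<lambda>p. poly p x0) G) (map_poly (\<lambda>p. poly p x0) H)) \<noteq> 0"
    proof (rule sylv_nonsing)
      show "degree (map_poly (\<lambda>p. poly p x0) G) \<le> a" using dG degree_map_poly_le order_trans by blast
      show "degree (map_poly (\<lambda>p. poly p x0) H) \<le> b" using dH degree_map_poly_le order_trans by blast
      show "coeff (map_poly (\<lambda>p. poly p x0) G) a \<noteq> 0" using x0 by (simp add: coeff_map_poly)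
      show "poly (map_poly (\<lambda>p. poly p x0) H) r \<noteq> 0" if "poly (map_poly (\<lambda>p. poly p x0) G) r = 0" for r
        using ncr that unfolding evm by blast
    qed
    ultimately show False by simp
  qed
  define Ix where "Ix x = {i\<in>I. xi i = x}" for x
  have key: "[:-x,1:]^(\<Sum>i\<in>Ix x. mu i) dvd R" if "x \<in> xi ` I" for x
  proof -
    have finx: "finite (Ix x)" using fin by (simp add: Ix_def)
    define k where "k = card (Ix x)"
    obtain h where h: "bij_betw h {0..<k} (Ix x)" unfolding k_def using ex_bij_betw_nat_finite[OF finx] by blast
    have hin: "h j \<in> I \<and> xi (h j) = x" if "j < k" for j using h that unfolding bij_betw_def Ix_def by auto
    have injh: "inj_on (\<lambda>j. poly (Y (h j)) x) {0..<k}"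
    proof (rule inj_onI)
      fix j l assume jl: "j \<in> {0..<k}" "l \<in> {0..<k}" "poly (Y (h j)) x = poly (Y (h l)) x"
      then have "h j = h l" by (intro inj_onD[OF inj]) (use hin[of j] hin[of l] in auto)
      then show "j = l" using h jl unfolding bij_betw_def inj_on_def by blast
    qed
    have ne: "map_poly (\<lambda>p. poly p x) G \<noteq> 0" using nz that by auto
    have "poly (map_poly (\<lambda>p. poly p x) G) (poly (Y (h j)) x) = 0" if "j < k" for j
    proof -
      have "[:-x,1:]^1 dvd [:-x,1:]^mu (h j)" by (rule le_imp_power_dvd) (use mu[of "h j"] hin[OF that] in auto)
      then have "[:-x,1:] dvd poly G (Y (h j))" using dvG[of "h j"] hin[OF that] by (auto elim: dvd_trans)
      then have "poly (poly G (Y (h j))) x = 0" by (simp only: poly_eq_0_iff_dvd)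
      then show ?thesis using poly_map_eval[of x G "Y (h j)"] by simp
    qed
    then have "(\<lambda>j. poly (Y (h j)) x) ` {0..<k} \<subseteq> {t. poly (map_poly (\<lambda>p. poly p x) G) t = 0}" by auto
    then have "k \<le> card {t. poly (map_poly (\<lambda>p. poly p x) G) t = 0}"
      using card_mono[OF poly_roots_finite[OF ne], of "(\<lambda>j. poly (Y (h j)) x) ` {0..<k}"] unfolding card_image[OF injh] by simp
    also have "\<dots> \<le> degree (map_poly (\<lambda>p. poly p x) G)" by (rule card_poly_roots_bound[OF ne])
    also have "\<dots> \<le> a" using dG degree_map_poly_le order_trans by blast
    finally have ka: "k \<le> a + b" by simp
    have "[:-x,1:]^(\<Sum>j=0..<k. mu (h j)) dvd R" unfolding R_def
      by (rule sylv_fibre[OF dG dH ka _ _ injh]) (use dvG dvH hin in auto)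
    moreover have "(\<Sum>j=0..<k. mu (h j)) = (\<Sum>i\<in>Ix x. mu i)" by (rule sum.reindex_bij_betw[OF h])
    ultimately show ?thesis by simp
  qed
  have "(\<Sum>i\<in>I. mu i) = (\<Sum>x\<in>xi ` I. \<Sum>i\<in>Ix x. mu i)" unfolding Ix_def by (rule sum.image_gen[OF fin])
  also have "\<dots> \<le> degree R" by (rule sum_mult_le_degree[OF _ \<open>R \<noteq> 0\<close> key]) (use fin in auto)
  also have "\<dots> \<le> b * m + a * n" unfolding R_def by (rule sylv_det_degree[OF mG nH])
  finally show ?thesis by simp
qed

section \<open>Lines meeting a given line\<close>

definition is_line :: "('a::field^4) set \<Rightarrow> bool" where "is_line L \<longleftrightarrow> (\<exists>a b. indep2 a b \<and> L = sp a b)"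
definition meets :: "('a::field^4) set \<Rightarrow> ('a^4) set \<Rightarrow> bool" where "meets L M \<longleftrightarrow> (\<exists>x. x \<noteq> 0 \<and> x \<in> L \<and> x \<in> M)"
definition lines_in :: "nat \<Rightarrow> 'a::field form4 \<Rightarrow> ('a^4) set set" where
  "lines_in d c = {L. is_line L \<and> (\<forall>x\<in>L. ev d c x = 0)}"

lemma sp_mem: "s *s a + t *s b \<in> sp a b" by (auto simp: sp_def)
lemma sp_gen [simp]: "a \<in> sp a b" "b \<in> sp a b" "0 \<in> sp a b"
  using sp_mem[of 1 a 0 b] sp_mem[of 0 a 1 b] sp_mem[of 0 a 0 b] by auto
lemma sp_add: "x \<in> sp a b \<Longrightarrow> y \<in> sp a b \<Longrightarrow> x + y \<in> sp a b"
proof -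
  assume "x \<in> sp a b" "y \<in> sp a b"
  then obtain s t s' t' where "x = s *s a + t *s b" "y = s' *s a + t' *s b" by (auto simp: sp_def)
  then have "x + y = (s + s') *s a + (t + t') *s b" by (simp add: cart_eq algebra_simps)
  then show ?thesis using sp_mem by metis
qed
lemma sp_scale: "x \<in> sp a b \<Longrightarrow> r *s x \<in> sp a b"
proof -
  assume "x \<in> sp a b"
  then obtain s t where "x = s *s a + t *s b" by (auto simp: sp_def)
  then have "r *s x = (r * s) *s a + (r * t) *s b" by (simp add: cart_eq algebra_simps)
  then show ?thesis using sp_mem by metis
qed
lemma sp_diff: "x \<in> sp a b \<Longrightarrow> y \<in> sp a b \<Longrightarrow> x - y \<in> sp a b"
  using sp_add[of x a b "(-1) *s y"] sp_scale[of y a b "-1"] by (simp add: cart_eq)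
lemma sp_sub: "x \<in> sp a b \<Longrightarrow> y \<in> sp a b \<Longrightarrow> sp x y \<subseteq> sp a b"
  by (auto simp: sp_def[of x y] intro: sp_add sp_scale)

lemma line_add: "is_line L \<Longrightarrow> x \<in> L \<Longrightarrow> y \<in> L \<Longrightarrow> x + y \<in> L"
  and line_scale: "is_line L \<Longrightarrow> x \<in> L \<Longrightarrow> r *s x \<in> L"
  and line_diff: "is_line L \<Longrightarrow> x \<in> L \<Longrightarrow> y \<in> L \<Longrightarrow> x - y \<in> L"
  by (auto simp: is_line_def sp_add sp_scale sp_diff dest: sp_sub)

lemma indep2_nz: assumes "indep2 a b" shows "a \<noteq> 0" "b \<noteq> 0"
  using assms[unfolded indep2_def, rule_format, of 1 0] assms[unfolded indep2_def, rule_format, of 0 1] by auto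
lemma indep2_sym: "indep2 a b \<Longrightarrow> indep2 b a"
  unfolding indep2_def by (metis add.commute)

lemma sp_eq: assumes xy: "indep2 x y" and x: "x \<in> sp a b" and y: "y \<in> sp a b" shows "sp x y = sp a b"
proof
  show "sp x y \<subseteq> sp a b" by (rule sp_sub[OF x y])
  obtain s t where xs: "x = s *s a + t *s b" using x by (auto simp: sp_def)
  obtain s' t' where ys: "y = s' *s a + t' *s b" using y by (auto simp: sp_def)
  define D where "D = s * t' - s' * t"
  have D: "D \<noteq> 0"
  proof
    assume "D = 0"
    have "t' *s x + (-t) *s y = D *s a" "s' *s x + (- s) *s y = (-D) *s b" unfolding xs ys D_def by (simp_all add: cart_eq algebra_simps)
    then have "t' *s x + (-t) *s y = 0" "s' *s x + (-s) *s y = 0" using \<open>D = 0\<close> by simp_all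
    then have "t = 0" "s = 0" using xy unfolding indep2_def by (metis neg_equal_0_iff_equal)+
    then have "x = 0" using xs by simp
    then show False using indep2_nz[OF xy] by simp
  qed
  have "a = (t'/D) *s x + (-t/D) *s y" "b = (-s'/D) *s x + (s/D) *s y"
    unfolding xs ys using D by (simp_all add: cart_eq) (simp_all add: field_simps, simp_all add: D_def algebra_simps)
  then have "a \<in> sp x y" "b \<in> sp x y" using sp_mem by metis+
  then show "sp a b \<subseteq> sp x y" by (rule sp_sub)
qed

lemma line_sp: "is_line L \<Longrightarrow> indep2 x y \<Longrightarrow> x \<in> L \<Longrightarrow> y \<in> L \<Longrightarrow> L = sp x y"
  unfolding is_line_def using sp_eq by blast
lemma is_line_sp: "indep2 a b \<Longrightarrow> is_line (sp a b)" unfolding is_line_def by blast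

lemma not_indep2: assumes "\<not> indep2 x y" "x \<noteq> 0" obtains r where "y = r *s x"
proof -
  obtain s t where st: "s *s x + t *s y = 0" "s \<noteq> 0 \<or> t \<noteq> 0" using assms(1) unfolding indep2_def by blast
  have "t \<noteq> 0"
  proof
    assume "t = 0"
    then have "s *s x = 0" "s \<noteq> 0" using st by auto
    then show False using assms(2) by (simp add: vector_mul_eq_0)
  qed
  then have "y = (-s/t) *s x" using st(1) by (simp add: cart_eq field_simps eq_neg_iff_add_eq_0 add.commute)
  then show ?thesis using that by blast
qed

lemma lines_two_pts: assumes "is_line L" "is_line M" "L \<noteq> M" "x \<in> L" "x \<in> M" "y \<in> L" "y \<in> M" "x \<noteq> 0"
  obtains r where "y = r *s x"
  using not_indep2[of x y] line_sp assms by metis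

lemma line_complete: assumes "is_line L" "p \<in> L" "p \<noteq> 0" obtains v where "indep2 p v" "v \<in> L" "L = sp p v"
proof -
  obtain a b where ab: "indep2 a b" "L = sp a b" using assms(1) by (auto simp: is_line_def)
  have "indep2 p a \<or> indep2 p b"
  proof (rule ccontr)
    assume "\<not> ?thesis"
    then obtain r s where rs: "a = r *s p" "b = s *s p" using not_indep2 assms(3) by metis
    have "s *s a + (-r) *s b = 0" unfolding rs by (simp add: cart_eq)
    then have "r = 0" using ab(1) unfolding indep2_def by (metis neg_equal_0_iff_equal)
    then show False using rs(1) indep2_nz[OF ab(1)] by simp
  qed
  then show ?thesis using that line_sp[OF assms(1) _ assms(2)] ab by (metis sp_gen(1,2))
qed

lemma dc_pderiv: "dc n p a \<Longrightarrow> n \<ge> 1 \<Longrightarrow> dc (n-1) (pderiv p) (of_nat n * a)" for p :: "'a::idom poly"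
  unfolding dc_def by (auto simp: coeff_pderiv degree_pderiv_le intro: order_trans[OF degree_pderiv_le])
lemma dc_numeral: "dc 0 (numeral k) (numeral k)" by (simp add: dc_def numeral_poly)
lemma dc_weaken: "dc n p a \<Longrightarrow> n < m \<Longrightarrow> dc m p 0" by (auto simp: dc_def coeff_eq_0)
lemma dc_zero: "dc (Suc n) p 0 \<Longrightarrow> dc n p (coeff p n)"
  unfolding dc_def by (metis Suc_le_eq le_SucE leading_coeff_0_iff degree_0 le0)

lemma pow_dvd_shift: assumes "[:0,1:]^k dvd Q \<circ>\<^sub>p [:z,1:]" shows "[:-z,1:]^k dvd (Q::'a::idom poly)"
proof -
  obtain T where T: "Q \<circ>\<^sub>p [:z,1:] = [:0,1:]^k * T" using assms by blast
  have "[:z,1:] \<circ>\<^sub>p [:-z,1:] = [:0,1:]" by (simp add: pcompose_pCons)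
  then have "Q = (Q \<circ>\<^sub>p [:z,1:]) \<circ>\<^sub>p [:-z,1:]" unfolding pcompose_assoc[symmetric] by (simp only: pcompose_idR)
  also have "\<dots> = ([:0,1:]^k) \<circ>\<^sub>p [:-z,1:] * (T \<circ>\<^sub>p [:-z,1:])" unfolding T by (rule pcompose_mult)
  also have "([:0,1:]^k) \<circ>\<^sub>p [:-z,1:] = [:-z,1:]^k" by (induction k) (simp_all add: pcompose_mult pcompose_pCons pcompose_1)
  finally show ?thesis by simp
qed

lemma pow_dvd_coeffs: assumes "\<And>i. i < k \<Longrightarrow> coeff P i = 0" shows "[:0,1:]^k dvd (P::'a::idom poly)"
proof -
  have "P = monom 1 k * poly_shift k P"
    by (rule poly_eqI) (use assms in \<open>auto simp: coeff_monom_mult coeff_poly_shift\<close>)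
  then show ?thesis by (metis dvd_triv_left x_pow_n monom_altdef smult_1_left)
qed

section \<open>Degree and zeros of \<open>W\<close>\<close>

context lsurf begin

text \<open>Two cancellations at the top: the Wronskian loses its leading coefficient, so deg u is
  at most 2d - 4, and then two of the three terms of W have degree 8d - 13 with opposite leading
  coefficients, while the third has degree at most 8d - 14.\<close>

lemma W_degree: "degree W \<le> 8 * d - 14"
proof -
  obtain a b where a: "dc (d-1) A a" and b: "dc (d-1) B b" using dcA dcB by blast
  have a': "dc (d-2) (pderiv A) (of_nat (d-1) * a)" and b': "dc (d-2) (pderiv B) (of_nat (d-1) * b)"
    using dc_pderiv[OF a] dc_pderiv[OF b] d3 by (simp_all add: numeral_2_eq_2)
  have u1: "dc ((d-1) + (d-2)) u (b * (of_nat (d-1) * a) - a * (of_nat (d-1) * b))"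
    unfolding u_eq by (intro dc_diff dc_mult a b a' b')
  have u2: "(d-1) + (d-2) = Suc (2*d-4)" "b * (of_nat (d-1) * a) - a * (of_nat (d-1) * b) = 0" using d3 by simp_all
  have "dc (Suc (2*d-4)) u 0" using u1 unfolding u2 .
  then obtain U where U: "dc (2*d-4) u U" using dc_zero by blast
  have U': "dc (2*d-5) (pderiv u) (of_nat (2*d-4) * U)" using dc_pderiv[OF U] d3 by (simp add: numeral_eq_Suc)
  obtain p q r where p: "dc (d-2) (D2 d (cl c) X (cv g1) (cv g1)) p" and q: "dc (d-2) (D2 d (cl c) X (cv g1) (cv g2)) q"
     and r: "dc (d-2) (D2 d (cl c) X (cv g2) (cv g2)) r" unfolding X_def using dc_D2_lin by blast
  have dD2: "pderiv (D2 d (cl c) X (cv v) (cv w)) = D3 d (cl c) X (cv v) (cv w) (cv f)" for v w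
    unfolding ch_D2 pX by (simp add: D0)
  have p': "dc (d-3) (D3 d (cl c) X (cv g1) (cv g1) (cv f)) (of_nat (d-2) * p)"
   and q': "dc (d-3) (D3 d (cl c) X (cv g1) (cv g2) (cv f)) (of_nat (d-2) * q)"
   and r': "dc (d-3) (D3 d (cl c) X (cv g2) (cv g2) (cv f)) (of_nat (d-2) * r)"
    using dc_pderiv[OF p] dc_pderiv[OF q] dc_pderiv[OF r] d3 unfolding dD2 by (simp_all add: numeral_eq_Suc)
  have w2e: "w2 = B * B * D2 d (cl c) X (cv g1) (cv g1) - 2 * A * B * D2 d (cl c) X (cv g1) (cv g2) + A * A * D2 d (cl c) X (cv g2) (cv g2)"
    unfolding w2_def tau_def D_lin D2_sym[of d "cl c" X "cv g2" "cv g1"] by (simp add: algebra_simps)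
  have ome: "om = B * B * D3 d (cl c) X (cv g1) (cv g1) (cv f) - 2 * A * B * D3 d (cl c) X (cv g1) (cv g2) (cv f) + A * A * D3 d (cl c) X (cv g2) (cv g2) (cv f)"
    unfolding om_def tau_def D_lin D3_sym12[of d "cl c" X "cv g2" "cv g1"] by (simp add: algebra_simps)
  define w where "w = b * b * p - 2 * a * b * q + a * a * r"
  have aa: "dc (d-1) (2 * A) (2 * a)" using dc_mult[OF dc_numeral a, of "num.Bit0 num.One"] by simp
  have e1: "(d-1)+(d-1)+(d-2) = 3*d-4" "(d-1)+(d-1)+(d-3) = 3*d-5" using d3 by simp_all
  have "dc ((d-1)+(d-1)+(d-2)) w2 (b*b*p - 2*a*b*q + a*a*r)"
    unfolding w2e by (intro dc_add dc_diff dc_mult aa a b p q r)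
  then have w: "dc (3*d-4) w2 w" unfolding w_def e1 .
  have "dc ((d-1)+(d-1)+(d-3)) om (b*b*(of_nat (d-2)*p) - 2*a*b*(of_nat (d-2)*q) + a*a*(of_nat (d-2)*r))"
    unfolding ome by (intro dc_add dc_diff dc_mult aa a b p' q' r')
  then have o: "dc (3*d-5) om (of_nat (d-2) * w)" unfolding w_def e1 by (simp add: algebra_simps)
  have "\<exists>s. dc (3*(d-1)+(d-3)) sg s"
  proof -
    have "dc (3*(d-1)+(d-3)) sg (coeff sg (3*(d-1)+(d-3)))"
    proof -
      have dt: "degree (tau $ i) \<le> d-1" for i
        using degA degB unfolding tau_def by (auto simp: algebra_simps intro!: degree_diff_le order_trans[OF degree_smult_le])
      have de: "degree (ev (d-3) (pd k (pd j (pd i (cl c)))) X) \<le> d-3" for i j k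
        using dc_ev_lin[of "d-3" "pd k (pd j (pd i c))" e f] unfolding pd_cl X_def by (simp add: dc_def)
      have "degree (tau$i * tau$j * tau$k * ev (d-3) (pd k (pd j (pd i (cl c)))) X) \<le> 3*(d-1)+(d-3)" for i j k
        using degree_mult_le[of "tau$i * tau$j * tau$k" "ev (d-3) (pd k (pd j (pd i (cl c)))) X"]
          degree_mult_le[of "tau$i * tau$j" "tau$k"] degree_mult_le[of "tau$i" "tau$j"] dt[of i] dt[of j] dt[of k] de[of k j i] by linarith
      then show ?thesis unfolding dc_def sg_def D3_expand by (intro conjI refl degree_sum_le) auto
    qed
    then show ?thesis by blast
  qed
  moreover have "3*(d-1)+(d-3) = 4*d-6" using d3 by simp
  ultimately obtain s where s: "dc (4*d-6) sg s" by auto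
  have t1: "dc (0 + ((3*d-4) + (3*d-4)) + (2*d-5)) (3 * (w2 * w2) * pderiv u) (3 * (w * w) * (of_nat (2*d-4) * U))"
    by (intro dc_mult dc_numeral w U')
  have t2: "dc (0 + (2*d-4) + (3*d-4) + (3*d-5)) (6 * u * w2 * om) (6 * U * w * (of_nat (d-2) * w))"
    by (intro dc_mult dc_numeral w U o)
  have t3: "dc (0 + ((2*d-4) + (2*d-4)) + (4*d-6)) (4 * (u * u) * sg) (4 * (U * U) * s)"
    by (intro dc_mult dc_numeral U s)
  have n1: "0 + ((3*d-4) + (3*d-4)) + (2*d-5) = 8*d-13" "0 + (2*d-4) + (3*d-4) + (3*d-5) = 8*d-13" using d3 by auto
  have t3': "dc (8*d-13) (4 * (u * u) * sg) 0" by (rule dc_weaken[OF t3]) (use d3 in simp)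
  have "dc (8*d-13) W (3 * (w * w) * (of_nat (2*d-4) * U) - 6 * U * w * (of_nat (d-2) * w) + 0)"
    unfolding W_def power2_eq_square using t1 t2 t3' unfolding n1 by (intro dc_add dc_diff)
  \<comment> \<open>With U and w the leading coefficients of u and w2, those of u' and om are
    (2d-4)U and (d-2)w, so that 3 w^2 (2d-4) U = 6 U w (d-2) w.\<close>
  moreover have "(of_nat (2*d-4) :: 'a) = 2 * of_nat (d-2)" using d3 by (simp add: of_nat_diff algebra_simps)
  ultimately have "dc (8*d-13) W 0" by (simp add: algebra_simps)
  moreover have "8*d-13 = Suc (8*d-14)" using d3 by simp
  ultimately show ?thesis using dc_zero unfolding dc_def by metis
qed

text \<open>Let k further lines pass through pz z. In the local coordinates s along the line and r
  along tz, every term of the equation of total degree at most k vanishes. Hence the coefficients of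
  r, r^2 and r^3 are divisible by s^k, s^(k-1) and s^(k-2), and this passes to u, w2, om, sg and
  finally W.\<close>

lemma fibre_mult:
  assumes Bz: "poly B z \<noteq> 0" and fin: "finite S"
    and al: "\<And>\<alpha> t. \<alpha> \<in> S \<Longrightarrow> ev d c (pz z + t *s (\<alpha> *s f + tz z)) = 0"
  shows "[:-z,1:]^(card S) dvd W"
proof -
  define k where "k = card S"
  define p where "p = pz z"
  define PP where "PP = ev d (cl (cl c)) (lin (lin p f) (cv (tz z)))"
  have PPv: "poly (poly PP [:r:]) s = ev d c (p + s *s f + r *s tz z)" for r s
    unfolding PP_def poly_ev mapv_lin by (simp add: cart_eq algebra_simps)
  have P00: "coeff PP 0 = 0"
  proof (rule poly_all_zero)
    fix s
    have "poly (coeff PP 0) s = poly (poly PP [:0:]) s" by (simp add: poly_0_coeff_0)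
    also have "\<dots> = 0" unfolding PPv p_def using on[of 1 "z + s"] by (simp add: pz_def cart_eq algebra_simps)
    finally show "poly (coeff PP 0) s = 0" .
  qed
  have zero: "coeff (coeff PP j) i = 0" if "1 \<le> j" "i + j \<le> k" for i j
  proof -
    define M where "M = i + j"
    \<comment> \<open>The homogeneous part of degree M, dehomogenised at r = 1. It is divisible by r
      since the line r = 0 lies on the surface, so h has degree below M; but it has k roots, one per
      line, and M is at most k.\<close>
    define h where "h = (\<Sum>j\<in>{1..M}. monom (coeff (coeff PP j) (M - j)) (M - j))"
    have ch: "coeff h n = (if n < M then coeff (coeff PP (M - n)) n else 0)" for n
    proof -
      have "coeff h n = (\<Sum>j\<in>{1..M}. if j = M - n \<and> n \<le> M then coeff (coeff PP j) n else 0)"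
        unfolding h_def coeff_sum by (rule sum.cong) auto
      then show ?thesis by (auto simp: sum.delta' cong: if_cong)
    qed
    have rt: "poly h \<alpha> = 0" if "\<alpha> \<in> S" for \<alpha>
    proof -
      define R where "R = (\<Sum>j\<le>degree PP. (coeff PP j \<circ>\<^sub>p [:0,\<alpha>:]) * monom 1 j)"
      have "R = 0"
      proof (rule poly_all_zero)
        fix r
        have "poly R r = (\<Sum>j\<le>degree PP. poly (coeff PP j) (\<alpha> * r) * r ^ j)"
          unfolding R_def by (simp add: poly_sum poly_pcompose poly_monom mult.commute)
        also have "\<dots> = poly (poly PP [:r:]) (\<alpha> * r)" unfolding poly_altdef[of PP] by (simp add: poly_sum poly_power)
        also have "\<dots> = 0" unfolding PPv p_def using al[OF that, of r] by (simp add: cart_eq algebra_simps)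
        finally show "poly R r = 0" .
      qed
      have "coeff R M = (\<Sum>j\<le>degree PP. if j \<le> M then coeff (coeff PP j) (M - j) * \<alpha>^(M - j) else 0)"
        unfolding R_def coeff_sum by (rule sum.cong) (auto simp: mult.commute[of _ "monom 1 _"] coeff_monom_mult coeff_pcompose_linear mult.commute)
      also have "\<dots> = (\<Sum>j\<in>{1..M}. coeff (coeff PP j) (M - j) * \<alpha>^(M - j))"
      proof -
        have "(\<Sum>j\<le>degree PP. if j \<le> M then coeff (coeff PP j) (M - j) * \<alpha>^(M - j) else 0) = (\<Sum>j\<in>{..degree PP} \<inter> {..M}. coeff (coeff PP j) (M - j) * \<alpha>^(M - j))"
          by (subst sum.inter_restrict, simp, rule sum.cong) auto
        also have "\<dots> = (\<Sum>j\<in>{..M}. coeff (coeff PP j) (M - j) * \<alpha>^(M - j))"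
          by (rule sum.mono_neutral_left) (auto simp: coeff_eq_0)
        also have "\<dots> = (\<Sum>j\<in>{1..M}. coeff (coeff PP j) (M - j) * \<alpha>^(M - j))"
          by (rule sum.mono_neutral_right) (auto simp: P00 Suc_le_eq)
        finally show ?thesis .
      qed
      finally show ?thesis using \<open>R = 0\<close> unfolding h_def by (simp add: poly_sum poly_monom)
    qed
    have "h = 0"
    proof (rule ccontr)
      assume h0: "h \<noteq> 0"
      have "card S \<le> card {x. poly h x = 0}" using rt by (intro card_mono poly_roots_finite[OF h0]) auto
      also have "\<dots> \<le> degree h" by (rule card_poly_roots_bound[OF h0])
      finally have "M \<le> degree h" using that unfolding M_def k_def by simp
      then have "coeff h (degree h) = 0" using ch by simp
      then show False using h0 by simp
    qed
    then have "coeff h i = 0" by simp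
    then show ?thesis using ch[of i] that unfolding M_def by auto
  qed
  have supcc: "supp4 d (cl (cl c))" by (rule supp4_cl[OF supc])
  have clcc: "pderiv (cl (cl c) m) = 0" for m by (simp add: pderiv_pCons)
  have pl: "mapv pderiv (lin (lin p f) (cv (tz z))) = cv (cv (tz z))" by simp
  have d1: "pderiv PP = D1 d (cl (cl c)) (lin (lin p f) (cv (tz z))) (cv (cv (tz z)))"
    unfolding PP_def ev_deriv[OF derivation_pderiv supcc clcc] pl ..
  have d2: "pderiv (pderiv PP) = D2 d (cl (cl c)) (lin (lin p f) (cv (tz z))) (cv (cv (tz z))) (cv (cv (tz z)))"
    unfolding d1 D1_deriv[OF derivation_pderiv supcc clcc] pl by (simp add: D0 D1_0)
  have d3': "pderiv (pderiv (pderiv PP)) = D3 d (cl (cl c)) (lin (lin p f) (cv (tz z))) (cv (cv (tz z))) (cv (cv (tz z))) (cv (cv (tz z)))"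
    unfolding d2 D2_deriv[OF derivation_pderiv supcc clcc] pl by (simp add: D0)
  define C1 where "C1 = D1 d (cl c) X (cv (tz z))"
  define P2 where "P2 = D2 d (cl c) X (cv (tz z)) (cv (tz z))"
  define P3 where "P3 = D3 d (cl c) X (cv (tz z)) (cv (tz z)) (cv (tz z))"
  have shift: "p + s *s f = pz (z + s)" for s unfolding p_def pz_def by (simp add: cart_eq algebra_simps)
  have c1: "coeff PP 1 = C1 \<circ>\<^sub>p [:z,1:]"
  proof (rule poly_fun_eqI)
    fix s
    have "coeff PP 1 = poly (pderiv PP) 0" by (simp add: poly_0_coeff_0 coeff_pderiv)
    then show "poly (coeff PP 1) s = poly (C1 \<circ>\<^sub>p [:z,1:]) s" unfolding d1 C1_def by (simp add: poly_D1 poly_pcompose mX shift add.commute)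
  qed
  have c2: "2 * coeff PP 2 = P2 \<circ>\<^sub>p [:z,1:]"
  proof (rule poly_fun_eqI)
    fix s
    have "2 * coeff PP 2 = poly (pderiv (pderiv PP)) 0" by (simp add: poly_0_coeff_0 coeff_pderiv numeral_2_eq_2)
    then have "poly (2 * coeff PP 2) s = poly (poly (pderiv (pderiv PP)) 0) s" by simp
    then show "poly (2 * coeff PP 2) s = poly (P2 \<circ>\<^sub>p [:z,1:]) s" unfolding d2 P2_def by (simp add: poly_D2 poly_pcompose mX shift add.commute)
  qed
  have c3: "6 * coeff PP 3 = P3 \<circ>\<^sub>p [:z,1:]"
  proof (rule poly_fun_eqI)
    fix s
    have "6 * coeff PP 3 = poly (pderiv (pderiv (pderiv PP))) 0" by (simp add: poly_0_coeff_0 coeff_pderiv numeral_3_eq_3)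
    then have "poly (6 * coeff PP 3) s = poly (poly (pderiv (pderiv (pderiv PP))) 0) s" by simp
    then show "poly (6 * coeff PP 3) s = poly (P3 \<circ>\<^sub>p [:z,1:]) s" unfolding d3' P3_def by (simp add: poly_D3 poly_pcompose mX shift add.commute)
  qed
  let ?q = "[:-z,1:]"
  have q1: "?q^k dvd C1" by (rule pow_dvd_shift, unfold c1[symmetric], rule pow_dvd_coeffs) (use zero in auto)
  have q2: "?q^(k-1) dvd P2" by (rule pow_dvd_shift, unfold c2[symmetric], intro dvd_mult pow_dvd_coeffs) (use zero[of 2] in auto)
  have q3: "?q^(k-2) dvd P3" by (rule pow_dvd_shift, unfold c3[symmetric], intro dvd_mult pow_dvd_coeffs) (use zero[of 3] in auto)
  show ?thesis
  proof (cases "k \<ge> 2")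
    case True
    define b where "b = poly B z"
    define \<beta> where "\<beta> = smult (1/b) B"
    define \<gamma> where "\<gamma> = smult (1/b) C1"
    have b0: "b \<noteq> 0" using Bz b_def by simp
    have C1e: "C1 = smult b A - smult (poly A z) B"
    proof (rule poly_fun_eqI)
      fix s show "poly C1 s = poly (smult b A - smult (poly A z) B) s"
        unfolding C1_def b_def by (simp add: poly_D1 mX tz_def D_lin A_val B_val)
    qed
    have Ae: "A = smult (poly A z) \<beta> + \<gamma>" unfolding \<beta>_def \<gamma>_def C1e using b0 by (simp add: smult_diff_right smult_add_right)
    have Be: "B = smult b \<beta>" unfolding \<beta>_def using b0 by simp
    \<comment> \<open>Exchanges the varying field tau for the constant vector tz at the price of a
      multiple \<gamma> of g2, and \<gamma> is divisible by (X-z)^k.\<close>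
    have taue: "tau = \<beta> *s cv (tz z) - \<gamma> *s cv g2"
    proof -
      have "tau = smult b \<beta> *s cv g1 - (smult (poly A z) \<beta> + \<gamma>) *s cv g2" unfolding tau_def using Ae Be by simp
      also have "\<dots> = \<beta> *s cv (tz z) - \<gamma> *s cv g2" by (simp add: cart_eq tz_def b_def algebra_simps smult_diff_left)
      finally show ?thesis .
    qed
    have qg: "?q^k dvd \<gamma>" unfolding \<gamma>_def using q1 by (simp add: dvd_smult)
    have dpow: "?q^(j-1) dvd pderiv Q" if "?q^j dvd Q" for j Q
    proof (cases j)
      case (Suc i)
      obtain T where "Q = ?q^Suc i * T" using \<open>?q^j dvd Q\<close> Suc by blast
      then have "?q * pderiv Q = ?q^Suc i * (of_nat (Suc i) * T + ?q * pderiv T)" using q_pderiv_pow[of z "Suc i" T] by simp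
      then have "pderiv Q = ?q^i * (of_nat (Suc i) * T + ?q * pderiv T)"
        unfolding power_Suc mult.assoc by (metis mult_left_cancel pCons_eq_0_iff zero_neq_one)
      then show ?thesis unfolding Suc by simp
    qed simp
    have le: "?q^i dvd Q" if "?q^j dvd Q" "i \<le> j" for i j Q using that by (meson dvd_trans le_imp_power_dvd)
    have ug: "u = smult b (\<beta> * pderiv \<gamma> - \<gamma> * pderiv \<beta>)"
      unfolding u_eq by (subst Ae, subst Be, subst Ae, subst Be) (simp add: pderiv_add pderiv_smult algebra_simps smult_diff_right)
    have qu: "?q^(k-1) dvd u" unfolding ug
      by (intro dvd_smult dvd_diff dvd_mult[OF dpow[OF qg]] dvd_mult2[OF le[OF qg]]) simp
    have qu': "?q^(k-2) dvd pderiv u" using dpow[OF qu] by (simp add: numeral_2_eq_2)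
    have w2e: "w2 = \<beta> * \<beta> * P2 - \<gamma> * (2 * \<beta> * D2 d (cl c) X (cv (tz z)) (cv g2) - \<gamma> * D2 d (cl c) X (cv g2) (cv g2))"
      unfolding w2_def taue D_lin P2_def D2_sym[of d "cl c" X "cv g2" "cv (tz z)"] by (simp add: algebra_simps)
    have qw: "?q^(k-1) dvd w2" unfolding w2e
      by (intro dvd_diff dvd_mult[OF q2] dvd_mult2[OF le[OF qg]]) simp
    have dP2: "pderiv P2 = D3 d (cl c) X (cv (tz z)) (cv (tz z)) (cv f)" unfolding P2_def ch_D2 pX by (simp add: D0)
    have ome: "om = \<beta> * \<beta> * pderiv P2 - \<gamma> * (2 * \<beta> * D3 d (cl c) X (cv (tz z)) (cv g2) (cv f) - \<gamma> * D3 d (cl c) X (cv g2) (cv g2) (cv f))"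
      unfolding om_def taue D_lin dP2 D3_sym12[of d "cl c" X "cv g2" "cv (tz z)"] by (simp add: algebra_simps)
    have qo: "?q^(k-2) dvd om"
      unfolding ome using dpow[OF q2] by (intro dvd_diff dvd_mult dvd_mult2[OF le[OF qg]]) (simp_all add: numeral_2_eq_2)
    have sge: "\<exists>Q. sg = \<beta> * \<beta> * \<beta> * P3 - \<gamma> * Q"
      unfolding sg_def taue D_lin P3_def D3_sym12[of d "cl c" X "cv g2" "cv (tz z)"] D3_sym13[of d "cl c" X "cv g2" "cv g2" "cv (tz z)"]
        D3_sym23[of d "cl c" X "cv (tz z)" "cv g2" "cv (tz z)"]
      by (rule exI[of _ "3 * \<beta> * \<beta> * D3 d (cl c) X (cv (tz z)) (cv (tz z)) (cv g2) - 3 * \<beta> * \<gamma> * D3 d (cl c) X (cv (tz z)) (cv g2) (cv g2) + \<gamma> * \<gamma> * D3 d (cl c) X (cv g2) (cv g2) (cv g2)"])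
        (simp add: algebra_simps)
    then obtain Q where sgQ: "sg = \<beta> * \<beta> * \<beta> * P3 - \<gamma> * Q" by blast
    have qs: "?q^(k-2) dvd sg" unfolding sgQ by (intro dvd_diff dvd_mult[OF q3] dvd_mult2[OF le[OF qg]]) simp
    \<comment> \<open>The three factors contribute (k-1) + (k-1) + (k-2) = 3k - 4, which reaches k
      only from k = 2 on; a single line is treated separately.\<close>
    have three: "?q^k dvd x * y * t" if "?q^(k-1) dvd x" "?q^(k-1) dvd y" "?q^(k-2) dvd t" for x y t
    proof -
      have "?q^(k-1) * ?q^(k-1) * ?q^(k-2) dvd x * y * t" by (intro mult_dvd_mono that)
      then have "?q^((k-1)+(k-1)+(k-2)) dvd x * y * t" by (simp only: power_add)
      moreover have "k \<le> (k-1)+(k-1)+(k-2)" using True by simp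
      ultimately show ?thesis by (rule le)
    qed
    have "W = 3 * (w2 * w2 * pderiv u) - 6 * (u * w2 * om) + 4 * (u * u * sg)" unfolding W_def by (simp add: power2_eq_square algebra_simps)
    then show ?thesis unfolding k_def[symmetric]
      by (simp only:) (intro dvd_add dvd_diff dvd_mult[OF three] qu qu' qw qo qs)
  next
    case False
    then consider "k = 0" | "k = 1" by linarith
    then show ?thesis
    proof cases
      case 2
      then obtain \<alpha> where \<alpha>: "S = {\<alpha>}" unfolding k_def by (auto simp: card_1_singleton_iff)
      define v where "v = \<alpha> *s f + tz z"
      define Q where "Q = ev d (cl c) (lin p v)"
      have "Q = 0" by (rule poly_all_zero) (use al[of \<alpha>] \<alpha> in \<open>simp add: Q_def poly_ev p_def v_def\<close>)
      have e1: "pderiv Q = D1 d (cl c) (lin p v) (cv v)" unfolding Q_def ch_ev by simp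
      have e2: "pderiv (pderiv Q) = D2 d (cl c) (lin p v) (cv v) (cv v)" unfolding e1 ch_D1 by (simp add: D0)
      have e3: "pderiv (pderiv (pderiv Q)) = D3 d (cl c) (lin p v) (cv v) (cv v) (cv v)" unfolding e2 ch_D2 by (simp add: D0)
      have "poly (D2 d (cl c) (lin p v) (cv v) (cv v)) 0 = 0" unfolding e2[symmetric] \<open>Q = 0\<close> by (simp add: pderiv_0)
      then have z2: "D2 d c (pz z) v v = 0" by (simp add: poly_D2 p_def)
      have "poly (D3 d (cl c) (lin p v) (cv v) (cv v) (cv v)) 0 = 0" unfolding e3[symmetric] \<open>Q = 0\<close> by (simp add: pderiv_0)
      then have z3: "D3 d c (pz z) v v v = 0" by (simp add: poly_D3 p_def)
      \<comment> \<open>Isotropy of \<alpha> f + tz gives w2 = -2\<alpha>u, which turns W(z) into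
        4u^2 times the third derivative in that direction.\<close>
      have w: "poly w2 z = - 2 * \<alpha> * poly u z"
        using z2 unfolding v_def D_lin D2_pz D2_sym[of d c _ "tz z" f] by (simp add: algebra_simps eq_neg_iff_add_eq_0)
      have s3: "3 * \<alpha>^2 * poly (pderiv u) z + 3 * \<alpha> * poly om z + poly sg z = 0"
      proof -
        have y: "D3 d c (pz z) f (tz z) (tz z) = poly om z" "D3 d c (pz z) (tz z) f (tz z) = poly om z"
          "D3 d c (pz z) f f (tz z) = poly (pderiv u) z" "D3 d c (pz z) f (tz z) f = poly (pderiv u) z"
          using D3_pz[of z] D3_sym12 D3_sym23 D3_sym13 by metis+
        show ?thesis using z3 unfolding v_def D_lin D3_pz y by (simp add: algebra_simps power2_eq_square)
      qed
      have "poly W z = 4 * (poly u z)^2 * (3 * \<alpha>^2 * poly (pderiv u) z + 3 * \<alpha> * poly om z + poly sg z)"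
        unfolding W_def by (simp add: w algebra_simps power2_eq_square)
      then have "poly W z = 0" unfolding s3 by simp
      then show ?thesis using 2 unfolding k_def by (simp add: poly_eq_0_iff_dvd)
    qed (simp add: k_def)
  qed
qed

end

lemma finite_at_most_one: assumes "\<And>x y. x \<in> S \<Longrightarrow> y \<in> S \<Longrightarrow> x = y" shows "finite S"
proof (cases "S = {}")
  case False
  then obtain x where "x \<in> S" by blast
  then have "S \<subseteq> {x}" using assms by blast
  then show ?thesis by (rule finite_subset) simp
qed simp

lemma avoid_finite: assumes "finite (S::'a::alg_closed_field set)" obtains x where "x \<notin> S"
  using infinite_alg_closed assms by (metis ex_new_if_finite)

lemma indep2_shift: "indep2 a b \<Longrightarrow> indep2 b (a + t *s b)"
  unfolding indep2_def
proof (intro allI impI)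
  fix r s assume i: "\<forall>s t. s *s a + t *s b = 0 \<longrightarrow> s = 0 \<and> t = 0" and z: "r *s b + s *s (a + t *s b) = 0"
  have "s *s a + (r + s * t) *s b = 0" using z by (simp add: cart_eq algebra_simps)
  then have "s = 0 \<and> r + s * t = 0" using i by blast
  then show "r = 0 \<and> s = 0" by auto
qed

lemma basis4_shear: "basis4 e f g h \<Longrightarrow> basis4 e f g (h + \<mu> *s g)"
  unfolding basis4_def
proof (elim conjE, intro conjI allI impI)
  assume 1: "\<forall>x. \<exists>a b p q. x = a *s e + b *s f + p *s g + q *s h"
    and 2: "\<forall>a b p q. a *s e + b *s f + p *s g + q *s h = 0 \<longrightarrow> a = 0 \<and> b = 0 \<and> p = 0 \<and> q = 0"
  { fix x
    obtain a b p q where "x = a *s e + b *s f + p *s g + q *s h" using 1 by blast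
    then have "x = a *s e + b *s f + (p - q * \<mu>) *s g + q *s (h + \<mu> *s g)" by (simp add: cart_eq algebra_simps)
    then show "\<exists>a b p q. x = a *s e + b *s f + p *s g + q *s (h + \<mu> *s g)" by blast }
  fix a b p q assume "a *s e + b *s f + p *s g + q *s (h + \<mu> *s g) = 0"
  then have "a *s e + b *s f + (p + q * \<mu>) *s g + q *s h = 0" by (simp add: cart_eq algebra_simps)
  then have "a = 0 \<and> b = 0 \<and> p + q * \<mu> = 0 \<and> q = 0" using 2 by blast
  then show "a = 0" "b = 0" "p = 0" "q = 0" by auto
qed

section \<open>Position of lines on the surface: valence, planes, skew lines\<close>

context surf begin

lemma lsurf_ex: assumes "indep2 e f" "sp e f \<in> lines_in d c" obtains g1 g2 where "lsurf d c e f g1 g2"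
proof -
  obtain g1 g2 where "basis4 e f g1 g2" by (rule basis4_extend[OF assms(1)])
  then have "lsurf d c e f g1 g2" using assms(2) by unfold_locales (auto simp: lines_in_def sp_mem)
  then show ?thesis using that by blast
qed

lemma line_tangent: assumes "L \<in> lines_in d c" "p \<in> L" "v \<in> L" shows "D1 d c p v = 0"
proof -
  have line: "is_line L" using assms by (simp add: lines_in_def)
  have "ev d (cl c) (lin p v) = 0"
    by (rule poly_all_zero) (use assms line_add[OF line] line_scale[OF line] in \<open>auto simp: poly_ev lines_in_def\<close>)
  then have "pderiv (ev d (cl c) (lin p v)) = 0" by (simp add: pderiv_0)
  then have "D1 d (cl c) (lin p v) (cv v) = 0"
    using ev_deriv[OF derivation_pderiv supp4_cl[OF sup], of "lin p v"] by (simp add: pderiv_pCons)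
  then have "poly (D1 d (cl c) (lin p v) (cv v)) 0 = 0" by simp
  then show ?thesis by (simp add: poly_D1)
qed

lemma D2_zero_pt: "D2 d c 0 v w = 0"
proof -
  have "ev (d-2) g 0 = 0" for g :: "'a form4" using ev_scale[of "d-2" g 0 0] d3 by (simp add: power_0_left)
  then show ?thesis unfolding D2_expand by simp
qed

text \<open>Each line meeting L0 contributes one to the order of vanishing of W at the point where
  it meets, and W has degree at most 8d - 14. The basis of L0 has to be adapted so that all these
  points are finite and B is nonzero at each of them.\<close>

theorem valence:
  assumes L0: "L0 \<in> lines_in d c" "\<not> second_kind d c L0" and M: "finite M" "M \<subseteq> lines_in d c - {L0}" "\<And>L. L \<in> M \<Longrightarrow> meets L L0"
  shows "card M \<le> 8 * d - 14"
proof -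
  obtain a b where ab: "indep2 a b" "L0 = sp a b" using L0 by (auto simp: lines_in_def is_line_def)
  have il: "is_line L0" using L0 by (simp add: lines_in_def)
  have lnM: "is_line L" if LM: "L \<in> M" for L using that M by (auto simp: lines_in_def)
  obtain p0 y0 v0 where w: "p0 \<in> L0" "y0 \<in> L0" "D1 d c p0 v0 = 0" "D2 d c p0 v0 v0 = 0" "D2 d c p0 y0 v0 \<noteq> 0" "D3 d c p0 v0 v0 v0 \<noteq> 0"
    using L0(2) unfolding second_kind_def by blast
  have p0: "p0 \<noteq> 0" using w(5) D2_zero_pt by auto
  have two: "x = y" if "a + x *s b \<in> L" "a + y *s b \<in> L" "is_line L" "L \<noteq> L0" for x y L
  proof (rule ccontr)
    assume "x \<noteq> y"
    have "(a + x *s b) - (a + y *s b) = (x - y) *s b" by (simp add: cart_eq algebra_simps)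
    then have "(x - y) *s b \<in> L" using that line_diff by metis
    then have "(1/(x-y)) *s ((x - y) *s b) \<in> L" using line_scale that by blast
    then have bL: "b \<in> L" using \<open>x \<noteq> y\<close> by simp
    then have "(a + x *s b) - x *s b \<in> L" using that line_diff line_scale by blast
    then have "a \<in> L" by simp
    then show False using that line_sp[OF that(3) ab(1)] bL ab(2) by blast
  qed
  \<comment> \<open>Parameters whose points cannot serve as the point at infinity f: those on
    another line, and that of the witness p0 showing that L0 is not of the second kind.\<close>
  define T where "T = (\<Union>L\<in>M. {t. a + t *s b \<in> L}) \<union> {t. \<exists>r. p0 = r *s (a + t *s b)}"
  have "finite T" unfolding T_def
  proof (intro finite_UnI finite_UN_I M(1))
    fix L assume "L \<in> M"
    then show "finite {t. a + t *s b \<in> L}" using two[of _ L] lnM M(2) by (intro finite_at_most_one) blast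
  next
    show "finite {t. \<exists>r. p0 = r *s (a + t *s b)}"
    proof (rule finite_at_most_one)
      fix x y assume "x \<in> {t. \<exists>r. p0 = r *s (a + t *s b)}" "y \<in> {t. \<exists>r. p0 = r *s (a + t *s b)}"
      then obtain r s where rs: "p0 = r *s (a + x *s b)" "p0 = s *s (a + y *s b)" by blast
      have "(r - s) *s a + (r * x - s * y) *s b = p0 - p0" by (subst rs(1), subst rs(2)) (simp add: cart_eq algebra_simps)
      then have "(r - s) *s a + (r * x - s * y) *s b = 0" by simp
      from ab(1)[unfolded indep2_def, rule_format, OF this] have "r - s = 0 \<and> r * x - s * y = 0" .
      moreover have "r \<noteq> 0" using rs(1) p0 by auto
      ultimately show "x = y" by auto
    qed
  qed
  then obtain \<tau> where \<tau>: "\<tau> \<notin> T" using avoid_finite by blast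
  define f where "f = a + \<tau> *s b"
  have ef: "indep2 b f" unfolding f_def by (rule indep2_shift[OF ab(1)])
  have L0ef: "L0 = sp b f" using line_sp[OF il ef] ab(2) unfolding f_def by (simp add: sp_add sp_scale)
  have fM: "f \<notin> L" if LM: "L \<in> M" for L using \<tau> that unfolding T_def f_def by auto
  have fp0: "p0 \<noteq> r *s f" for r using \<tau> unfolding T_def f_def by auto
  obtain g1 g2 where l0: "lsurf d c b f g1 g2" using lsurf_ex[OF ef] L0(1) L0ef by metis
  interpret l0: lsurf d c b f g1 g2 by (rule l0)
  have onp: "\<exists>z r. r \<noteq> 0 \<and> x = r *s (b + z *s f)" if "x \<in> L0" "\<And>r. x \<noteq> r *s f" for x
  proof -
    obtain s t where x: "x = s *s b + t *s f" using \<open>x \<in> L0\<close> unfolding L0ef sp_def by blast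
    have "s \<noteq> 0" using that(2)[of t] x by auto
    then have "x = s *s (b + (t/s) *s f)" unfolding x by (simp add: cart_eq algebra_simps)
    then show ?thesis using \<open>s \<noteq> 0\<close> by blast
  qed
  have zL: "\<exists>z. b + z *s f \<in> L" if LM: "L \<in> M" for L
  proof -
    obtain x where x: "x \<noteq> 0" "x \<in> L" "x \<in> L0" using M(3)[OF LM] by (auto simp: meets_def)
    have "x \<noteq> r *s f" for r
    proof
      assume xr: "x = r *s f"
      then have "r \<noteq> 0" using x by auto
      then have "f = (1/r) *s x" using xr by simp
      then show False using fM[OF LM] line_scale[OF lnM[OF LM] x(2)] by metis
    qed
    then obtain z r where zr: "r \<noteq> 0" "x = r *s (b + z *s f)" using onp[OF x(3)] by blast
    then have "b + z *s f = (1/r) *s x" by simp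
    then show ?thesis using line_scale[OF lnM[OF LM] x(2)] by metis
  qed
  then obtain zf where zf: "\<And>L. L \<in> M \<Longrightarrow> b + zf L *s f \<in> L" by metis
  \<comment> \<open>Adding \<mu> g1 to g2 changes B to B + \<mu> A; the excluded values are those
    that make it vanish at one of the finitely many points.\<close>
  obtain \<mu> where \<mu>: "\<mu> \<notin> (\<lambda>L. - poly l0.B (zf L) / poly l0.A (zf L)) ` M" using avoid_finite[OF finite_imageI[OF M(1)]] by metis
  define h where "h = g2 + \<mu> *s g1"
  have "basis4 b f g1 h" unfolding h_def by (rule basis4_shear[OF l0.bas])
  then interpret l: lsurf d c b f g1 h using l0.on by unfold_locales auto
  have Bz: "poly l.B (zf L) \<noteq> 0" if LM: "L \<in> M" for L
  proof -
    have "poly l.B (zf L) = poly l0.B (zf L) + \<mu> * poly l0.A (zf L)"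
    proof -
      have "poly l.B (zf L) = D1 d c (b + zf L *s f) h" using l.B_val[of "zf L"] by (simp add: l.pz_def)
      also have "\<dots> = D1 d c (b + zf L *s f) g2 + \<mu> * D1 d c (b + zf L *s f) g1" unfolding h_def D_lin ..
      finally show ?thesis using l0.B_val[of "zf L"] l0.A_val[of "zf L"] by (simp add: l0.pz_def)
    qed
    moreover have "poly l0.B (zf L) + \<mu> * poly l0.A (zf L) \<noteq> 0"
    proof (cases "poly l0.A (zf L) = 0")
      case True then show ?thesis using l0.ncr by simp
    next
      case False
      then have "\<mu> \<noteq> - poly l0.B (zf L) / poly l0.A (zf L)" using \<mu> that by auto
      then show ?thesis using False by (simp add: field_simps eq_neg_iff_add_eq_0 add.commute)
    qed
    ultimately show ?thesis by simp
  qed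
  have W: "l.W \<noteq> 0"
  proof -
    obtain z r where zr: "r \<noteq> 0" "p0 = r *s (b + z *s f)" using onp[OF w(1)] fp0 by blast
    have pe: "l.pz z = (1/r) *s p0" using zr by (simp add: l.pz_def)
    have s1: "D1 d c (t *s p) v = t^(d-1) * D1 d c p v" for t p v by (simp add: D1_def ev_scale sum_distrib_left algebra_simps)
    have s2: "D2 d c (t *s p) v w = t^(d-2) * D2 d c p v w" for t p v w by (simp add: D2_expand ev_scale sum_distrib_left algebra_simps)
    have s3: "D3 d c (t *s p) u v w = t^(d-3) * D3 d c p u v w" for t p u v w by (simp add: D3_expand ev_scale sum_distrib_left algebra_simps)
    show ?thesis by (rule l.not_sec_W[of "l.pz z" z y0 v0]) (use w zr L0ef in \<open>simp_all add: pe s1 s2 s3\<close>)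
  qed
  have ex: "\<exists>\<alpha>. L = sp (l.pz (zf L)) (\<alpha> *s f + l.tz (zf L))" if LM: "L \<in> M" for L
  proof -
    let ?p = "l.pz (zf L)"
    have pL: "?p \<in> L" using zf[OF LM] by (simp add: l.pz_def)
    obtain v where v: "indep2 ?p v" "v \<in> L" "L = sp ?p v" using line_complete[OF lnM[OF LM] pL l.pz_nz] by blast
    have "D1 d c ?p v = 0" using line_tangent[OF _ pL v(2)] that M(2) by auto
    then obtain x y q where vx: "v = x *s b + y *s f + q *s l.tz (zf L)" using l.tangent_cases by blast
    have q: "q \<noteq> 0"
    proof
      assume "q = 0"
      then have "v \<in> L0" unfolding L0ef vx by (simp add: sp_mem)
      moreover have "?p \<in> L0" unfolding L0ef by (rule l.pz_in)
      ultimately have "L0 = L" using line_sp[OF il v(1)] v(3) by simp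
      then show False using that M(2) by auto
    qed
    define \<alpha> where "\<alpha> = (y - x * zf L) / q"
    have eq: "\<alpha> *s f + l.tz (zf L) = (1/q) *s v - (x/q) *s ?p"
      unfolding vx \<alpha>_def l.pz_def using q by (simp add: cart_eq field_simps)
    have in1: "\<alpha> *s f + l.tz (zf L) \<in> L" unfolding eq using pL v(2) line_diff line_scale lnM[OF LM] by blast
    have "indep2 ?p (\<alpha> *s f + l.tz (zf L))" unfolding indep2_def
    proof (intro allI impI)
      fix s t assume "s *s ?p + t *s (\<alpha> *s f + l.tz (zf L)) = 0"
      then have "(s - t * (x/q)) *s ?p + (t/q) *s v = 0" unfolding eq by (simp add: cart_eq algebra_simps)
      then have "s - t * (x/q) = 0 \<and> t/q = 0" using v(1) unfolding indep2_def by blast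
      then show "s = 0 \<and> t = 0" using q by auto
    qed
    then show ?thesis using line_sp[OF lnM[OF LM] _ pL in1] by blast
  qed
  then obtain \<alpha> where \<alpha>: "\<And>L. L \<in> M \<Longrightarrow> L = sp (l.pz (zf L)) (\<alpha> L *s f + l.tz (zf L))" by metis
  define S where "S z = \<alpha> ` {L\<in>M. zf L = z}" for z
  have cS: "card (S z) = card {L\<in>M. zf L = z}" for z
  proof -
    have "inj_on \<alpha> {L\<in>M. zf L = z}"
    proof (rule inj_onI)
      fix L L' assume "L \<in> {L\<in>M. zf L = z}" "L' \<in> {L\<in>M. zf L = z}" "\<alpha> L = \<alpha> L'"
      then show "L = L'" using \<alpha>[of L] \<alpha>[of L'] by auto
    qed
    then show ?thesis unfolding S_def by (rule card_image)
  qed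
  have dv: "[:-z,1:]^card (S z) dvd l.W" if z: "z \<in> zf ` M" for z
  proof (rule l.fibre_mult)
    show "poly l.B z \<noteq> 0" using Bz z by auto
    show "finite (S z)" unfolding S_def using M(1) by simp
    fix \<beta> t assume "\<beta> \<in> S z"
    then obtain L where L: "L \<in> M" "zf L = z" "\<beta> = \<alpha> L" unfolding S_def by auto
    have "l.pz z + t *s (\<beta> *s f + l.tz z) \<in> sp (l.pz (zf L)) (\<alpha> L *s f + l.tz (zf L))"
      unfolding L(2) L(3)[symmetric] using sp_mem[of 1 "l.pz z" t] by simp
    then have "l.pz z + t *s (\<beta> *s f + l.tz z) \<in> L" using \<alpha>[OF L(1)] by simp
    then show "ev d c (l.pz z + t *s (\<beta> *s f + l.tz z)) = 0" using L(1) M(2) by (auto simp: lines_in_def)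
  qed
  have "card M = (\<Sum>z\<in>zf ` M. card {L\<in>M. zf L = z})"
    using sum.image_gen[OF M(1), of "\<lambda>_. 1::nat" zf] by simp
  also have "\<dots> = (\<Sum>z\<in>zf ` M. card (S z))" unfolding cS ..
  also have "\<dots> \<le> degree l.W" by (rule sum_mult_le_degree[OF _ W dv]) (use M(1) in auto)
  also have "\<dots> \<le> 8*d-14" by (rule l.W_degree)
  finally show ?thesis .
qed

text \<open>If the plane spanned by the line and g lay on the surface, the constant field g would be
  tangent along the line, against \<open>NLS\<close>.\<close>

lemma no_plane_in:
  assumes "lsurf d c e f g1 g2" "g \<notin> sp e f"
  obtains x y t where "ev d c (x *s e + y *s f + t *s g) \<noteq> 0"
proof (rule ccontr)
  interpret l: lsurf d c e f g1 g2 by fact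
  assume "\<not> thesis"
  then have z: "ev d c (x *s e + y *s f + t *s g) = 0" for x y t using that by blast
  have "D1 d c (l.pz s) (g + s *s 0) = 0" for s
  proof -
    have "ev d (cl c) (lin (l.pz s) g) = 0"
      by (rule poly_all_zero) (use z[of 1 s] in \<open>simp add: poly_ev l.pz_def\<close>)
    then have "pderiv (ev d (cl c) (lin (l.pz s) g)) = 0" by (simp add: pderiv_0)
    then have "D1 d (cl c) (lin (l.pz s) g) (cv g) = 0" unfolding l.ch_ev by simp
    then have "poly (D1 d (cl c) (lin (l.pz s) g) (cv g)) 0 = 0" by simp
    then show ?thesis by (simp add: poly_D1)
  qed
  then have "g \<in> sp e f" using l.NLS(1)[of "{}" g 0] by simp
  then show False using assms by simp
qed

text \<open>A plane section is a curve of degree d. Take k in the plane off the surface; every line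
  of the section avoids k, so it is given by e + l1 k and f + l2 k. A generic line through k then
  meets the lines of the section in distinct points, which are roots of a polynomial of degree
  d.\<close>

lemma plane_bound:
  assumes l: "lsurf d c e f g1 g2" and g: "g \<notin> sp e f"
    and M: "finite M" "M \<subseteq> lines_in d c" "\<And>L x. L \<in> M \<Longrightarrow> x \<in> L \<Longrightarrow> \<exists>r s t. x = r *s e + s *s f + t *s g"
  shows "card M \<le> d"
proof (rule ccontr)
  assume big: "\<not> card M \<le> d"
  interpret l: lsurf d c e f g1 g2 by fact
  obtain x0 y0 t0 where nz: "ev d c (x0 *s e + y0 *s f + t0 *s g) \<noteq> 0" by (rule no_plane_in[OF l g])
  define k where "k = x0 *s e + y0 *s f + t0 *s g"
  have t0: "t0 \<noteq> 0" using nz l.on by auto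
  have lnM: "is_line L" if LM: "L \<in> M" for L using that M by (auto simp: lines_in_def)
  have kL: "r *s k \<notin> L" if "L \<in> M" "r \<noteq> 0" for L r
  proof
    assume "r *s k \<in> L"
    then have "ev d c (r *s k) = 0" using that M by (auto simp: lines_in_def)
    then show False using nz that unfolding k_def[symmetric] by (simp add: ev_scale)
  qed
  have inpl: "\<exists>r s t. x = r *s e + s *s f + t *s k" if lm: "L \<in> M" "x \<in> L" for L x
  proof -
    obtain r s t where x: "x = r *s e + s *s f + t *s g" using M(3)[OF lm] by blast
    have "x = (r - t/t0 * x0) *s e + (s - t/t0 * y0) *s f + (t/t0) *s k" unfolding x k_def using t0 by (simp add: cart_eq field_simps)
    then show ?thesis by blast
  qed
  have ex: "\<exists>l1 l2. e + l1 *s k \<in> L \<and> f + l2 *s k \<in> L" if LM: "L \<in> M" for L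
  proof -
    obtain a b where ab: "indep2 a b" "L = sp a b" using lnM[OF LM] by (auto simp: is_line_def)
    obtain a1 a2 a3 where a: "a = a1 *s e + a2 *s f + a3 *s k" using inpl[OF LM] ab(2) by (metis sp_gen(1))
    obtain b1 b2 b3 where b: "b = b1 *s e + b2 *s f + b3 *s k" using inpl[OF LM] ab(2) by (metis sp_gen(2))
    define D where "D = a1 * b2 - a2 * b1"
    have D: "D \<noteq> 0"
    proof
      assume D0: "D = 0"
      have e1: "b2 *s a + (- a2) *s b = D *s e + (a3 * b2 - a2 * b3) *s k" "b1 *s a + (- a1) *s b = (-D) *s f + (a3 * b1 - a1 * b3) *s k"
        unfolding a b D_def by (simp_all add: cart_eq algebra_simps)
      have "a3 * b2 - a2 * b3 = 0" using kL[OF that, of "a3 * b2 - a2 * b3"] e1(1) D0 sp_mem[of b2 a "-a2" b] ab(2) by auto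
      moreover have "a3 * b1 - a1 * b3 = 0" using kL[OF that, of "a3 * b1 - a1 * b3"] e1(2) D0 sp_mem[of b1 a "-a1" b] ab(2) by auto
      ultimately have "b2 *s a + (- a2) *s b = 0" "b1 *s a + (- a1) *s b = 0" using e1 D0 by auto
      then have "a1 = 0" "a2 = 0" using ab(1) unfolding indep2_def by (metis neg_equal_0_iff_equal)+
      then have "a = a3 *s k" using a by simp
      then show False using kL[OF that, of a3] ab sp_gen(1) indep2_nz(1)[OF ab(1)] by (metis vector_smult_lzero)
    qed
    have "e + ((a3 * b2 - a2 * b3)/D) *s k = (b2/D) *s a + (-a2/D) *s b"
      unfolding a b using D by (simp add: cart_eq field_simps) (simp add: D_def algebra_simps)
    moreover have "f + ((a1 * b3 - a3 * b1)/D) *s k = (-b1/D) *s a + (a1/D) *s b"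
      unfolding a b using D by (simp add: cart_eq field_simps) (simp add: D_def algebra_simps)
    ultimately show ?thesis using sp_mem ab(2) by metis
  qed
  then obtain l1 l2 where ll: "\<And>L. L \<in> M \<Longrightarrow> e + l1 L *s k \<in> L \<and> f + l2 L *s k \<in> L" by metis
  have inj: "L = L'" if "L \<in> M" "L' \<in> M" "l1 L = l1 L'" "l2 L = l2 L'" for L L'
  proof -
    have "indep2 (e + l1 L *s k) (f + l2 L *s k)" unfolding indep2_def
    proof (intro allI impI)
      fix s t assume "s *s (e + l1 L *s k) + t *s (f + l2 L *s k) = 0"
      then have z: "s *s e + t *s f = (-(s * l1 L + t * l2 L)) *s k" by (simp add: cart_eq algebra_simps eq_neg_iff_add_eq_0)
      have "ev d c ((-(s * l1 L + t * l2 L)) *s k) = 0" unfolding z[symmetric] by (rule l.on)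
      then have "(-(s * l1 L + t * l2 L)) ^ d = 0" using nz unfolding k_def[symmetric] ev_scale by (metis mult_eq_0_iff)
      then have "-(s * l1 L + t * l2 L) = 0" by (metis power_eq_0_iff)
      then have "s * l1 L + t * l2 L = 0" by (simp only: neg_equal_0_iff_equal)
      then have "s *s e + t *s f + 0 *s g1 + 0 *s g2 = 0" using z by simp
      then show "s = 0 \<and> t = 0" using l.bas_ind by blast
    qed
    then show ?thesis using line_sp lnM ll that by metis
  qed
  have finb: "finite (\<Union>L\<in>M. \<Union>L'\<in>M - {L}. {y. l1 L + y * l2 L = l1 L' + y * l2 L'})"
  proof (intro finite_UN_I finite_Diff M(1) finite_at_most_one)
    fix L L' x y assume LL: "L \<in> M" "L' \<in> M - {L}" and xy: "x \<in> {y. l1 L + y * l2 L = l1 L' + y * l2 L'}" "y \<in> {y. l1 L + y * l2 L = l1 L' + y * l2 L'}"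
    show "x = y"
    proof (rule ccontr)
      assume ne: "x \<noteq> y"
      have e1: "x * (l2 L - l2 L') = l1 L' - l1 L" "y * (l2 L - l2 L') = l1 L' - l1 L" using xy by (simp_all add: algebra_simps)
      then have "(x - y) * (l2 L - l2 L') = 0" unfolding left_diff_distrib[of x y] by simp
      then have "l2 L = l2 L'" using ne by simp
      then show False using e1 inj[of L L'] LL by auto
    qed
  qed
  \<comment> \<open>Two different pairs (l1, l2) give the same value l1 + y l2 for at most one
    y.\<close>
  then obtain y where y: "y \<notin> (\<Union>L\<in>M. \<Union>L'\<in>M - {L}. {y. l1 L + y * l2 L = l1 L' + y * l2 L'})" using avoid_finite by blast
  define P where "P = ev d (cl c) (lin (e + y *s f) k)"
  have dcP: "dc d P (ev d c k)" unfolding P_def by (rule dc_ev_lin)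
  then have P0: "P \<noteq> 0" using nz unfolding k_def by (auto simp: dc_def)
  have rt: "poly P (l1 L + y * l2 L) = 0" if LM: "L \<in> M" for L
  proof -
    have "e + y *s f + (l1 L + y * l2 L) *s k = (e + l1 L *s k) + y *s (f + l2 L *s k)" by (simp add: cart_eq algebra_simps)
    also have "\<dots> \<in> L" using ll[OF LM] line_add line_scale lnM[OF LM] by blast
    finally have "ev d c (e + y *s f + (l1 L + y * l2 L) *s k) = 0" using that M by (auto simp: lines_in_def)
    then show ?thesis unfolding P_def by (simp add: poly_ev)
  qed
  have "inj_on (\<lambda>L. l1 L + y * l2 L) M" by (rule inj_onI) (use y in blast)
  then have "card M = card ((\<lambda>L. l1 L + y * l2 L) ` M)" by (simp add: card_image)
  also have "\<dots> \<le> card {x. poly P x = 0}" using rt by (intro card_mono poly_roots_finite[OF P0]) auto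
  also have "\<dots> \<le> degree P" by (rule card_poly_roots_bound[OF P0])
  also have "\<dots> \<le> d" using dcP by (simp add: dc_def)
  finally show False using big by simp
qed

text \<open>A third line either meets L1 and L2 in different points and lies in their plane, or
  passes through their common point. In the second case all three lines lie in the tangent plane at
  that point.\<close>

lemma coplanar:
  assumes L1: "L1 \<in> lines_in d c" and L2: "L2 \<in> lines_in d c" and ne: "L1 \<noteq> L2" and m: "meets L1 L2"
  obtains e f g g1 g2 where "lsurf d c e f g1 g2" "g \<notin> sp e f" "L1 = sp e f" "L2 = sp e g"
    "\<And>L3. L3 \<in> lines_in d c \<Longrightarrow> L3 \<noteq> L1 \<Longrightarrow> L3 \<noteq> L2 \<Longrightarrow> meets L3 L1 \<Longrightarrow> meets L3 L2 \<Longrightarrow> (\<forall>x\<in>L3. \<exists>r s t. x = r *s e + s *s f + t *s g)"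
proof -
  have l1: "is_line L1" "is_line L2" using L1 L2 by (auto simp: lines_in_def)
  obtain e where e: "e \<noteq> 0" "e \<in> L1" "e \<in> L2" using m by (auto simp: meets_def)
  obtain f where f: "indep2 e f" "f \<in> L1" "L1 = sp e f" using line_complete[OF l1(1) e(2,1)] by blast
  obtain g where g: "indep2 e g" "g \<in> L2" "L2 = sp e g" using line_complete[OF l1(2) e(3,1)] by blast
  have gn: "g \<notin> sp e f" using line_sp[OF l1(1) g(1)] e f g ne by auto
  obtain g1 g2 where ls: "lsurf d c e f g1 g2" using lsurf_ex[OF f(1)] L1 f(3) by metis
  interpret l: lsurf d c e f g1 g2 by (rule ls)
  have "\<forall>x\<in>L3. \<exists>r s t. x = r *s e + s *s f + t *s g"
    if L3: "L3 \<in> lines_in d c" "L3 \<noteq> L1" "L3 \<noteq> L2" "meets L3 L1" "meets L3 L2" for L3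
  proof -
    have l3: "is_line L3" using L3 by (simp add: lines_in_def)
    obtain x where x: "x \<noteq> 0" "x \<in> L3" "x \<in> L1" using L3(4) by (auto simp: meets_def)
    obtain y where y: "y \<noteq> 0" "y \<in> L3" "y \<in> L2" using L3(5) by (auto simp: meets_def)
    obtain x1 x2 where xe: "x = x1 *s e + x2 *s f" using x(3) f(3) by (auto simp: sp_def)
    obtain y1 y2 where ye: "y = y1 *s e + y2 *s g" using y(3) g(3) by (auto simp: sp_def)
    show ?thesis
    proof (cases "indep2 x y")
      case True
      then have "L3 = sp x y" using line_sp[OF l3] x y by blast
      then show ?thesis
      proof (intro ballI)
        fix z assume "z \<in> L3"
        then obtain s t where "z = s *s x + t *s y" using \<open>L3 = sp x y\<close> by (auto simp: sp_def)
        then have "z = (s * x1 + t * y1) *s e + (s * x2) *s f + (t * y2) *s g" unfolding xe ye by (simp add: cart_eq algebra_simps)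
        then show "\<exists>r s t. z = r *s e + s *s f + t *s g" by blast
      qed
    next
      case False
      then obtain r where r: "y = r *s x" using not_indep2 x(1) by blast
      have yL1: "y \<in> L1" unfolding r using line_scale l1 x by blast
      obtain r' where r': "y = r' *s e" using lines_two_pts[OF l1 ne e(2,3) yL1 y(3) e(1)] by blast
      have "r' \<noteq> 0" using r' y by auto
      then have "e = (1/r') *s y" using r' by simp
      then have eL3: "e \<in> L3" using line_scale[OF l3 y(2)] by metis
      obtain v where v: "indep2 e v" "v \<in> L3" "L3 = sp e v" using line_complete[OF l3 eL3 e(1)] by blast
      have e0: "l.pz 0 = e" by (simp add: l.pz_def)
      have "D1 d c e v = 0" using line_tangent[OF L3(1) eL3 v(2)] .
      then obtain a b q where va: "v = a *s e + b *s f + q *s l.tz 0" using l.tangent_cases[of 0] e0 by metis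
      have "D1 d c e g = 0" using line_tangent[OF L2 e(3) g(2)] .
      then obtain a' b' q' where ga: "g = a' *s e + b' *s f + q' *s l.tz 0" using l.tangent_cases[of 0] e0 by metis
      have q': "q' \<noteq> 0" using ga gn by (auto simp: sp_mem)
      have tzeq: "l.tz 0 = (1/q') *s g - (a'/q') *s e - (b'/q') *s f" unfolding ga using q' by (simp add: cart_eq field_simps)
      have vv: "v = (a - q * a'/q') *s e + (b - q * b'/q') *s f + (q/q') *s g" unfolding va by (subst tzeq) (use q' in \<open>simp add: cart_eq field_simps\<close>)
      show ?thesis
      proof (intro ballI)
        fix z assume "z \<in> L3"
        then obtain s t where "z = s *s e + t *s v" using v(3) by (auto simp: sp_def)
        then have "z = (s + t * (a - q * a'/q')) *s e + (t * (b - q * b'/q')) *s f + (t * (q/q')) *s g" by (subst (asm) vv) (simp add: cart_eq algebra_simps)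
        then show "\<exists>r s t. z = r *s e + s *s f + t *s g" by blast
      qed
    qed
  qed
  then show ?thesis using that[OF ls gn f(3) g(3)] by blast
qed

lemma plane_lines_bound:
  assumes L1: "L1 \<in> lines_in d c" and L2: "L2 \<in> lines_in d c" and ne: "L1 \<noteq> L2" and m: "meets L1 L2"
    and M: "finite M" "M \<subseteq> lines_in d c" "\<And>L. L \<in> M \<Longrightarrow> meets L L1 \<and> meets L L2"
  shows "card (M \<union> {L1, L2}) \<le> d"
proof -
  obtain e f g g1 g2 where c: "lsurf d c e f g1 g2" "g \<notin> sp e f" "L1 = sp e f" "L2 = sp e g"
    "\<And>L3. L3 \<in> lines_in d c \<Longrightarrow> L3 \<noteq> L1 \<Longrightarrow> L3 \<noteq> L2 \<Longrightarrow> meets L3 L1 \<Longrightarrow> meets L3 L2 \<Longrightarrow> (\<forall>x\<in>L3. \<exists>r s t. x = r *s e + s *s f + t *s g)"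
    by (rule coplanar[OF assms(1-4)]) (rule that)
  show ?thesis
  proof (rule plane_bound[OF c(1,2)])
    show "finite (M \<union> {L1, L2})" "M \<union> {L1, L2} \<subseteq> lines_in d c" using M L1 L2 by auto
    fix L x assume L: "L \<in> M \<union> {L1, L2}" and x: "x \<in> L"
    show "\<exists>r s t. x = r *s e + s *s f + t *s g"
    proof (cases "L = L1 \<or> L = L2")
      case True
      then show ?thesis
      proof
        assume "L = L1"
        then obtain s t where "x = s *s e + t *s f" using x c(3) by (auto simp: sp_def)
        then have "x = s *s e + t *s f + 0 *s g" by simp
        then show ?thesis by blast
      next
        assume "L = L2"
        then obtain s t where "x = s *s e + t *s g" using x c(4) by (auto simp: sp_def)
        then have "x = s *s e + 0 *s f + t *s g" by simp
        then show ?thesis by blast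
      qed
    next
      case False
      then show ?thesis using c(5)[of L] M L x by blast
    qed
  qed
qed

lemma pairwise_meeting_bound:
  assumes M: "finite M" "M \<subseteq> lines_in d c" "\<And>L L'. L \<in> M \<Longrightarrow> L' \<in> M \<Longrightarrow> meets L L'"
  shows "card M \<le> d"
proof (cases "card M \<le> 1")
  case False
  then obtain L1 L2 where L: "L1 \<in> M" "L2 \<in> M" "L1 \<noteq> L2" using M(1) by (metis card_le_Suc0_iff_eq One_nat_def)
  have "card (M \<union> {L1,L2}) \<le> d" by (rule plane_lines_bound[of L1 L2 M]) (use L M in auto)
  moreover have "M \<union> {L1,L2} = M" using L by auto
  ultimately show ?thesis by simp
qed (use d3 in simp)

lemma skew_basis: assumes "indep2 a b" "indep2 a' b'" "\<not> meets (sp a b) (sp a' b')" shows "\<And>s t s' t'. s *s a + t *s b = s' *s a' + t' *s b' \<Longrightarrow> s = 0 \<and> t = 0 \<and> s' = 0 \<and> t' = 0"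
proof -
  fix s t s' t' assume eq: "s *s a + t *s b = s' *s a' + t' *s b'"
  have "s *s a + t *s b = 0" using assms(3) sp_mem[of s a t b] sp_mem[of s' a' t' b'] eq unfolding meets_def by metis
  then show "s = 0 \<and> t = 0 \<and> s' = 0 \<and> t' = 0" using assms(1,2) eq unfolding indep2_def by metis
qed

text \<open>Cramer's rule modulo the first line: D is the determinant of a' and b' there, and it is
  nonzero because the lines are skew.\<close>

lemma basis4_of_skew: assumes "indep2 a b" "indep2 a' b'" "\<not> meets (sp a b) (sp a' b')" shows "basis4 a b a' b'"
proof -
  obtain g h where gh: "basis4 a b g h" by (rule basis4_extend[OF assms(1)])
  obtain p1 p2 p3 p4 where p: "a' = p1 *s a + p2 *s b + p3 *s g + p4 *s h" using gh unfolding basis4_def by meson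
  obtain q1 q2 q3 q4 where q: "b' = q1 *s a + q2 *s b + q3 *s g + q4 *s h" using gh unfolding basis4_def by meson
  define D where "D = p3 * q4 - p4 * q3"
  have D: "D \<noteq> 0"
  proof
    assume D0: "D = 0"
    have "(p1 * q4 - q1 * p4) *s a + (p2 * q4 - q2 * p4) *s b = q4 *s a' + (-p4) *s b' - D *s g"
      "(p1 * q3 - q1 * p3) *s a + (p2 * q3 - q2 * p3) *s b = q3 *s a' + (-p3) *s b' + D *s h"
      unfolding p q D_def by (simp_all add: cart_eq algebra_simps)
    then have "q4 = 0 \<and> -p4 = 0" "q3 = 0 \<and> -p3 = 0"
      using skew_basis[OF assms, of "p1 * q4 - q1 * p4" "p2 * q4 - q2 * p4" q4 "-p4"] skew_basis[OF assms, of "p1 * q3 - q1 * p3" "p2 * q3 - q2 * p3" q3 "-p3"] D0 by auto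
    then have "p1 *s a + p2 *s b = 1 *s a' + 0 *s b'" using p by simp
    from skew_basis[OF assms this] show False by simp
  qed
  have g: "g = (q4/D) *s a' + (-p4/D) *s b' - ((p1 * q4 - q1 * p4)/D) *s a - ((p2 * q4 - q2 * p4)/D) *s b"
    unfolding p q using D by (simp add: cart_eq field_simps) (simp add: D_def algebra_simps)
  have h: "h = (-q3/D) *s a' + (p3/D) *s b' + ((p1 * q3 - q1 * p3)/D) *s a + ((p2 * q3 - q2 * p3)/D) *s b"
    unfolding p q using D by (simp add: cart_eq field_simps) (simp add: D_def algebra_simps)
  show ?thesis unfolding basis4_def
  proof (intro conjI allI impI)
    fix x
    obtain r1 r2 r3 r4 where x: "x = r1 *s a + r2 *s b + r3 *s g + r4 *s h" using gh unfolding basis4_def by meson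
    have "x = (r1 - r3 * ((p1 * q4 - q1 * p4)/D) + r4 * ((p1 * q3 - q1 * p3)/D)) *s a
       + (r2 - r3 * ((p2 * q4 - q2 * p4)/D) + r4 * ((p2 * q3 - q2 * p3)/D)) *s b
       + (r3 * (q4/D) + r4 * (-q3/D)) *s a' + (r3 * (-p4/D) + r4 * (p3/D)) *s b'"
      unfolding x by (subst g, subst h) (simp add: cart_eq algebra_simps)
    then show "\<exists>r1 r2 r3 r4. x = r1 *s a + r2 *s b + r3 *s a' + r4 *s b'" by blast
  next
    fix r1 r2 r3 r4 assume "r1 *s a + r2 *s b + r3 *s a' + r4 *s b' = 0"
    then have "r1 *s a + r2 *s b = (-r3) *s a' + (-r4) *s b'" by (simp add: cart_eq algebra_simps eq_neg_iff_add_eq_0)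
    from skew_basis[OF assms this] show "r1 = 0" "r2 = 0" "r3 = 0" "r4 = 0" by auto
  qed
qed

text \<open>On a cubic, contact of order four means containment, so the second asymptotic directions
  along a line of the second kind would sweep out a moving family of lines. Its infinitesimal motion
  is a linear tangent field along one member, and \<open>NLS\<close> forces it into that member,
  which f does not belong to. The cubic is treated apart because the bound d(8d - 14) would give 30
  instead of 27.\<close>

lemma no_sec_cubic: assumes d: "d = 3" and L: "L \<in> lines_in d c" shows "\<not> second_kind d c L"
proof
  assume sec: "second_kind d c L"
  obtain e f where ef: "indep2 e f" "L = sp e f" using L by (auto simp: lines_in_def is_line_def)
  obtain g1 g2 where "lsurf d c e f g1 g2" using lsurf_ex[OF ef(1)] L ef(2) by metis
  then interpret l: lsurf d c e f g1 g2 .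
  have W: "l.W = 0" using l.sec_W sec ef(2) by simp
  have van: "ev d c (l.pz z + t *s l.v2 z) = 0" for z t
  proof -
    define Q where "Q = ev d (cl c) (lin (l.pz z) (l.v2 z))"
    have e1: "pderiv Q = D1 d (cl c) (lin (l.pz z) (l.v2 z)) (cv (l.v2 z))" unfolding Q_def l.ch_ev by simp
    have e2: "pderiv (pderiv Q) = D2 d (cl c) (lin (l.pz z) (l.v2 z)) (cv (l.v2 z)) (cv (l.v2 z))" unfolding e1 l.ch_D1 by (simp add: l.D0)
    have e3: "pderiv (pderiv (pderiv Q)) = D3 d (cl c) (lin (l.pz z) (l.v2 z)) (cv (l.v2 z)) (cv (l.v2 z)) (cv (l.v2 z))" unfolding e2 l.ch_D2 by (simp add: l.D0)
    have c0: "coeff Q 0 = 0" using l.ev_pz[of z] by (simp add: poly_0_coeff_0[symmetric] Q_def poly_ev)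
    have c1: "coeff Q 1 = 0"
    proof -
      have "coeff Q 1 = poly (pderiv Q) 0" by (simp add: poly_0_coeff_0 coeff_pderiv)
      then show ?thesis unfolding e1 by (simp add: poly_D1 l.D1_pz)
    qed
    have "2 * coeff Q 2 = poly (pderiv (pderiv Q)) 0" by (simp add: poly_0_coeff_0 coeff_pderiv numeral_2_eq_2)
    then have c2: "coeff Q 2 = 0" unfolding e2 using two_nz by (simp add: poly_D2 l.D2_pz)
    have "6 * coeff Q 3 = poly (pderiv (pderiv (pderiv Q))) 0" by (simp add: poly_0_coeff_0 coeff_pderiv numeral_3_eq_3)
    then have "6 * coeff Q 3 = 0" unfolding e3 by (simp add: poly_D3 l.D3_pz W)
    moreover have "(6::'a) = 2 * 3" by simp
    ultimately have c3: "coeff Q 3 = 0" using two_nz three_nz by (metis mult_eq_0_iff)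
    have dq: "degree Q \<le> 3" using dc_ev_lin[of d c] d unfolding Q_def dc_def by auto
    have "Q = 0"
    proof (rule poly_eqI)
      fix n :: nat
      consider "n = 0" | "n = 1" | "n = 2" | "n = 3" | "n > 3" by linarith
      then show "coeff Q n = coeff 0 n" using c0 c1 c2 c3 dq coeff_eq_0[of Q n] by cases auto
    qed
    then have "poly Q t = 0" by simp
    then show ?thesis unfolding Q_def by (simp add: poly_ev)
  qed
  obtain z where z: "poly l.u z \<noteq> 0" using exists_nonroot[OF l.u_nz, of "{}"] by blast
  have ind: "indep2 (l.pz z) (l.v2 z)" unfolding indep2_def
  proof (intro allI impI)
    fix s t assume "s *s l.pz z + t *s l.v2 z = 0"
    then have "s *s e + (s * z - t * poly l.w2 z) *s f + (t * (2 * poly l.u z) * poly l.B z) *s g1 + (- (t * (2 * poly l.u z) * poly l.A z)) *s g2 = 0"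
      unfolding l.pz_def l.v2_def l.tz_def by (simp add: cart_eq algebra_simps)
    from l.bas_ind[OF this] have "s = 0" "t * (2 * poly l.u z) * poly l.B z = 0" "t * (2 * poly l.u z) * poly l.A z = 0" by auto
    then show "s = 0 \<and> t = 0" using z two_nz l.ncr[of z] by auto
  qed
  have on2: "ev d c (s *s l.pz z + t *s l.v2 z) = 0" for s t
  proof -
    have e0: "ev d (cl c) (lin (l.pz z) (l.v2 z)) = 0" by (rule poly_all_zero) (simp add: poly_ev van)
    show ?thesis
    proof (cases "s = 0")
      case True
      have "ev d c (l.v2 z) = 0" using dc_ev_lin[of d c "l.pz z" "l.v2 z"] e0 by (simp add: dc_def)
      then show ?thesis using True by (simp add: ev_scale)
    next
      case False
      then have "s *s l.pz z + t *s l.v2 z = s *s (l.pz z + (t/s) *s l.v2 z)" by (simp add: cart_eq algebra_simps)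
      then show ?thesis using van by (simp add: ev_scale)
    qed
  qed
  obtain h1 h2 where "basis4 (l.pz z) (l.v2 z) h1 h2" by (rule basis4_extend[OF ind])
  then interpret m: lsurf d c "l.pz z" "l.v2 z" h1 h2 using on2 by unfold_locales auto
  \<comment> \<open>Differentiating pz + t v2 with respect to z at fixed t gives the field f + t
    y1.\<close>
  define y1 where "y1 = mapv (\<lambda>p. poly p z) (mapv pderiv l.V2)"
  have "D1 d c (m.pz t) (f + t *s y1) = 0" for t
  proof -
    have "ev d (cl c) (l.X + [:t:] *s l.V2) = 0" by (rule poly_all_zero) (simp add: poly_ev l.mX l.mV2 van)
    then have "pderiv (ev d (cl c) (l.X + [:t:] *s l.V2)) = 0" by (simp add: pderiv_0)
    then have "D1 d (cl c) (l.X + [:t:] *s l.V2) (mapv pderiv (l.X + [:t:] *s l.V2)) = 0" unfolding l.ch_ev .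
    moreover have "mapv pderiv (l.X + [:t:] *s l.V2) = cv f + [:t:] *s mapv pderiv l.V2"
      using l.pX by (simp add: cart_eq pderiv_add pderiv_smult)
    ultimately have "poly (D1 d (cl c) (l.X + [:t:] *s l.V2) (cv f + [:t:] *s mapv pderiv l.V2)) z = 0" by simp
    then show ?thesis unfolding poly_D1 by (simp add: l.mX l.mV2 m.pz_def y1_def)
  qed
  then have "f \<in> sp (l.pz z) (l.v2 z)" using m.NLS(1)[of "{}" f y1] by simp
  then obtain s t where "f = s *s l.pz z + t *s l.v2 z" by (auto simp: sp_def)
  then have "s *s e + (s * z - t * poly l.w2 z - 1) *s f + (t * (2 * poly l.u z) * poly l.B z) *s g1 + (- (t * (2 * poly l.u z) * poly l.A z)) *s g2 = 0"
    unfolding l.pz_def l.v2_def l.tz_def by (simp add: cart_eq algebra_simps)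
  from l.bas_ind[OF this] have "s = 0" "s * z - t * poly l.w2 z - 1 = 0" "t * (2 * poly l.u z) * poly l.B z = 0" "t * (2 * poly l.u z) * poly l.A z = 0" by auto
  then show False using z two_nz l.ncr[of z] by auto
qed

text \<open>The common transversals form one ruling of the quadric through the three lines: m3 is
  the graph of an isomorphism from m1 to m2, and each transversal joins corresponding points. A line
  of the opposite ruling not contained in the surface meets it in at most d points, each on one
  transversal; the extra 1 is the transversal at the infinite parameter.\<close>

lemma three_skew:
  assumes m: "m1 \<in> lines_in d c" "m2 \<in> lines_in d c" "m3 \<in> lines_in d c" "\<not> meets m1 m2" "\<not> meets m1 m3" "\<not> meets m2 m3"
    and M: "finite M" "M \<subseteq> lines_in d c" "\<And>L. L \<in> M \<Longrightarrow> meets L m1 \<and> meets L m2 \<and> meets L m3"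
  shows "card M \<le> d + 1"
proof -
  have il: "is_line m1" "is_line m2" "is_line m3" using m by (auto simp: lines_in_def)
  obtain a b where ab: "indep2 a b" "m1 = sp a b" using il by (auto simp: is_line_def)
  obtain a' b' where ab': "indep2 a' b'" "m2 = sp a' b'" using il by (auto simp: is_line_def)
  obtain x y where xy: "indep2 x y" "m3 = sp x y" using il by (auto simp: is_line_def)
  have bas: "basis4 a b a' b'" by (rule basis4_of_skew) (use ab ab' m in auto)
  have dec: "\<exists>v1\<in>m1. \<exists>v2\<in>m2. v = v1 + v2" for v
  proof -
    obtain p q r s where "v = p *s a + q *s b + r *s a' + s *s b'" using bas unfolding basis4_def by meson
    then have "v = (p *s a + q *s b) + (r *s a' + s *s b')" by (simp add: add.assoc)
    then show ?thesis using ab ab' sp_mem by blast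
  qed
  obtain x1 x2 where x: "x1 \<in> m1" "x2 \<in> m2" "x = x1 + x2" using dec by blast
  obtain y1 y2 where y: "y1 \<in> m1" "y2 \<in> m2" "y = y1 + y2" using dec by blast
  have skew: "v = 0 \<and> w = 0" if "v \<in> m1" "w \<in> m2" "v = w" for v w using that m(4) unfolding meets_def by metis
  have i1: "indep2 x1 y1" unfolding indep2_def
  proof (intro allI impI)
    fix s t assume z: "s *s x1 + t *s y1 = 0"
    have "s *s x + t *s y = (s *s x1 + t *s y1) + (s *s x2 + t *s y2)" unfolding x y by (simp add: cart_eq algebra_simps)
    then have "s *s x + t *s y \<in> m2" using z line_add[OF il(2) line_scale[OF il(2) x(2)] line_scale[OF il(2) y(2)], of s t] by simp
    moreover have "s *s x + t *s y \<in> m3" using xy sp_mem by blast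
    ultimately have "s *s x + t *s y = 0" using m(6) unfolding meets_def by blast
    then show "s = 0 \<and> t = 0" using xy(1) unfolding indep2_def by blast
  qed
  have i2: "indep2 x2 y2" unfolding indep2_def
  proof (intro allI impI)
    fix s t assume z: "s *s x2 + t *s y2 = 0"
    have "s *s x + t *s y = (s *s x1 + t *s y1) + (s *s x2 + t *s y2)" unfolding x y by (simp add: cart_eq algebra_simps)
    then have "s *s x + t *s y \<in> m1" using z line_add[OF il(1) line_scale[OF il(1) x(1)] line_scale[OF il(1) y(1)], of s t] by simp
    moreover have "s *s x + t *s y \<in> m3" using xy sp_mem by blast
    ultimately have "s *s x + t *s y = 0" using m(5) unfolding meets_def by blast
    then show "s = 0 \<and> t = 0" using xy(1) unfolding indep2_def by blast
  qed
  have m1e: "m1 = sp x1 y1" using line_sp[OF il(1) i1] x y by blast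
  have lnM: "is_line L" if LM: "L \<in> M" for L using that M by (auto simp: lines_in_def)
  have ex: "\<exists>s r. (s \<noteq> 0 \<or> r \<noteq> 0) \<and> L = sp (s *s x1 + r *s y1) (s *s x2 + r *s y2)" if LM: "L \<in> M" for L
  proof -
    obtain p where p: "p \<noteq> 0" "p \<in> L" "p \<in> m1" using M(3)[OF LM] by (auto simp: meets_def)
    obtain q where q: "q \<noteq> 0" "q \<in> L" "q \<in> m2" using M(3)[OF LM] by (auto simp: meets_def)
    obtain o' where o: "o' \<noteq> 0" "o' \<in> L" "o' \<in> m3" using M(3)[OF LM] by (auto simp: meets_def)
    have ipq: "indep2 p q"
    proof (rule ccontr)
      assume "\<not> indep2 p q"
      then obtain r where "q = r *s p" using not_indep2 p(1) by blast
      then have "q \<in> m1" using p line_scale il by metis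
      then show False using q m(4) unfolding meets_def by blast
    qed
    have Lpq: "L = sp p q" using line_sp[OF lnM[OF LM] ipq] p q by blast
    obtain k1 k2 where k: "o' = k1 *s p + k2 *s q" using o(2) Lpq by (auto simp: sp_def)
    obtain s r where sr: "o' = s *s x + r *s y" using o(3) xy(2) by (auto simp: sp_def)
    have sr2: "o' = (s *s x1 + r *s y1) + (s *s x2 + r *s y2)" unfolding sr x y by (simp add: cart_eq algebra_simps)
    have "k1 *s p - (s *s x1 + r *s y1) = (s *s x2 + r *s y2) - k2 *s q" using k sr2 by (simp add: algebra_simps)
    moreover have "k1 *s p - (s *s x1 + r *s y1) \<in> m1" by (rule line_diff[OF il(1) line_scale[OF il(1) p(3)] line_add[OF il(1) line_scale[OF il(1) x(1)] line_scale[OF il(1) y(1)]]])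
    moreover have "(s *s x2 + r *s y2) - k2 *s q \<in> m2" by (rule line_diff[OF il(2) line_add[OF il(2) line_scale[OF il(2) x(2)] line_scale[OF il(2) y(2)]] line_scale[OF il(2) q(3)]])
    ultimately have e: "k1 *s p = s *s x1 + r *s y1" "k2 *s q = s *s x2 + r *s y2" using skew by fastforce+
    have nz: "s \<noteq> 0 \<or> r \<noteq> 0" using sr o(1) by auto
    have ind: "indep2 (s *s x1 + r *s y1) (s *s x2 + r *s y2)" unfolding indep2_def
    proof (intro allI impI)
      fix \<alpha> \<beta> assume z: "\<alpha> *s (s *s x1 + r *s y1) + \<beta> *s (s *s x2 + r *s y2) = 0"
      then have zz: "\<alpha> *s (s *s x1 + r *s y1) = (- \<beta>) *s (s *s x2 + r *s y2)" by (simp add: cart_eq eq_neg_iff_add_eq_0)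
      have "\<alpha> *s (s *s x1 + r *s y1) \<in> m1" "(-\<beta>) *s (s *s x2 + r *s y2) \<in> m2"
        using line_scale[OF il(1) line_add[OF il(1) line_scale[OF il(1) x(1)] line_scale[OF il(1) y(1)]]]
          line_scale[OF il(2) line_add[OF il(2) line_scale[OF il(2) x(2)] line_scale[OF il(2) y(2)]]] by blast+
      then have "\<alpha> *s (s *s x1 + r *s y1) = 0" "(-\<beta>) *s (s *s x2 + r *s y2) = 0" using skew zz by blast+
      then have "(\<alpha> * s) *s x1 + (\<alpha> * r) *s y1 = 0" "(-\<beta> * s) *s x2 + (-\<beta> * r) *s y2 = 0" by (simp_all add: cart_eq algebra_simps)
      then have "\<alpha> * s = 0 \<and> \<alpha> * r = 0" "-\<beta> * s = 0 \<and> -\<beta> * r = 0" using i1 i2 unfolding indep2_def by blast+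
      then show "\<alpha> = 0 \<and> \<beta> = 0" using nz by auto
    qed
    have "s *s x1 + r *s y1 \<in> L" "s *s x2 + r *s y2 \<in> L" unfolding e[symmetric] using p q lnM[OF LM] line_scale by auto
    then show ?thesis using line_sp[OF lnM[OF LM] ind] nz by blast
  qed
  then obtain sf rf where sf: "\<And>L. L \<in> M \<Longrightarrow> (sf L \<noteq> 0 \<or> rf L \<noteq> 0) \<and> L = sp (sf L *s x1 + rf L *s y1) (sf L *s x2 + rf L *s y2)" by metis
  have scl: "sp (k *s v) (k *s w) = sp v w" if "k \<noteq> 0" for k and v w :: "'a^4"
  proof
    show "sp (k *s v) (k *s w) \<subseteq> sp v w" by (rule sp_sub) (simp_all add: sp_scale)
    have "v = (1/k) *s (k *s v)" "w = (1/k) *s (k *s w)" using that by simp_all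
    then show "sp v w \<subseteq> sp (k *s v) (k *s w)" using sp_sub sp_scale sp_gen(1,2) by metis
  qed
  define zf where "zf L = rf L / sf L" for L
  have Lz: "L = sp (x1 + zf L *s y1) (x2 + zf L *s y2)" if "L \<in> M" "sf L \<noteq> 0" for L
  proof -
    have "sf L *s x1 + rf L *s y1 = sf L *s (x1 + zf L *s y1)" "sf L *s x2 + rf L *s y2 = sf L *s (x2 + zf L *s y2)"
      using that by (simp_all add: cart_eq zf_def algebra_simps)
    then show ?thesis using sf[OF that(1)] scl[OF that(2)] by metis
  qed
  have L0: "L = sp y1 y2" if "L \<in> M" "sf L = 0" for L
    using sf[OF that(1)] scl[of "rf L" y1 y2] that(2) by simp
  have fin1: "card {L\<in>M. sf L = 0} \<le> 1"
    using L0 M(1) by (subst card_le_Suc0_iff_eq[unfolded One_nat_def[symmetric]]) auto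
  obtain g1 g2 where "lsurf d c x1 y1 g1 g2" using lsurf_ex[OF i1] m(1) m1e by metis
  then interpret l: lsurf d c x1 y1 g1 g2 .
  \<comment> \<open>If every line of the opposite ruling lay on the surface, m1 would move in it
    along the field x2 + z y2, against \<open>NLS\<close>.\<close>
  obtain t where t: "ev d (cl c) (lin (x1 + t *s x2) (y1 + t *s y2)) \<noteq> 0"
  proof (rule ccontr)
    assume "\<not> thesis"
    then have "ev d (cl c) (lin (x1 + t *s x2) (y1 + t *s y2)) = 0" for t using that by blast
    then have "poly (ev d (cl c) (lin (x1 + t *s x2) (y1 + t *s y2))) z = 0" for t z by simp
    then have v: "ev d c ((x1 + t *s x2) + z *s (y1 + t *s y2)) = 0" for t z by (simp add: poly_ev)
    have "D1 d c (l.pz z) (x2 + z *s y2) = 0" for z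
    proof -
      have "ev d (cl c) (lin (l.pz z) (x2 + z *s y2)) = 0"
      proof (rule poly_all_zero)
        fix t
        have "l.pz z + t *s (x2 + z *s y2) = (x1 + t *s x2) + z *s (y1 + t *s y2)" by (simp add: l.pz_def cart_eq algebra_simps)
        then show "poly (ev d (cl c) (lin (l.pz z) (x2 + z *s y2))) t = 0" using v by (simp add: poly_ev)
      qed
      then have "pderiv (ev d (cl c) (lin (l.pz z) (x2 + z *s y2))) = 0" by (simp add: pderiv_0)
      then have "poly (D1 d (cl c) (lin (l.pz z) (x2 + z *s y2)) (cv (x2 + z *s y2))) 0 = 0" unfolding l.ch_ev by simp
      then show ?thesis unfolding poly_D1 by simp
    qed
    then have "x2 \<in> sp x1 y1" using l.NLS(1)[of "{}" x2 y2] by simp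
    then have "x2 = 0" using skew[of x2 x2] x m1e by simp
    then show False using indep2_nz[OF i2] by simp
  qed
  define P where "P = ev d (cl c) (lin (x1 + t *s x2) (y1 + t *s y2))"
  let ?N = "{L\<in>M. sf L \<noteq> 0}"
  have P0: "P \<noteq> 0" using t P_def by simp
  have inj: "inj_on zf ?N"
  proof (rule inj_onI)
    fix L L' assume "L \<in> ?N" "L' \<in> ?N" "zf L = zf L'"
    then show "L = L'" using Lz[of L] Lz[of L'] by simp
  qed
  have sub: "zf ` ?N \<subseteq> {z. poly P z = 0}"
  proof (clarify)
    fix L assume L: "L \<in> M" "sf L \<noteq> 0"
    have "(x1 + t *s x2) + zf L *s (y1 + t *s y2) = 1 *s (x1 + zf L *s y1) + t *s (x2 + zf L *s y2)" by (simp add: cart_eq algebra_simps)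
    also have "\<dots> \<in> sp (x1 + zf L *s y1) (x2 + zf L *s y2)" by (rule sp_mem)
    also have "\<dots> = L" using Lz[OF L] by simp
    finally show "poly P (zf L) = 0" unfolding P_def using M(2) L by (auto simp: poly_ev lines_in_def)
  qed
  have "card ?N \<le> card {z. poly P z = 0}" using card_mono[OF poly_roots_finite[OF P0] sub] unfolding card_image[OF inj] .
  also have "\<dots> \<le> degree P" by (rule card_poly_roots_bound[OF P0])
  also have "\<dots> \<le> d" using dc_ev_lin unfolding P_def dc_def by blast
  finally have "card ?N \<le> d" .
  moreover have "M = ?N \<union> {L\<in>M. sf L = 0}" by auto
  ultimately show ?thesis using fin1 card_Un_le[of ?N "{L\<in>M. sf L = 0}"] by simp
qed

end

section \<open>Irreducibility and plane sections\<close>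

definition v4 :: "'a \<Rightarrow> 'a \<Rightarrow> 'a \<Rightarrow> 'a \<Rightarrow> 'a^4" where
  "v4 x1 x2 x3 x4 = (\<chi> i. if i = 1 then x1 else if i = 2 then x2 else if i = 3 then x3 else x4)"
lemma v4_nth [simp]: "v4 x1 x2 x3 x4 $ 1 = x1" "v4 x1 x2 x3 x4 $ 2 = x2" "v4 x1 x2 x3 x4 $ 3 = x3" "v4 x1 x2 x3 x4 $ 4 = x4"
  by (simp_all add: v4_def)
lemma v4_eqI: "x$1 = y$1 \<Longrightarrow> x$2 = y$2 \<Longrightarrow> x$3 = y$3 \<Longrightarrow> x$4 = y$4 \<Longrightarrow> x = (y::'a^4)"
  unfolding cart_eq forall_4 by simp
lemma v4_eta: "v4 (x$1) (x$2) (x$3) (x$4) = x" by (rule v4_eqI) simp_all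

text \<open>Polynomial on every affine line: a substitute for multivariate polynomials in generic choices.\<close>
definition pline :: "('a::field^'n \<Rightarrow> 'a) \<Rightarrow> bool" where
  "pline f \<longleftrightarrow> (\<forall>v w. \<exists>P. \<forall>t. f (v + t *s w) = poly P t)"

text \<open>Adding one function at a time: on the line joining a point good for the old functions to
  a point good for the new one, all functions restrict to nonzero polynomials, and finitely many
  parameters are bad.\<close>

lemma generic_point:
  fixes Fs :: "('a::alg_closed_field^'n \<Rightarrow> 'a) set"
  assumes "finite Fs" "\<And>f. f \<in> Fs \<Longrightarrow> pline f" "\<And>f. f \<in> Fs \<Longrightarrow> \<exists>v. f v \<noteq> 0"
  shows "\<exists>v. \<forall>f\<in>Fs. f v \<noteq> 0"
  using assms
proof (induction Fs rule: finite_induct)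
  case (insert f Fs)
  then obtain v where v: "\<forall>g\<in>Fs. g v \<noteq> 0" by auto
  obtain w where w: "f w \<noteq> 0" using insert.prems(2)[of f] by auto
  have "\<exists>P. \<forall>t. g (v + t *s (w - v)) = poly P t" if "g \<in> insert f Fs" for g using insert.prems(1)[OF that] unfolding pline_def by blast
  then obtain P where P: "\<And>g t. g \<in> insert f Fs \<Longrightarrow> g (v + t *s (w - v)) = poly (P g) t" by metis
  have nz: "P g \<noteq> 0" if "g \<in> insert f Fs" for g
  proof (cases "g = f")
    case True
    have "v + 1 *s (w - v) = w" by simp
    then show ?thesis using P[of f 1] w True by auto
  next
    case False
    then have "g v \<noteq> 0" using v that by auto
    moreover have "v + 0 *s (w - v) = v" by simp
    ultimately show ?thesis using P[OF that, of 0] by auto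
  qed
  have "finite (\<Union>g\<in>insert f Fs. {t. poly (P g) t = 0})" using insert.hyps poly_roots_finite[OF nz] by auto
  then obtain t where t: "t \<notin> (\<Union>g\<in>insert f Fs. {t. poly (P g) t = 0})" using avoid_finite by blast
  then have "\<forall>g\<in>insert f Fs. g (v + t *s (w - v)) \<noteq> 0" using P by auto
  then show ?case by blast
qed auto

lemma chom: assumes "comm_ring_hom h"
  shows "h (x * y) = h x * h y" "h (x + y) = h x + h y" "h (x - y) = h x - h y" "h 1 = 1" "h 0 = 0"
proof -
  interpret h: comm_ring_hom h by fact
  show "h (x * y) = h x * h y" "h (x + y) = h x + h y" "h (x - y) = h x - h y" "h 1 = 1" "h 0 = 0"
    by (simp_all add: h.hom_mult h.hom_add h.hom_minus)
qed

lemma map_poly_pCons0: "h 0 = 0 \<Longrightarrow> map_poly h (pCons a p) = pCons (h a) (map_poly h p)"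
  by (rule poly_eqI) (auto simp: coeff_map_poly coeff_pCons split: nat.splits)
lemma ep_const: assumes "h 0 = 0" shows "poly (map_poly h [:r:]) a = h r"
  using map_poly_pCons0[of h r 0] assms by simp
lemma ep_var: fixes a :: "'b::comm_ring_1" assumes "h 0 = 0" "h 1 = 1" shows "poly (map_poly h [:0,1:]) a = a"
  using map_poly_pCons0[of h 0 "[:1:]"] map_poly_pCons0[of h 1 0] assms by simp

lemma eval_hom: assumes "comm_ring_hom h" shows "comm_ring_hom (\<lambda>P. poly (map_poly h P) a)"
proof -
  interpret h: comm_ring_hom h by fact
  interpret m: map_poly_comm_ring_hom h ..
  show ?thesis by unfold_locales (auto simp: m.hom_add m.hom_mult)
qed

lemma eval_comp: assumes "comm_ring_hom h" "comm_ring_hom g"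
  shows "h (poly (map_poly g P) a) = poly (map_poly (\<lambda>x. h (g x)) P) (h a)"
proof -
  interpret h: comm_ring_hom h by fact
  interpret g: comm_ring_hom g by fact
  show ?thesis by (induction P) (auto simp: map_poly_pCons0 h.hom_add h.hom_mult)
qed

text \<open>Evaluation of a polynomial in three variables at elements of an algebra over the
  coefficients. With values in K, K[s] or K[s][t] it restricts to points, lines and planes.\<close>

definition e3 :: "('a::comm_ring_1 \<Rightarrow> 'b::comm_ring_1) \<Rightarrow> 'b \<Rightarrow> 'b \<Rightarrow> 'b \<Rightarrow> 'a poly poly poly \<Rightarrow> 'b" where
  "e3 \<kappa> a b c P = poly (map_poly (\<lambda>Q. poly (map_poly (\<lambda>q. poly (map_poly \<kappa> q) a) Q) b) P) c"

lemma e3_hom: assumes "comm_ring_hom \<kappa>" shows "comm_ring_hom (e3 \<kappa> a b c)"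
  unfolding e3_def by (intro eval_hom assms)

lemma e3_comp: assumes "comm_ring_hom h" "comm_ring_hom \<kappa>" shows "h (e3 \<kappa> a b c P) = e3 (\<lambda>x. h (\<kappa> x)) (h a) (h b) (h c) P"
proof -
  have 1: "comm_ring_hom (\<lambda>q. poly (map_poly \<kappa> q) a)" by (intro eval_hom assms)
  have 2: "comm_ring_hom (\<lambda>Q. poly (map_poly (\<lambda>q. poly (map_poly \<kappa> q) a) Q) b)" by (intro eval_hom assms)
  show ?thesis unfolding e3_def eval_comp[OF assms(1) 2] eval_comp[OF assms(1) 1] eval_comp[OF assms] ..
qed

definition E :: "'a::comm_ring_1 \<Rightarrow> 'a \<Rightarrow> 'a \<Rightarrow> 'a poly poly poly \<Rightarrow> 'a" where
  "E x y z P = poly (poly (poly P [:[:z:]:]) [:y:]) x"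

lemma E_e3: "E x y z = e3 (\<lambda>a. a) x y z"
proof
  fix P
  have 1: "poly (map_poly (\<lambda>q. poly q x) Q) y = poly (poly Q [:y:]) x" for Q :: "'a poly poly"
    using poly_map_eval[of x Q "[:y:]"] by simp
  have h: "comm_ring_hom (\<lambda>Q::'a poly poly. poly (poly Q [:y:]) x)"
    by unfold_locales auto
  have "e3 (\<lambda>a. a) x y z P = poly (map_poly (\<lambda>Q. poly (poly Q [:y:]) x) P) z"
    unfolding e3_def by (simp add: map_poly_idI 1)
  also have "\<dots> = poly (poly (poly P [:[:z:]:]) [:y:]) x"
    by (induction P) (auto simp: map_poly_pCons0)
  finally show "E x y z P = e3 (\<lambda>a. a) x y z P" by (simp add: E_def)
qed

abbreviation c3 :: "'a::comm_ring_1 form4 \<Rightarrow> 'a poly poly poly form4" where "c3 c \<equiv> (\<lambda>m. [:[:[:c m:]:]:])"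
text \<open>The affine equation on x1 = 1, in K[x2][x3][x4].\<close>
definition Ft :: "nat \<Rightarrow> 'a::comm_ring_1 form4 \<Rightarrow> 'a poly poly poly" where
  "Ft d c = ev d (c3 c) (v4 1 [:[:[:0,1:]:]:] [:[:0,1:]:] [:0,1:])"

lemma e3_Ft: assumes "comm_ring_hom \<kappa>" shows "e3 \<kappa> a b g (Ft d c) = ev d (\<lambda>m. \<kappa> (c m)) (v4 1 a b g)"
proof -
  interpret k: comm_ring_hom \<kappa> by fact
  let ?h1 = "\<lambda>q. poly (map_poly \<kappa> q) a" let ?h2 = "\<lambda>Q. poly (map_poly ?h1 Q) b"
  have h1: "comm_ring_hom ?h1" by (intro eval_hom assms)
  have h2: "comm_ring_hom ?h2" by (intro eval_hom assms)
  note z = chom(4,5)[OF assms] chom(4,5)[OF h1] chom(4,5)[OF h2]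
  have s: "e3 \<kappa> a b g [:[:[:r:]:]:] = \<kappa> r" "e3 \<kappa> a b g 1 = 1" "e3 \<kappa> a b g [:[:[:0,1:]:]:] = a" "e3 \<kappa> a b g [:[:0,1:]:] = b" "e3 \<kappa> a b g [:0,1:] = g" for r
    using chom(4)[OF e3_hom[OF assms], of a b g] unfolding e3_def
    by (simp_all only: ep_const[of ?h2, OF z(6)] ep_const[of ?h1, OF z(4)] ep_const[of \<kappa>, OF z(2)]
       ep_var[of ?h2, OF z(6,5)] ep_var[of ?h1, OF z(4,3)] ep_var[of \<kappa>, OF z(2,1)])
  have "mapv (e3 \<kappa> a b g) (v4 1 [:[:[:0,1:]:]:] [:[:0,1:]:] [:0,1:]) = v4 1 a b g"
    by (rule v4_eqI) (simp_all only: mapv_nth v4_nth s)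
  then show ?thesis unfolding Ft_def comm_ring_hom.ev_hom[OF e3_hom[OF assms]] s by simp
qed

lemma id_hom: "comm_ring_hom (\<lambda>a::'a::comm_ring_1. a)" by unfold_locales auto
lemma E_Ft: "E x y z (Ft d c) = ev d c (v4 1 x y z)" unfolding E_e3 e3_Ft[OF id_hom] ..

lemma E_hom: "comm_ring_hom (E (x::'a::comm_ring_1) y z)" unfolding E_e3 by (rule e3_hom[OF id_hom])

lemma infinite_roots_zero: fixes P :: "'b::idom poly" and h :: "'a::alg_closed_field \<Rightarrow> 'b"
  assumes "inj h" "\<And>x. poly P (h x) = 0" shows "P = 0"
proof (rule ccontr)
  assume "P \<noteq> 0"
  then have "finite {y. poly P y = 0}" by (rule poly_roots_finite)
  moreover have "range h \<subseteq> {y. poly P y = 0}" using assms(2) by auto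
  ultimately have "finite (range h)" using finite_subset by blast
  then show False using assms(1) infinite_alg_closed by (metis finite_imageD)
qed

lemma E_all_zero: fixes P :: "'a::alg_closed_field poly poly poly" assumes "\<And>x y z. E x y z P = 0" shows "P = 0"
proof (rule infinite_roots_zero[where h="\<lambda>z. [:[:z:]:]"])
  fix z
  show "poly P [:[:z:]:] = 0"
  proof (rule infinite_roots_zero[where h="\<lambda>y. [:y:]"])
    fix y
    show "poly (poly P [:[:z:]:]) [:y:] = 0" by (rule poly_all_zero) (use assms in \<open>simp add: E_def\<close>)
  qed (auto simp: inj_def)
qed (auto simp: inj_def)

text \<open>Elimination of the last variable. An element m of least degree in the ideal (f,g)
  divides f and g up to constants by pseudo-division. As f is prime and does not divide g, either m
  is itself constant or f is.\<close>

lemma elim_last: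
  fixes f g :: "'b::idom poly"
  assumes p: "prime_elem f" and nd: "\<not> f dvd g"
  obtains a b r where "r \<noteq> 0" "[:r:] = a * f + b * g"
proof -
  have f0: "f \<noteq> 0" using p by (simp add: prime_elem_def)
  define I where "I = {a * f + b * g | a b. True}"
  have "f = 1 * f + 0 * g" by simp
  then have "f \<in> I" unfolding I_def by blast
  then obtain m where m: "m \<in> I" "m \<noteq> 0" and least: "\<And>h. h \<in> I \<Longrightarrow> h \<noteq> 0 \<Longrightarrow> degree m \<le> degree h"
    using f0 ex_has_least_nat[of "\<lambda>h. h \<in> I \<and> h \<noteq> 0" f degree] by blast
  have Iadd: "h * k + h' * k' \<in> I" if "h \<in> I" "h' \<in> I" for h h' k k'
  proof -
    obtain a b a' b' where "h = a * f + b * g" "h' = a' * f + b' * g" using \<open>h \<in> I\<close> \<open>h' \<in> I\<close> unfolding I_def by blast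
    then have "h * k + h' * k' = (a * k + a' * k') * f + (b * k + b' * k') * g" by (simp add: algebra_simps)
    then show ?thesis unfolding I_def by blast
  qed
  have div: "\<exists>a q. a \<noteq> 0 \<and> smult a h = m * q" if "h \<in> I" for h
  proof -
    obtain a q where aq: "a \<noteq> 0" "smult a h = m * q + pseudo_mod h m" using pseudo_mod(1)[OF m(2), of h] by blast
    have "pseudo_mod h m = h * [:a:] + m * (- q)" using aq(2) by (simp add: algebra_simps)
    then have "pseudo_mod h m \<in> I" using Iadd[OF that m(1)] by metis
    then have "pseudo_mod h m = 0" using least pseudo_mod(2)[OF m(2), of h] by (metis not_less)
    then show ?thesis using aq by auto
  qed
  have "g = 0 * f + 1 * g" by simp
  then have "g \<in> I" unfolding I_def by blast
  obtain a1 q1 where 1: "a1 \<noteq> 0" "smult a1 f = m * q1" using div[OF \<open>f \<in> I\<close>] by blast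
  obtain a2 q2 where 2: "a2 \<noteq> 0" "smult a2 g = m * q2" using div[OF \<open>g \<in> I\<close>] by blast
  have "degree m = 0 \<or> degree f = 0"
  proof -
    have "f dvd m * q1" using 1 by (metis dvd_refl dvd_smult)
    then consider "f dvd m" | "f dvd q1" using p by (metis prime_elem_dvd_multD)
    then show ?thesis
    proof cases
      case 1
      then have "f dvd smult a2 g" unfolding 2(2) by (rule dvd_mult2)
      then have "f dvd [:a2:] * g" by simp
      then have "f dvd [:a2:]" using p nd by (metis prime_elem_dvd_multD)
      then have "degree f \<le> degree [:a2:]" using dvd_imp_degree_le 2(1) by (metis pCons_eq_0_iff)
      then show ?thesis by simp
    next
      case 2
      then obtain k where "q1 = f * k" by blast
      then have "f * [:a1:] = f * (m * k)" using 1 by (simp add: algebra_simps)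
      then have "[:a1:] = m * k" using f0 by (metis mult_left_cancel)
      then have "degree m \<le> degree [:a1:]" using dvd_imp_degree_le 1(1) by (metis dvd_triv_left pCons_eq_0_iff)
      then show ?thesis by simp
    qed
  qed
  then show ?thesis
  proof
    assume "degree m = 0"
    then obtain r where "m = [:r:]" by (metis degree_eq_zeroE)
    then show ?thesis using that[of r] m unfolding I_def by auto
  next
    assume "degree f = 0"
    then obtain r where "f = [:r:]" by (metis degree_eq_zeroE)
    then show ?thesis using that[of r 1 0] f0 by auto
  qed
qed

text \<open>A line on which the first two coordinates can serve as coordinates: in the chart x1 = 1
  it is the graph of x -> (a3 + b3 x, a4 + b4 x).\<close>

locale chart = lsurf d c a b "axis 3 1" "axis 4 1" for d :: nat and c :: "'a::alg_closed_field form4" and a b :: "'a^4" +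
  assumes a1: "a$1 = 1" and a2: "a$2 = 0" and b1: "b$1 = 0" and b2: "b$2 = 1"
begin

lemma Ft_nz: "Ft d c \<noteq> 0"
proof
  assume "Ft d c = 0"
  then have "ev d c (v4 1 x y z) = 0" for x y z using E_Ft[of x y z d c] by (simp add: E_def)
  moreover have "pz 0 + 0 *s axis 3 1 = v4 1 0 (a$3) (a$4)" by (rule v4_eqI) (simp_all add: pz_def a1 a2 axis_def)
  have "axis 3 1 \<notin> sp a b"
  proof
    assume "axis 3 1 \<in> sp a b"
    then obtain s t where "axis 3 1 = s *s a + t *s b" by (auto simp: sp_def)
    then have "(-s) *s a + (-t) *s b + 1 *s axis 3 1 + 0 *s axis 4 1 = 0" by (simp add: cart_eq algebra_simps)
    then show False using bas_ind by (metis zero_neq_one)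
  qed
  then obtain x y t where nz: "ev d c (x *s a + y *s b + t *s axis 3 1) \<noteq> 0" using no_plane_in[OF lsurf_axioms] by blast
  define Q where "Q = ev d (cl c) (lin (y *s b + t *s axis 3 1) a)"
  have "Q = 0"
  proof (rule poly_zero_cofinite)
    show "finite {0::'a}" by simp
    fix r :: 'a assume "r \<notin> {0}"
    then have "y *s b + t *s axis 3 1 + r *s a = r *s v4 1 (y / r) ((r * a$3 + y * b$3 + t) / r) ((r * a$4 + y * b$4) / r)"
      by (intro v4_eqI) (simp_all add: a1 a2 b1 b2 axis_def)
    then show "poly Q r = 0" unfolding Q_def using calculation by (simp add: poly_ev ev_scale)
  qed
  then have "poly Q x = 0" by simp
  then show False using nz unfolding Q_def by (simp add: poly_ev algebra_simps)
qed

text \<open>Restriction to the plane spanned by the line and (0,0,p,q): the inner variable runs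
  along the line and the outer one leaves it, so coefficients 0 and 1 describe the first-order
  neighbourhood of the line.\<close>

definition th where "th p q = e3 (\<lambda>k. [:[:k:]:]) [:[:0,1:]:] [:[:a$3,b$3:],[:p:]:] [:[:a$4,b$4:],[:q:]:]"
lemma cc_hom: "comm_ring_hom (\<lambda>k::'a. [:[:k:]:])" by unfold_locales auto
lemma th_hom: "comm_ring_hom (th p q)" unfolding th_def by (rule e3_hom[OF cc_hom])

lemma th_Ft: "th p q (Ft d c) = ev d (cl (cl c)) (lin (lin a b) (cv (v4 0 0 p q)))"
proof -
  have "v4 1 [:[:0,1:]:] [:[:a$3,b$3:],[:p:]:] [:[:a$4,b$4:],[:q:]:] = lin (lin a b) (cv (v4 0 0 p q))"
    by (rule v4_eqI) (simp_all add: a1 a2 b1 b2)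
  then show ?thesis unfolding th_def e3_Ft[OF cc_hom] by simp
qed

lemma th_Ft_coeff: "coeff (th p q (Ft d c)) 0 = 0" "coeff (th p q (Ft d c)) 1 = smult p A + smult q B"
proof -
  show "coeff (th p q (Ft d c)) 0 = 0"
    unfolding th_Ft poly_0_coeff_0[symmetric] poly_ev using evX by (simp add: X_def)
  have "coeff (th p q (Ft d c)) 1 = poly (pderiv (th p q (Ft d c))) 0" by (simp add: poly_0_coeff_0 coeff_pderiv)
  also have "\<dots> = D1 d (cl c) X (cv (v4 0 0 p q))"
    unfolding th_Ft ev_deriv[OF derivation_pderiv supp4_cl[OF supc], simplified pderiv_pCons, simplified] by (simp add: poly_D1 X_def)
  also have "cv (v4 0 0 p q) = [:p:] *s cv (axis 3 1) + [:q:] *s cv (axis 4 1)"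
    by (rule v4_eqI) (simp_all add: axis_def)
  also have "D1 d (cl c) X \<dots> = smult p A + smult q B" unfolding D_lin A_def B_def by simp
  finally show "coeff (th p q (Ft d c)) 1 = smult p A + smult q B" .
qed

lemma th_coeff0: "coeff (th p q H) 0 = e3 (\<lambda>k. [:k:]) [:0,1:] [:a$3,b$3:] [:a$4,b$4:] H"
proof -
  have "poly (th p q H) 0 = e3 (\<lambda>k. poly [:[:k:]:] 0) (poly [:[:0,1:]:] 0) (poly [:[:a$3,b$3:],[:p:]:] 0) (poly [:[:a$4,b$4:],[:q:]:] 0) H"
    unfolding th_def by (rule e3_comp[OF poly_eval_hom cc_hom])
  then show ?thesis by (simp add: poly_0_coeff_0)
qed

text \<open>Restriction to the affine line with direction v through the point a of the
  chart.\<close>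

definition lv where "lv v P = e3 (\<lambda>k. [:k:]) [:0, v$1:] [:a$3, v$2:] [:a$4, v$3:] P" for v :: "'a^3" and P
lemma lv_hom: "comm_ring_hom (lv v)" unfolding lv_def by (rule e3_hom[OF const_hom])
lemma lv_val: "poly (lv v P) s = E (s * v$1) (a$3 + s * v$2) (a$4 + s * v$3) P"
proof -
  have "poly (lv v P) s = e3 (\<lambda>k. poly [:k:] s) (poly [:0, v$1:] s) (poly [:a$3, v$2:] s) (poly [:a$4, v$3:] s) P"
    unfolding lv_def by (rule e3_comp[OF poly_eval_hom const_hom])
  then show ?thesis unfolding E_e3 by simp
qed

lemma lv_pline: "pline (\<lambda>v. coeff (lv v P) M)"
  unfolding pline_def
proof (intro allI)
  fix v w :: "'a^3"
  define Q where "Q = e3 (\<lambda>k::'a. [:[:k:]:]) [:0, [:v$1, w$1:]:] [:[:a$3:], [:v$2, w$2:]:] [:[:a$4:], [:v$3, w$3:]:] P"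
  have "map_poly (\<lambda>p. poly p t) Q = lv (v + t *s w) P" for t
  proof -
    have h: "comm_ring_hom (map_poly (\<lambda>p::'a poly. poly p t))"
    proof -
      interpret g: comm_ring_hom "\<lambda>p::'a poly. poly p t" by (rule poly_eval_hom)
      interpret m: map_poly_comm_ring_hom "\<lambda>p::'a poly. poly p t" ..
      show ?thesis by (rule m.comm_ring_hom_axioms)
    qed
    show ?thesis unfolding Q_def e3_comp[OF h cc_hom] lv_def by (simp add: map_poly_pCons0)
  qed
  then have "coeff (lv (v + t *s w) P) M = poly (coeff Q M) t" for t by (metis coeff_map_poly poly_0)
  then show "\<exists>R. \<forall>t. coeff (lv (v + t *s w) P) M = poly R t" by blast
qed

lemma lv_val_pline: "pline (\<lambda>v. poly (lv v P) 1)"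
  unfolding pline_def
proof (intro allI)
  fix v w :: "'a^3"
  define Q where "Q = e3 (\<lambda>k::'a. [:k:]) [:v$1, w$1:] [:a$3 + v$2, w$2:] [:a$4 + v$3, w$3:] P"
  have "poly (lv (v + t *s w) P) 1 = poly Q t" for t
    unfolding Q_def e3_comp[OF poly_eval_hom const_hom] lv_val E_e3 by (simp add: algebra_simps)
  then show "\<exists>R. \<forall>t. poly (lv (v + t *s w) P) 1 = poly R t" by blast
qed

lemma pline_diff_const: "pline f \<Longrightarrow> pline (\<lambda>v. f v - k)"
  unfolding pline_def by (metis poly_diff poly_pCons poly_0 mult_zero_right add.right_neutral)

text \<open>To first order off the line the equation is pA + qB, and it equals h1 \<eta> with \<eta>
  the restriction of K to the line. The factor \<eta> is constant, so h1 has a term of degree d - 1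
  along the line and H already has a term of total degree d. On a generic line through a, H keeps
  degree at least d, K is not constant, and their product has degree at most d.\<close>

lemma factor_unit:
  assumes FHK: "Ft d c = H * K" and H0: "e3 (\<lambda>k. [:k:]) [:0,1:] [:a$3,b$3:] [:a$4,b$4:] H = 0"
  shows "K dvd 1"
proof (rule ccontr)
  assume nu: "\<not> K dvd 1"
  define \<eta> where "\<eta> = e3 (\<lambda>k. [:k:]) [:0,1:] [:a$3,b$3:] [:a$4,b$4:] K"
  have mul: "th p q (Ft d c) = th p q H * th p q K" for p q
    unfolding FHK using chom(1)[OF th_hom] by blast
  have c1: "smult p A + smult q B = coeff (th p q H) 1 * \<eta>" for p q
  proof -
    have "coeff (th p q (Ft d c)) 1 = coeff (th p q H) 0 * coeff (th p q K) 1 + coeff (th p q H) 1 * coeff (th p q K) 0"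
      unfolding mul by (simp add: coeff_mult)
    then show ?thesis unfolding th_Ft_coeff th_coeff0 H0 \<eta>_def[symmetric] by simp
  qed
  \<comment> \<open>A root of \<eta> would be a common zero of A and B.\<close>
  have nr: "poly \<eta> r \<noteq> 0" for r
  proof
    assume z: "poly \<eta> r = 0"
    have "poly A r = 0" using arg_cong[OF c1[of 1 0], of "\<lambda>p. poly p r"] z by simp
    moreover have "poly B r = 0" using arg_cong[OF c1[of 0 1], of "\<lambda>p. poly p r"] z by simp
    ultimately show False using ncr by blast
  qed
  then have "degree \<eta> = 0" using alg_closed_imp_poly_has_root by blast
  then obtain k where k: "\<eta> = [:k:]" by (metis degree_eq_zeroE)
  obtain p q where pq: "coeff (smult p A + smult q B) (d-1) \<noteq> 0"
  proof (cases "coeff A (d-1) = 0")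
    case True
    then have "coeff (smult 0 A + smult 1 B) (d-1) \<noteq> 0" using topAB by (simp del: One_nat_def)
    then show ?thesis by (rule that)
  next
    case False
    then have "coeff (smult 1 A + smult 0 B) (d-1) \<noteq> 0" by (simp del: One_nat_def)
    then show ?thesis by (rule that)
  qed
  then have h1: "coeff (coeff (th p q H) 1) (d-1) \<noteq> 0" unfolding c1 k by auto
  define h where "h = th p q H"
  have ex1: "\<exists>v::'a^3. coeff (lv v H) d \<noteq> 0"
  proof -
    \<comment> \<open>The direction for which leaving the line by y is tied to moving along it by y
      = t x; the coefficient of x^d is then a polynomial in t whose linear coefficient is the term
      found above.\<close>
    define vv where "vv t = ((\<chi> i. if i = 1 then 1 else if i = 2 then b$3 + t * p else b$4 + t * q) :: 'a^3)" for t
    have lvh: "lv (vv t) H = (\<Sum>j\<le>degree h. coeff h j * monom (t^j) j)" for t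
    proof -
      have hh: "comm_ring_hom (\<lambda>Q::'a poly poly. poly Q [:0,t:])" by (rule poly_eval_hom)
      have "poly h [:0,t:] = e3 (\<lambda>k. poly [:[:k:]:] [:0,t:]) (poly [:[:0,1:]:] [:0,t:]) (poly [:[:a$3,b$3:],[:p:]:] [:0,t:]) (poly [:[:a$4,b$4:],[:q:]:] [:0,t:]) H"
        unfolding h_def th_def by (rule e3_comp[OF hh cc_hom])
      also have "\<dots> = lv (vv t) H" unfolding lv_def vv_def by (simp add: algebra_simps)
      finally have "lv (vv t) H = poly h [:0,t:]" by simp
      also have "\<dots> = (\<Sum>j\<le>degree h. coeff h j * [:0,t:]^j)" by (rule poly_altdef)
      also have "\<dots> = (\<Sum>j\<le>degree h. coeff h j * monom (t^j) j)"
        by (rule sum.cong) (simp_all add: monom_altdef smult_power[symmetric] x_pow_n)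
      finally show ?thesis .
    qed
    define R where "R = (\<Sum>j\<le>d. monom (if j \<le> degree h then coeff (coeff h j) (d - j) else 0) j)"
    have "coeff (lv (vv t) H) d = poly R t" for t
    proof -
      have "coeff (lv (vv t) H) d = (\<Sum>j\<le>degree h. if j \<le> d then coeff (coeff h j) (d - j) * t^j else 0)"
        unfolding lvh coeff_sum by (rule sum.cong) (auto simp: mult.commute[of _ "monom _ _"] coeff_monom_mult)
      also have "\<dots> = (\<Sum>j\<in>{..degree h} \<inter> {..d}. coeff (coeff h j) (d - j) * t^j)"
        by (subst sum.inter_restrict, simp, rule sum.cong) auto
      also have "\<dots> = (\<Sum>j\<in>{..d} \<inter> {..degree h}. coeff (coeff h j) (d - j) * t^j)" by (simp only: Int_commute)
      also have "\<dots> = (\<Sum>j\<le>d. if j \<le> degree h then coeff (coeff h j) (d - j) * t^j else 0)"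
        by (subst sum.inter_restrict, simp, rule sum.cong) auto
      also have "\<dots> = poly R t" unfolding R_def poly_sum poly_monom by (rule sum.cong) auto
      finally show ?thesis .
    qed
    moreover have "R \<noteq> 0"
    proof
      assume "R = 0"
      have "1 \<le> degree h" using h1 le_degree[of h 1] unfolding h_def[symmetric] by (metis coeff_0)
      then have "coeff R 1 = coeff (coeff h 1) (d - 1)" unfolding R_def coeff_sum using d3 by (simp add: sum.delta')
      then show False using \<open>R = 0\<close> h1 unfolding h_def by simp
    qed
    ultimately show ?thesis using poly_all_zero by metis
  qed
  have ex2: "\<exists>v::'a^3. poly (lv v K) 1 - E 0 (a$3) (a$4) K \<noteq> 0"
  proof (rule ccontr)
    assume "\<not> ?thesis"
    then have al: "poly (lv v K) 1 = E 0 (a$3) (a$4) K" for v :: "'a^3" by auto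
    define k0 where "k0 = E 0 (a$3) (a$4) K"
    have "K - [:[:[:k0:]:]:] = 0"
    proof (rule E_all_zero)
      fix x y z :: 'a
      define v :: "'a^3" where "v = (\<chi> i. if i = 1 then x else if i = 2 then y - a$3 else z - a$4)"
      have "E x y z K = k0" using al[of v] unfolding lv_val k0_def by (simp add: v_def)
      moreover have "E x y z [:[:[:k0:]:]:] = k0" by (simp add: E_def)
      moreover have "E x y z (K - [:[:[:k0:]:]:]) = E x y z K - E x y z [:[:[:k0:]:]:]" by (rule chom(3)[OF E_hom])
      ultimately show "E x y z (K - [:[:[:k0:]:]:]) = 0" by simp
    qed
    then have K: "K = [:[:[:k0:]:]:]" by simp
    have "k0 \<noteq> 0" using K Ft_nz FHK by auto
    then have "K * [:[:[:1/k0:]:]:] = 1" unfolding K by (simp add:)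
    then show False using nu by (metis dvd_triv_left)
  qed
  have ex3: "\<exists>v::'a^3. poly (lv v (Ft d c)) 1 \<noteq> 0"
  proof (rule ccontr)
    assume "\<not> ?thesis"
    then have al: "poly (lv v (Ft d c)) 1 = 0" for v :: "'a^3" by auto
    have "Ft d c = 0"
    proof (rule E_all_zero)
      fix x y z :: 'a
      define v :: "'a^3" where "v = (\<chi> i. if i = 1 then x else if i = 2 then y - a$3 else z - a$4)"
      show "E x y z (Ft d c) = 0" using al[of v] unfolding lv_val by (simp add: v_def)
    qed
    then show False using Ft_nz by simp
  qed
  have "\<exists>v::'a^3. \<forall>f\<in>{\<lambda>v. coeff (lv v H) d, \<lambda>v. poly (lv v K) 1 - E 0 (a$3) (a$4) K, \<lambda>v. poly (lv v (Ft d c)) 1}. f v \<noteq> 0"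
    by (rule generic_point) (use ex1 ex2 ex3 lv_pline lv_val_pline pline_diff_const[OF lv_val_pline] in auto)
  then obtain v :: "'a^3" where v: "coeff (lv v H) d \<noteq> 0" "poly (lv v K) 1 \<noteq> E 0 (a$3) (a$4) K" "poly (lv v (Ft d c)) 1 \<noteq> 0" by auto
  have prod: "lv v (Ft d c) = lv v H * lv v K" unfolding FHK by (rule chom(1)[OF lv_hom])
  have nz: "lv v (Ft d c) \<noteq> 0" using v(3) by auto
  then have nz2: "lv v H \<noteq> 0" "lv v K \<noteq> 0" using prod by auto
  have "degree (lv v H) \<ge> d" using v(1) le_degree by blast
  moreover have "degree (lv v K) \<ge> 1"
  proof (rule ccontr)
    assume "\<not> ?thesis"
    then obtain k where "lv v K = [:k:]" by (metis degree_eq_zeroE less_one not_le)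
    then have "poly (lv v K) 1 = poly (lv v K) 0" by simp
    then show False using v(2) unfolding lv_val by simp
  qed
  moreover have "degree (lv v (Ft d c)) = degree (lv v H) + degree (lv v K)" unfolding prod using nz2 by (rule degree_mult_eq)
  moreover have "degree (lv v (Ft d c)) \<le> d"
  proof -
    have "v4 1 [:0, v$1:] [:a$3, v$2:] [:a$4, v$3:] = lin (v4 1 0 (a$3) (a$4)) (v4 0 (v$1) (v$2) (v$3))"
      by (rule v4_eqI) (simp_all add:)
    then have "lv v (Ft d c) = ev d (cl c) (lin (v4 1 0 (a$3) (a$4)) (v4 0 (v$1) (v$2) (v$3)))"
      unfolding lv_def e3_Ft[OF const_hom] by simp
    then show ?thesis using dc_ev_lin[of d c "v4 1 0 (a$3) (a$4)" "v4 0 (v$1) (v$2) (v$3)"] by (simp only: dc_def)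
  qed
  ultimately show False by simp
qed

text \<open>The equation vanishes on the line, so one factor does, and then the other factor is a
  unit. Irreducible elements are prime since polynomial rings over a field are factorial.\<close>

theorem Ft_prime: "prime_elem (Ft d c)"
proof -
  have "irreducible (Ft d c)"
  proof (rule irreducibleI)
    show "Ft d c \<noteq> 0" by (rule Ft_nz)
    show "\<not> Ft d c dvd 1"
    proof
      assume "Ft d c dvd 1"
      then obtain K where K: "1 = Ft d c * K" by blast
      have "E x y z (Ft d c) * E x y z K = 1" for x y z
        using chom(1)[OF E_hom, of x y z "Ft d c" K] K chom(4)[OF E_hom, of x y z] by metis
      moreover have "E 0 (a$3) (a$4) (Ft d c) = 0"
      proof -
        have "v4 1 0 (a$3) (a$4) = 1 *s a + 0 *s b" by (rule v4_eqI) (simp_all add: a1 a2)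
        then show ?thesis unfolding E_Ft using on by metis
      qed
      ultimately show False by (metis mult_zero_left zero_neq_one)
    qed
    fix H K assume HK: "Ft d c = H * K"
    interpret h: comm_ring_hom "e3 (\<lambda>k::'a. [:k:]) [:0,1:] [:a$3,b$3:] [:a$4,b$4:]" by (rule e3_hom[OF const_hom])
    have "e3 (\<lambda>k. [:k:]) [:0,1:] [:a$3,b$3:] [:a$4,b$4:] (Ft d c) = 0" using th_Ft_coeff(1) th_coeff0 by metis
    then have "e3 (\<lambda>k. [:k:]) [:0,1:] [:a$3,b$3:] [:a$4,b$4:] H = 0 \<or> e3 (\<lambda>k. [:k:]) [:0,1:] [:a$3,b$3:] [:a$4,b$4:] K = 0"
      unfolding HK h.hom_mult by simp
    then show "H dvd 1 \<or> K dvd 1"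
    proof
      assume "e3 (\<lambda>k. [:k:]) [:0,1:] [:a$3,b$3:] [:a$4,b$4:] H = 0"
      then show ?thesis using factor_unit[OF HK] by simp
    next
      assume "e3 (\<lambda>k. [:k:]) [:0,1:] [:a$3,b$3:] [:a$4,b$4:] K = 0"
      then show ?thesis using factor_unit[of K H] HK by (simp add: mult.commute)
    qed
  qed
  then show ?thesis by simp
qed

text \<open>A multiple of the equation vanishes to second order along any line tangent to the
  surface at a point of it, whereas \<open>ev n \<phi>\<close> has a nonzero linear term in the
  direction w.\<close>

theorem Ft_not_dvd:
  assumes sp: "supp4 n \<phi>" and zl: "\<And>s t. ev n \<phi> (s *s a + t *s b) = 0"
    and w: "D1 d c (pz z) w = 0" "D1 n \<phi> (pz z) w \<noteq> 0"
  shows "\<not> Ft d c dvd Ft n \<phi>"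
proof
  assume "Ft d c dvd Ft n \<phi>"
  then obtain M where M: "Ft n \<phi> = Ft d c * M" by blast
  define p where "p = pz z"
  \<comment> \<open>Makes the first coordinate 0, so that p + t w' stays in the chart. Both
    derivatives are unchanged, since D1(p,p) = 0 by Euler's identity.\<close>
  define w' where "w' = w - w$1 *s p"
  have p1: "p$1 = 1" by (simp add: p_def pz_def a1 b1)
  have w1: "w'$1 = 0" by (simp add: w'_def p1)
  have "D1 d c p p = 0" using Euler1[OF sup, of p] ev_pz by (simp add: p_def)
  then have a: "D1 d c p w' = 0" using w(1) unfolding w'_def D_lin p_def by simp
  have "D1 n \<phi> p p = 0" using Euler1[OF sp, of p] zl[of 1 z] by (simp add: p_def pz_def)
  then have b: "D1 n \<phi> p w' \<noteq> 0" using w(2) unfolding w'_def D_lin p_def by simp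
  define h where "h = e3 (\<lambda>k. [:k:]) [:p$2, w'$2:] [:p$3, w'$3:] [:p$4, w'$4:]"
  have vv: "v4 1 [:p$2, w'$2:] [:p$3, w'$3:] [:p$4, w'$4:] = lin p w'" by (rule v4_eqI) (simp_all add: p1 w1)
  have "h (Ft n \<phi>) = h (Ft d c) * h M" unfolding M h_def by (rule chom(1)[OF e3_hom[OF const_hom]])
  then have eq: "ev n (cl \<phi>) (lin p w') = ev d (cl c) (lin p w') * h M" unfolding h_def e3_Ft[OF const_hom] vv .
  have c0: "coeff (ev d (cl c) (lin p w')) 0 = 0" using ev_pz by (simp add: poly_0_coeff_0[symmetric] poly_ev p_def)
  have cf: "coeff (ev k (cl q) (lin p w')) 1 = D1 k q p w'" if "supp4 k q" for k q
  proof -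
    have "coeff (ev k (cl q) (lin p w')) 1 = poly (pderiv (ev k (cl q) (lin p w'))) 0" by (simp add: poly_0_coeff_0 coeff_pderiv)
    then show ?thesis unfolding ev_deriv[OF derivation_pderiv supp4_cl[OF that], simplified pderiv_pCons, simplified] by (simp add: poly_D1)
  qed
  have "coeff (ev n (cl \<phi>) (lin p w')) 1 = 0" unfolding eq using c0 cf[OF sup] a by (simp add: coeff_mult)
  then show False using cf[OF sp] b by simp
qed

text \<open>Eliminating z gives a nonzero polynomial r(x,y) that vanishes at all common zeros.
  Outside finitely many x it leaves finitely many y, and each of these finitely many z, unless the
  vertical line over (x,y) lies on the surface.\<close>

theorem plane_sections_finite:
  assumes nd: "\<not> Ft d c dvd Ft n \<phi>"
  obtains S where "finite S" "\<And>x. x \<notin> S \<Longrightarrow> finite {(y,z). ev d c (v4 1 x y z) = 0 \<and> ev n \<phi> (v4 1 x y z) = 0}"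
proof -
  obtain P Q r where r: "r \<noteq> 0" "[:r:] = P * Ft d c + Q * Ft n \<phi>" using elim_last[OF Ft_prime nd] by blast
  have rz: "poly (poly r [:y:]) x = 0" if "ev d c (v4 1 x y z) = 0" "ev n \<phi> (v4 1 x y z) = 0" for x y z
  proof -
    interpret e: comm_ring_hom "E x y z" by (rule E_hom)
    have "E x y z [:r:] = 0" unfolding r(2) e.hom_add e.hom_mult E_Ft using that by simp
    then show ?thesis by (simp add: E_def)
  qed
  obtain j where j: "coeff r j \<noteq> 0" using r(1) by (metis leading_coeff_0_iff)
  define S1 where "S1 = {x. poly (coeff r j) x = 0}"
  have fin1: "finite S1" unfolding S1_def by (rule poly_roots_finite[OF j])
  have ys: "finite {y. poly (poly r [:y:]) x = 0}" if "x \<notin> S1" for x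
  proof -
    have ne: "map_poly (\<lambda>p. poly p x) r \<noteq> 0"
    proof
      assume "map_poly (\<lambda>p. poly p x) r = 0"
      then have "coeff (map_poly (\<lambda>p. poly p x) r) j = 0" by simp
      then show False using that by (simp add: S1_def coeff_map_poly)
    qed
    have "{y. poly (poly r [:y:]) x = 0} = {y. poly (map_poly (\<lambda>p. poly p x) r) y = 0}"
      using poly_map_eval[of x r "[:_:]"] by simp
    then show ?thesis using poly_roots_finite[OF ne] by simp
  qed
  \<comment> \<open>All vertical lines pass through this point, so they meet pairwise and at most d
    of them lie on the surface.\<close>
  define e4 :: "'a^4" where "e4 = v4 0 0 0 1"
  define bad where "bad = {L \<in> lines_in d c. e4 \<in> L}"
  have e4n: "e4 \<noteq> 0"
  proof
    assume "e4 = 0" then have "e4 $ 4 = 0" by simp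
    then show False by (simp add: e4_def)
  qed
  have finbad: "finite bad"
  proof (rule ccontr)
    assume "infinite bad"
    then obtain M where M: "M \<subseteq> bad" "finite M" "card M = d + 1" using infinite_arbitrarily_large by blast
    have "card M \<le> d"
    proof (rule pairwise_meeting_bound[OF M(2)])
      show "M \<subseteq> lines_in d c" using M(1) by (auto simp: bad_def)
      fix L L' assume "L \<in> M" "L' \<in> M"
      then have "e4 \<in> L" "e4 \<in> L'" using M(1) by (auto simp: bad_def)
      then show "meets L L'" using e4n unfolding meets_def by blast
    qed
    then show False using M by simp
  qed
  define S2 where "S2 = {x. \<exists>y. \<forall>z. ev d c (v4 1 x y z) = 0}"
  have indv: "indep2 (v4 1 x y 0) e4" for x y
    unfolding indep2_def
  proof (intro allI impI)
    fix s t assume z: "s *s v4 1 x y 0 + t *s e4 = 0"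
    have "(s *s v4 1 x y 0 + t *s e4) $ 1 = 0" "(s *s v4 1 x y 0 + t *s e4) $ 4 = 0" using z by simp_all
    then show "s = 0 \<and> t = 0" by (simp add: e4_def)
  qed
  have "finite S2"
  proof -
    define yy where "yy x = (SOME y. \<forall>z. ev d c (v4 1 x y z) = 0)" for x
    have yy: "\<forall>z. ev d c (v4 1 x (yy x) z) = 0" if "x \<in> S2" for x
      using someI_ex[of "\<lambda>y. \<forall>z. ev d c (v4 1 x y z) = 0"] that unfolding S2_def yy_def by blast
    have "(\<lambda>x. sp (v4 1 x (yy x) 0) e4) ` S2 \<subseteq> bad"
    proof
      fix L assume "L \<in> (\<lambda>x. sp (v4 1 x (yy x) 0) e4) ` S2"
      then obtain x where x: "x \<in> S2" "L = sp (v4 1 x (yy x) 0) e4" by blast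
      have pe: "v4 1 x (yy x) 0 + t *s e4 = v4 1 x (yy x) t" for t by (rule v4_eqI) (simp_all add: e4_def)
      have e0: "ev d (cl c) (lin (v4 1 x (yy x) 0) e4) = 0" by (rule poly_all_zero) (use yy[OF x(1)] in \<open>simp add: poly_ev pe\<close>)
      have "ev d c (s *s v4 1 x (yy x) 0 + t *s e4) = 0" for s t
      proof (cases "s = 0")
        case True
        have "ev d c e4 = 0" using dc_ev_lin[of d c "v4 1 x (yy x) 0" e4] e0 by (simp add: dc_def)
        then show ?thesis using True by (simp add: ev_scale)
      next
        case False
        then have "s *s v4 1 x (yy x) 0 + t *s e4 = s *s (v4 1 x (yy x) 0 + (t/s) *s e4)" by (simp add: cart_eq algebra_simps)
        then show ?thesis using yy[OF x(1)] by (simp add: ev_scale pe)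
      qed
      then have "L \<in> lines_in d c" unfolding x(2) lines_in_def using is_line_sp[OF indv] by (auto simp: sp_def)
      then show "L \<in> bad" unfolding bad_def x(2) by simp
    qed
    moreover have "inj_on (\<lambda>x. sp (v4 1 x (yy x) 0) e4) S2"
    proof (rule inj_onI)
      fix x x' assume "sp (v4 1 x (yy x) 0) e4 = sp (v4 1 x' (yy x') 0) e4"
      then have "v4 1 x (yy x) 0 \<in> sp (v4 1 x' (yy x') 0) e4" using sp_gen(1) by metis
      then obtain s t where st: "v4 1 x (yy x) 0 = s *s v4 1 x' (yy x') 0 + t *s e4" by (auto simp: sp_def)
      have "v4 1 x (yy x) 0 $ 1 = (s *s v4 1 x' (yy x') 0 + t *s e4) $ 1" "v4 1 x (yy x) 0 $ 2 = (s *s v4 1 x' (yy x') 0 + t *s e4) $ 2"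
        using st by simp_all
      then show "x = x'" by (simp add: e4_def)
    qed
    ultimately show ?thesis using finbad by (meson finite_imageD finite_subset)
  qed
  moreover have "finite {(y,z). ev d c (v4 1 x y z) = 0 \<and> ev n \<phi> (v4 1 x y z) = 0}" if x: "x \<notin> S1 \<union> S2" for x
  proof (rule finite_subset)
    show "{(y,z). ev d c (v4 1 x y z) = 0 \<and> ev n \<phi> (v4 1 x y z) = 0}
       \<subseteq> (SIGMA y:{y. poly (poly r [:y:]) x = 0}. {z. ev d c (v4 1 x y z) = 0})" using rz by auto
    show "finite (SIGMA y:{y. poly (poly r [:y:]) x = 0}. {z. ev d c (v4 1 x y z) = 0})"
    proof (rule finite_SigmaI)
      show "finite {y. poly (poly r [:y:]) x = 0}" using ys x by simp
      fix y
      obtain z0 where z0: "ev d c (v4 1 x y z0) \<noteq> 0" using x unfolding S2_def by blast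
      define P where "P = ev d (cl c) (lin (v4 1 x y 0) e4)"
      have pe: "v4 1 x y 0 + t *s e4 = v4 1 x y t" for t by (rule v4_eqI) (simp_all add: e4_def)
      have Pv: "poly P t = ev d c (v4 1 x y t)" for t unfolding P_def by (simp add: poly_ev pe)
      then have "P \<noteq> 0" using z0 by auto
      then show "finite {z. ev d c (v4 1 x y z) = 0}" unfolding Pv[symmetric] by (rule poly_roots_finite)
    qed
  qed
  ultimately show ?thesis using that[of "S1 \<union> S2"] fin1 by blast
qed

end

section \<open>Nets of quadrics through a chain of lines\<close>

lemma D1_hscale: "D1 d c (a *s x) v = a^(d-1) * D1 d c x v"
  unfolding D1_def ev_scale by (simp add: sum_distrib_left mult_ac)

lemma pline_const: "pline (\<lambda>v. k)" unfolding pline_def by (intro allI exI[of _ "[:k:]"]) simp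
lemma pline_coord: "pline (\<lambda>v::'a::field^'n. v$i)"
  unfolding pline_def
proof (intro allI)
  fix v w :: "'a^'n"
  show "\<exists>P. \<forall>t. (v + t *s w) $ i = poly P t" by (rule exI[of _ "[:v$i,w$i:]"]) simp
qed
lemma pline_add: assumes "pline f" "pline g" shows "pline (\<lambda>v. f v + g v)"
  using assms unfolding pline_def by (metis poly_add)
lemma pline_diff: assumes "pline f" "pline g" shows "pline (\<lambda>v. f v - g v)"
  using assms unfolding pline_def by (metis poly_diff)
lemma pline_mult: assumes "pline f" "pline g" shows "pline (\<lambda>v. f v * g v)"
  using assms unfolding pline_def by (metis poly_mult)

lemma pline_ev: assumes "\<And>v w t. M (v + t *s w) = M v + t *s M w" shows "pline (\<lambda>v. ev d c (M v))"
  unfolding pline_def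
proof (intro allI)
  fix v w
  show "\<exists>P. \<forall>t. ev d c (M (v + t *s w)) = poly P t"
    by (rule exI[of _ "ev d (cl c) (lin (M v) (M w))"]) (simp add: poly_ev assms)
qed
lemma pline_D1_pt: assumes "\<And>v w t. M (v + t *s w) = M v + t *s M w" shows "pline (\<lambda>v. D1 d c (M v) u)"
  unfolding pline_def
proof (intro allI)
  fix v w
  show "\<exists>P. \<forall>t. D1 d c (M (v + t *s w)) u = poly P t"
    by (rule exI[of _ "D1 d (cl c) (lin (M v) (M w)) (cv u)"]) (simp add: poly_D1 assms)
qed
lemma pline_D1_dir: assumes "\<And>v w t. M (v + t *s w) = M v + t *s M w" shows "pline (\<lambda>v. D1 d c u (M v))"
  unfolding pline_def
proof (intro allI)
  fix v w
  show "\<exists>P. \<forall>t. D1 d c u (M (v + t *s w)) = poly P t"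
    by (rule exI[of _ "[:D1 d c u (M v), D1 d c u (M w):]"]) (simp add: assms D_lin)
qed

text \<open>The quadrics through the three edges x3 = x4 = 0, x1 = x2 = 0 and x2 = x4 = 0 of the coordinate tetrahedron.
The quadric of v is parametrised by (1, x, y (v1 + v2 x), y v3 x), see \<open>ux\<close> and \<open>wx\<close>.\<close>
definition qf :: "'a::field^3 \<Rightarrow> 'a^4 \<Rightarrow> 'a" where
  "qf v p = v$3 * (p$2 * p$3) - v$1 * (p$1 * p$4) - v$2 * (p$2 * p$4)"
definition qb :: "'a::field^3 \<Rightarrow> 'a^4 \<Rightarrow> 'a^4 \<Rightarrow> 'a" where
  "qb v p q = v$3 * (p$2 * q$3 + p$3 * q$2) - v$1 * (p$1 * q$4 + p$4 * q$1) - v$2 * (p$2 * q$4 + p$4 * q$2)"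
definition onb1 :: "'a::field^4 \<Rightarrow> bool" where "onb1 p \<longleftrightarrow> p$3 = 0 \<and> p$4 = 0"
definition onb2 :: "'a::field^4 \<Rightarrow> bool" where "onb2 p \<longleftrightarrow> p$1 = 0 \<and> p$2 = 0"
definition onb3 :: "'a::field^4 \<Rightarrow> bool" where "onb3 p \<longleftrightarrow> p$2 = 0 \<and> p$4 = 0"
lemmas onb = onb1_def onb2_def onb3_def

lemma qf_line: "qf v (p + t *s q) = qf v p + t * qb v p q + t^2 * qf v q"
  unfolding qf_def qb_def by (simp add: power2_eq_square algebra_simps)
lemma pline_qf: "pline (\<lambda>v. qf v p)" unfolding qf_def by (intro pline_diff pline_mult pline_coord pline_const)
lemma pline_qb: "pline (\<lambda>v. qb v p q)" unfolding qb_def by (intro pline_diff pline_mult pline_coord pline_const)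

definition v3 :: "'a \<Rightarrow> 'a \<Rightarrow> 'a \<Rightarrow> 'a^3" where
  "v3 x1 x2 x3 = (\<chi> i. if i = 1 then x1 else if i = 2 then x2 else x3)"
lemma v3_nth [simp]: "v3 x1 x2 x3 $ 1 = x1" "v3 x1 x2 x3 $ 2 = x2" "v3 x1 x2 x3 $ 3 = x3"
  by (simp_all add: v3_def)

lemma qf_exists: assumes "\<not> onb1 p" "\<not> onb2 p" "\<not> onb3 p" shows "\<exists>v. qf v p \<noteq> 0"
proof -
  have "p$2 * p$3 \<noteq> 0 \<or> p$1 * p$4 \<noteq> 0 \<or> p$2 * p$4 \<noteq> 0" using assms unfolding onb by auto
  moreover have "qf (v3 0 0 1) p = p$2 * p$3" "qf (v3 1 0 0) p = - (p$1 * p$4)" "qf (v3 0 1 0) p = - (p$2 * p$4)"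
    by (simp_all add: qf_def)
  ultimately show ?thesis by (metis neg_equal_0_iff_equal)
qed

text \<open>When q lies on an edge, every quadric of the net vanishes there and its restriction to p
  + t q is linear in t with slope \<open>qb v p q\<close>. A nonzero slope gives exactly one further
  intersection point.\<close>

lemma qb_exists:
  assumes "\<not> onb1 p" "\<not> onb2 p" "\<not> onb3 p"
    and "onb1 q \<and> \<not> onb2 q \<and> \<not> onb3 q \<or> onb2 q \<and> \<not> onb1 q \<and> \<not> onb3 q \<or> onb3 q \<and> \<not> onb1 q \<and> \<not> onb2 q"
  shows "\<exists>v. qb v p q \<noteq> 0"
proof -
  have "p$2 * q$3 + p$3 * q$2 \<noteq> 0 \<or> p$1 * q$4 + p$4 * q$1 \<noteq> 0 \<or> p$2 * q$4 + p$4 * q$2 \<noteq> 0"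
    using assms unfolding onb by auto
  moreover have "qb (v3 0 0 1) p q = p$2 * q$3 + p$3 * q$2" "qb (v3 1 0 0) p q = - (p$1 * q$4 + p$4 * q$1)"
    "qb (v3 0 1 0) p q = - (p$2 * q$4 + p$4 * q$2)"
    by (simp_all add: qb_def)
  ultimately show ?thesis by (metis neg_equal_0_iff_equal)
qed

text \<open>The pair of planes x2 x4 = 0 in the net suffices: its discriminant on the line is a
  square, nonzero as soon as the line misses the edge x2 = x4 = 0.\<close>

lemma disc_exists:
  assumes "\<And>s t. s \<noteq> 0 \<or> t \<noteq> 0 \<Longrightarrow> \<not> onb3 (s *s p + t *s q)"
  shows "\<exists>v. (qb v p q)^2 - 4 * qf v p * qf v q \<noteq> 0"
proof
  have "p$2 * q$4 - p$4 * q$2 \<noteq> 0"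
  proof
    assume z: "p$2 * q$4 - p$4 * q$2 = 0"
    show False
    proof (cases "q$2 = 0 \<and> q$4 = 0")
      case True
      then show False using assms[of 0 1] unfolding onb by simp
    next
      case False
      then consider "q$2 \<noteq> 0" | "q$4 \<noteq> 0" by auto
      then show False
      proof cases
        case 1
        then show False using assms[of "q$2" "- p$2"] z unfolding onb by (simp add: algebra_simps)
      next
        case 2
        then show False using assms[of "q$4" "- p$4"] z unfolding onb by (simp add: algebra_simps)
      qed
    qed
  qed
  moreover have "(qb (v3 0 1 0) p q)^2 - 4 * qf (v3 0 1 0) p * qf (v3 0 1 0) q = (p$2 * q$4 - p$4 * q$2)^2"
    by (simp add: qb_def qf_def power2_eq_square algebra_simps)
  ultimately show "(qb (v3 0 1 0) p q)^2 - 4 * qf (v3 0 1 0) p * qf (v3 0 1 0) q \<noteq> 0" by simp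
qed

lemma quad_roots:
  fixes a b q :: "'a::alg_closed_field"
  assumes "q \<noteq> 0" "b^2 - 4 * a * q \<noteq> 0" "(2::'a) \<noteq> 0"
  obtains R where "card R = 2" "finite R" "\<And>t. t \<in> R \<Longrightarrow> a + t * b + t^2 * q = 0"
proof -
  obtain s where s: "s^2 = b^2 - 4 * a * q" using nth_root_exists[of 2 "b^2 - 4 * a * q"] by auto
  define t1 t2 where "t1 = (- b + s) / (2 * q)" and "t2 = (- b - s) / (2 * q)"
  have s0: "s \<noteq> 0" using s assms(2) by auto
  have four: "(4::'a) = 2 * 2" by simp
  have "t1 \<noteq> t2"
  proof
    assume "t1 = t2"
    then have "- b + s = - b - s" using assms by (simp add: t1_def t2_def)
    then have "2 * s = 0" by (simp add: algebra_simps)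
    then show False using s0 assms(3) by simp
  qed
  have r: "a + t * b + t^2 * q = 0" if "2 * q * t = - b + s' " "s'^2 = s^2" for t s'
  proof -
    have "(2 * q) * (2 * q) * (q * t * t) = q * (2 * q * t)^2" by (simp add: power2_eq_square algebra_simps)
    have "(4 * q) * (a + t * b + t^2 * q) = 4 * a * q + 2 * b * (2 * q * t) + (2 * q * t)^2"
      by (simp add: power2_eq_square algebra_simps)
    also have "\<dots> = 4 * a * q + 2 * b * (- b + s') + (- b + s')^2" unfolding that(1) ..
    also have "\<dots> = 4 * a * q - b^2 + s'^2" by (simp add: power2_eq_square algebra_simps)
    also have "\<dots> = 0" unfolding that(2) s by simp
    finally show ?thesis using assms(1,3) four by (metis mult_eq_0_iff)
  qed
  have "a + t1 * b + t1^2 * q = 0" by (rule r[of t1 s]) (use assms in \<open>simp_all add: t1_def\<close>)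
  moreover have "a + t2 * b + t2^2 * q = 0" by (rule r[of t2 "- s"]) (use assms in \<open>simp_all add: t2_def\<close>)
  ultimately show ?thesis using that[of "{t1,t2}"] \<open>t1 \<noteq> t2\<close> by auto
qed

text \<open>Degree at most m in the inner variable x of K[x][y].\<close>

definition bd :: "nat \<Rightarrow> 'a::comm_ring_1 poly poly \<Rightarrow> bool" where "bd m P \<longleftrightarrow> (\<forall>j. degree (coeff P j) \<le> m)"
lemma bd_mult: assumes "bd m P" "bd k Q" shows "bd (m + k) (P * Q)"
  unfolding bd_def coeff_mult
proof (intro allI degree_sum_le)
  fix j i
  have "degree (coeff P i * coeff Q (j - i)) \<le> degree (coeff P i) + degree (coeff Q (j - i))" by (rule degree_mult_le)
  also have "\<dots> \<le> m + k" using assms unfolding bd_def by (meson add_mono)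
  finally show "degree (coeff P i * coeff Q (j - i)) \<le> m + k" .
qed auto
lemma bd_1: "bd 0 1" unfolding bd_def by (auto simp: coeff_1)
lemma bd_power: "bd m P \<Longrightarrow> bd (m * k) (P ^ k)"
  by (induction k) (auto simp: bd_1 intro: bd_mult)
lemma bd_ev:
  assumes "\<And>i. bd 1 (X$i)"
  shows "bd d (ev d (cl (cl c)) X)"
proof -
  have "bd d (cl (cl c) m * monom_eval m (X$1, X$2, X$3, X$4))" if "m \<in> mons d" for m
  proof -
    obtain i j k l where m: "m = (i,j,k,l)" and d: "d = i + j + k + l" using \<open>m \<in> mons d\<close> by (cases m) (auto simp: mons_def)
    have "bd (0 + (i + j + k + l)) ([:[:c m:]:] * ((X$1)^i * (X$2)^j * (X$3)^k * (X$4)^l))"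
      using bd_power[OF assms[of 1], of i] bd_power[OF assms[of 2], of j] bd_power[OF assms[of 3], of k] bd_power[OF assms[of 4], of l]
      by (intro bd_mult) (auto simp: bd_def coeff_pCons split: nat.splits)
    then show ?thesis using m d by (simp add: monom_eval_def)
  qed
  then show ?thesis unfolding ev_def form_eval_def bd_def coeff_sum by (auto intro!: degree_sum_le)
qed

lemma degree_drop: "degree P \<le> k \<Longrightarrow> coeff P k = 0 \<Longrightarrow> degree P \<le> k - 1"
  by (intro degree_le) (metis Suc_diff_1 coeff_eq_0 le_neq_implies_less less_Suc_eq_le not_less_eq not_less_zero
      diff_0_eq_0 gr0I le_trans not_less order_less_imp_le)

text \<open>The flags e and e' are exponents 0 or 1, so that the cases with and without removed
  factors y and x share one statement.\<close>

lemma strip_factors: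
  fixes P :: "'a::field poly poly"
  assumes deg: "degree P \<le> D" and b: "bd k P" and e: "e \<le> 1" "e' \<le> 1"
    and z: "e = 1 \<Longrightarrow> coeff P 0 = 0" and z': "\<And>j. e' = 1 \<Longrightarrow> poly (coeff P j) 0 = 0"
  obtains G where "\<And>Y. poly P Y = [:0,1:]^e' * Y^e * poly G Y" "degree G \<le> D - e" "bd (k - e') G"
    "\<And>j. coeff P (j + e) = [:0,1:]^e' * coeff G j"
proof -
  define G where "G = map_poly (poly_shift e') (poly_shift e P)"
  have cG: "coeff G j = poly_shift e' (coeff P (j + e))" for j
    unfolding G_def by (simp add: coeff_map_poly coeff_poly_shift poly_eq_iff)
  have 1: "degree G \<le> D - e"
  proof (rule degree_le, intro allI impI)
    fix j assume "j > D - e"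
    then have "coeff P (j + e) = 0" using deg by (intro coeff_eq_0) auto
    then show "coeff G j = 0" unfolding cG by (simp add: poly_eq_iff coeff_poly_shift)
  qed
  have 2: "bd (k - e') G" unfolding bd_def
  proof
    fix j
    show "degree (coeff G j) \<le> k - e'"
    proof (rule degree_le, intro allI impI)
      fix i assume "i > k - e'"
      then show "coeff (coeff G j) i = 0" using b unfolding cG bd_def coeff_poly_shift by (metis coeff_eq_0 less_diff_conv2 le_less_trans not_le le_add2 trans_le_add2 diff_le_self add.commute less_diff_conv le_diff_conv not_less)
    qed
  qed
  have 3: "coeff P (j + e) = [:0,1:]^e' * coeff G j" for j
  proof (cases "e' = 0")
    case True then show ?thesis unfolding cG by (simp add: poly_eq_iff coeff_poly_shift)
  next
    case False
    then have "e' = 1" using e by simp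
    then show ?thesis unfolding cG using z'[of "j+e"] by (auto simp: poly_eq_iff coeff_poly_shift coeff_pCons poly_0_coeff_0 split: nat.splits)
  qed
  have P: "P = [:[:0,1:]^e':] * ([:0,1:]^e * G)"
  proof (cases "e = 0")
    case True then show ?thesis using 3 by (simp add: poly_eq_iff)
  next
    case False
    then have e1: "e = 1" using e by simp
    show ?thesis
    proof (rule poly_eqI)
      fix j
      show "coeff P j = coeff ([:[:0,1:]^e':] * ([:0,1:]^e * G)) j"
        using 3[of "j - 1"] z e1 by (cases j) (auto simp: coeff_pCons)
    qed
  qed
  have "poly P Y = [:0,1:]^e' * Y^e * poly G Y" for Y by (subst P) (simp add: poly_power mult_ac)
  then show ?thesis using that 1 2 3 by blast
qed

lemma coeff_top_minus_one:
  fixes c :: "'a::idom form4"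
  assumes "supp4 d c" "d \<ge> 1"
  shows "coeff (ev d (cl c) (lin e f)) (d - 1) = D1 d c f e"
proof -
  define Q where "Q = ev d (cl c) (lin e f)"
  have sc: "supp4 d (cl c)" by (rule supp4_cl[OF assms(1)])
  have Q': "pderiv Q = D1 d (cl c) (lin e f) (cv f)"
    unfolding Q_def using ev_deriv[OF derivation_pderiv sc, of "lin e f"] by (simp add: pderiv_pCons)
  have "lin e f = cv e + [:0,1:] *s cv f" by (simp add: cart_eq)
  then have "D1 d (cl c) (lin e f) (lin e f) = D1 d (cl c) (lin e f) (cv e) + [:0,1:] * pderiv Q"
    unfolding Q' by (metis D1_add D1_scale)
  then have eq: "of_nat d * Q = D1 d (cl c) (lin e f) (cv e) + [:0,1:] * pderiv Q"
    using Euler1[OF sc, of "lin e f"] unfolding Q_def by simp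
  have "of_nat d * coeff Q (d-1) = D1 d c f e + of_nat (d - 1) * coeff Q (d-1)"
  proof -
    have "coeff (of_nat d * Q) (d-1) = of_nat d * coeff Q (d-1)" by (simp add: of_nat_poly)
    moreover have "coeff ([:0,1:] * pderiv Q) (d-1) = of_nat (d - 1) * coeff Q (d-1)"
      by (cases "d - 1") (auto simp: coeff_pCons coeff_pderiv)
    moreover have "coeff (D1 d (cl c) (lin e f) (cv e)) (d-1) = D1 d c f e" using dc_D1_lin unfolding dc_def by blast
    ultimately show ?thesis using arg_cong[OF eq, of "\<lambda>p. coeff p (d-1)"] by simp
  qed
  moreover have "(of_nat d :: 'a) = of_nat (d - 1) + 1" using assms(2) by (metis Suc_diff_1 add.commute of_nat_Suc One_nat_def less_eq_Suc_le)
  ultimately show ?thesis unfolding Q_def by (simp add: algebra_simps)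
qed

lemma double_root: fixes Q :: "'a::field poly" assumes "poly Q x = 0" "poly (pderiv Q) x = 0" shows "[:-x,1:]^2 dvd Q"
proof -
  obtain R where R: "Q = [:-x,1:] * R" using assms(1) by (metis poly_eq_0_iff_dvd dvdE)
  have "pderiv Q = R + [:-x,1:] * pderiv R" unfolding R pderiv_mult by (simp add: pderiv_pCons)
  then have "poly R x = 0" using assms(2) by simp
  then obtain S where "R = [:-x,1:] * S" by (metis poly_eq_0_iff_dvd dvdE)
  then have "Q = [:-x,1:]^2 * S" unfolding R by (simp only: power2_eq_square mult.assoc)
  then show ?thesis by simp
qed

section \<open>Forms on the parametrised quadric\<close>

definition ux :: "'a::comm_ring_1 \<Rightarrow> 'a^4" where "ux x = v4 1 x 0 0"
definition wx :: "'a::comm_ring_1^3 \<Rightarrow> 'a \<Rightarrow> 'a^4" where "wx v x = v4 0 0 (v$1 + v$2 * x) (v$3 * x)"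
definition Up :: "'a::comm_ring_1 poly^4" where "Up = v4 1 [:0,1:] 0 0"
definition Wp :: "'a::comm_ring_1^3 \<Rightarrow> 'a poly^4" where "Wp v = v4 0 0 [:v$1, v$2:] [:0, v$3:]"
definition PP :: "nat \<Rightarrow> 'a::comm_ring_1 form4 \<Rightarrow> 'a^3 \<Rightarrow> 'a poly poly" where
  "PP k f v = ev k (cl (cl f)) (lin Up (Wp v))"

lemma mapv_Up [simp]: "mapv (\<lambda>p. poly p x) Up = ux (x::'a::comm_ring_1)" by (rule v4_eqI) (simp_all add: Up_def ux_def)
lemma mapv_Wp [simp]: "mapv (\<lambda>p. poly p x) (Wp v) = wx v (x::'a::comm_ring_1)"
  by (rule v4_eqI) (simp_all add: Wp_def wx_def mult.commute)
lemma PP_Y: "poly (PP k f v) Y = ev k (cl f) (Up + Y *s Wp v)" unfolding PP_def by (simp add: poly_ev)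

lemma PP_x: "map_poly (\<lambda>p. poly p x) (PP k f v) = ev k (cl f) (lin (ux x) (wx v (x::'a::comm_ring_1)))"
proof -
  interpret h: comm_ring_hom "\<lambda>p. poly p x" by (rule poly_eval_hom)
  interpret m: map_poly_comm_ring_hom "\<lambda>p. poly p x" ..
  have hm: "comm_ring_hom (map_poly (\<lambda>p. poly p x))" by (rule m.comm_ring_hom_axioms)
  have 1: "map_poly (\<lambda>p. poly p x) [:q,q':] = [:poly q x, poly q' x:]" for q q' by (simp add: map_poly_pCons0)
  have 2: "map_poly (\<lambda>p. poly p x) [:q:] = [:poly q x:]" for q by (simp add: map_poly_pCons0)
  have "mapv (map_poly (\<lambda>p. poly p x)) (lin Up (Wp v)) = lin (mapv (\<lambda>p. poly p x) Up) (mapv (\<lambda>p. poly p x) (Wp v))"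
    unfolding cart_eq by (simp only: mapv_nth lin_nth 1) simp
  then show ?thesis unfolding PP_def comm_ring_hom.ev_hom[OF hm] 2 by simp
qed
lemma PP_coeff: "poly (coeff (PP k f v) j) x = coeff (ev k (cl f) (lin (ux x) (wx v (x::'a::comm_ring_1)))) j"
  unfolding PP_x[symmetric] by (simp add: coeff_map_poly)

text \<open>On the quadric the two skew edges are y = 0 and y = infinity, so containing both removes
  a factor y and also lowers the top degree: two degrees in y. The third edge is the fibre x = 0 and
  costs one degree in x.\<close>

lemma PP_strip:
  fixes f :: "'a::alg_closed_field form4"
  assumes e: "e \<le> 1" "e' \<le> 1"
    and z: "\<And>s t. e = 1 \<Longrightarrow> ev k f (v4 s t 0 0) = 0" "\<And>s t. e = 1 \<Longrightarrow> ev k f (v4 0 0 s t) = 0"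
      "\<And>s t. e' = 1 \<Longrightarrow> ev k f (v4 s 0 t 0) = 0"
  obtains G where "\<And>Y. ev k (cl f) (Up + Y *s Wp v) = [:0,1:]^e' * Y^e * poly G Y" "degree G \<le> k - 2 * e" "bd (k - e') G"
    "\<And>j. coeff (PP k f v) (j + e) = [:0,1:]^e' * coeff G j"
proof -
  have dg: "degree (PP k f v) \<le> k" "coeff (PP k f v) k = ev k (cl f) (Wp v)"
    using dc_ev_lin[of k "cl f" Up "Wp v"] unfolding PP_def dc_def by auto
  have "degree (PP k f v) \<le> k - e"
  proof (cases "e = 1")
    case True
    have "ev k (cl f) (Wp v) = 0" by (rule poly_all_zero) (simp add: poly_ev wx_def z(2)[OF True])
    then show ?thesis using degree_drop[OF dg(1)] dg(2) True by simp
  next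
    case False then show ?thesis using dg e by auto
  qed
  moreover have "bd k (PP k f v)" unfolding PP_def
  proof (rule bd_ev)
    have deg: "degree (Up$i) \<le> 1" "degree (Wp v$i) \<le> 1" for i :: 4
      using exhaust_4[of i] by (auto simp: Up_def Wp_def)
    show "bd 1 (lin Up (Wp v) $ i)" for i unfolding bd_def lin_nth
      by (auto simp: coeff_pCons deg split: nat.splits simp del: One_nat_def)
  qed
  moreover have "coeff (PP k f v) 0 = 0" if "e = 1"
  proof -
    have "coeff (PP k f v) 0 = ev k (cl f) Up" using PP_Y[of k f v 0] by (simp add: poly_0_coeff_0)
    also have "\<dots> = 0" by (rule poly_all_zero) (simp add: poly_ev ux_def z(1)[OF \<open>e = 1\<close>])
    finally show ?thesis .
  qed
  moreover have "poly (coeff (PP k f v) j) 0 = 0" if "e' = 1" for j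
  proof -
    have "ux 0 + y *s wx v 0 = v4 1 0 (y * v$1) 0" for y by (rule v4_eqI) (simp_all add: ux_def wx_def)
    then have "ev k (cl f) (lin (ux 0) (wx v 0)) = 0" by (intro poly_all_zero) (simp add: poly_ev z(3)[OF \<open>e' = 1\<close>])
    then show ?thesis unfolding PP_coeff by simp
  qed
  ultimately obtain G where "\<And>Y. poly (PP k f v) Y = [:0,1:]^e' * Y^e * poly G Y" "degree G \<le> k - e - e" "bd (k - e') G"
    "\<And>j. coeff (PP k f v) (j + e) = [:0,1:]^e' * coeff G j"
    using strip_factors[OF _ _ e] by metis
  then show ?thesis using that[of G] unfolding PP_Y by (simp add: mult_2)
qed

text \<open>The fibre direction at p is transverse to the surface, so the surface cuts the quadric
  in a branch y = Y(x). A linear Y with the right slope follows it to first order, which suffices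
  for multiplicity two: where the second form is tangent, it too vanishes to second order along that
  branch.\<close>

lemma local_graph:
  fixes c \<phi> :: "'a::alg_closed_field form4"
  assumes sup: "supp4 d c" "supp4 n \<phi>" and p: "p = r *s (ux x + y *s wx v x)" "r \<noteq> 0" "y \<noteq> 0"
    and on: "ev d c p = 0" "ev n \<phi> p = 0" and tr: "D1 d c p (v4 0 0 (p$3) (p$4)) \<noteq> 0"
    and m: "m = 1 \<or> m = 2 \<and> (\<forall>w. D1 d c p w = 0 \<longrightarrow> D1 n \<phi> p w = 0)"
  shows "\<exists>Y. poly Y x = y \<and> [:-x,1:]^m dvd ev d (cl c) (Up + Y *s Wp v) \<and> [:-x,1:]^m dvd ev n (cl \<phi>) (Up + Y *s Wp v)"
    and "map_poly (\<lambda>p. poly p x) (PP d c v) \<noteq> 0"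
proof -
  define p' where "p' = ux x + y *s wx v x"
  have pp: "p = r *s p'" using p(1) unfolding p'_def .
  have on': "ev d c p' = 0" "ev n \<phi> p' = 0" using on p(2) unfolding pp ev_scale by simp_all
  have "v4 0 0 (p$3) (p$4) = (r * y) *s wx v x" unfolding p by (rule v4_eqI) (simp_all add: ux_def wx_def algebra_simps)
  then have tr': "D1 d c p' (wx v x) \<noteq> 0" using tr unfolding pp D1_hscale by (auto simp: D_lin)
  have pt: "mapv (\<lambda>p. poly p x) (Up + Y *s Wp v) = ux x + poly Y x *s wx v x" for Y by simp
  show "\<exists>Y. poly Y x = y \<and> [:-x,1:]^m dvd ev d (cl c) (Up + Y *s Wp v) \<and> [:-x,1:]^m dvd ev n (cl \<phi>) (Up + Y *s Wp v)"
  proof (cases "m = 1")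
    case True
    have "[:-x,1:]^1 dvd ev k (cl f) (Up + [:y:] *s Wp v)" if "ev k f p' = 0" for k f
    proof -
      have "poly (ev k (cl f) (Up + [:y:] *s Wp v)) x = 0" using that by (simp add: poly_ev p'_def)
      then show ?thesis unfolding poly_eq_0_iff_dvd power_one_right .
    qed
    from this[OF on'(1)] this[OF on'(2)] show ?thesis unfolding True by (intro exI[of _ "[:y:]"] conjI) simp
  next
    case False
    then have m2: "m = 2" and tg: "\<And>w. D1 d c p w = 0 \<Longrightarrow> D1 n \<phi> p w = 0" using m by auto
    have tg': "D1 n \<phi> p' w = 0" if "D1 d c p' w = 0" for w
      using tg[of w] that p(2) unfolding pp D1_hscale by simp
    define v0 where "v0 = v4 0 1 (y * v$2) (y * v$3)"
    \<comment> \<open>The slope for which the velocity v0 + \<eta> wx of the branch is tangent to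
      the surface.\<close>
    define \<eta> where "\<eta> = - D1 d c p' v0 / D1 d c p' (wx v x)"
    define Y where "Y = [:y - \<eta> * x, \<eta>:]"
    have Yx: "poly Y x = y" by (simp add: Y_def)
    have Y': "pderiv Y = [:\<eta>:]" by (simp add: Y_def pderiv_pCons)
    have tn: "D1 d c p' (v0 + \<eta> *s wx v x) = 0" unfolding D_lin \<eta>_def using tr' by simp
    have dv: "mapv (\<lambda>p. poly p x) (mapv pderiv (Up + Y *s Wp v)) = v0 + \<eta> *s wx v x"
      by (rule v4_eqI) (simp_all add: Up_def Wp_def v0_def wx_def pderiv_add pderiv_mult pderiv_pCons pderiv_smult Y' Yx algebra_simps)
    have "[:-x,1:]^2 dvd ev k (cl f) (Up + Y *s Wp v)" if s: "supp4 k f" "ev k f p' = 0" "D1 k f p' (v0 + \<eta> *s wx v x) = 0" for k f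
    proof (rule double_root)
      show "poly (ev k (cl f) (Up + Y *s Wp v)) x = 0" using s(2) by (simp add: poly_ev Yx p'_def)
      have "pderiv (ev k (cl f) (Up + Y *s Wp v)) = D1 k (cl f) (Up + Y *s Wp v) (mapv pderiv (Up + Y *s Wp v))"
        by (rule ev_deriv[OF derivation_pderiv supp4_cl[OF s(1)]]) (simp add: pderiv_pCons)
      then show "poly (pderiv (ev k (cl f) (Up + Y *s Wp v))) x = 0" unfolding poly_D1
        using s(3) by (simp add: poly_D1 dv Yx p'_def del: mapv_plus) (simp add: Yx)
    qed
    from this[OF sup(1) on'(1) tn] this[OF sup(2) on'(2) tg'[OF tn]] show ?thesis using Yx m2 by blast
  qed
  show "map_poly (\<lambda>p. poly p x) (PP d c v) \<noteq> 0"
  proof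
    assume "map_poly (\<lambda>p. poly p x) (PP d c v) = 0"
    then have z: "ev d (cl c) (lin (ux x) (wx v x)) = 0" unfolding PP_x .
    have "pderiv (ev d (cl c) (lin (ux x) (wx v x))) = D1 d (cl c) (lin (ux x) (wx v x)) (cv (wx v x))"
      using ev_deriv[OF derivation_pderiv supp4_cl[OF sup(1)], of "lin (ux x) (wx v x)"] by (simp add: pderiv_pCons)
    then have "D1 d (cl c) (lin (ux x) (wx v x)) (cv (wx v x)) = 0" unfolding z by simp
    then have "poly (D1 d (cl c) (lin (ux x) (wx v x)) (cv (wx v x))) y = 0" by simp
    then show False using tr' unfolding poly_D1 by (simp add: p'_def)
  qed
qed

definition goodF :: "('a::field^'n \<Rightarrow> 'a) set \<Rightarrow> bool" where
  "goodF F \<longleftrightarrow> finite F \<and> (\<forall>f\<in>F. pline f \<and> (\<exists>v. f v \<noteq> 0))"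
lemma goodF_Un: "goodF F \<Longrightarrow> goodF G \<Longrightarrow> goodF (F \<union> G)" unfolding goodF_def by blast
lemma goodF_image: "finite I \<Longrightarrow> (\<And>i. i \<in> I \<Longrightarrow> pline (h i)) \<Longrightarrow> (\<And>i. i \<in> I \<Longrightarrow> \<exists>v. h i v \<noteq> 0) \<Longrightarrow> goodF (h ` I)"
  unfolding goodF_def by blast

lemma wx_lin: "wx (v + t *s w) x = wx v x + t *s wx w (x::'a::field)"
  by (rule v4_eqI) (simp_all add: wx_def algebra_simps)

lemma wx_surj: assumes "x \<noteq> (0::'a::field)" obtains v where "wx v x = v4 0 0 \<alpha> \<beta>"
  using that[of "v3 \<alpha> 0 (\<beta> / x)"] assms by (simp add: wx_def)

lemma normal_form:
  fixes v :: "'a::field^3"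
  assumes v: "v$1 \<noteq> 0" "v$3 \<noteq> 0" and q: "qf v p = 0" and p1: "p$1 \<noteq> 0" and nb: "\<not> onb1 p" "\<not> onb3 p"
  shows "\<exists>y. p = p$1 *s (ux (p$2/p$1) + y *s wx v (p$2/p$1)) \<and> y \<noteq> 0 \<and> p$2/p$1 \<noteq> 0"
proof -
  define x where "x = p$2/p$1"
  have p2: "p$2 = p$1 * x" using p1 by (simp add: x_def)
  have "p$1 * (v$3 * x * p$3 - (v$1 + v$2 * x) * p$4) = 0" using q unfolding qf_def p2 by (simp add: algebra_simps)
  then have r: "v$3 * x * p$3 = (v$1 + v$2 * x) * p$4" using p1 by simp
  have x0: "x \<noteq> 0"
  proof
    assume "x = 0"
    then have "p$4 = 0" "p$2 = 0" using r v(1) p2 by auto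
    then show False using nb(2) by (simp add: onb)
  qed
  define y where "y = p$4 / (p$1 * (v$3 * x))"
  have 4: "p$4 = p$1 * (y * (v$3 * x))" unfolding y_def using v p1 x0 by simp
  have "v$3 * x * p$3 = v$3 * x * (p$1 * (y * (v$1 + v$2 * x)))" unfolding r 4 by (simp add: algebra_simps)
  then have 3: "p$3 = p$1 * (y * (v$1 + v$2 * x))" using v x0 by simp
  have "p = p$1 *s (ux x + y *s wx v x)" by (rule v4_eqI) (simp_all add: ux_def wx_def p2 3[symmetric] 4[symmetric])
  moreover have "y \<noteq> 0" using 3 4 nb(1) by (auto simp: onb)
  ultimately show ?thesis using x0 unfolding x_def by blast
qed

text \<open>The flag e tells whether the two skew edges lie on the surface, e' whether the third one does.\<close>
locale qnet = surf d c for d :: nat and c :: "'a::alg_closed_field form4" +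
  fixes n :: nat and \<phi> :: "'a form4" and e e' :: nat and S0 :: "'a set"
  assumes supn: "supp4 n \<phi>" and e: "e \<le> 1" "e' \<le> 1"
    and l1: "\<And>s t. e = 1 \<Longrightarrow> ev d c (v4 s t 0 0) = 0" "\<And>s t. e = 1 \<Longrightarrow> ev n \<phi> (v4 s t 0 0) = 0"
    and l2: "\<And>s t. e = 1 \<Longrightarrow> ev d c (v4 0 0 s t) = 0" "\<And>s t. e = 1 \<Longrightarrow> ev n \<phi> (v4 0 0 s t) = 0"
    and l3: "\<And>s t. e' = 1 \<Longrightarrow> ev d c (v4 s 0 t 0) = 0" "\<And>s t. e' = 1 \<Longrightarrow> ev n \<phi> (v4 s 0 t 0) = 0"
    and nl1: "e = 0 \<Longrightarrow> \<exists>s t. ev d c (v4 s t 0 0) \<noteq> 0" and nl2: "e = 0 \<Longrightarrow> \<exists>s t. ev d c (v4 0 0 s t) \<noteq> 0"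
    and S0: "finite S0" "\<And>x. x \<notin> S0 \<Longrightarrow> finite {(y,z). ev d c (v4 1 x y z) = 0 \<and> ev n \<phi> (v4 1 x y z) = 0}"
begin

lemma v4_comb: "v4 s t 0 0 = s *s v4 1 0 0 0 + t *s v4 0 1 0 (0::'a)" "v4 0 0 s t = s *s v4 0 0 1 0 + t *s v4 0 0 0 (1::'a)"
  by (rule v4_eqI; simp)+

lemma base_line1: assumes "e = 1" shows "sp (v4 1 0 0 0) (v4 0 1 0 0) \<in> lines_in d c" "indep2 (v4 1 0 0 0) (v4 0 1 0 (0::'a))"
proof -
  show i: "indep2 (v4 1 0 0 0) (v4 0 1 0 (0::'a))" unfolding indep2_def
  proof (intro allI impI)
    fix s t :: 'a assume z: "s *s v4 1 0 0 0 + t *s v4 0 1 0 0 = 0"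
    have "(s *s v4 1 0 0 0 + t *s v4 0 1 0 0) $ 1 = (0::'a)" "(s *s v4 1 0 0 0 + t *s v4 0 1 0 0) $ 2 = (0::'a)" using z by simp_all
    then show "s = 0 \<and> t = 0" by simp
  qed
  show "sp (v4 1 0 0 0) (v4 0 1 0 0) \<in> lines_in d c" unfolding lines_in_def
    using is_line_sp[OF i] l1(1)[OF assms] by (auto simp: sp_def v4_comb(1)[symmetric])
qed
lemma base_line2: assumes "e = 1" shows "sp (v4 0 0 1 0) (v4 0 0 0 1) \<in> lines_in d c" "indep2 (v4 0 0 1 0) (v4 0 0 0 (1::'a))"
proof -
  show i: "indep2 (v4 0 0 1 0) (v4 0 0 0 (1::'a))" unfolding indep2_def
  proof (intro allI impI)
    fix s t :: 'a assume z: "s *s v4 0 0 1 0 + t *s v4 0 0 0 1 = 0"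
    have "(s *s v4 0 0 1 0 + t *s v4 0 0 0 1) $ 3 = (0::'a)" "(s *s v4 0 0 1 0 + t *s v4 0 0 0 1) $ 4 = (0::'a)" using z by simp_all
    then show "s = 0 \<and> t = 0" by simp
  qed
  show "sp (v4 0 0 1 0) (v4 0 0 0 1) \<in> lines_in d c" unfolding lines_in_def
    using is_line_sp[OF i] l2(1)[OF assms] by (auto simp: sp_def v4_comb(2)[symmetric])
qed

lemma good_fibre: obtains x where "x \<notin> S0" "x \<noteq> 0" "e = 0 \<Longrightarrow> ev d c (ux x) \<noteq> 0"
proof (cases "e = 0")
  case False
  have "finite (insert 0 S0)" using S0(1) by simp
  then obtain x where "x \<notin> insert 0 S0" using avoid_finite by blast
  then show ?thesis using that[of x] False by blast
next
  case True
  define Q where "Q = ev d (cl c) (lin (v4 1 0 0 0) (v4 0 1 0 0))"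
  have pt: "v4 1 0 0 0 + x *s v4 0 1 0 0 = ux x" for x :: 'a by (rule v4_eqI) (simp_all add: ux_def)
  have Qx: "poly Q x = ev d c (ux x)" for x unfolding Q_def by (simp add: poly_ev pt)
  have "Q \<noteq> 0"
  proof
    assume Q0: "Q = 0"
    have f: "ev d c (v4 0 1 0 0) = 0" using dc_ev_lin[of d c "v4 1 0 0 0" "v4 0 1 0 0"] Q0 unfolding dc_def Q_def by simp
    obtain s t where st: "ev d c (v4 s t 0 0) \<noteq> 0" using nl1[OF True] by blast
    show False
    proof (cases "s = 0")
      case True
      then have "v4 s t 0 0 = t *s v4 0 1 0 0" by (intro v4_eqI) simp_all
      then show False using st f by (simp add: ev_scale)
    next
      case False
      then have "v4 s t 0 0 = s *s ux (t / s)" by (intro v4_eqI) (simp_all add: ux_def)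
      then show False using st Qx[of "t/s"] Q0 by (simp add: ev_scale)
    qed
  qed
  then obtain x where "poly Q x \<noteq> 0" "x \<notin> insert 0 S0" using exists_nonroot[of Q "insert 0 S0"] S0(1) by (metis finite_insert)
  then show ?thesis using that[of x] Qx by auto
qed

text \<open>These functions are extreme coefficients of the equation on the fibre over x: without
  removed edges the coefficient of y^d, otherwise those of y and of y^(d-1). They control the degree
  in y and the point y = 0.\<close>

lemma good_edge:
  assumes x: "x \<noteq> 0"
  shows "goodF (if e = 1 then {\<lambda>v. D1 d c (ux x) (wx v x), \<lambda>v. D1 d c (wx v x) (ux x)} else {\<lambda>v. ev d c (wx v x)})"
proof (cases "e = 1")
  case True
  have "\<exists>v. D1 d c (ux x) (wx v x) \<noteq> 0"
  proof (rule ccontr)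
    assume n: "\<not> ?thesis"
    have "ev d c (ux x) = 0" unfolding ux_def using l1(1)[OF True] .
    moreover have "ux x \<noteq> 0"
    proof
      assume "ux x = 0" then have "ux x $ 1 = 0" by simp
      then show False by (simp add: ux_def)
    qed
    ultimately obtain y where y: "D1 d c (ux x) y \<noteq> 0" using sm unfolding smooth4_def by blast
    obtain v where v: "wx v x = v4 0 0 (y$3) (y$4)" using wx_surj[OF x] .
    have mem: "v4 s t 0 0 \<in> sp (v4 1 0 0 0) (v4 0 1 0 (0::'a))" for s t unfolding v4_comb(1)[of s t] by (rule sp_mem)
    have "D1 d c (ux x) (v4 (y$1) (y$2) 0 0) = 0"
      by (rule line_tangent[OF base_line1(1)[OF True]]) (simp_all add: ux_def mem)
    moreover have "y = v4 (y$1) (y$2) 0 0 + wx v x" unfolding v by (rule v4_eqI) simp_all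
    ultimately have "D1 d c (ux x) (wx v x) \<noteq> 0" using y by (metis D1_add add_0)
    then show False using n by blast
  qed
  moreover have "\<exists>v. D1 d c (wx v x) (ux x) \<noteq> 0"
  proof (rule ccontr)
    assume n: "\<not> ?thesis"
    obtain g1 g2 where l: "lsurf d c (v4 0 0 1 0) (v4 0 0 0 1) g1 g2" using lsurf_ex[OF base_line2(2)[OF True] base_line2(1)[OF True]] .
    interpret l: lsurf d c "v4 0 0 1 0" "v4 0 0 0 1" g1 g2 by fact
    \<comment> \<open>If the derivative towards ux vanished for all v, ux would be a constant
      tangent field along the second skew edge.\<close>
    have "D1 d c (l.pz t) (ux x + t *s 0) = 0" for t
    proof -
      obtain v where "wx v x = v4 0 0 1 t" using wx_surj[OF x] .
      moreover have "l.pz t = v4 0 0 1 t" unfolding l.pz_def by (rule v4_eqI) simp_all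
      ultimately show ?thesis using n by (metis add.right_neutral vector_smult_rzero)
    qed
    then have "ux x \<in> sp (v4 0 0 1 0) (v4 0 0 0 1)" by (rule l.NLS(1)[of "{}"]) simp
    then obtain s t where "ux x = s *s v4 0 0 1 0 + t *s v4 0 0 0 1" unfolding sp_def by blast
    then have "ux x $ 1 = (s *s v4 0 0 1 0 + t *s v4 0 0 0 1) $ 1" by simp
    then show False by (simp add: ux_def)
  qed
  ultimately show ?thesis using True unfolding goodF_def
    by (auto intro!: pline_D1_dir pline_D1_pt wx_lin)
next
  case False
  then have "e = 0" using e by simp
  then obtain s t where st: "ev d c (v4 0 0 s t) \<noteq> 0" using nl2 by blast
  obtain v where "wx v x = v4 0 0 s t" using wx_surj[OF x] .
  then have "\<exists>v. ev d c (wx v x) \<noteq> 0" using st by metis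
  then show ?thesis using False unfolding goodF_def by (auto intro!: pline_ev wx_lin)
qed

text \<open>A generic quadric of the net meets line i in r i points off the edges: two, or one if
  the point B i lies on an edge. All these points are counted by \<open>bezout_bidegree\<close> on
  the quadric after the factors of the edges are removed, each with multiplicity m i.\<close>

theorem quadric_bound:
  fixes A B :: "'i \<Rightarrow> 'a^4" and r m :: "'i \<Rightarrow> nat"
  assumes fin: "finite I"
    and ind: "\<And>i. i \<in> I \<Longrightarrow> indep2 (A i) (B i)"
    and van: "\<And>i s t. i \<in> I \<Longrightarrow> ev d c (s *s A i + t *s B i) = 0" "\<And>i s t. i \<in> I \<Longrightarrow> ev n \<phi> (s *s A i + t *s B i) = 0"
    and dist: "\<And>i j. i \<in> I \<Longrightarrow> j \<in> I \<Longrightarrow> i \<noteq> j \<Longrightarrow> sp (A i) (B i) \<noteq> sp (A j) (B j)"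
    and aff: "\<And>i. i \<in> I \<Longrightarrow> A i $ 1 \<noteq> 0 \<or> B i $ 1 \<noteq> 0"
    and off: "\<And>i t. i \<in> I \<Longrightarrow> \<not> onb1 (A i + t *s B i) \<and> \<not> onb2 (A i + t *s B i) \<and> \<not> onb3 (A i + t *s B i)"
    and rr: "\<And>i. i \<in> I \<Longrightarrow> r i = 2 \<and> \<not> onb1 (B i) \<and> \<not> onb2 (B i) \<and> \<not> onb3 (B i) \<or>
      r i = 1 \<and> (onb1 (B i) \<and> \<not> onb2 (B i) \<and> \<not> onb3 (B i) \<or> onb2 (B i) \<and> \<not> onb1 (B i) \<and> \<not> onb3 (B i)
         \<or> onb3 (B i) \<and> \<not> onb1 (B i) \<and> \<not> onb2 (B i))"
    and mm: "\<And>i. i \<in> I \<Longrightarrow> m i = 1 \<or> m i = 2 \<and> finite (T i) \<and>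
       (\<forall>t w. t \<notin> T i \<longrightarrow> D1 d c (A i + t *s B i) w = 0 \<longrightarrow> D1 n \<phi> (A i + t *s B i) w = 0)"
  shows "(\<Sum>i\<in>I. r i * m i) \<le> (d - 2 * e) * (n - e') + (n - 2 * e) * (d - e')"
proof -
  define pt where "pt i t = A i + t *s B i" for i t
  define fib where "fib p = v4 0 0 (p$3) (p$4)" for p :: "'a^4"
  \<comment> \<open>Parameters to be avoided on line i: the plane at infinity, points where tangency
    may fail, points where the fibre direction is tangent to the surface, and points on other
    lines.\<close>
  define Tb where "Tb i = {t. pt i t $ 1 = 0} \<union> (if m i = 2 then T i else {}) \<union> {t. D1 d c (pt i t) (fib (pt i t)) = 0}
     \<union> (\<Union>j\<in>I-{i}. {t. pt i t \<in> sp (A j) (B j)})" for i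
  have pt0: "pt i t \<noteq> 0" if "i \<in> I" for i t
  proof
    assume "pt i t = 0"
    then have "onb1 (pt i t)" by (simp add: onb)
    then show False using off[OF that] unfolding pt_def by blast
  qed
  have ptL: "pt i t \<in> sp (A i) (B i)" for i t using sp_mem[of 1 "A i" t "B i"] by (simp add: pt_def)
  have finTb: "finite (Tb i)" if i: "i \<in> I" for i
  proof -
    have 1: "finite {t. pt i t $ 1 = 0}"
    proof (rule finite_subset)
      show "{t. pt i t $ 1 = 0} \<subseteq> {t. poly [:A i $ 1, B i $ 1:] t = 0}" by (auto simp: pt_def)
      show "finite {t. poly [:A i $ 1, B i $ 1:] t = 0}" by (rule poly_roots_finite) (use aff[OF i] in auto)
    qed
    have 2: "finite (if m i = 2 then T i else {})" using mm[OF i] by auto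
    have 3: "finite {t. D1 d c (pt i t) (fib (pt i t)) = 0}"
    proof -
      \<comment> \<open>If the fibre direction were tangent along the whole line, \<open>NLS\<close>
        would place fib(A) in the line; then some point A + t B would lie on one of the skew
        edges.\<close>
      define Q where "Q = D1 d (cl c) (lin (A i) (B i)) (lin (fib (A i)) (fib (B i)))"
      have fl: "fib (pt i t) = fib (A i) + t *s fib (B i)" for t unfolding fib_def pt_def by (rule v4_eqI) simp_all
      have Qt: "poly Q t = D1 d c (pt i t) (fib (pt i t))" for t
        unfolding Q_def poly_D1 mapv_lin fl by (simp add: pt_def)
      have "Q \<noteq> 0"
      proof
        assume Q0: "Q = 0"
        have "sp (A i) (B i) \<in> lines_in d c" unfolding lines_in_def using is_line_sp[OF ind[OF i]] van(1)[OF i] by (auto simp: sp_def)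
        then obtain g1 g2 where l: "lsurf d c (A i) (B i) g1 g2" using lsurf_ex[OF ind[OF i]] by blast
        interpret l: lsurf d c "A i" "B i" g1 g2 by fact
        have "D1 d c (l.pz t) (fib (A i) + t *s fib (B i)) = 0" for t
          using Qt[of t] Q0 fl[of t] unfolding l.pz_def pt_def by simp
        then have "fib (A i) \<in> sp (A i) (B i)" by (rule l.NLS(1)[of "{}"]) simp
        then obtain s t where st: "fib (A i) = s *s A i + t *s B i" unfolding sp_def by blast
        have A0: "A i + 0 *s B i = A i" by simp
        have nA: "\<not> onb1 (A i)" "\<not> onb2 (A i)" using off[OF i, of 0] unfolding A0 by auto
        have s0: "s = 0"
        proof (rule ccontr)
          assume s: "s \<noteq> 0"
          have "onb2 (s *s A i + t *s B i)" unfolding st[symmetric] by (simp add: onb fib_def)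
          moreover have "A i + (t/s) *s B i = (1/s) *s (s *s A i + t *s B i)" using s by (simp add: cart_eq algebra_simps)
          ultimately have "onb2 (A i + (t/s) *s B i)" by (auto simp: onb)
          then show False using off[OF i] by blast
        qed
        have t0: "t \<noteq> 0"
        proof
          assume "t = 0"
          then have "fib (A i) = 0" using st s0 by simp
          then have "fib (A i) $ 3 = 0" "fib (A i) $ 4 = 0" by simp_all
          then show False using nA(1) by (simp add: onb fib_def)
        qed
        have "A i - fib (A i) = A i + (- t) *s B i" using st s0 by simp
        moreover have "onb1 (A i - fib (A i))" by (simp add: onb fib_def)
        ultimately show False using off[OF i, of "- t"] by metis
      qed
      then have "finite {t. poly Q t = 0}" by (rule poly_roots_finite)
      then show ?thesis unfolding Qt .
    qed
    have 4: "finite {t. pt i t \<in> sp (A j) (B j)}" if j: "j \<in> I - {i}" for j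
    proof (rule finite_at_most_one)
      fix s t assume a: "s \<in> {t. pt i t \<in> sp (A j) (B j)}" "t \<in> {t. pt i t \<in> sp (A j) (B j)}"
      show "s = t"
      proof (rule ccontr)
        assume ne: "s \<noteq> t"
        have li: "is_line (sp (A i) (B i))" "is_line (sp (A j) (B j))" using is_line_sp ind i j by blast+
        have nij: "sp (A i) (B i) \<noteq> sp (A j) (B j)" using dist[of i j] i j by auto
        obtain k where k: "pt i t = k *s pt i s"
          using lines_two_pts[OF li nij ptL _ ptL _ pt0[OF i]] a by blast
        then have "(1 - k) *s A i + (t - k * s) *s B i = 0" unfolding pt_def by (simp add: cart_eq algebra_simps)
        then have "1 - k = 0 \<and> t - k * s = 0" using ind[OF i] unfolding indep2_def by blast
        then show False using ne by auto
      qed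
    qed
    show ?thesis unfolding Tb_def using 1 2 3 4 fin by simp
  qed
  obtain xs where xs: "xs \<notin> S0" "xs \<noteq> 0" and xe: "e = 0 \<Longrightarrow> ev d c (ux xs) \<noteq> 0" using good_fibre by blast
  define Z where "Z = {(y,z). ev d c (v4 1 xs y z) = 0 \<and> ev n \<phi> (v4 1 xs y z) = 0}"
  have finZ: "finite Z" unfolding Z_def by (rule S0(2)[OF xs(1)])
  \<comment> \<open>The conditions on v: \<open>F1\<close> makes the parametrisation usable,
    \<open>F2\<close> keeps the fibre over xs away from the finitely many common zeros in the plane
    x2 = xs x1 off the first edge, \<open>F3\<close> controls the coefficients of that fibre,
    \<open>F4\<close> avoids the bad points, and \<open>F5\<close> and \<open>F6\<close> give
    exactly r i simple intersections with each line.\<close>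
  define F1 where "F1 = {\<lambda>v::'a^3. v$1, \<lambda>v. v$3}"
  define F2 where "F2 = (\<lambda>q (v::'a^3). fst q * (v$3 * xs) - snd q * (v$1 + v$2 * xs)) ` (Z - {(0,0)})"
  define F3 where "F3 = (if e = 1 then {\<lambda>v. D1 d c (ux xs) (wx v xs), \<lambda>v. D1 d c (wx v xs) (ux xs)} else {\<lambda>v. ev d c (wx v xs)})"
  define F4 where "F4 = (\<lambda>q v. qf v (pt (fst q) (snd q))) ` (SIGMA i:I. Tb i)"
  define F5 where "F5 = (\<lambda>i v. if r i = 2 then qf v (B i) else qb v (A i) (B i)) ` I"
  define F6 where "F6 = (\<lambda>i v. if r i = 2 then (qb v (A i) (B i))^2 - 4 * qf v (A i) * qf v (B i) else 1) ` I"
  have g1: "goodF F1" unfolding F1_def goodF_def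
  proof (intro conjI ballI)
    show "\<exists>v. f v \<noteq> 0" if "f \<in> {\<lambda>v::'a^3. v$1, \<lambda>v. v$3}" for f
      using that by (intro exI[of _ "v3 1 0 1"]) auto
  qed (auto intro: pline_coord)
  have g2: "goodF F2" unfolding F2_def
  proof (rule goodF_image)
    show "finite (Z - {(0,0)})" using finZ by simp
    fix q assume q: "q \<in> Z - {(0,0)}"
    show "pline (\<lambda>v::'a^3. fst q * (v$3 * xs) - snd q * (v$1 + v$2 * xs))"
      by (intro pline_diff pline_add pline_mult pline_coord pline_const)
    show "\<exists>v::'a^3. fst q * (v$3 * xs) - snd q * (v$1 + v$2 * xs) \<noteq> 0"
    proof (cases "fst q = 0")
      case True
      then have "snd q \<noteq> 0" using q by (cases q) auto
      then show ?thesis using True by (intro exI[of _ "v3 1 0 0"]) simp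
    next
      case False then show ?thesis using xs(2) by (intro exI[of _ "v3 0 0 1"]) simp
    qed
  qed
  have g3: "goodF F3" unfolding F3_def by (rule good_edge[OF xs(2)])
  have g4: "goodF F4" unfolding F4_def
  proof (rule goodF_image)
    show "finite (SIGMA i:I. Tb i)" using fin finTb by auto
    show "pline (\<lambda>v. qf v (pt (fst q) (snd q)))" for q by (rule pline_qf)
    show "\<exists>v. qf v (pt (fst q) (snd q)) \<noteq> 0" if "q \<in> (SIGMA i:I. Tb i)" for q
      by (rule qf_exists) (use that off in \<open>auto simp: pt_def\<close>)
  qed
  have Ai: "\<not> onb1 (A i)" "\<not> onb2 (A i)" "\<not> onb3 (A i)" if "i \<in> I" for i using off[OF that, of 0] by auto
  have g5: "goodF F5" unfolding F5_def
  proof (rule goodF_image[OF fin])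
    fix i assume i: "i \<in> I"
    show "pline (\<lambda>v. if r i = 2 then qf v (B i) else qb v (A i) (B i))" by (cases "r i = 2") (simp_all add: pline_qf pline_qb)
    show "\<exists>v. (if r i = 2 then qf v (B i) else qb v (A i) (B i)) \<noteq> 0"
    proof (cases "r i = 2")
      case True
      then show ?thesis using qf_exists[of "B i"] rr[OF i] by auto
    next
      case False
      then show ?thesis using qb_exists[OF Ai[OF i], of "B i"] rr[OF i] by auto
    qed
  qed
  have g6: "goodF F6" unfolding F6_def
  proof (rule goodF_image[OF fin])
    fix i assume i: "i \<in> I"
    show "pline (\<lambda>v. if r i = 2 then (qb v (A i) (B i))^2 - 4 * qf v (A i) * qf v (B i) else 1)"
    proof (cases "r i = 2")
      case True
      have "pline (\<lambda>v. qb v (A i) (B i) * qb v (A i) (B i) - 4 * qf v (A i) * qf v (B i))"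
        by (intro pline_diff pline_mult pline_qf pline_qb pline_const)
      then show ?thesis using True by (simp add: power2_eq_square)
    next
      case False then show ?thesis using pline_const by simp
    qed
    show "\<exists>v. (if r i = 2 then (qb v (A i) (B i))^2 - 4 * qf v (A i) * qf v (B i) else 1) \<noteq> 0"
    proof (cases "r i = 2")
      case True
      have "\<not> onb3 (s *s A i + t *s B i)" if "s \<noteq> 0 \<or> t \<noteq> 0" for s t
      proof (cases "s = 0")
        case s: True
        then have "t \<noteq> 0" using that by simp
        then show ?thesis using s True rr[OF i] by (auto simp: onb)
      next
        case False
        then have "A i + (t/s) *s B i = (1/s) *s (s *s A i + t *s B i)" by (simp add: cart_eq algebra_simps)
        then have "onb3 (s *s A i + t *s B i) \<Longrightarrow> onb3 (A i + (t/s) *s B i)" by (auto simp: onb)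
        then show ?thesis using off[OF i] by blast
      qed
      from disc_exists[of "A i" "B i", OF this] show ?thesis using True by simp
    next
      case False then show ?thesis by simp
    qed
  qed
  have "goodF (F1 \<union> F2 \<union> F3 \<union> F4 \<union> F5 \<union> F6)" by (intro goodF_Un g1 g2 g3 g4 g5 g6)
  then obtain v where v: "\<And>f. f \<in> F1 \<union> F2 \<union> F3 \<union> F4 \<union> F5 \<union> F6 \<Longrightarrow> f v \<noteq> 0"
    using generic_point[of "F1 \<union> F2 \<union> F3 \<union> F4 \<union> F5 \<union> F6"] unfolding goodF_def by blast
  have v13: "v$1 \<noteq> 0" "v$3 \<noteq> 0" using v[of "\<lambda>v. v$1"] v[of "\<lambda>v. v$3"] unfolding F1_def by auto
  have vZ: "y * (v$3 * xs) - z * (v$1 + v$2 * xs) \<noteq> 0" if "(y,z) \<in> Z" "(y,z) \<noteq> (0,0)" for y z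
  proof -
    have "(\<lambda>v::'a^3. fst (y,z) * (v$3 * xs) - snd (y,z) * (v$1 + v$2 * xs)) \<in> F2" unfolding F2_def using that by blast
    then show ?thesis using v[of "\<lambda>v::'a^3. fst (y,z) * (v$3 * xs) - snd (y,z) * (v$1 + v$2 * xs)"] by simp
  qed
  have vT: "qf v (pt i t) \<noteq> 0" if "i \<in> I" "t \<in> Tb i" for i t
  proof -
    have "(\<lambda>v. qf v (pt (fst (i,t)) (snd (i,t)))) \<in> F4" unfolding F4_def using that by blast
    then show ?thesis using v[of "\<lambda>v. qf v (pt (fst (i,t)) (snd (i,t)))"] by simp
  qed
  have v5: "(if r i = 2 then qf v (B i) else qb v (A i) (B i)) \<noteq> 0" if "i \<in> I" for i
    using v[of "\<lambda>v. if r i = 2 then qf v (B i) else qb v (A i) (B i)"] that unfolding F5_def by blast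
  have v6: "(if r i = 2 then (qb v (A i) (B i))^2 - 4 * qf v (A i) * qf v (B i) else 1) \<noteq> 0" if "i \<in> I" for i
    using v[of "\<lambda>v. if r i = 2 then (qb v (A i) (B i))^2 - 4 * qf v (A i) * qf v (B i) else 1"] that unfolding F6_def by blast
  have "\<forall>i\<in>I. \<exists>R. finite R \<and> card R = r i \<and> (\<forall>t\<in>R. qf v (pt i t) = 0)"
  proof
    fix i assume i: "i \<in> I"
    show "\<exists>R. finite R \<and> card R = r i \<and> (\<forall>t\<in>R. qf v (pt i t) = 0)"
    proof (cases "r i = 2")
      case True
      then have "qf v (B i) \<noteq> 0" "(qb v (A i) (B i))^2 - 4 * qf v (A i) * qf v (B i) \<noteq> 0" using v5[OF i] v6[OF i] by auto
      then obtain R where R: "card R = 2" "finite R" "\<And>t. t \<in> R \<Longrightarrow> qf v (A i) + t * qb v (A i) (B i) + t^2 * qf v (B i) = 0"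
        using quad_roots[OF _ _ two_nz] by metis
      show ?thesis
      proof (intro exI[of _ R] conjI ballI)
        show "qf v (pt i t) = 0" if "t \<in> R" for t unfolding pt_def qf_line by (rule R(3)[OF that])
      qed (use R True in simp_all)
    next
      case False
      then have r1: "r i = 1" and q0: "qf v (B i) = 0" using rr[OF i] by (auto simp: onb qf_def)
      have nz: "qb v (A i) (B i) \<noteq> 0" using v5[OF i] False by simp
      then have "qf v (pt i (- qf v (A i) / qb v (A i) (B i))) = 0" unfolding pt_def qf_line by (simp add: q0)
      then show ?thesis using r1 by (intro exI[of _ "{- qf v (A i) / qb v (A i) (B i)}"]) simp
    qed
  qed
  then obtain R where R: "\<And>i. i \<in> I \<Longrightarrow> finite (R i)" "\<And>i. i \<in> I \<Longrightarrow> card (R i) = r i" "\<And>i t. i \<in> I \<Longrightarrow> t \<in> R i \<Longrightarrow> qf v (pt i t) = 0"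
    by metis
  define J where "J = (SIGMA i:I. R i)"
  have finJ: "finite J" unfolding J_def using fin R(1) by auto
  define q where "q j = pt (fst j) (snd j)" for j
  define xi where "xi j = q j $ 2 / q j $ 1" for j
  have notTb: "snd j \<notin> Tb (fst j)" "fst j \<in> I" if "j \<in> J" for j
    using that R(3)[of "fst j" "snd j"] vT[of "fst j" "snd j"] unfolding J_def by auto
  have q1: "q j $ 1 \<noteq> 0" and qtr: "D1 d c (q j) (v4 0 0 (q j $ 3) (q j $ 4)) \<noteq> 0"
    and qm: "m (fst j) = 2 \<Longrightarrow> snd j \<notin> T (fst j)"
    and qne: "\<And>k. k \<in> I \<Longrightarrow> k \<noteq> fst j \<Longrightarrow> q j \<notin> sp (A k) (B k)" if "j \<in> J" for j
    using notTb[OF that] unfolding Tb_def q_def fib_def by auto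
  have "\<forall>j\<in>J. \<exists>y. q j = q j $ 1 *s (ux (xi j) + y *s wx v (xi j)) \<and> y \<noteq> 0 \<and> xi j \<noteq> 0"
    unfolding xi_def
  proof
    fix j assume j: "j \<in> J"
    show "\<exists>y. q j = q j $ 1 *s (ux (q j $ 2 / q j $ 1) + y *s wx v (q j $ 2 / q j $ 1)) \<and> y \<noteq> 0 \<and> q j $ 2 / q j $ 1 \<noteq> 0"
    proof (rule normal_form[OF v13])
      show "qf v (q j) = 0" using j R(3) unfolding J_def q_def by auto
      show "q j $ 1 \<noteq> 0" by (rule q1[OF j])
      show "\<not> onb1 (q j)" "\<not> onb3 (q j)" using off[OF notTb(2)[OF j]] unfolding q_def pt_def by auto
    qed
  qed
  then obtain y where y: "\<And>j. j \<in> J \<Longrightarrow> q j = q j $ 1 *s (ux (xi j) + y j *s wx v (xi j))" "\<And>j. j \<in> J \<Longrightarrow> y j \<noteq> 0"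
    "\<And>j. j \<in> J \<Longrightarrow> xi j \<noteq> 0" by metis
  have von: "ev d c (q j) = 0" "ev n \<phi> (q j) = 0" if "j \<in> J" for j
    using van[OF notTb(2)[OF that], of 1 "snd j"] unfolding q_def pt_def by simp_all
  have mj: "m (fst j) = 1 \<or> m (fst j) = 2 \<and> (\<forall>w. D1 d c (q j) w = 0 \<longrightarrow> D1 n \<phi> (q j) w = 0)" if "j \<in> J" for j
    using mm[OF notTb(2)[OF that]] qm[OF that] unfolding q_def pt_def by blast
  have lg: "\<exists>Y. poly Y (xi j) = y j \<and> [:-xi j,1:]^m (fst j) dvd ev d (cl c) (Up + Y *s Wp v) \<and> [:-xi j,1:]^m (fst j) dvd ev n (cl \<phi>) (Up + Y *s Wp v)"
    and nzf: "map_poly (\<lambda>p. poly p (xi j)) (PP d c v) \<noteq> 0" if j: "j \<in> J" for j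
    using local_graph[OF sup supn y(1)[OF j] q1[OF j] y(2)[OF j] von[OF j] qtr[OF j] mj[OF j]] by blast+
  have "\<forall>j\<in>J. \<exists>Y. poly Y (xi j) = y j \<and> [:-xi j,1:]^m (fst j) dvd ev d (cl c) (Up + Y *s Wp v) \<and> [:-xi j,1:]^m (fst j) dvd ev n (cl \<phi>) (Up + Y *s Wp v)"
    using lg by blast
  from bchoice[OF this] obtain Y where Y: "\<And>j. j \<in> J \<Longrightarrow> poly (Y j) (xi j) = y j"
    "\<And>j. j \<in> J \<Longrightarrow> [:-xi j,1:]^m (fst j) dvd ev d (cl c) (Up + Y j *s Wp v)"
    "\<And>j. j \<in> J \<Longrightarrow> [:-xi j,1:]^m (fst j) dvd ev n (cl \<phi>) (Up + Y j *s Wp v)"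
    by blast
  obtain G where G: "\<And>Y. ev d (cl c) (Up + Y *s Wp v) = [:0,1:]^e' * Y^e * poly G Y" "degree G \<le> d - 2 * e" "bd (d - e') G"
    "\<And>j. coeff (PP d c v) (j + e) = [:0,1:]^e' * coeff G j"
    using PP_strip[where k=d and f=c and v=v, OF e l1(1) l2(1) l3(1)] by blast
  obtain H where H: "\<And>Y. ev n (cl \<phi>) (Up + Y *s Wp v) = [:0,1:]^e' * Y^e * poly H Y" "degree H \<le> n - 2 * e" "bd (n - e') H"
    "\<And>j. coeff (PP n \<phi> v) (j + e) = [:0,1:]^e' * coeff H j"
    using PP_strip[where k=n and f=\<phi> and v=v, OF e l1(2) l2(2) l3(2)] by blast
  have canc: "[:-xi j,1:]^m (fst j) dvd K" if "j \<in> J" "[:-xi j,1:]^m (fst j) dvd [:0,1:]^e' * Y j^e * K" for j K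
    by (rule power_root_cancel[OF that(2)]) (use Y(1)[OF that(1)] y(2,3)[OF that(1)] in simp)
  have Gx: "xs^e' * poly (coeff G j) xs = coeff (ev d (cl c) (lin (ux xs) (wx v xs))) (j + e)" for j
    using arg_cong[OF G(4)[of j], of "\<lambda>p. poly p xs"] unfolding PP_coeff by simp
  have d1: "d \<ge> 1" using d3 by simp
  have "(\<Sum>j\<in>J. m (fst j)) \<le> (d - 2 * e) * (n - e') + (n - 2 * e) * (d - e')"
  proof (rule bezout_bidegree[OF G(2) H(2) _ _ _ _ finJ])
    show "degree (coeff G j) \<le> d - e'" for j using G(3) unfolding bd_def by blast
    show "degree (coeff H j) \<le> n - e'" for j using H(3) unfolding bd_def by blast
    show "poly (coeff G (d - 2 * e)) xs \<noteq> 0"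
    proof -
      have "coeff (ev d (cl c) (lin (ux xs) (wx v xs))) (d - 2 * e + e) \<noteq> 0"
      proof (cases "e = 1")
        case True
        then have "D1 d c (wx v xs) (ux xs) \<noteq> 0" using v[of "\<lambda>v. D1 d c (wx v xs) (ux xs)"] unfolding F3_def by simp
        moreover have "d - 2 * e + e = d - 1" using True d3 by simp
        ultimately show ?thesis using coeff_top_minus_one[OF sup d1] by metis
      next
        case False
        then have "ev d c (wx v xs) \<noteq> 0" "e = 0" using v[of "\<lambda>v. ev d c (wx v xs)"] e unfolding F3_def by simp_all
        then show ?thesis using dc_ev_lin[of d c "ux xs" "wx v xs"] unfolding dc_def by simp
      qed
      then show ?thesis using Gx[of "d - 2 * e"] by auto
    qed
    show "poly (poly H [:z:]) xs \<noteq> 0" if Gz: "poly (poly G [:z:]) xs = 0" for z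
    proof
      assume Hz: "poly (poly H [:z:]) xs = 0"
      have "mapv (\<lambda>p. poly p xs) (Up + [:z:] *s Wp v) = v4 1 xs (z * (v$1 + v$2 * xs)) (z * (v$3 * xs))"
        by (rule v4_eqI) (simp_all add: Up_def Wp_def algebra_simps)
      then have "(z * (v$1 + v$2 * xs), z * (v$3 * xs)) \<in> Z"
        using arg_cong[OF G(1)[of "[:z:]"], of "\<lambda>p. poly p xs"] arg_cong[OF H(1)[of "[:z:]"], of "\<lambda>p. poly p xs"] Gz Hz
        unfolding Z_def poly_ev by simp
      moreover have "z * (v$1 + v$2 * xs) * (v$3 * xs) - z * (v$3 * xs) * (v$1 + v$2 * xs) = 0" by (simp add: algebra_simps)
      ultimately have "(z * (v$1 + v$2 * xs), z * (v$3 * xs)) = (0,0)" using vZ by blast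
      then have z0: "z = 0" using v13 xs(2) by simp
      show False
      proof (cases "e = 1")
        case True
        then have "D1 d c (ux xs) (wx v xs) \<noteq> 0" using v[of "\<lambda>v. D1 d c (ux xs) (wx v xs)"] unfolding F3_def by simp
        moreover have "coeff (ev d (cl c) (lin (ux xs) (wx v xs))) 1 = D1 d c (ux xs) (wx v xs)"
        proof -
          have "pderiv (ev d (cl c) (lin (ux xs) (wx v xs))) = D1 d (cl c) (lin (ux xs) (wx v xs)) (cv (wx v xs))"
            using ev_deriv[OF derivation_pderiv supp4_cl[OF sup], of "lin (ux xs) (wx v xs)"] by (simp add: pderiv_pCons)
          then show ?thesis unfolding coeff1 by (simp add: poly_D1)
        qed
        moreover have "poly (coeff G 0) xs = 0" using Gz z0 by (simp add: poly_0_coeff_0)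
        ultimately show False using Gx[of 0] True by simp
      next
        case False
        then have e0: "e = 0" using e by simp
        have "ev d c (ux xs) = 0"
          using arg_cong[OF G(1)[of 0], of "\<lambda>p. poly p xs"] Gz z0 e0 by (simp add: poly_ev)
        then show False using xe[OF e0] by simp
      qed
    qed
    show "[:-xi j,1:]^m (fst j) dvd poly G (Y j)" if "j \<in> J" for j
      by (rule canc[OF that]) (use Y(2)[OF that] in \<open>simp only: G(1)\<close>)
    show "[:-xi j,1:]^m (fst j) dvd poly H (Y j)" if "j \<in> J" for j
      by (rule canc[OF that]) (use Y(3)[OF that] in \<open>simp only: H(1)\<close>)
    show "m (fst j) \<ge> 1" if "j \<in> J" for j using mj[OF that] by auto
    show "map_poly (\<lambda>p. poly p (xi j)) G \<noteq> 0" if j: "j \<in> J" for j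
    proof
      assume z: "map_poly (\<lambda>p. poly p (xi j)) G = 0"
      have "poly (map_poly (\<lambda>p. poly p (xi j)) (PP d c v)) z = 0" for z
      proof -
        have "poly (map_poly (\<lambda>p. poly p (xi j)) (PP d c v)) z = poly (poly (PP d c v) [:z:]) (xi j)"
          using poly_map_eval[of "xi j" "PP d c v" "[:z:]"] by simp
        also have "\<dots> = xi j^e' * z^e * poly (poly G [:z:]) (xi j)" unfolding PP_Y G(1) by simp
        also have "poly (poly G [:z:]) (xi j) = 0" using poly_map_eval[of "xi j" G "[:z:]"] z by simp
        finally show ?thesis by simp
      qed
      then show False using nzf[OF j] poly_all_zero by blast
    qed
    \<comment> \<open>Equal coordinates mean proportional vectors. Points on two of the given lines
      were excluded by \<open>Tb\<close>, and on one line proportional points have equal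
      parameters.\<close>
    show "inj_on (\<lambda>j. (xi j, poly (Y j) (xi j))) J"
    proof (rule inj_onI)
      fix j k assume j: "j \<in> J" and k: "k \<in> J" and eq: "(xi j, poly (Y j) (xi j)) = (xi k, poly (Y k) (xi k))"
      then have xy: "xi j = xi k" "y j = y k" using Y(1)[OF j] Y(1)[OF k] by auto
      define w where "w = ux (xi j) + y j *s wx v (xi j)"
      have qj: "q j = q j $ 1 *s w" using y(1)[OF j] unfolding w_def .
      have qk: "q k = q k $ 1 *s w" using y(1)[OF k] unfolding w_def xy .
      have "w = (1 / q k $ 1) *s q k" by (subst qk) (use q1[OF k] in simp)
      then obtain l where l: "q j = l *s q k" using qj by (metis vector_smult_assoc)
      have fe: "fst j = fst k"
      proof (rule ccontr)
        assume ne: "fst j \<noteq> fst k"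
        have "q k \<in> sp (A (fst k)) (B (fst k))" unfolding q_def by (rule ptL)
        then have "q j \<in> sp (A (fst k)) (B (fst k))" unfolding l by (rule sp_scale)
        then show False using qne[OF j notTb(2)[OF k]] ne by auto
      qed
      have "(1 - l) *s A (fst k) + (snd j - l * snd k) *s B (fst k) = 0"
        using l unfolding q_def pt_def fe by (simp add: cart_eq algebra_simps)
      then have "1 - l = 0 \<and> snd j - l * snd k = 0" using ind[OF notTb(2)[OF k]] unfolding indep2_def by blast
      then have "snd j = snd k" by auto
      then show "j = k" using fe by (simp add: prod_eq_iff)
    qed
  qed
  moreover have "(\<Sum>j\<in>J. m (fst j)) = (\<Sum>i\<in>I. \<Sum>t\<in>R i. m i)"
    unfolding J_def by (subst sum.Sigma) (use fin R(1) in \<open>auto simp: case_prod_beta\<close>)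
  moreover have "(\<Sum>i\<in>I. \<Sum>t\<in>R i. m i) = (\<Sum>i\<in>I. r i * m i)" using R(2) by (intro sum.cong) auto
  ultimately show ?thesis by simp
qed

end

section \<open>Change of frame\<close>

text \<open>The form cuts the surface transversally at infinitely many points of the line. This
  excludes that it vanishes on the whole surface.\<close>

definition transv :: "nat \<Rightarrow> 'a::field form4 \<Rightarrow> nat \<Rightarrow> 'a form4 \<Rightarrow> ('a^4) set \<Rightarrow> bool" where
  "transv d c n \<phi> L \<longleftrightarrow> (\<exists>e f. indep2 e f \<and> L = sp e f \<and>
     (\<forall>S. finite S \<longrightarrow> (\<exists>z w. z \<notin> S \<and> D1 d c (e + z *s f) w = 0 \<and> D1 n \<phi> (e + z *s f) w \<noteq> 0)))"
text \<open>Multiplicity at least two along the line: at almost all points the derivative of the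
  form vanishes on the tangent plane of the surface. It is required for every basis because the
  basis is chosen later.\<close>

definition tang :: "nat \<Rightarrow> 'a::field form4 \<Rightarrow> nat \<Rightarrow> 'a form4 \<Rightarrow> ('a^4) set \<Rightarrow> bool" where
  "tang d c n \<phi> L \<longleftrightarrow> (\<forall>a b. indep2 a b \<and> L = sp a b \<longrightarrow>
     (\<exists>T. finite T \<and> (\<forall>t w. t \<notin> T \<longrightarrow> D1 d c (a + t *s b) w = 0 \<longrightarrow> D1 n \<phi> (a + t *s b) w = 0)))"

definition fr :: "'a::field^4 \<Rightarrow> 'a^4 \<Rightarrow> 'a^4 \<Rightarrow> 'a^4 \<Rightarrow> 'a^4 \<Rightarrow> 'a^4" where
  "fr h1 h2 h3 h4 x = x$1 *s h1 + x$2 *s h2 + x$3 *s h3 + x$4 *s h4"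

lemma fr_add: "fr h1 h2 h3 h4 (x + y) = fr h1 h2 h3 h4 x + fr h1 h2 h3 h4 y" by (simp add: fr_def cart_eq algebra_simps)
lemma fr_scale: "fr h1 h2 h3 h4 (r *s x) = r *s fr h1 h2 h3 h4 x" by (simp add: fr_def cart_eq algebra_simps)
lemma fr_v4: "fr h1 h2 h3 h4 (v4 s t p q) = s *s h1 + t *s h2 + p *s h3 + q *s h4" by (simp add: fr_def)
lemma fr_surj: assumes "basis4 h1 h2 h3 h4" obtains x where "fr h1 h2 h3 h4 x = y"
proof -
  obtain s t p q where "y = s *s h1 + t *s h2 + p *s h3 + q *s h4" using assms unfolding basis4_def by meson
  then show ?thesis using that[of "v4 s t p q"] by (simp add: fr_v4)
qed
lemma fr_zero: assumes "basis4 h1 h2 h3 h4" "fr h1 h2 h3 h4 x = 0" shows "x = 0"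
proof -
  have "x$1 = 0 \<and> x$2 = 0 \<and> x$3 = 0 \<and> x$4 = 0" using assms unfolding basis4_def fr_def by blast
  then show ?thesis by (intro v4_eqI) simp_all
qed
lemma fr_inj: assumes "basis4 h1 h2 h3 h4" "fr h1 h2 h3 h4 x = fr h1 h2 h3 h4 y" shows "x = y"
proof -
  have "fr h1 h2 h3 h4 (x + (-1) *s y) = 0" unfolding fr_add fr_scale assms(2) by simp
  then have "x + (-1) *s y = 0" by (rule fr_zero[OF assms(1)])
  then show ?thesis by simp
qed

lemma coeff1_ev: fixes q :: "'a::idom form4" assumes "supp4 k q" shows "coeff (ev k (cl q) (lin p w)) 1 = D1 k q p w"
proof -
  have "pderiv (ev k (cl q) (lin p w)) = D1 k (cl q) (lin p w) (cv w)"
    using ev_deriv[OF derivation_pderiv supp4_cl[OF assms], of "lin p w"] by (simp add: pderiv_pCons)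
  then show ?thesis unfolding coeff1 by (simp add: poly_D1)
qed

lemma frame_form:
  fixes c :: "'a::alg_closed_field form4"
  assumes "supp4 d c"
  obtains c' where "supp4 d c'" "\<And>x. ev d c' x = ev d c (fr h1 h2 h3 h4 x)" "\<And>x v. D1 d c' x v = D1 d c (fr h1 h2 h3 h4 x) (fr h1 h2 h3 h4 v)"
proof -
  let ?f = "fr h1 h2 h3 h4"
  have "is_form 1 (\<lambda>x. ?f x $ i)" for i
  proof -
    have "is_form 1 (\<lambda>x. (h1$i) * x$1 + (h2$i) * x$2 + (h3$i) * x$3 + (h4$i) * x$4)"
      by (intro is_form_add is_form_cmul is_form_coord)
    then show ?thesis by (simp add: fr_def mult.commute)
  qed
  then have "is_form d (\<lambda>x. ev d c (?f x))" by (rule is_form_comp)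
  then obtain c' where c': "supp4 d c'" "\<And>x. ev d c (?f x) = ev d c' x" unfolding is_form_def by blast
  have "D1 d c' x v = D1 d c (?f x) (?f v)" for x v
  proof -
    have "ev d (cl c') (lin x v) = ev d (cl c) (lin (?f x) (?f v))"
      by (rule poly_fun_eqI) (simp add: poly_ev c'(2)[symmetric] fr_add fr_scale)
    then show ?thesis using coeff1_ev[OF c'(1), of x v] coeff1_ev[OF assms, of "?f x" "?f v"] by simp
  qed
  then show ?thesis using that c' by metis
qed

lemma fr_onb: assumes "basis4 h1 h2 h3 h4"
  shows "onb1 x \<longleftrightarrow> fr h1 h2 h3 h4 x \<in> sp h1 h2" "onb2 x \<longleftrightarrow> fr h1 h2 h3 h4 x \<in> sp h3 h4" "onb3 x \<longleftrightarrow> fr h1 h2 h3 h4 x \<in> sp h1 h3"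
proof -
  have 1: "x = v4 s t 0 0 \<Longrightarrow> onb1 x" "x = v4 0 0 s t \<Longrightarrow> onb2 x" "x = v4 s 0 t 0 \<Longrightarrow> onb3 x" for s t by (simp_all add: onb)
  have v: "fr h1 h2 h3 h4 (v4 s t 0 0) = s *s h1 + t *s h2" "fr h1 h2 h3 h4 (v4 0 0 s t) = s *s h3 + t *s h4"
    "fr h1 h2 h3 h4 (v4 s 0 t 0) = s *s h1 + t *s h3" for s t by (simp_all add: fr_v4)
  show "onb1 x \<longleftrightarrow> fr h1 h2 h3 h4 x \<in> sp h1 h2"
  proof
    assume "onb1 x" then show "fr h1 h2 h3 h4 x \<in> sp h1 h2" by (auto simp: onb fr_def sp_def)
  next
    assume "fr h1 h2 h3 h4 x \<in> sp h1 h2"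
    then obtain s t where "fr h1 h2 h3 h4 x = s *s h1 + t *s h2" unfolding sp_def by blast
    then show "onb1 x" using fr_inj[OF assms, of x "v4 s t 0 0"] v(1) 1(1) by metis
  qed
  show "onb2 x \<longleftrightarrow> fr h1 h2 h3 h4 x \<in> sp h3 h4"
  proof
    assume "onb2 x" then show "fr h1 h2 h3 h4 x \<in> sp h3 h4" by (auto simp: onb fr_def sp_def)
  next
    assume "fr h1 h2 h3 h4 x \<in> sp h3 h4"
    then obtain s t where "fr h1 h2 h3 h4 x = s *s h3 + t *s h4" unfolding sp_def by blast
    then show "onb2 x" using fr_inj[OF assms, of x "v4 0 0 s t"] v(2) 1(2) by metis
  qed
  show "onb3 x \<longleftrightarrow> fr h1 h2 h3 h4 x \<in> sp h1 h3"
  proof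
    assume "onb3 x" then show "fr h1 h2 h3 h4 x \<in> sp h1 h3" by (auto simp: onb fr_def sp_def)
  next
    assume "fr h1 h2 h3 h4 x \<in> sp h1 h3"
    then obtain s t where "fr h1 h2 h3 h4 x = s *s h1 + t *s h3" unfolding sp_def by blast
    then show "onb3 x" using fr_inj[OF assms, of x "v4 s 0 t 0"] v(3) 1(3) by metis
  qed
qed

context surf begin

lemma frame_surf:
  assumes bas: "basis4 h1 h2 h3 h4" and c': "supp4 d c'" "\<And>x. ev d c' x = ev d c (fr h1 h2 h3 h4 x)"
     "\<And>x v. D1 d c' x v = D1 d c (fr h1 h2 h3 h4 x) (fr h1 h2 h3 h4 v)"
  shows "surf d c'"
proof
  show "smooth4 d c'" unfolding smooth4_def
  proof (intro allI impI)
    fix x :: "'a^4" assume x: "x \<noteq> 0" "ev d c' x = 0"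
    have "fr h1 h2 h3 h4 x \<noteq> 0" using fr_zero[OF bas] x(1) by blast
    then obtain v where v: "D1 d c (fr h1 h2 h3 h4 x) v \<noteq> 0" using sm x(2) unfolding c'(2) smooth4_def by blast
    obtain v' where "fr h1 h2 h3 h4 v' = v" using fr_surj[OF bas] .
    then show "\<exists>v. D1 d c' x v \<noteq> 0" using v c'(3) by metis
  qed
qed (use c'(1) d3 ch in auto)

text \<open>As L0 misses the edge through h3 and h4, the first two frame coordinates are coordinates
  on L0. It is then a line of a \<open>chart\<close>, and transversality along it shows that the
  prime equation does not divide the form.\<close>

lemma frame_sections:
  assumes bas: "basis4 h1 h2 h3 h4" and sn: "supp4 n \<phi>"
    and c': "supp4 d c'" "\<And>x. ev d c' x = ev d c (fr h1 h2 h3 h4 x)"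
     "\<And>x v. D1 d c' x v = D1 d c (fr h1 h2 h3 h4 x) (fr h1 h2 h3 h4 v)"
    and p': "supp4 n \<phi>'" "\<And>x. ev n \<phi>' x = ev n \<phi> (fr h1 h2 h3 h4 x)"
     "\<And>x v. D1 n \<phi>' x v = D1 n \<phi> (fr h1 h2 h3 h4 x) (fr h1 h2 h3 h4 v)"
    and L0: "L0 \<in> lines_in d c" "\<not> meets L0 (sp h3 h4)" "\<And>x. x \<in> L0 \<Longrightarrow> ev n \<phi> x = 0" "transv d c n \<phi> L0"
  obtains S where "finite S" "\<And>x. x \<notin> S \<Longrightarrow> finite {(y,z). ev d c' (v4 1 x y z) = 0 \<and> ev n \<phi>' (v4 1 x y z) = 0}"
proof -
  let ?f = "fr h1 h2 h3 h4"
  obtain p q where pq: "indep2 p q" "L0 = sp p q"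
    and w: "\<And>S. finite S \<Longrightarrow> \<exists>z w. z \<notin> S \<and> D1 d c (p + z *s q) w = 0 \<and> D1 n \<phi> (p + z *s q) w \<noteq> 0"
    using L0(4) unfolding transv_def by blast
  obtain P where P: "?f P = p" using fr_surj[OF bas] .
  obtain Q where Q: "?f Q = q" using fr_surj[OF bas] .
  define \<Delta> where "\<Delta> = P$1 * Q$2 - P$2 * Q$1"
  have nb: "s = 0 \<and> t = 0" if "onb2 (s *s P + t *s Q)" for s t
  proof -
    have in2: "s *s p + t *s q \<in> sp h3 h4" using that unfolding fr_onb(2)[OF bas] fr_add fr_scale P Q .
    have "s *s p + t *s q \<in> L0" unfolding pq(2) by (rule sp_mem)
    then have "s *s p + t *s q = 0" using in2 L0(2) unfolding meets_def by blast
    then show ?thesis using pq(1) unfolding indep2_def by blast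
  qed
  have D: "\<Delta> \<noteq> 0"
  proof
    assume D0: "\<Delta> = 0"
    have 1: "onb2 (Q$2 *s P + (- P$2) *s Q)" "onb2 (Q$1 *s P + (- P$1) *s Q)"
      using D0 unfolding onb \<Delta>_def by (simp_all add: algebra_simps)
    then have "P$1 = 0" "P$2 = 0" using nb[OF 1(1)] nb[OF 1(2)] by auto
    then have "onb2 (1 *s P + 0 *s Q)" by (simp add: onb)
    then show False using nb by fastforce
  qed
  \<comment> \<open>The basis of L0 with first two coordinates (1,0) and (0,1), by Cramer's
    rule.\<close>
  define a where "a = (Q$2/\<Delta>) *s P + (- P$2/\<Delta>) *s Q"
  define b where "b = (- Q$1/\<Delta>) *s P + (P$1/\<Delta>) *s Q"
  have a12: "a$1 = 1" "a$2 = 0" and b12: "b$1 = 0" "b$2 = 1"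
    using D unfolding a_def b_def by (simp_all add: field_simps) (simp_all add: \<Delta>_def algebra_simps)
  have Pab: "P = P$1 *s a + P$2 *s b" "Q = Q$1 *s a + Q$2 *s b"
  proof -
    have "P$1 *s a + P$2 *s b = ((P$1 * Q$2 - P$2 * Q$1) / \<Delta>) *s P" unfolding a_def b_def using D by (simp add: cart_eq field_simps)
    then show "P = P$1 *s a + P$2 *s b" using D by (simp add: \<Delta>_def[symmetric])
    have "Q$1 *s a + Q$2 *s b = ((P$1 * Q$2 - P$2 * Q$1) / \<Delta>) *s Q" unfolding a_def b_def using D by (simp add: cart_eq field_simps)
    then show "Q = Q$1 *s a + Q$2 *s b" using D by (simp add: \<Delta>_def[symmetric])
  qed
  have inL: "?f (s *s a + t *s b) \<in> L0" for s t
  proof -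
    have "?f a \<in> sp p q" "?f b \<in> sp p q" unfolding a_def b_def fr_add fr_scale P Q by (rule sp_mem)+
    then show ?thesis unfolding fr_add fr_scale pq(2) by (intro sp_add sp_scale)
  qed
  have on: "ev d c' (s *s a + t *s b) = 0" "ev n \<phi>' (s *s a + t *s b) = 0" for s t
    using inL[of s t] L0(1,3) unfolding c'(2) p'(2) lines_in_def by auto
  have bab: "basis4 a b (axis 3 1) (axis 4 1)" unfolding basis4_def
  proof (intro conjI allI impI)
    fix x :: "'a^4"
    have "x = x$1 *s a + x$2 *s b + (x$3 - x$1 * a$3 - x$2 * b$3) *s axis 3 1 + (x$4 - x$1 * a$4 - x$2 * b$4) *s axis 4 1"
      by (rule v4_eqI) (simp_all add: a12 b12 axis_def)
    then show "\<exists>\<alpha> \<beta> p q. x = \<alpha> *s a + \<beta> *s b + p *s axis 3 1 + q *s axis 4 1" by blast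
  next
    fix s t p q assume z: "s *s a + t *s b + p *s axis 3 1 + q *s axis 4 1 = 0"
    then have zi: "(s *s a + t *s b + p *s axis 3 1 + q *s axis 4 1) $ i = 0" for i by simp
    have "s = 0" "t = 0" using zi[of 1] zi[of 2] by (simp_all add: a12 b12 axis_def)
    moreover have "p = 0" "q = 0" using zi[of 3] zi[of 4] calculation by (simp_all add: axis_def)
    ultimately show "s = 0" "t = 0" "p = 0" "q = 0" by blast+
  qed
  have sf: "surf d c'" by (rule frame_surf[OF bas c'])
  interpret s': surf d c' by fact
  interpret ch: chart d c' a b
    by unfold_locales (use bab on a12 b12 in auto)
  have Pn: "P$1 \<noteq> 0 \<or> Q$1 \<noteq> 0" using D unfolding \<Delta>_def by auto
  have "finite {z. poly [:P$1,Q$1:] z = 0}" by (rule poly_roots_finite) (use Pn in auto)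
  then obtain z w where zw: "z \<notin> {z. poly [:P$1,Q$1:] z = 0}" "D1 d c (p + z *s q) w = 0" "D1 n \<phi> (p + z *s q) w \<noteq> 0" using w by blast
  define k where "k = P$1 + z * Q$1"
  have k0: "k \<noteq> 0" using zw(1) by (simp add: k_def)
  define z' where "z' = (P$2 + z * Q$2) / k"
  have "P + z *s Q = k *s (a + z' *s b)"
  proof -
    have "P + z *s Q = k *s a + (P$2 + z * Q$2) *s b" by (subst Pab(1), subst Pab(2)) (simp add: k_def cart_eq algebra_simps)
    also have "P$2 + z * Q$2 = k * z'" unfolding z'_def using k0 by simp
    finally show ?thesis by (simp add: vector_add_ldistrib vector_smult_assoc)
  qed
  then have pt: "p + z *s q = k *s ?f (a + z' *s b)" unfolding P[symmetric] Q[symmetric] fr_scale[symmetric] fr_add[symmetric] by simp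
  obtain w' where w': "?f w' = w" using fr_surj[OF bas] .
  have "D1 d c' (ch.pz z') w' = 0" "D1 n \<phi>' (ch.pz z') w' \<noteq> 0"
    using zw(2,3) k0 unfolding pt D1_hscale c'(3) p'(3) w' ch.pz_def by auto
  then have "\<not> Ft d c' dvd Ft n \<phi>'" using ch.Ft_not_dvd[OF p'(1) on(2)] by blast
  then show ?thesis using ch.plane_sections_finite that by blast
qed

text \<open>\<open>quadric_bound\<close> transported to an arbitrary tetrahedron. A line of weight r
  L meets 2 - r L of the three edges, and \<open>aff\<close> keeps it out of the plane at
  infinity.\<close>

theorem net_bound:
  fixes r m :: "('a^4) set \<Rightarrow> nat"
  assumes bas: "basis4 h1 h2 h3 h4" and sn: "supp4 n \<phi>" and e: "e \<le> 1" "e' \<le> 1"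
    and l1: "\<And>x. e = 1 \<Longrightarrow> x \<in> sp h1 h2 \<Longrightarrow> ev d c x = 0 \<and> ev n \<phi> x = 0"
    and l2: "\<And>x. e = 1 \<Longrightarrow> x \<in> sp h3 h4 \<Longrightarrow> ev d c x = 0 \<and> ev n \<phi> x = 0"
    and l3: "\<And>x. e' = 1 \<Longrightarrow> x \<in> sp h1 h3 \<Longrightarrow> ev d c x = 0 \<and> ev n \<phi> x = 0"
    and nl1: "e = 0 \<Longrightarrow> \<exists>x\<in>sp h1 h2. ev d c x \<noteq> 0" and nl2: "e = 0 \<Longrightarrow> \<exists>x\<in>sp h3 h4. ev d c x \<noteq> 0"
    and L0: "L0 \<in> lines_in d c" "\<not> meets L0 (sp h3 h4)" "\<And>x. x \<in> L0 \<Longrightarrow> ev n \<phi> x = 0" "transv d c n \<phi> L0"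
    and M: "finite M" "M \<subseteq> lines_in d c" "\<And>L x. L \<in> M \<Longrightarrow> x \<in> L \<Longrightarrow> ev n \<phi> x = 0"
    and aff: "\<And>L. L \<in> M \<Longrightarrow> \<exists>x\<in>L. \<forall>p q s. x \<noteq> p *s h2 + q *s h3 + s *s h4"
    and rr: "\<And>L. L \<in> M \<Longrightarrow> 1 \<le> r L \<and> r L + of_bool (meets L (sp h1 h2)) + of_bool (meets L (sp h3 h4)) + of_bool (meets L (sp h1 h3)) = 2"
    and mm: "\<And>L. L \<in> M \<Longrightarrow> m L = 1 \<or> m L = 2 \<and> tang d c n \<phi> L"
  shows "(\<Sum>L\<in>M. r L * m L) \<le> (d - 2 * e) * (n - e') + (n - 2 * e) * (d - e')"
proof -
  let ?f = "fr h1 h2 h3 h4"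
  obtain c' where c': "supp4 d c'" "\<And>x. ev d c' x = ev d c (?f x)" "\<And>x v. D1 d c' x v = D1 d c (?f x) (?f v)"
    using frame_form[OF sup] by metis
  obtain \<phi>' where p': "supp4 n \<phi>'" "\<And>x. ev n \<phi>' x = ev n \<phi> (?f x)" "\<And>x v. D1 n \<phi>' x v = D1 n \<phi> (?f x) (?f v)"
    using frame_form[OF sn] by metis
  obtain S0 where S0: "finite S0" "\<And>x. x \<notin> S0 \<Longrightarrow> finite {(y,z). ev d c' (v4 1 x y z) = 0 \<and> ev n \<phi>' (v4 1 x y z) = 0}"
    using frame_sections[OF bas sn c' p' L0] by blast
  interpret s': surf d c' by (rule frame_surf[OF bas c'])
  have fv: "?f (v4 s t 0 0) \<in> sp h1 h2" "?f (v4 0 0 s t) \<in> sp h3 h4" "?f (v4 s 0 t 0) \<in> sp h1 h3" for s t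
    by (simp_all add: fr_onb[OF bas, symmetric] onb)
  interpret q: qnet d c' n \<phi>' e e' S0
  proof unfold_locales
    show "supp4 n \<phi>'" "e \<le> 1" "e' \<le> 1" "finite S0" by (fact p'(1) e S0(1))+
    show "finite {(y,z). ev d c' (v4 1 x y z) = 0 \<and> ev n \<phi>' (v4 1 x y z) = 0}" if "x \<notin> S0" for x by (rule S0(2)[OF that])
    fix s t
    show "ev d c' (v4 s t 0 0) = 0" "ev n \<phi>' (v4 s t 0 0) = 0" if "e = 1" unfolding c'(2) p'(2) using l1[OF that fv(1)] by auto
    show "ev d c' (v4 0 0 s t) = 0" "ev n \<phi>' (v4 0 0 s t) = 0" if "e = 1" unfolding c'(2) p'(2) using l2[OF that fv(2)] by auto
    show "ev d c' (v4 s 0 t 0) = 0" "ev n \<phi>' (v4 s 0 t 0) = 0" if "e' = 1" unfolding c'(2) p'(2) using l3[OF that fv(3)] by auto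
  next
    assume "e = 0"
    then obtain x where x: "x \<in> sp h1 h2" "ev d c x \<noteq> 0" using nl1 by blast
    then obtain s t where "x = s *s h1 + t *s h2" unfolding sp_def by blast
    then have "ev d c' (v4 s t 0 0) \<noteq> 0" using x(2) unfolding c'(2) fr_v4 by simp
    then show "\<exists>s t. ev d c' (v4 s t 0 0) \<noteq> 0" by blast
  next
    assume "e = 0"
    then obtain x where x: "x \<in> sp h3 h4" "ev d c x \<noteq> 0" using nl2 by blast
    then obtain s t where "x = s *s h3 + t *s h4" unfolding sp_def by blast
    then have "ev d c' (v4 0 0 s t) \<noteq> 0" using x(2) unfolding c'(2) fr_v4 by simp
    then show "\<exists>s t. ev d c' (v4 0 0 s t) \<noteq> 0" by blast
  qed
  have line: "is_line L" if "L \<in> M" for L using M(2) that unfolding lines_in_def by blast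
  have bi: "a *s h1 + b *s h2 + p *s h3 + q *s h4 = 0 \<Longrightarrow> a = 0 \<and> b = 0 \<and> p = 0 \<and> q = 0" for a b p q
    using bas unfolding basis4_def by blast
  have i1: "indep2 h1 h2" unfolding indep2_def using bi[of _ _ 0 0] by simp
  have i2: "indep2 h3 h4" unfolding indep2_def using bi[of 0 0] by simp
  have i3: "indep2 h1 h3" unfolding indep2_def using bi[of _ 0 _ 0] by simp
  note ls = is_line_sp[OF i1] is_line_sp[OF i2] is_line_sp[OF i3]
  have hz: "h1 \<noteq> 0" "h3 \<noteq> 0" using indep2_nz[OF i3] by auto
  have notL: "L \<noteq> sp h1 h2" "L \<noteq> sp h3 h4" "L \<noteq> sp h1 h3" if L: "L \<in> M" for L
  proof -
    have m: "meets (sp h1 h2) (sp h1 h2)" "meets (sp h1 h2) (sp h1 h3)" "meets (sp h3 h4) (sp h3 h4)" "meets (sp h3 h4) (sp h1 h3)"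
      "meets (sp h1 h3) (sp h1 h2)" "meets (sp h1 h3) (sp h3 h4)" unfolding meets_def using hz sp_gen by blast+
    show "L \<noteq> sp h1 h2" using rr[OF L] m(1,2) by auto
    show "L \<noteq> sp h3 h4" using rr[OF L] m(3,4) by auto
    show "L \<noteq> sp h1 h3" using rr[OF L] m(5,6) by auto
  qed
  have mt: "onb1 x \<Longrightarrow> meets L (sp h1 h2)" "onb2 x \<Longrightarrow> meets L (sp h3 h4)" "onb3 x \<Longrightarrow> meets L (sp h1 h3)"
    if "?f x \<in> L" "?f x \<noteq> 0" for x L
    using that unfolding fr_onb[OF bas] meets_def by blast+
  \<comment> \<open>A basis of L in frame coordinates whose affine points A + t B avoid all edges;
    an edge can be met only at B.\<close>
  define gd where "gd L A B \<longleftrightarrow> indep2 (?f A) (?f B) \<and> L = sp (?f A) (?f B)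
     \<and> (\<forall>t. \<not> onb1 (A + t *s B) \<and> \<not> onb2 (A + t *s B) \<and> \<not> onb3 (A + t *s B))
     \<and> (r L = 2 \<and> \<not> onb1 B \<and> \<not> onb2 B \<and> \<not> onb3 B \<or>
        r L = 1 \<and> (onb1 B \<and> \<not> onb2 B \<and> \<not> onb3 B \<or> onb2 B \<and> \<not> onb1 B \<and> \<not> onb3 B \<or> onb3 B \<and> \<not> onb1 B \<and> \<not> onb2 B))" for L A B
  have ex: "\<exists>A B. gd L A B"
    if L: "L \<in> M" for L
  proof -
    have nz: "?f (A + t *s B) \<noteq> 0" "?f (A + t *s B) \<in> L" "?f B \<noteq> 0" "?f B \<in> L" if AB: "indep2 (?f A) (?f B)" "L = sp (?f A) (?f B)" for A B t
    proof -
      show "?f (A + t *s B) \<noteq> 0"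
      proof
        assume "?f (A + t *s B) = 0"
        then have "1 *s ?f A + t *s ?f B = 0" by (simp add: fr_add fr_scale)
        then show False using AB(1) unfolding indep2_def by (metis zero_neq_one)
      qed
      show "?f (A + t *s B) \<in> L" using sp_mem[of 1 "?f A" t "?f B"] unfolding AB(2) by (simp add: fr_add fr_scale)
      show "?f B \<noteq> 0" using indep2_nz(2)[OF AB(1)] .
      show "?f B \<in> L" unfolding AB(2) by simp
    qed
    show ?thesis
    proof (cases "r L = 2")
      case True
      then have nm: "\<not> meets L (sp h1 h2)" "\<not> meets L (sp h3 h4)" "\<not> meets L (sp h1 h3)" using rr[OF L] by auto
      obtain p q where pq: "indep2 p q" "L = sp p q" using line[OF L] unfolding is_line_def by blast
      obtain A where A: "?f A = p" using fr_surj[OF bas] .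
      obtain B where B: "?f B = q" using fr_surj[OF bas] .
      have AB: "indep2 (?f A) (?f B)" "L = sp (?f A) (?f B)" using pq A B by simp_all
      note mA = mt[OF nz(2)[OF AB] nz(1)[OF AB]] and mB = mt[OF nz(4)[OF AB] nz(3)[OF AB]]
      have "\<not> onb1 (A + t *s B) \<and> \<not> onb2 (A + t *s B) \<and> \<not> onb3 (A + t *s B)" for t using nm mA[of t] by blast
      moreover have "\<not> onb1 B \<and> \<not> onb2 B \<and> \<not> onb3 B" using nm mB by blast
      ultimately have "gd L A B" using AB True unfolding gd_def by blast
      then show ?thesis by blast
    next
      case False
      then have r1: "r L = 1" using rr[OF L] by linarith
      \<comment> \<open>Puts the intersection with the edge at B; a second point on the edge would
        make L equal to it.\<close>
      have step: "\<exists>A B. indep2 (?f A) (?f B) \<and> L = sp (?f A) (?f B) \<and> ?f B \<in> l \<and> (\<forall>t. ?f (A + t *s B) \<notin> l)"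
        if l: "is_line l" "meets L l" "L \<noteq> l" for l
      proof -
        obtain b where b: "b \<noteq> 0" "b \<in> L" "b \<in> l" using l(2) unfolding meets_def by blast
        obtain v where v: "indep2 b v" "v \<in> L" "L = sp b v" using line_complete[OF line[OF L] b(2,1)] .
        obtain A where A: "?f A = v" using fr_surj[OF bas] .
        obtain B where B: "?f B = b" using fr_surj[OF bas] .
        have AB: "indep2 (?f A) (?f B)" unfolding A B by (rule indep2_sym[OF v(1)])
        have LAB: "L = sp (?f A) (?f B)" by (rule line_sp[OF line[OF L] AB]) (simp_all add: A B v b)
        have "?f (A + t *s B) \<notin> l" for t
        proof
          assume "?f (A + t *s B) \<in> l"
          then have "v + t *s b \<in> l" by (simp add: fr_add fr_scale A B)
          moreover have "t *s b \<in> l" by (rule line_scale[OF l(1) b(3)])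
          ultimately have "v + t *s b - t *s b \<in> l" by (rule line_diff[OF l(1)])
          then have "v \<in> l" by simp
          then have "l = sp b v" by (rule line_sp[OF l(1) v(1) b(3)])
          then show False using v(3) l(3) by simp
        qed
        then show ?thesis using AB LAB B b(3) by blast
      qed
      have "of_bool (meets L (sp h1 h2)) + of_bool (meets L (sp h3 h4)) + of_bool (meets L (sp h1 h3)) = (1::nat)"
        using rr[OF L] r1 by linarith
      then consider "meets L (sp h1 h2)" "\<not> meets L (sp h3 h4)" "\<not> meets L (sp h1 h3)"
        | "\<not> meets L (sp h1 h2)" "meets L (sp h3 h4)" "\<not> meets L (sp h1 h3)"
        | "\<not> meets L (sp h1 h2)" "\<not> meets L (sp h3 h4)" "meets L (sp h1 h3)"
        by (cases "meets L (sp h1 h2)"; cases "meets L (sp h3 h4)"; cases "meets L (sp h1 h3)"; simp)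
      then show ?thesis
      proof cases
        case 1
        obtain A B where AB: "indep2 (?f A) (?f B)" "L = sp (?f A) (?f B)" and o: "?f B \<in> sp h1 h2" "\<And>t. ?f (A + t *s B) \<notin> sp h1 h2"
          using step[OF ls(1) 1(1) notL(1)[OF L]] by blast
        note mA = mt[OF nz(2)[OF AB] nz(1)[OF AB]] and mB = mt[OF nz(4)[OF AB] nz(3)[OF AB]]
        note o' = o[unfolded fr_onb(1)[OF bas, symmetric]]
        have "\<not> onb1 (A + t *s B) \<and> \<not> onb2 (A + t *s B) \<and> \<not> onb3 (A + t *s B)" for t using 1(2,3) mA[of t] o'(2)[of t] by blast
        moreover have "\<not> onb2 B \<and> \<not> onb3 B" using 1(2,3) mB by blast
        ultimately have "gd L A B" using AB r1 o'(1) unfolding gd_def by blast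
      then show ?thesis by blast
      next
        case 2
        obtain A B where AB: "indep2 (?f A) (?f B)" "L = sp (?f A) (?f B)" and o: "?f B \<in> sp h3 h4" "\<And>t. ?f (A + t *s B) \<notin> sp h3 h4"
          using step[OF ls(2) 2(2) notL(2)[OF L]] by blast
        note mA = mt[OF nz(2)[OF AB] nz(1)[OF AB]] and mB = mt[OF nz(4)[OF AB] nz(3)[OF AB]]
        note o' = o[unfolded fr_onb(2)[OF bas, symmetric]]
        have "\<not> onb1 (A + t *s B) \<and> \<not> onb2 (A + t *s B) \<and> \<not> onb3 (A + t *s B)" for t using 2(1,3) mA[of t] o'(2)[of t] by blast
        moreover have "\<not> onb1 B \<and> \<not> onb3 B" using 2(1,3) mB by blast
        ultimately have "gd L A B" using AB r1 o'(1) unfolding gd_def by blast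
      then show ?thesis by blast
      next
        case 3
        obtain A B where AB: "indep2 (?f A) (?f B)" "L = sp (?f A) (?f B)" and o: "?f B \<in> sp h1 h3" "\<And>t. ?f (A + t *s B) \<notin> sp h1 h3"
          using step[OF ls(3) 3(3) notL(3)[OF L]] by blast
        note mA = mt[OF nz(2)[OF AB] nz(1)[OF AB]] and mB = mt[OF nz(4)[OF AB] nz(3)[OF AB]]
        note o' = o[unfolded fr_onb(3)[OF bas, symmetric]]
        have "\<not> onb1 (A + t *s B) \<and> \<not> onb2 (A + t *s B) \<and> \<not> onb3 (A + t *s B)" for t using 3(1,2) mA[of t] o'(2)[of t] by blast
        moreover have "\<not> onb1 B \<and> \<not> onb2 B" using 3(1,2) mB by blast
        ultimately have "gd L A B" using AB r1 o'(1) unfolding gd_def by blast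
      then show ?thesis by blast
      qed
    qed
  qed
  have "\<exists>F. gd L (fst F) (snd F)" if "L \<in> M" for L using ex[OF that] by simp
  then have "\<forall>L\<in>M. \<exists>F. gd L (fst F) (snd F)" by blast
  from bchoice[OF this] obtain F where F: "\<forall>L\<in>M. gd L (fst (F L)) (snd (F L))" by blast
  define A B where "A L = fst (F L)" and "B L = snd (F L)" for L
  have gdL: "gd L (A L) (B L)" if "L \<in> M" for L using F that unfolding A_def B_def by blast
  have AB: "indep2 (?f (A L)) (?f (B L))" "L = sp (?f (A L)) (?f (B L))"
    and off: "\<not> onb1 (A L + t *s B L) \<and> \<not> onb2 (A L + t *s B L) \<and> \<not> onb3 (A L + t *s B L)"
    and rAB: "(r L = 2 \<and> \<not> onb1 (B L) \<and> \<not> onb2 (B L) \<and> \<not> onb3 (B L) \<or>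
        r L = 1 \<and> (onb1 (B L) \<and> \<not> onb2 (B L) \<and> \<not> onb3 (B L) \<or> onb2 (B L) \<and> \<not> onb1 (B L) \<and> \<not> onb3 (B L)
         \<or> onb3 (B L) \<and> \<not> onb1 (B L) \<and> \<not> onb2 (B L)))" if L: "L \<in> M" for L t
  proof -
    note g = gdL[OF L, unfolded gd_def]
    show "indep2 (?f (A L)) (?f (B L))" using g by (rule conjunct1)
    show "L = sp (?f (A L)) (?f (B L))" using g[THEN conjunct2] by (rule conjunct1)
    show "\<not> onb1 (A L + t *s B L) \<and> \<not> onb2 (A L + t *s B L) \<and> \<not> onb3 (A L + t *s B L)"
      using g[THEN conjunct2, THEN conjunct2, THEN conjunct1] by (rule spec)
    show "(r L = 2 \<and> \<not> onb1 (B L) \<and> \<not> onb2 (B L) \<and> \<not> onb3 (B L) \<or>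
        r L = 1 \<and> (onb1 (B L) \<and> \<not> onb2 (B L) \<and> \<not> onb3 (B L) \<or> onb2 (B L) \<and> \<not> onb1 (B L) \<and> \<not> onb3 (B L)
         \<or> onb3 (B L) \<and> \<not> onb1 (B L) \<and> \<not> onb2 (B L)))" using g[THEN conjunct2, THEN conjunct2] by (rule conjunct2)
  qed
  have fL: "?f (s *s A L + t *s B L) \<in> L" if "L \<in> M" for L s t
    using sp_mem[of s "?f (A L)" t "?f (B L)"] AB(2)[OF that] by (simp add: fr_add fr_scale)
  define T where "T L = (SOME T. finite T \<and> (\<forall>t w. t \<notin> T \<longrightarrow> D1 d c (?f (A L) + t *s ?f (B L)) w = 0 \<longrightarrow> D1 n \<phi> (?f (A L) + t *s ?f (B L)) w = 0))" for L
  show ?thesis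
  proof (rule q.quadric_bound[where A=A and B=B and T=T, OF M(1)])
    fix L assume L: "L \<in> M"
    show "indep2 (A L) (B L)" unfolding indep2_def
    proof (intro allI impI)
      fix s t assume "s *s A L + t *s B L = 0"
      then have "?f (s *s A L + t *s B L) = 0" by (simp add: fr_def)
      then show "s = 0 \<and> t = 0" using AB(1)[OF L] unfolding fr_add fr_scale indep2_def by blast
    qed
    show "ev d c' (s *s A L + t *s B L) = 0" "ev n \<phi>' (s *s A L + t *s B L) = 0" for s t
      unfolding c'(2) p'(2) using fL[OF L] M(2,3) L unfolding lines_in_def by blast+
    show "\<not> onb1 (A L + t *s B L) \<and> \<not> onb2 (A L + t *s B L) \<and> \<not> onb3 (A L + t *s B L)" for t by (rule off[OF L])
    show "r L = 2 \<and> \<not> onb1 (B L) \<and> \<not> onb2 (B L) \<and> \<not> onb3 (B L) \<or>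
        r L = 1 \<and> (onb1 (B L) \<and> \<not> onb2 (B L) \<and> \<not> onb3 (B L) \<or> onb2 (B L) \<and> \<not> onb1 (B L) \<and> \<not> onb3 (B L)
         \<or> onb3 (B L) \<and> \<not> onb1 (B L) \<and> \<not> onb2 (B L))" by (rule rAB[OF L])
    show "A L $ 1 \<noteq> 0 \<or> B L $ 1 \<noteq> 0"
    proof (rule ccontr)
      assume z: "\<not> ?thesis"
      obtain x where x: "x \<in> L" "\<And>p q s. x \<noteq> p *s h2 + q *s h3 + s *s h4" using aff[OF L] by blast
      obtain s t where "x = s *s ?f (A L) + t *s ?f (B L)" using x(1) AB(2)[OF L] unfolding sp_def by blast
      then have "x = ?f (s *s A L + t *s B L)" by (simp add: fr_add fr_scale)
      also have "\<dots> = (s *s A L + t *s B L)$2 *s h2 + (s *s A L + t *s B L)$3 *s h3 + (s *s A L + t *s B L)$4 *s h4"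
        unfolding fr_def using z by simp
      finally show False using x(2) by blast
    qed
    show "m L = 1 \<or> m L = 2 \<and> finite (T L) \<and> (\<forall>t w. t \<notin> T L \<longrightarrow> D1 d c' (A L + t *s B L) w = 0 \<longrightarrow> D1 n \<phi>' (A L + t *s B L) w = 0)"
    proof (cases "m L = 1")
      case False
      then have m2: "m L = 2" and tg: "tang d c n \<phi> L" using mm[OF L] by auto
      have "\<exists>T. finite T \<and> (\<forall>t w. t \<notin> T \<longrightarrow> D1 d c (?f (A L) + t *s ?f (B L)) w = 0 \<longrightarrow> D1 n \<phi> (?f (A L) + t *s ?f (B L)) w = 0)"
        using tg AB(1)[OF L] AB(2)[OF L] unfolding tang_def by blast
      from someI_ex[OF this] have "finite (T L) \<and> (\<forall>t w. t \<notin> T L \<longrightarrow> D1 d c (?f (A L) + t *s ?f (B L)) w = 0 \<longrightarrow> D1 n \<phi> (?f (A L) + t *s ?f (B L)) w = 0)"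
        unfolding T_def .
      then show ?thesis using m2 unfolding c'(3) p'(3) fr_add fr_scale by blast
    qed simp
  next
    fix L L' assume L: "L \<in> M" "L' \<in> M" "L \<noteq> L'"
    show "sp (A L) (B L) \<noteq> sp (A L') (B L')"
    proof
      assume eq: "sp (A L) (B L) = sp (A L') (B L')"
      have im: "K = ?f ` sp (A K) (B K)" if "K \<in> M" for K
      proof -
        have "?f ` sp (A K) (B K) = sp (?f (A K)) (?f (B K))" unfolding sp_def by (auto simp: fr_add fr_scale image_iff)+ (metis fr_add fr_scale)?
        then show ?thesis using AB(2)[OF that] by simp
      qed
      show False using im[OF L(1)] im[OF L(2)] eq L(3) by metis
    qed
  qed
qed

end

section \<open>Generic frames\<close>

definition rows4 :: "'a^4 \<Rightarrow> 'a^4 \<Rightarrow> 'a^4 \<Rightarrow> 'a^4 \<Rightarrow> 'a^4^4" where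
  "rows4 p q r s = (\<chi> i. if i = 1 then p else if i = 2 then q else if i = 3 then r else s)"
text \<open>Skewness of two lines as the nonvanishing of a function to which
  \<open>generic_point\<close> applies.\<close>

definition dt :: "'a::field^4 \<Rightarrow> 'a^4 \<Rightarrow> 'a^4 \<Rightarrow> 'a^4 \<Rightarrow> 'a" where "dt p q r s = Determinants.det (rows4 p q r s)"

lemma dt_indep: "dt p q r s \<noteq> 0 \<longleftrightarrow> (\<forall>a b c e. a *s p + b *s q + c *s r + e *s s = 0 \<longrightarrow> a = 0 \<and> b = 0 \<and> c = 0 \<and> e = 0)"
proof -
  have "dt p q r s \<noteq> 0 \<longleftrightarrow> (\<forall>c. sum (\<lambda>i. c i *s row i (rows4 p q r s)) UNIV = 0 \<longrightarrow> (\<forall>i. c i = 0))"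
    unfolding dt_def invertible_det_nz[symmetric] invertible_right_inverse matrix_right_invertible_independent_rows ..
  also have "\<dots> \<longleftrightarrow> (\<forall>c::4 \<Rightarrow> 'a. c 1 *s p + c 2 *s q + c 3 *s r + c 4 *s s = 0 \<longrightarrow> c 1 = 0 \<and> c 2 = 0 \<and> c 3 = 0 \<and> c 4 = 0)"
  proof -
    have rw: "row 1 (rows4 p q r s) = p" "row 2 (rows4 p q r s) = q" "row 3 (rows4 p q r s) = r" "row 4 (rows4 p q r s) = s"
      by (simp_all add: Finite_Cartesian_Product.row_def rows4_def cart_eq)
    show ?thesis unfolding sum_4 rw forall_4 ..
  qed
  also have "\<dots> \<longleftrightarrow> (\<forall>a b c e. a *s p + b *s q + c *s r + e *s s = 0 \<longrightarrow> a = 0 \<and> b = 0 \<and> c = 0 \<and> e = 0)"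
  proof (intro iffI allI impI)
    fix a b c' e assume h: "\<forall>c::4 \<Rightarrow> 'a. c 1 *s p + c 2 *s q + c 3 *s r + c 4 *s s = 0 \<longrightarrow> c 1 = 0 \<and> c 2 = 0 \<and> c 3 = 0 \<and> c 4 = (0::'a)"
      and z: "a *s p + b *s q + c' *s r + e *s s = 0"
    show "a = 0 \<and> b = 0 \<and> c' = 0 \<and> e = 0"
      using h[rule_format, of "\<lambda>i. v4 a b c' e $ i"] z by simp
  next
    fix c' :: "4 \<Rightarrow> 'a" assume h: "\<forall>a b c e. a *s p + b *s q + c *s r + e *s s = 0 \<longrightarrow> a = 0 \<and> b = 0 \<and> c = 0 \<and> e = 0"
      and z: "c' 1 *s p + c' 2 *s q + c' 3 *s r + c' 4 *s s = 0"
    show "c' 1 = 0 \<and> c' 2 = 0 \<and> c' 3 = 0 \<and> c' 4 = 0" using h[rule_format, OF z] by simp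
  qed
  finally show ?thesis .
qed

lemma dt_swap: assumes "dt p q r s \<noteq> 0" shows "dt p q s r \<noteq> 0"
  unfolding dt_indep
proof (intro allI impI)
  fix a b c e assume "a *s p + b *s q + c *s s + e *s r = 0"
  then have "a *s p + b *s q + e *s r + c *s s = 0" by (simp add: ac_simps)
  then show "a = 0 \<and> b = 0 \<and> c = 0 \<and> e = 0" using assms unfolding dt_indep by blast
qed

lemma dt_basis: "dt p q r s \<noteq> 0 \<Longrightarrow> indep2 p q" "dt p q r s \<noteq> 0 \<Longrightarrow> indep2 r s" "dt p q r s \<noteq> 0 \<Longrightarrow> \<not> meets (sp p q) (sp r s)"
proof -
  assume "dt p q r s \<noteq> 0"
  then have i: "a *s p + b *s q + c *s r + e *s s = 0 \<Longrightarrow> a = 0 \<and> b = 0 \<and> c = 0 \<and> e = 0" for a b c e unfolding dt_indep by blast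
  show "indep2 p q" unfolding indep2_def using i[of _ _ 0 0] by simp
  show "indep2 r s" unfolding indep2_def using i[of 0 0] by simp
  show "\<not> meets (sp p q) (sp r s)"
  proof
    assume "meets (sp p q) (sp r s)"
    then obtain x where x: "x \<noteq> 0" "x \<in> sp p q" "x \<in> sp r s" unfolding meets_def by blast
    obtain a b where ab: "x = a *s p + b *s q" using x(2) unfolding sp_def by blast
    obtain a' b' where ab': "x = a' *s r + b' *s s" using x(3) unfolding sp_def by blast
    have "a *s p + b *s q + (- a') *s r + (- b') *s s = x - (a' *s r + b' *s s)" unfolding ab by (simp add: cart_eq algebra_simps)
    also have "\<dots> = 0" unfolding ab'[symmetric] by simp
    finally have "a = 0" "b = 0" using i by blast+
    then show False using x(1) ab by simp
  qed
qed

lemma dt_of_basis4: "basis4 p q r s \<Longrightarrow> dt p q r s \<noteq> 0" unfolding dt_indep basis4_def by blast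

lemma pline_sum: "(\<And>i. i \<in> I \<Longrightarrow> pline (f i)) \<Longrightarrow> pline (\<lambda>v. \<Sum>i\<in>I. f i v)"
  by (induction I rule: infinite_finite_induct) (auto intro: pline_const pline_add)
lemma pline_prod: "(\<And>i. i \<in> I \<Longrightarrow> pline (f i)) \<Longrightarrow> pline (\<lambda>v. \<Prod>i\<in>I. f i v)"
  by (induction I rule: infinite_finite_induct) (auto intro: pline_const pline_mult)
lemma pline_dt:
  assumes "\<And>i. pline (\<lambda>v. p v $ i)" "\<And>i. pline (\<lambda>v. q v $ i)" "\<And>i. pline (\<lambda>v. r v $ i)" "\<And>i. pline (\<lambda>v. s v $ i)"
  shows "pline (\<lambda>v. dt (p v) (q v) (r v) (s v))"
proof -
  have "pline (\<lambda>v. rows4 (p v) (q v) (r v) (s v) $ i $ j)" for i j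
    using exhaust_4[of i] assms by (auto simp: rows4_def)
  then show ?thesis unfolding dt_def Determinants.det_def by (intro pline_sum pline_mult pline_prod pline_const)
qed

lemma line_not_sub: assumes "is_line L" "is_line K" "L \<noteq> K" obtains y where "y \<in> L" "y \<notin> K"
proof -
  obtain a b where ab: "indep2 a b" "L = sp a b" using assms(1) unfolding is_line_def by blast
  have "a \<notin> K \<or> b \<notin> K" using line_sp[OF assms(2) ab(1)] ab(2) assms(3) by blast
  then show ?thesis using that[of a] that[of b] ab(2) by auto
qed

text \<open>Modulo the line pq, the vector h is a nonzero combination of a and b, so it is
  independent of one of them.\<close>

lemma skew_pick:
  fixes p q a b h :: "'a::field^4"
  assumes "basis4 p q a b" "h \<notin> sp p q" shows "dt p q a h \<noteq> 0 \<or> dt p q b h \<noteq> 0"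
proof -
  obtain x y z w where h: "h = x *s p + y *s q + z *s a + w *s b" using assms(1) unfolding basis4_def by meson
  have i: "s *s p + t *s q + u *s a + v *s b = 0 \<Longrightarrow> s = 0 \<and> t = 0 \<and> u = 0 \<and> v = 0" for s t u v using assms(1) unfolding basis4_def by blast
  have "z \<noteq> 0 \<or> w \<noteq> 0"
  proof (rule ccontr)
    assume "\<not> ?thesis"
    then have "h = x *s p + y *s q" using h by simp
    then show False using assms(2) sp_mem by metis
  qed
  then show ?thesis
  proof
    assume w: "z \<noteq> 0"
    have "dt p q b h \<noteq> 0" unfolding dt_indep
    proof (intro allI impI)
      fix s t u v assume "s *s p + t *s q + u *s b + v *s h = 0"
      then have "(s + v * x) *s p + (t + v * y) *s q + (v * z) *s a + (u + v * w) *s b = 0" unfolding h by (simp add: cart_eq algebra_simps)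
      from i[OF this] show "s = 0 \<and> t = 0 \<and> u = 0 \<and> v = 0" using w by auto
    qed
    then show ?thesis ..
  next
    assume w: "w \<noteq> 0"
    have "dt p q a h \<noteq> 0" unfolding dt_indep
    proof (intro allI impI)
      fix s t u v assume "s *s p + t *s q + u *s a + v *s h = 0"
      then have "(s + v * x) *s p + (t + v * y) *s q + (u + v * z) *s a + (v * w) *s b = 0" unfolding h by (simp add: cart_eq algebra_simps)
      from i[OF this] show "s = 0 \<and> t = 0 \<and> u = 0 \<and> v = 0" using w by auto
    qed
    then show ?thesis ..
  qed
qed

text \<open>Replacing b by b + t h1 keeps the edge but turns the plane at infinity about the
  opposite edge; every line other than that edge lies in it for at most one t.\<close>

lemma affine_frame:
  fixes h1 b h3 h4 :: "'a::alg_closed_field^4"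
  assumes bas: "basis4 h1 b h3 h4" and M: "finite M" "\<And>L. L \<in> M \<Longrightarrow> is_line L \<and> L \<noteq> sp h3 h4"
  obtains h2 where "basis4 h1 h2 h3 h4" "sp h1 h2 = sp h1 b" "\<And>L. L \<in> M \<Longrightarrow> \<exists>x\<in>L. \<forall>p q s. x \<noteq> p *s h2 + q *s h3 + s *s h4"
proof -
  have i: "s *s h1 + t *s b + u *s h3 + v *s h4 = 0 \<Longrightarrow> s = 0 \<and> t = 0 \<and> u = 0 \<and> v = 0" for s t u v using bas unfolding basis4_def by blast
  have l34: "is_line (sp h3 h4)" by (rule is_line_sp) (use i[of 0 0] in \<open>simp add: indep2_def\<close>)
  define good where "good L t \<longleftrightarrow> (\<exists>x\<in>L. \<forall>p q s. x \<noteq> p *s (b + t *s h1) + q *s h3 + s *s h4)" for L t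
  have fin: "finite {t. \<not> good L t}" if L: "L \<in> M" for L
  proof -
    obtain y where y: "y \<in> L" "y \<notin> sp h3 h4" using line_not_sub[of L "sp h3 h4"] M(2)[OF L] l34 by blast
    obtain y1 y2 y3 y4 where ye: "y = y1 *s h1 + y2 *s b + y3 *s h3 + y4 *s h4" using bas unfolding basis4_def by meson
    have nz: "y1 \<noteq> 0 \<or> y2 \<noteq> 0"
    proof (rule ccontr)
      assume "\<not> ?thesis"
      then have "y = y3 *s h3 + y4 *s h4" using ye by simp
      then show False using y(2) sp_mem by metis
    qed
    have "{t. \<not> good L t} \<subseteq> {t. poly [:y1, - y2:] t = 0}"
    proof
      fix t assume "t \<in> {t. \<not> good L t}"
      then obtain p q s where "y = p *s (b + t *s h1) + q *s h3 + s *s h4" using y(1) unfolding good_def by blast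
      then have "(y1 - p * t) *s h1 + (y2 - p) *s b + (y3 - q) *s h3 + (y4 - s) *s h4 = 0" using ye by (simp add: cart_eq algebra_simps)
      from i[OF this] show "t \<in> {t. poly [:y1, - y2:] t = 0}" by (auto simp: algebra_simps)
    qed
    moreover have "finite {t. poly [:y1, - y2:] t = 0}" by (rule poly_roots_finite) (use nz in auto)
    ultimately show ?thesis by (rule finite_subset)
  qed
  then have "finite (\<Union>L\<in>M. {t. \<not> good L t})" using M(1) by blast
  then obtain t where t: "t \<notin> (\<Union>L\<in>M. {t. \<not> good L t})" using avoid_finite by blast
  define h2 where "h2 = b + t *s h1"
  have "basis4 h1 h2 h3 h4" unfolding basis4_def
  proof (intro conjI allI impI)
    fix x
    obtain x1 x2 x3 x4 where "x = x1 *s h1 + x2 *s b + x3 *s h3 + x4 *s h4" using bas unfolding basis4_def by meson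
    then have "x = (x1 - x2 * t) *s h1 + x2 *s h2 + x3 *s h3 + x4 *s h4" unfolding h2_def by (simp add: cart_eq algebra_simps)
    then show "\<exists>a b p q. x = a *s h1 + b *s h2 + p *s h3 + q *s h4" by blast
  next
    fix s u p q assume "s *s h1 + u *s h2 + p *s h3 + q *s h4 = 0"
    then have "(s + u * t) *s h1 + u *s b + p *s h3 + q *s h4 = 0" unfolding h2_def by (simp add: cart_eq algebra_simps)
    from i[OF this] show "s = 0" "u = 0" "p = 0" "q = 0" by auto
  qed
  moreover have "sp h1 h2 = sp h1 b"
  proof (rule sp_eq)
    show "indep2 h1 h2" unfolding indep2_def using calculation unfolding basis4_def by (metis add.right_neutral vector_smult_lzero)
    show "h2 \<in> sp h1 b" unfolding h2_def by (intro sp_add sp_scale sp_gen)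
  qed simp
  moreover have "\<exists>x\<in>L. \<forall>p q s. x \<noteq> p *s h2 + q *s h3 + s *s h4" if "L \<in> M" for L
    using t that unfolding good_def h2_def by blast
  ultimately show ?thesis by (rule that)
qed

lemma LS_line: "L \<in> lines_in d c \<Longrightarrow> is_line L" unfolding lines_in_def by blast
lemma LS_ev: "L \<in> lines_in d c \<Longrightarrow> x \<in> L \<Longrightarrow> ev d c x = 0" unfolding lines_in_def by blast
lemma meets_sym: "meets L K \<longleftrightarrow> meets K L" unfolding meets_def by blast
lemma meets_self: assumes "is_line L" shows "meets L L"
proof -
  obtain a b where "indep2 a b" "L = sp a b" using assms unfolding is_line_def by blast
  then show ?thesis using indep2_nz(1)[of a b] sp_gen(1)[of a b] unfolding meets_def by blast
qed

context surf begin

text \<open>Truncated subtraction is intended: a line meeting two or three edges gets weight 0 and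
  is dropped before \<open>net_bound\<close> is applied.\<close>

lemma net_bound':
  fixes m :: "('a^4) set \<Rightarrow> nat"
  assumes bas: "basis4 h1 b h3 h4" and sn: "supp4 n \<phi>" and e: "e \<le> 1" "e' \<le> 1"
    and l1: "\<And>x. e = 1 \<Longrightarrow> x \<in> sp h1 b \<Longrightarrow> ev d c x = 0 \<and> ev n \<phi> x = 0"
    and l2: "\<And>x. e = 1 \<Longrightarrow> x \<in> sp h3 h4 \<Longrightarrow> ev d c x = 0 \<and> ev n \<phi> x = 0"
    and l3: "\<And>x. e' = 1 \<Longrightarrow> x \<in> sp h1 h3 \<Longrightarrow> ev d c x = 0 \<and> ev n \<phi> x = 0"
    and nl1: "e = 0 \<Longrightarrow> \<exists>x\<in>sp h1 b. ev d c x \<noteq> 0" and nl2: "e = 0 \<Longrightarrow> \<exists>x\<in>sp h3 h4. ev d c x \<noteq> 0"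
    and L0: "L0 \<in> lines_in d c" "\<not> meets L0 (sp h3 h4)" "\<And>x. x \<in> L0 \<Longrightarrow> ev n \<phi> x = 0" "transv d c n \<phi> L0"
    and M: "finite M" "M \<subseteq> lines_in d c" "\<And>L x. L \<in> M \<Longrightarrow> x \<in> L \<Longrightarrow> ev n \<phi> x = 0"
    and mm: "\<And>L. L \<in> M \<Longrightarrow> m L = 1 \<or> m L = 2 \<and> tang d c n \<phi> L"
  shows "(\<Sum>L\<in>M. (2 - (of_bool (meets L (sp h1 b)) + of_bool (meets L (sp h3 h4)) + of_bool (meets L (sp h1 h3)))) * m L)
     \<le> (d - 2 * e) * (n - e') + (n - 2 * e) * (d - e')"
proof -
  define cnt :: "('a^4) set \<Rightarrow> nat" where "cnt L = of_bool (meets L (sp h1 b)) + of_bool (meets L (sp h3 h4)) + of_bool (meets L (sp h1 h3))" for L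
  define M' where "M' = {L\<in>M. cnt L \<le> 1}"
  have ln: "is_line L" if "L \<in> M'" for L using that M(2) LS_line unfolding M'_def by blast
  have i: "s *s h1 + t *s b + u *s h3 + v *s h4 = 0 \<Longrightarrow> s = 0 \<and> t = 0 \<and> u = 0 \<and> v = 0" for s t u v using bas unfolding basis4_def by blast
  have "h3 \<noteq> 0" using i[of 0 0 1 0] by auto
  then have "meets (sp h3 h4) (sp h3 h4)" "meets (sp h3 h4) (sp h1 h3)" unfolding meets_def using sp_gen by blast+
  then have c2: "cnt (sp h3 h4) \<ge> 2" unfolding cnt_def by simp
  have "finite M'" unfolding M'_def using M(1) by simp
  moreover have "is_line L \<and> L \<noteq> sp h3 h4" if "L \<in> M'" for L using ln[OF that] that c2 unfolding M'_def by auto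
  ultimately obtain h2 where h2: "basis4 h1 h2 h3 h4" "sp h1 h2 = sp h1 b" "\<And>L. L \<in> M' \<Longrightarrow> \<exists>x\<in>L. \<forall>p q s. x \<noteq> p *s h2 + q *s h3 + s *s h4"
    using affine_frame[OF bas] by blast
  have "(\<Sum>L\<in>M. (2 - cnt L) * m L) = (\<Sum>L\<in>M'. (2 - cnt L) * m L)"
    by (rule sum.mono_neutral_right) (auto simp: M'_def M(1))
  also have "\<dots> \<le> (d - 2 * e) * (n - e') + (n - 2 * e) * (d - e')"
  proof (rule net_bound[OF h2(1) sn e _ _ _ _ _ L0(1) _ L0(3,4), where M=M'])
    show "M' \<subseteq> lines_in d c" using M(2) unfolding M'_def by blast
    fix L assume L: "L \<in> M'"
    show "1 \<le> 2 - cnt L \<and> 2 - cnt L + of_bool (meets L (sp h1 h2)) + of_bool (meets L (sp h3 h4)) + of_bool (meets L (sp h1 h3)) = 2"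
      using L unfolding h2(2) M'_def cnt_def by auto
    show "m L = 1 \<or> m L = 2 \<and> tang d c n \<phi> L" using mm L unfolding M'_def by blast
    show "ev n \<phi> x = 0" if "x \<in> L" for x using M(3) L that unfolding M'_def by blast
  qed (use l1 l2 l3 nl1 nl2 h2(2,3) L0(2) \<open>finite M'\<close> in auto)
  finally show ?thesis unfolding cnt_def .
qed

lemma ev_nonzero: obtains x where "ev d c x \<noteq> 0"
proof (rule ccontr)
  assume "\<not> thesis"
  then have z: "ev d c x = 0" for x using that by blast
  have "D1 d c x v = 0" for x v
  proof -
    have "ev d (cl c) (lin x v) = 0" by (rule poly_all_zero) (simp add: poly_ev z)
    then show ?thesis using coeff1_ev[OF sup, of x v] by simp
  qed
  moreover have "v4 1 0 0 0 \<noteq> (0::'a^4)"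
  proof
    assume "v4 1 0 0 0 = (0::'a^4)"
    then have "v4 1 0 0 0 $ 1 = (0::'a^4) $ 1" by simp
    then show False by simp
  qed
  ultimately show False using sm z unfolding smooth4_def by blast
qed

text \<open>Bezout in degrees d and n, with all three edges skew to all lines and no factors
  removed: every line meets the quadric twice, and the bidegrees (d,d) and (n,n) give 2dn.\<close>

theorem generic_bound:
  fixes m :: "('a^4) set \<Rightarrow> nat"
  assumes sn: "supp4 n \<phi>"
    and M: "finite M" "M \<subseteq> lines_in d c" "\<And>L x. L \<in> M \<Longrightarrow> x \<in> L \<Longrightarrow> ev n \<phi> x = 0"
    and L0: "L0 \<in> M" "transv d c n \<phi> L0"
    and mm: "\<And>L. L \<in> M \<Longrightarrow> m L = 1 \<or> m L = 2 \<and> tang d c n \<phi> L"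
  shows "(\<Sum>L\<in>M. m L) \<le> d * n"
proof -
  have "\<exists>p q. indep2 p q \<and> L = sp p q" if "L \<in> M" for L using M(2) that LS_line unfolding is_line_def by blast
  then obtain P Q where PQ: "\<And>L. L \<in> M \<Longrightarrow> indep2 (P L) (Q L)" "\<And>L. L \<in> M \<Longrightarrow> L = sp (P L) (Q L)" by metis
  \<comment> \<open>The four frame vectors are the rows of one point of K^16, so a single generic
    choice serves all conditions.\<close>
  define H :: "'a^(4\<times>4) \<Rightarrow> 4 \<Rightarrow> 'a^4" where "H v k = (\<chi> i. v $ (k,i))" for v k
  have mk: "\<exists>v. \<forall>k. H v k = f k" for f
    by (rule exI[of _ "\<chi> ki. f (fst ki) $ snd ki"]) (simp add: H_def cart_eq)
  have pH: "pline (\<lambda>v. H v k $ i)" for k i unfolding H_def using pline_coord by simp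
  have Hl: "H (v + t *s w) k = H v k + t *s H w k" for v w t k unfolding H_def by (simp add: cart_eq)
  have cst: "pline (\<lambda>v::'a^(4\<times>4). x $ i)" for x :: "'a^4" and i by (rule pline_const)
  have dtn: "\<exists>v. dt (P L) (Q L) (H v k) (H v l) \<noteq> 0" if "L \<in> M" "k \<noteq> l" for L k l
  proof -
    have i: "indep2 (P L) (Q L)" and kl: "k \<noteq> l" using PQ(1) that by auto
    obtain g h where "basis4 (P L) (Q L) g h" using basis4_extend[OF i] .
    then have "dt (P L) (Q L) g h \<noteq> 0" by (rule dt_of_basis4)
    moreover obtain v where "\<forall>j. H v j = (if j = k then g else h)" using mk[of "\<lambda>j. if j = k then g else h"] by blast
    ultimately show ?thesis using kl by (intro exI[of _ v]) auto
  qed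
  define F1 where "F1 = {\<lambda>v. dt (H v 1) (H v 2) (H v 3) (H v 4)}"
  define F2 where "F2 = (\<lambda>k v. ev d c (H v k)) ` {1,3}"
  define F3 where "F3 = (\<lambda>q v. dt (P (fst q)) (Q (fst q)) (H v (fst (snd q))) (H v (snd (snd q)))) ` (M \<times> {(1,2),(3,4),(1,3)})"
  have g1: "goodF F1"
  proof -
    obtain v where v: "\<forall>k. H v k = axis k 1" using mk[of "\<lambda>k. axis k 1"] by blast
    have "dt (axis 1 1) (axis 2 1) (axis 3 1) (axis 4 (1::'a)) \<noteq> 0" unfolding dt_indep
    proof (intro allI impI)
      fix a b p q :: 'a assume "a *s axis 1 1 + b *s axis 2 1 + p *s axis 3 1 + q *s axis 4 1 = (0::'a^4)"
      then have z: "(a *s axis 1 1 + b *s axis 2 1 + p *s axis 3 1 + q *s axis 4 1 :: 'a^4) $ i = 0" for i by simp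
      show "a = 0 \<and> b = 0 \<and> p = 0 \<and> q = 0" using z[of 1] z[of 2] z[of 3] z[of 4] by (simp add: axis_def)
    qed
    then have "\<exists>v. dt (H v 1) (H v 2) (H v 3) (H v 4) \<noteq> 0" using v by metis
    then show ?thesis unfolding goodF_def F1_def by (auto intro!: pline_dt pH)
  qed
  have g2: "goodF F2" unfolding F2_def
  proof (rule goodF_image)
    obtain x where x: "ev d c x \<noteq> 0" using ev_nonzero .
    obtain v where v: "\<forall>k. H v k = x" using mk[of "\<lambda>k. x"] by blast
    show "\<exists>v. ev d c (H v k) \<noteq> 0" for k using x v by (intro exI[of _ v]) simp
    show "pline (\<lambda>v. ev d c (H v k))" for k by (rule pline_ev) (rule Hl)
  qed simp
  have g3: "goodF F3" unfolding F3_def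
  proof (rule goodF_image)
    show "finite (M \<times> {(1::4,2::4),(3,4),(1,3)})" using M(1) by simp
    show "pline (\<lambda>v. dt (P (fst q)) (Q (fst q)) (H v (fst (snd q))) (H v (snd (snd q))))" for q by (intro pline_dt pH cst)
    show "\<exists>v. dt (P (fst q)) (Q (fst q)) (H v (fst (snd q))) (H v (snd (snd q))) \<noteq> 0" if "q \<in> M \<times> {(1,2),(3,4),(1,3)}" for q
      by (rule dtn) (use that in auto)
  qed
  have "goodF (F1 \<union> F2 \<union> F3)" by (intro goodF_Un g1 g2 g3)
  then obtain v where v: "\<And>f. f \<in> F1 \<union> F2 \<union> F3 \<Longrightarrow> f v \<noteq> 0" using generic_point[of "F1 \<union> F2 \<union> F3"] unfolding goodF_def by blast
  have b: "dt (H v 1) (H v 2) (H v 3) (H v 4) \<noteq> 0" using v[of "\<lambda>v. dt (H v 1) (H v 2) (H v 3) (H v 4)"] unfolding F1_def by simp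
  have bas: "basis4 (H v 1) (H v 2) (H v 3) (H v 4)" by (rule basis4_of_skew[OF dt_basis[OF b]])
  have evk: "ev d c (H v k) \<noteq> 0" if "k \<in> {1,3}" for k
  proof -
    have "(\<lambda>v. ev d c (H v k)) \<in> F2" unfolding F2_def using that by blast
    then show ?thesis using v[of "\<lambda>v. ev d c (H v k)"] by blast
  qed
  have sk: "\<not> meets L (sp (H v k) (H v l))" if "L \<in> M" "(k,l) \<in> {(1,2),(3,4),(1,3)}" for L k l
  proof -
    have "(\<lambda>v. dt (P (fst (L,k,l))) (Q (fst (L,k,l))) (H v (fst (snd (L,k,l)))) (H v (snd (snd (L,k,l))))) \<in> F3"
      unfolding F3_def by (rule imageI) (use that in blast)
    then have "dt (P L) (Q L) (H v k) (H v l) \<noteq> 0"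
      using v[of "\<lambda>v. dt (P (fst (L,k,l))) (Q (fst (L,k,l))) (H v (fst (snd (L,k,l)))) (H v (snd (snd (L,k,l))))"] by simp
    from dt_basis(3)[OF this] show ?thesis using PQ(2)[OF that(1)] by simp
  qed
  have "(\<Sum>L\<in>M. (2 - (of_bool (meets L (sp (H v 1) (H v 2))) + of_bool (meets L (sp (H v 3) (H v 4))) + of_bool (meets L (sp (H v 1) (H v 3))))) * m L)
     \<le> (d - 2 * 0) * (n - 0) + (n - 2 * 0) * (d - 0)"
  proof (rule net_bound'[OF bas sn _ _ _ _ _ _ _ _ _ _ L0(2) M mm])
    show "\<exists>x\<in>sp (H v 1) (H v 2). ev d c x \<noteq> 0" using evk[of 1] by (intro bexI[of _ "H v 1"]) simp_all
    show "\<exists>x\<in>sp (H v 3) (H v 4). ev d c x \<noteq> 0" using evk[of 3] by (intro bexI[of _ "H v 3"]) simp_all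
    show "L0 \<in> lines_in d c" using L0(1) M(2) by blast
    show "\<not> meets L0 (sp (H v 3) (H v 4))" by (rule sk[OF L0(1)]) simp
    show "ev n \<phi> x = 0" if "x \<in> L0" for x by (rule M(3)[OF L0(1) that])
  qed auto
  moreover have "(\<Sum>L\<in>M. (2 - (of_bool (meets L (sp (H v 1) (H v 2))) + of_bool (meets L (sp (H v 3) (H v 4))) + of_bool (meets L (sp (H v 1) (H v 3))))) * m L)
     = (\<Sum>L\<in>M. 2 * m L)" by (rule sum.cong) (use sk in simp_all)
  moreover have "(\<Sum>L\<in>M. 2 * m L) = 2 * (\<Sum>L\<in>M. m L)" by (rule sum_distrib_left[symmetric])
  moreover have "(d - 2 * 0) * (n - 0) + (n - 2 * 0) * (d - 0) = 2 * (d * n)" by simp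
  ultimately show ?thesis by linarith
qed

text \<open>The frame is the chain itself: h1 and h3 are the points where l3 meets l1 and
  l2.\<close>

theorem chain_bound:
  fixes m :: "('a^4) set \<Rightarrow> nat"
  assumes sn: "supp4 n \<phi>"
    and l: "l1 \<in> lines_in d c" "l2 \<in> lines_in d c" "l3 \<in> lines_in d c" "\<not> meets l1 l2" "meets l3 l1" "meets l3 l2"
    and z: "\<And>x. x \<in> l1 \<Longrightarrow> ev n \<phi> x = 0" "\<And>x. x \<in> l2 \<Longrightarrow> ev n \<phi> x = 0" "\<And>x. x \<in> l3 \<Longrightarrow> ev n \<phi> x = 0"
    and t: "transv d c n \<phi> l1"
    and M: "finite M" "M \<subseteq> lines_in d c" "\<And>L x. L \<in> M \<Longrightarrow> x \<in> L \<Longrightarrow> ev n \<phi> x = 0"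
    and mm: "\<And>L. L \<in> M \<Longrightarrow> m L = 1 \<or> m L = 2 \<and> tang d c n \<phi> L"
  shows "(\<Sum>L\<in>M. (2 - (of_bool (meets L l1) + of_bool (meets L l2) + of_bool (meets L l3))) * m L) \<le> (d - 2) * (n - 1) + (n - 2) * (d - 1)"
proof -
  obtain h1 where h1: "h1 \<noteq> 0" "h1 \<in> l3" "h1 \<in> l1" using l(5) unfolding meets_def by blast
  obtain h3 where h3: "h3 \<noteq> 0" "h3 \<in> l3" "h3 \<in> l2" using l(6) unfolding meets_def by blast
  obtain b where b: "indep2 h1 b" "b \<in> l1" "l1 = sp h1 b" using line_complete[OF LS_line[OF l(1)] h1(3,1)] .
  obtain h4 where h4: "indep2 h3 h4" "h4 \<in> l2" "l2 = sp h3 h4" using line_complete[OF LS_line[OF l(2)] h3(3,1)] .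
  have bas: "basis4 h1 b h3 h4" by (rule basis4_of_skew[OF b(1) h4(1)]) (use l(4) b(3) h4(3) in simp)
  have i3: "indep2 h1 h3" unfolding indep2_def using bas unfolding basis4_def by (metis add.right_neutral vector_smult_lzero)
  have l3: "l3 = sp h1 h3" by (rule line_sp[OF LS_line[OF l(3)] i3 h1(2) h3(2)])
  have "(\<Sum>L\<in>M. (2 - (of_bool (meets L (sp h1 b)) + of_bool (meets L (sp h3 h4)) + of_bool (meets L (sp h1 h3)))) * m L)
     \<le> (d - 2 * 1) * (n - 1) + (n - 2 * 1) * (d - 1)"
  proof (rule net_bound'[OF bas sn _ _ _ _ _ _ _ l(1) _ z(1) t M mm])
    show "\<not> meets l1 (sp h3 h4)" using l(4) h4(3) by simp
  qed (use z LS_ev[OF l(1)] LS_ev[OF l(2)] LS_ev[OF l(3)] b(3) h4(3) l3 in auto)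
  then show ?thesis unfolding b(3)[symmetric] h4(3)[symmetric] l3[symmetric] by simp
qed

text \<open>Only the two skew lines lie on the surface by assumption; the third edge joins generic
  points of them. A line meeting at most one of them misses such a join, and one meeting both has
  weight 0, so it can be left out.\<close>

theorem pair_bound:
  fixes m :: "('a^4) set \<Rightarrow> nat"
  assumes sn: "supp4 n \<phi>"
    and l: "l1 \<in> lines_in d c" "l2 \<in> lines_in d c" "\<not> meets l1 l2"
    and z: "\<And>x. x \<in> l1 \<Longrightarrow> ev n \<phi> x = 0" "\<And>x. x \<in> l2 \<Longrightarrow> ev n \<phi> x = 0"
    and t: "transv d c n \<phi> l1"
    and M: "finite M" "M \<subseteq> lines_in d c - {l1, l2}" "\<And>L x. L \<in> M \<Longrightarrow> x \<in> L \<Longrightarrow> ev n \<phi> x = 0"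
    and mm: "\<And>L. L \<in> M \<Longrightarrow> m L = 1 \<or> m L = 2 \<and> tang d c n \<phi> L"
  shows "(\<Sum>L\<in>M. (2 - (of_bool (meets L l1) + of_bool (meets L l2))) * m L) \<le> (d - 2) * n + (n - 2) * d"
proof -
  obtain a1 b1 where ab1: "indep2 a1 b1" "l1 = sp a1 b1" using LS_line[OF l(1)] unfolding is_line_def by blast
  obtain a2 b2 where ab2: "indep2 a2 b2" "l2 = sp a2 b2" using LS_line[OF l(2)] unfolding is_line_def by blast
  have ln: "is_line L" if "L \<in> M" for L using M(2) that LS_line by blast
  have "\<exists>p q. indep2 p q \<and> L = sp p q" if "L \<in> M" for L using ln[OF that] unfolding is_line_def by blast
  then obtain P Q where PQ: "\<And>L. L \<in> M \<Longrightarrow> indep2 (P L) (Q L)" "\<And>L. L \<in> M \<Longrightarrow> L = sp (P L) (Q L)" by metis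
  define M' where "M' = {L\<in>M. \<not> (meets L l1 \<and> meets L l2)}"
  \<comment> \<open>The generic vector v holds the coordinates of a point on each of the two
    lines.\<close>
  define H1 :: "'a^4 \<Rightarrow> 'a^4" where "H1 v = v$1 *s a1 + v$2 *s b1" for v
  define H3 :: "'a^4 \<Rightarrow> 'a^4" where "H3 v = v$3 *s a2 + v$4 *s b2" for v
  have pH: "pline (\<lambda>v. H1 v $ i)" "pline (\<lambda>v. H3 v $ i)" for i unfolding H1_def H3_def
    by (simp_all only: vector_add_component vector_smult_component) (intro pline_add pline_mult pline_coord pline_const)+
  have cst: "pline (\<lambda>v::'a^4. x $ i)" for x :: "'a^4" and i by (rule pline_const)
  define F1 where "F1 = {\<lambda>v::'a^4. v$1, \<lambda>v. v$3}"
  define F2 where "F2 = (\<lambda>L v. dt (P L) (Q L) (H1 v) (H3 v)) ` M'"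
  have g1: "goodF F1" unfolding F1_def goodF_def
  proof (intro conjI ballI)
    show "\<exists>v. f v \<noteq> 0" if "f \<in> {\<lambda>v::'a^4. v$1, \<lambda>v. v$3}" for f
      using that by (intro exI[of _ "v4 1 0 1 0"]) auto
  qed (auto intro: pline_coord)
  have g2: "goodF F2" unfolding F2_def
  proof (rule goodF_image)
    show "finite M'" unfolding M'_def using M(1) by simp
    show "pline (\<lambda>v. dt (P L) (Q L) (H1 v) (H3 v))" for L by (intro pline_dt pH cst)
    fix L assume "L \<in> M'"
    then have L: "L \<in> M" and nm: "\<not> meets L l1 \<or> \<not> meets L l2" unfolding M'_def by auto
    show "\<exists>v. dt (P L) (Q L) (H1 v) (H3 v) \<noteq> 0"
    proof (cases "meets L l1")
      case False
      have bs: "basis4 (P L) (Q L) a1 b1" by (rule basis4_of_skew[OF PQ(1)[OF L] ab1(1)]) (use False PQ(2)[OF L] ab1(2) in simp)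
      have "l2 \<noteq> L" using L M(2) by blast
      then obtain h where h: "h \<in> l2" "h \<notin> L" using line_not_sub[OF LS_line[OF l(2)] ln[OF L]] by blast
      obtain s u where su: "h = s *s a2 + u *s b2" using h(1) ab2(2) unfolding sp_def by blast
      have "h \<notin> sp (P L) (Q L)" using h(2) PQ(2)[OF L] by simp
      from skew_pick[OF bs this] show ?thesis
      proof
        assume a: "dt (P L) (Q L) a1 h \<noteq> 0"
        show ?thesis by (rule exI[of _ "v4 1 0 s u"]) (use a in \<open>simp add: H1_def H3_def su\<close>)
      next
        assume a: "dt (P L) (Q L) b1 h \<noteq> 0"
        show ?thesis by (rule exI[of _ "v4 0 1 s u"]) (use a in \<open>simp add: H1_def H3_def su\<close>)
      qed
    next
      case True
      then have F: "\<not> meets L l2" using nm by blast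
      have bs: "basis4 (P L) (Q L) a2 b2" by (rule basis4_of_skew[OF PQ(1)[OF L] ab2(1)]) (use F PQ(2)[OF L] ab2(2) in simp)
      have "l1 \<noteq> L" using L M(2) by blast
      then obtain h where h: "h \<in> l1" "h \<notin> L" using line_not_sub[OF LS_line[OF l(1)] ln[OF L]] by blast
      obtain s u where su: "h = s *s a1 + u *s b1" using h(1) ab1(2) unfolding sp_def by blast
      have "h \<notin> sp (P L) (Q L)" using h(2) PQ(2)[OF L] by simp
      from skew_pick[OF bs this] show ?thesis
      proof
        assume "dt (P L) (Q L) a2 h \<noteq> 0"
        then have a: "dt (P L) (Q L) h a2 \<noteq> 0" by (rule dt_swap)
        show ?thesis by (rule exI[of _ "v4 s u 1 0"]) (use a in \<open>simp add: H1_def H3_def su\<close>)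
      next
        assume "dt (P L) (Q L) b2 h \<noteq> 0"
        then have a: "dt (P L) (Q L) h b2 \<noteq> 0" by (rule dt_swap)
        show ?thesis by (rule exI[of _ "v4 s u 0 1"]) (use a in \<open>simp add: H1_def H3_def su\<close>)
      qed
    qed
  qed
  have "goodF (F1 \<union> F2)" by (intro goodF_Un g1 g2)
  then obtain v where v: "\<And>f. f \<in> F1 \<union> F2 \<Longrightarrow> f v \<noteq> 0" using generic_point[of "F1 \<union> F2"] unfolding goodF_def by blast
  have v13: "v$1 \<noteq> 0" "v$3 \<noteq> 0" using v[of "\<lambda>v. v$1"] v[of "\<lambda>v. v$3"] unfolding F1_def by auto
  define h1 h3 where "h1 = H1 v" and "h3 = H3 v"
  have h1: "h1 \<in> l1" "h1 \<noteq> 0"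
  proof -
    show "h1 \<in> l1" unfolding h1_def H1_def ab1(2) by (rule sp_mem)
    show "h1 \<noteq> 0" using ab1(1) v13 unfolding h1_def H1_def indep2_def by blast
  qed
  have h3: "h3 \<in> l2" "h3 \<noteq> 0"
  proof -
    show "h3 \<in> l2" unfolding h3_def H3_def ab2(2) by (rule sp_mem)
    show "h3 \<noteq> 0" using ab2(1) v13 unfolding h3_def H3_def indep2_def by blast
  qed
  have sk: "\<not> meets L (sp h1 h3)" if "L \<in> M'" for L
  proof -
    have "dt (P L) (Q L) h1 h3 \<noteq> 0" using v[of "\<lambda>v. dt (P L) (Q L) (H1 v) (H3 v)"] that unfolding F2_def h1_def h3_def by blast
    from dt_basis(3)[OF this] show ?thesis using PQ(2)[of L] that unfolding M'_def by simp
  qed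
  obtain b where b: "indep2 h1 b" "b \<in> l1" "l1 = sp h1 b" using line_complete[OF LS_line[OF l(1)] h1] .
  obtain h4 where h4: "indep2 h3 h4" "h4 \<in> l2" "l2 = sp h3 h4" using line_complete[OF LS_line[OF l(2)] h3] .
  have bas: "basis4 h1 b h3 h4" by (rule basis4_of_skew[OF b(1) h4(1)]) (use l(3) b(3) h4(3) in simp)
  have "(\<Sum>L\<in>M'. (2 - (of_bool (meets L (sp h1 b)) + of_bool (meets L (sp h3 h4)) + of_bool (meets L (sp h1 h3)))) * m L)
     \<le> (d - 2 * 1) * (n - 0) + (n - 2 * 1) * (d - 0)"
  proof (rule net_bound'[OF bas sn _ _ _ _ _ _ _ l(1) _ z(1) t])
    show "\<not> meets l1 (sp h3 h4)" using l(3) h4(3) by simp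
    show "finite M'" "M' \<subseteq> lines_in d c" using M(1,2) unfolding M'_def by auto
    show "ev n \<phi> x = 0" if "L \<in> M'" "x \<in> L" for L x using M(3) that unfolding M'_def by blast
    show "m L = 1 \<or> m L = 2 \<and> tang d c n \<phi> L" if "L \<in> M'" for L using mm that unfolding M'_def by blast
  qed (use z LS_ev[OF l(1)] LS_ev[OF l(2)] b(3) h4(3) in auto)
  also have "(\<Sum>L\<in>M'. (2 - (of_bool (meets L (sp h1 b)) + of_bool (meets L (sp h3 h4)) + of_bool (meets L (sp h1 h3)))) * m L)
    = (\<Sum>L\<in>M'. (2 - (of_bool (meets L l1) + of_bool (meets L l2))) * m L)"
    unfolding b(3)[symmetric] h4(3)[symmetric] by (rule sum.cong) (simp_all add: sk)
  also have "\<dots> = (\<Sum>L\<in>M. (2 - (of_bool (meets L l1) + of_bool (meets L l2))) * m L)"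
    by (rule sum.mono_neutral_left) (auto simp: M'_def M(1))
  finally show ?thesis by simp
qed

end

section \<open>Counting lines\<close>

lemma sum_of_bool_card: "finite M \<Longrightarrow> (\<Sum>L\<in>M. of_bool (P L) :: int) = int (card {L\<in>M. P L})"
  by (simp add: of_bool_def sum.inter_filter[symmetric])

context surf begin

text \<open>Since W = 0 on every line, \<open>Rf\<close> vanishes on all of them, and its transverse
  derivative along L0 involves only the Schwarzian. Thus a form of degree 8d - 14 not vanishing on
  the whole surface contains all lines.\<close>

lemma R_bound:
  assumes d4: "d \<ge> 4" and M: "finite M" "M \<subseteq> lines_in d c" "\<And>L. L \<in> M \<Longrightarrow> second_kind d c L"
  shows "card M \<le> d * (8 * d - 14)"
proof (cases "M = {}")
  case False
  then obtain L0 where L0: "L0 \<in> M" by blast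
  have LL: "L0 \<in> lines_in d c" using L0 M(2) by blast
  obtain e f where ef: "indep2 e f" "L0 = sp e f" using LS_line[OF LL] unfolding is_line_def by blast
  obtain g1 g2 where l: "lsurf d c e f g1 g2" using lsurf_ex[OF ef(1)] LL ef(2) by blast
  interpret l: lsurf d c e f g1 g2 by fact
  \<comment> \<open>The vector g must not be tangent to the surface all along L0; g1 or g2
    qualifies.\<close>
  have "l.A \<noteq> 0 \<or> l.B \<noteq> 0" using l.ncr[of 0] by auto
  then obtain g where g: "D1 d (cl c) l.X (cv g) \<noteq> 0" unfolding l.A_def l.B_def by blast
  obtain \<psi> where ps: "supp4 (8*d-14) \<psi>" "\<And>x. Rf d c e g x = ev (8*d-14) \<psi> x"
    using is_form_Rf[OF d3, of c e g] unfolding is_form_def by blast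
  have "transv d c (8*d-14) \<psi> L0" unfolding transv_def
  proof (rule exI, rule exI, intro conjI allI impI)
    show "indep2 e f" "L0 = sp e f" by (fact ef)+
    fix S :: "'a set" assume "finite S"
    then obtain z where "z \<notin> S" "D1 (8*d-14) \<psi> (l.pz z) (l.tz z) \<noteq> 0" "D1 d c (l.pz z) (l.tz z) = 0"
      using l.psi_witness[OF ps g] by blast
    then show "\<exists>z w. z \<notin> S \<and> D1 d c (e + z *s f) w = 0 \<and> D1 (8*d-14) \<psi> (e + z *s f) w \<noteq> 0" unfolding l.pz_def by blast
  qed
  moreover have "ev (8*d-14) \<psi> x = 0" if L: "L \<in> M" "x \<in> L" for L x
  proof -
    have LL: "L \<in> lines_in d c" using L(1) M(2) by blast
    obtain a b where ab: "indep2 a b" "L = sp a b" using LS_line[OF LL] unfolding is_line_def by blast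
    obtain k1 k2 where k: "lsurf d c a b k1 k2" using lsurf_ex[OF ab(1)] LL ab(2) by blast
    interpret k: lsurf d c a b k1 k2 by fact
    have W: "k.W = 0" using k.sec_W M(3)[OF L(1)] ab(2) by simp
    obtain s t where "x = s *s a + t *s b" using L(2) ab(2) unfolding sp_def by blast
    then show ?thesis using k.psi_line[OF ps W] by simp
  qed
  ultimately have "(\<Sum>L\<in>M. 1) \<le> d * (8*d-14)"
    using generic_bound[OF ps(1) M(1,2) _ L0, of "\<lambda>L. 1"] by blast
  then show ?thesis by simp
qed simp

end

locale flec = surf d c for d :: nat and c :: "'a::alg_closed_field form4" +
  fixes n :: nat and \<phi> :: "'a form4"
  assumes supn: "supp4 n \<phi>" and phi: "\<And>x. Phi d c x = ev n \<phi> x" and n: "n = 11 * d - 24"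
begin

lemma zero_on: assumes L: "L \<in> lines_in d c" "x \<in> L" shows "ev n \<phi> x = 0"
proof -
  obtain e f where ef: "indep2 e f" "L = sp e f" using LS_line[OF L(1)] unfolding is_line_def by blast
  obtain g1 g2 where l: "lsurf d c e f g1 g2" using lsurf_ex[OF ef(1)] L(1) ef(2) by blast
  interpret l: lsurf d c e f g1 g2 by fact
  obtain s t where "x = s *s e + t *s f" using L(2) ef(2) unfolding sp_def by blast
  then show ?thesis using l.phi_line[OF supn phi] by simp
qed

lemma tang_sec: assumes L: "L \<in> lines_in d c" "second_kind d c L" shows "tang d c n \<phi> L"
  unfolding tang_def
proof (intro allI impI)
  fix e f assume ef: "indep2 e f \<and> L = sp e f"
  obtain g1 g2 where l: "lsurf d c e f g1 g2" using lsurf_ex[of e f] L(1) ef by blast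
  interpret l: lsurf d c e f g1 g2 by fact
  have W: "l.W = 0" using l.sec_W L(2) ef by simp
  show "\<exists>T. finite T \<and> (\<forall>t w. t \<notin> T \<longrightarrow> D1 d c (e + t *s f) w = 0 \<longrightarrow> D1 n \<phi> (e + t *s f) w = 0)"
  proof (intro exI conjI allI impI)
    show "finite {z. poly l.u z = 0}" by (rule poly_roots_finite[OF l.u_nz])
    fix t w assume "t \<notin> {z. poly l.u z = 0}" "D1 d c (e + t *s f) w = 0"
    then show "D1 n \<phi> (e + t *s f) w = 0" using l.phi_tangent[OF supn phi W, of t w] by (simp add: l.pz_def)
  qed
qed

text \<open>The witness p0 against the second kind becomes the first basis vector, so it sits at the
  finite parameter 0 and shows W to be nonzero.\<close>

lemma transv_first: assumes L: "L \<in> lines_in d c" "\<not> second_kind d c L" shows "transv d c n \<phi> L"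
proof -
  obtain p0 y0 v0 where w: "p0 \<in> L" "y0 \<in> L" "D1 d c p0 v0 = 0" "D2 d c p0 v0 v0 = 0" "D2 d c p0 y0 v0 \<noteq> 0" "D3 d c p0 v0 v0 v0 \<noteq> 0"
    using L(2) unfolding second_kind_def by blast
  have p0: "p0 \<noteq> 0" using w(5) D2_zero_pt by auto
  obtain f where f: "indep2 p0 f" "f \<in> L" "L = sp p0 f" using line_complete[OF LS_line[OF L(1)] w(1) p0] .
  obtain g1 g2 where l: "lsurf d c p0 f g1 g2" using lsurf_ex[OF f(1)] L(1) f(3) by blast
  interpret l: lsurf d c p0 f g1 g2 by fact
  have W: "l.W \<noteq> 0" by (rule l.not_sec_W[of p0 0 y0 v0]) (use w f(3) in \<open>simp_all add: l.pz_def\<close>)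
  show ?thesis unfolding transv_def
  proof (rule exI, rule exI, intro conjI allI impI)
    show "indep2 p0 f" "L = sp p0 f" by (fact f)+
    fix S :: "'a set" assume "finite S"
    then obtain z where "z \<notin> S" "D1 n \<phi> (l.pz z) (l.tz z) \<noteq> 0" "D1 d c (l.pz z) (l.tz z) = 0"
      using l.phi_witness[OF supn phi W] by blast
    then show "\<exists>z w. z \<notin> S \<and> D1 d c (p0 + z *s f) w = 0 \<and> D1 n \<phi> (p0 + z *s f) w \<noteq> 0" unfolding l.pz_def by blast
  qed
qed

definition mu :: "('a^4) set \<Rightarrow> nat" where "mu L = (if second_kind d c L then 2 else 1)"
lemma mu: "L \<in> lines_in d c \<Longrightarrow> mu L = 1 \<or> mu L = 2 \<and> tang d c n \<phi> L" unfolding mu_def using tang_sec by auto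

lemma int_n: "int n = 11 * int d - 24" using n d3 by simp

text \<open>The chain bound allows 22d^2 - 84d + 76 weighted points and the three valences return at
  most 24d - 46. Half of the total is 11d^2 - 30d + 15, and the three lines of the chain are
  added.\<close>

lemma chain_count:
  assumes A: "finite A" "A \<subseteq> lines_in d c"
    and l: "l1 \<in> A" "l2 \<in> A" "l3 \<in> A" "\<not> second_kind d c l1" "\<not> second_kind d c l2" "\<not> second_kind d c l3" "\<not> meets l1 l2" "meets l3 l1" "meets l3 l2"
  shows "int (card A) \<le> 11 * int d ^ 2 - 30 * int d + 18"
proof -
  have LS: "l1 \<in> lines_in d c" "l2 \<in> lines_in d c" "l3 \<in> lines_in d c" using l(1-3) A(2) by auto
  have ne: "l1 \<noteq> l2" "l1 \<noteq> l3" "l2 \<noteq> l3" using l(7,8,9) meets_self[OF LS_line] LS meets_sym by blast+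
  define M where "M = A - {l1,l2,l3}"
  have fM: "finite M" "M \<subseteq> lines_in d c" using A unfolding M_def by auto
  have cM: "int (card A) = int (card M) + 3"
  proof -
    have "A = M \<union> {l1,l2,l3}" "M \<inter> {l1,l2,l3} = {}" using l(1-3) unfolding M_def by auto
    then have "card A = card M + card {l1,l2,l3}" using card_Un_disjoint[OF fM(1), of "{l1,l2,l3}"] by simp
    then show ?thesis using ne by simp
  qed
  have v: "card {L\<in>M. meets L l} + card K \<le> 8 * d - 14"
    if "l \<in> {l1,l2,l3}" "\<not> second_kind d c l" "K \<subseteq> {l1,l2,l3} - {l}" "\<And>x. x \<in> K \<Longrightarrow> meets x l" for l K
  proof -
    have fK: "finite K" using that(3) finite_subset by blast
    have lLS: "l \<in> lines_in d c" using that(1) LS by blast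
    have "card ({L\<in>M. meets L l} \<union> K) \<le> 8 * d - 14"
    proof (rule valence[OF lLS that(2)])
      show "finite ({L\<in>M. meets L l} \<union> K)" using fM(1) fK by simp
      show "{L\<in>M. meets L l} \<union> K \<subseteq> lines_in d c - {l}" using fM(2) that(1,3) LS unfolding M_def by blast
      show "\<And>L. L \<in> {L \<in> M. meets L l} \<union> K \<Longrightarrow> meets L l" using that(4) by blast
    qed
    moreover have "card ({L\<in>M. meets L l} \<union> K) = card {L\<in>M. meets L l} + card K"
      by (rule card_Un_disjoint) (use fM(1) fK that(3) in \<open>auto simp: M_def\<close>)
    ultimately show ?thesis by simp
  qed
  have i8: "int (8 * d - 14) = 8 * int d - 14" using d3 by simp
  \<comment> \<open>One less than the valence bound, since l3 also meets l1; for l3 two are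
    subtracted.\<close>
  have v1: "int (card {L\<in>M. meets L l1}) \<le> 8 * int d - 15" using v[of l1 "{l3}"] l ne i8 by auto
  have v2: "int (card {L\<in>M. meets L l2}) \<le> 8 * int d - 15" using v[of l2 "{l3}"] l ne i8 by auto
  have "card {L\<in>M. meets L l3} + card {l1,l2} \<le> 8 * d - 14"
    by (rule v) (use l ne meets_sym in auto)
  then have v3: "int (card {L\<in>M. meets L l3}) \<le> 8 * int d - 16" using ne i8 by auto
  have "(\<Sum>L\<in>M. (2 - (of_bool (meets L l1) + of_bool (meets L l2) + of_bool (meets L l3))) * mu L) \<le> (d - 2) * (n - 1) + (n - 2) * (d - 1)"
    by (rule chain_bound[OF supn LS l(7,8,9)]) (use zero_on LS transv_first l(4) fM mu in blast)+
  then have "int (\<Sum>L\<in>M. (2 - (of_bool (meets L l1) + of_bool (meets L l2) + of_bool (meets L l3))) * mu L) \<le> int ((d - 2) * (n - 1) + (n - 2) * (d - 1))"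
    by (simp only: of_nat_le_iff)
  also have "int ((d - 2) * (n - 1) + (n - 2) * (d - 1)) = 22 * int d ^ 2 - 84 * int d + 76"
  proof -
    obtain k where k: "d = k + 3" using d3 by (metis add.commute le_Suc_ex)
    have "d - 2 = k + 1" "n - 1 = 11 * k + 8" "n - 2 = 11 * k + 7" "d - 1 = k + 2" unfolding n k by simp_all
    then show ?thesis unfolding k by (simp add: power2_eq_square algebra_simps)
  qed
  finally have up: "int (\<Sum>L\<in>M. (2 - (of_bool (meets L l1) + of_bool (meets L l2) + of_bool (meets L l3))) * mu L) \<le> 22 * int d ^ 2 - 84 * int d + 76" .
  \<comment> \<open>An inequality for two reasons: a line meeting all three edges counts -1 here but
    0 in the truncated weight, and the weights \<open>mu\<close> are at least 1.\<close>
  have "(\<Sum>L\<in>M. 2 - of_bool (meets L l1) - of_bool (meets L l2) - of_bool (meets L l3)) \<le> int (\<Sum>L\<in>M. (2 - (of_bool (meets L l1) + of_bool (meets L l2) + of_bool (meets L l3))) * mu L)"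
    unfolding of_nat_sum by (rule sum_mono) (auto simp: mu_def of_bool_def)
  moreover have "(\<Sum>L\<in>M. 2 - of_bool (meets L l1) - of_bool (meets L l2) - of_bool (meets L l3))
    = 2 * int (card M) - int (card {L\<in>M. meets L l1}) - int (card {L\<in>M. meets L l2}) - int (card {L\<in>M. meets L l3})"
    unfolding sum_subtractf sum_of_bool_card[OF fM(1)] by simp
  ultimately show ?thesis using up cM v1 v2 v3 by linarith
qed

text \<open>Lines of the second kind enter with weight 2 throughout. The bound (d-2)n + (n-2)d
  equals 22d^2 - 72d + 48, and l and l' themselves account for the remaining 4.\<close>

lemma pair_count:
  assumes A: "finite A" "A \<subseteq> lines_in d c"
    and F: "F = {L\<in>A. \<not> second_kind d c L}" and S: "S = {L\<in>A. second_kind d c L}"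
    and l: "l \<in> F" "l' \<in> F" "\<not> meets l l'"
  shows "2 * int (card F) + 4 * int (card S) \<le> 22 * int d ^ 2 - 72 * int d + 52
     + int (card {L\<in>F-{l}. meets L l}) + int (card {L\<in>F-{l'}. meets L l'}) + 2 * int (card {L\<in>S. meets L l}) + 2 * int (card {L\<in>S. meets L l'})"
proof -
  have LS: "l \<in> lines_in d c" "l' \<in> lines_in d c" "\<not> second_kind d c l" using l A(2) F by auto
  have ne: "l \<noteq> l'" using l(3) meets_self[OF LS_line[OF LS(1)]] by blast
  define M where "M = A - {l,l'}"
  have fM: "finite M" "M \<subseteq> lines_in d c - {l,l'}" "M \<subseteq> lines_in d c" using A unfolding M_def by auto
  have fin: "finite F" "finite S" using A(1) F S by auto
  have Msplit: "M = (F - {l,l'}) \<union> S" "(F - {l,l'}) \<inter> S = {}" using l unfolding M_def F S by auto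
  have cF: "int (card (F - {l,l'})) = int (card F) - 2"
  proof -
    have "card (F - {l,l'}) = card F - card {l,l'}" by (rule card_Diff_subset) (use l in auto)
    moreover have "card {l,l'} \<le> card F" by (rule card_mono[OF fin(1)]) (use l in auto)
    ultimately show ?thesis using ne by simp
  qed
  have "(\<Sum>L\<in>M. (2 - (of_bool (meets L l) + of_bool (meets L l'))) * mu L) \<le> (d - 2) * n + (n - 2) * d"
    by (rule pair_bound[OF supn LS(1,2) l(3) _ _ _ fM(1,2)]) (use zero_on LS transv_first fM(3) mu in blast)+
  then have "int (\<Sum>L\<in>M. (2 - (of_bool (meets L l) + of_bool (meets L l'))) * mu L) \<le> int ((d - 2) * n + (n - 2) * d)"
    by (simp only: of_nat_le_iff)
  also have "int ((d - 2) * n + (n - 2) * d) = 22 * int d ^ 2 - 72 * int d + 48"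
  proof -
    obtain k where k: "d = k + 3" using d3 by (metis add.commute le_Suc_ex)
    have "d - 2 = k + 1" "n = 11 * k + 9" "n - 2 = 11 * k + 7" unfolding n k by simp_all
    then show ?thesis unfolding k by (simp add: power2_eq_square algebra_simps)
  qed
  also have "int (\<Sum>L\<in>M. (2 - (of_bool (meets L l) + of_bool (meets L l'))) * mu L)
    = (\<Sum>L\<in>M. (2 - of_bool (meets L l) - of_bool (meets L l')) * int (mu L))"
    unfolding of_nat_sum by (rule sum.cong) (auto simp: of_bool_def)
  also have "\<dots> = (\<Sum>L\<in>F-{l,l'}. (2 - of_bool (meets L l) - of_bool (meets L l')) * int (mu L))
      + (\<Sum>L\<in>S. (2 - of_bool (meets L l) - of_bool (meets L l')) * int (mu L))"
    unfolding Msplit(1) by (rule sum.union_disjoint) (use fin Msplit(2) in auto)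
  also have "(\<Sum>L\<in>F-{l,l'}. (2 - of_bool (meets L l) - of_bool (meets L l')) * int (mu L))
      = (\<Sum>L\<in>F-{l,l'}. 2 - of_bool (meets L l) - of_bool (meets L l'))"
    by (rule sum.cong) (auto simp: mu_def F)
  also have "(\<Sum>L\<in>S. (2 - of_bool (meets L l) - of_bool (meets L l')) * int (mu L))
      = 2 * (\<Sum>L\<in>S. 2 - of_bool (meets L l) - of_bool (meets L l'))"
    unfolding sum_distrib_left by (rule sum.cong) (auto simp: mu_def S)
  finally have "(\<Sum>L\<in>F-{l,l'}. 2 - of_bool (meets L l) - of_bool (meets L l')) + 2 * (\<Sum>L\<in>S. 2 - of_bool (meets L l) - of_bool (meets L l'))
     \<le> 22 * int d ^ 2 - 72 * int d + 48" .
  moreover have "(\<Sum>L\<in>F-{l,l'}. 2 - of_bool (meets L l) - of_bool (meets L l')) = 2 * int (card (F - {l,l'}))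
      - int (card {L\<in>F-{l,l'}. meets L l}) - int (card {L\<in>F-{l,l'}. meets L l'})"
    unfolding sum_subtractf using fin by (subst sum_of_bool_card, simp)+ simp
  moreover have "(\<Sum>L\<in>S. 2 - of_bool (meets L l) - of_bool (meets L l')) = 2 * int (card S)
      - int (card {L\<in>S. meets L l}) - int (card {L\<in>S. meets L l'})"
    unfolding sum_subtractf sum_of_bool_card[OF fin(2)] by simp
  moreover have "card {L\<in>F-{l,l'}. meets L l} \<le> card {L\<in>F-{l}. meets L l}" "card {L\<in>F-{l,l'}. meets L l'} \<le> card {L\<in>F-{l'}. meets L l'}"
    by (intro card_mono; use fin in auto)+
  ultimately show ?thesis using cF by linarith
qed

end

context flec begin

lemma weighted_count:
  assumes A: "finite A" "A \<subseteq> lines_in d c" and F: "F = {L\<in>A. \<not> second_kind d c L}" and S: "S = {L\<in>A. second_kind d c L}" and ne: "F \<noteq> {}"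
  shows "int (card F) + 2 * int (card S) \<le> 11 * int d ^ 2 - 24 * int d"
proof -
  obtain l where l: "l \<in> F" using ne by blast
  have "(\<Sum>L\<in>A. mu L) \<le> d * n"
    by (rule generic_bound[OF supn A, of l]) (use zero_on transv_first mu l F A(2) in blast)+
  moreover have "(\<Sum>L\<in>A. mu L) = (\<Sum>L\<in>F. mu L) + (\<Sum>L\<in>S. mu L)"
    by (subst sum.union_disjoint[symmetric]) (use A(1) F S in \<open>auto intro: sum.cong\<close>)
  moreover have "(\<Sum>L\<in>F. mu L) = card F" unfolding mu_def F by simp
  moreover have "(\<Sum>L\<in>S. mu L) = 2 * card S" unfolding mu_def S by simp
  ultimately have "int (card F + 2 * card S) \<le> int (d * n)" by (simp only: of_nat_le_iff)
  then show ?thesis by (simp add: int_n power2_eq_square algebra_simps)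
qed

text \<open>Without chains the neighbours of l meet each other, so together with l they are at most
  d pairwise meeting lines.\<close>

lemma first_kind_valence:
  assumes F: "finite F" "F \<subseteq> lines_in d c" and l: "l \<in> F"
    and nochain: "\<And>l1 l2. l1 \<in> F \<Longrightarrow> l2 \<in> F \<Longrightarrow> meets l l1 \<Longrightarrow> meets l l2 \<Longrightarrow> meets l1 l2"
  shows "int (card {L\<in>F-{l}. meets L l}) \<le> int d - 1"
proof -
  let ?N = "{L\<in>F-{l}. meets L l}"
  have "card (insert l ?N) \<le> d"
  proof (rule pairwise_meeting_bound)
    show "finite (insert l ?N)" "insert l ?N \<subseteq> lines_in d c" using F l by auto
    fix L L' assume L: "L \<in> insert l ?N" "L' \<in> insert l ?N"
    have "meets l l" by (rule meets_self[OF LS_line]) (use l F(2) in blast)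
    then have nb: "K \<in> F \<and> meets l K" if "K \<in> insert l ?N" for K using that l meets_sym[of l K] by auto
    show "meets L L'" using nochain[of L L'] nb[OF L(1)] nb[OF L(2)] by simp
  qed
  moreover have "card (insert l ?N) = card ?N + 1" using F(1) by simp
  ultimately show ?thesis by simp
qed

text \<open>Each s i is missed by at most a fifth of F; removing two or three such parts leaves
  three or two fifths.\<close>

lemma common_neighbours:
  assumes F: "finite F" "F \<subseteq> lines_in d c" and N: "5 * card {l\<in>F. \<not> meets l s1} \<le> card F" "5 * card {l\<in>F. \<not> meets l s2} \<le> card F"
    "5 * card {l\<in>F. \<not> meets l s3} \<le> card F"
  shows "2 * card F \<le> 5 * card {l\<in>F. meets l s1 \<and> meets l s2 \<and> meets l s3}"
    and "3 * card F \<le> 5 * card {l\<in>F. meets l s1 \<and> meets l s2}"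
proof -
  have "card F \<le> card ({l\<in>F. meets l s1 \<and> meets l s2} \<union> ({l\<in>F. \<not> meets l s1} \<union> {l\<in>F. \<not> meets l s2}))"
    by (rule card_mono) (use F(1) in auto)
  also have "\<dots> \<le> card {l\<in>F. meets l s1 \<and> meets l s2} + card ({l\<in>F. \<not> meets l s1} \<union> {l\<in>F. \<not> meets l s2})" by (rule card_Un_le)
  finally show 2: "3 * card F \<le> 5 * card {l\<in>F. meets l s1 \<and> meets l s2}"
    using N card_Un_le[of "{l\<in>F. \<not> meets l s1}" "{l\<in>F. \<not> meets l s2}"] by linarith
  have "card {l\<in>F. meets l s1 \<and> meets l s2} \<le> card ({l\<in>F. meets l s1 \<and> meets l s2 \<and> meets l s3} \<union> {l\<in>F. \<not> meets l s3})"
    by (rule card_mono) (use F(1) in auto)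
  also have "\<dots> \<le> card {l\<in>F. meets l s1 \<and> meets l s2 \<and> meets l s3} + card {l\<in>F. \<not> meets l s3}" by (rule card_Un_le)
  finally show "2 * card F \<le> 5 * card {l\<in>F. meets l s1 \<and> meets l s2 \<and> meets l s3}" using 2 N by linarith
qed

text \<open>A counterexample has no chain in F, so lines of the first kind meet few of each other,
  and the pair count forces them to meet almost all of S. Double counting then yields three lines of
  S met by most of F. They are pairwise skew, and their common transversals exceed d + 1.\<close>

theorem count_with_first_kind:
  assumes A: "finite A" "A \<subseteq> lines_in d c" and ne: "\<exists>L\<in>A. \<not> second_kind d c L"
  shows "int (card A) \<le> 11 * int d ^ 2 - 30 * int d + 18"
proof (rule ccontr)
  assume "\<not> ?thesis"
  then have big: "int (card A) \<ge> 11 * int d ^ 2 - 30 * int d + 19" by simp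
  define F where "F = {L\<in>A. \<not> second_kind d c L}"
  define S where "S = {L\<in>A. second_kind d c L}"
  have fin: "finite F" "finite S" "F \<subseteq> lines_in d c" "S \<subseteq> lines_in d c" using A unfolding F_def S_def by auto
  have cA: "int (card A) = int (card F) + int (card S)"
  proof -
    have "A = F \<union> S" "F \<inter> S = {}" unfolding F_def S_def by auto
    then show ?thesis using card_Un_disjoint[OF fin(1,2)] by simp
  qed
  have wc: "int (card F) + 2 * int (card S) \<le> 11 * int d ^ 2 - 24 * int d"
    by (rule weighted_count[OF A F_def S_def]) (use ne F_def in blast)
  have nochain: "meets l1 l2" if "l \<in> F" "l1 \<in> F" "l2 \<in> F" "meets l l1" "meets l l2" for l l1 l2
  proof (rule ccontr)
    assume nm: "\<not> meets l1 l2"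
    have "int (card A) \<le> 11 * int d ^ 2 - 30 * int d + 18"
      by (rule chain_count[OF A, of l1 l2 l]) (use that nm in \<open>auto simp: F_def\<close>)
    then show False using big by simp
  qed
  have val: "int (card {L\<in>F-{l}. meets L l}) \<le> int d - 1" if "l \<in> F" for l
    by (rule first_kind_valence[OF fin(1,3) that]) (use nochain that in blast)
  have dd: "3 * int d \<le> int d ^ 2" using d3 by (simp add: power2_eq_square)
  \<comment> \<open>The weighted count exceeds the plain count by card S, so card S is at most
    (11d^2 - 24d) - (11d^2 - 30d + 19).\<close>
  have S6: "int (card S) \<le> 6 * int d - 19" using wc big cA by linarith
  have d3i: "int d \<ge> 3" using d3 by simp
  have Fbig: "int (card F) \<ge> 11 * int d ^ 2 - 36 * int d + 38" using S6 big cA by linarith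
  have partner: "\<exists>l'\<in>F. \<not> meets l l'" if l: "l \<in> F" for l
  proof (rule ccontr)
    assume "\<not> ?thesis"
    then have "F - {l} = {L\<in>F-{l}. meets L l}" using meets_sym by blast
    then have "int (card (F - {l})) \<le> int d - 1" using val[OF l] by simp
    moreover have "int (card (F - {l})) = int (card F) - 1"
      using card.remove[OF fin(1) l] by simp
    ultimately have "11 * int d ^ 2 - 36 * int d + 38 \<le> int d" using Fbig by linarith
    moreover have "11 * (int d)^2 - 37 * int d + 38 > 0"
    proof (cases "d = 3")
      case False
      then have "int d \<ge> 4" using d3 by simp
      then have "4 * int d \<le> int d ^ 2" by (simp add: power2_eq_square)
      then show ?thesis using d3i by linarith
    qed simp
    ultimately show False by linarith
  qed
  \<comment> \<open>The pair count with neighbours in F bounded by d - 1 and card F + card S bounded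
    below, divided by 2.\<close>
  have pc: "int (card {L\<in>S. meets L l}) + int (card {L\<in>S. meets L l'}) \<ge> int (card S) + 5 * int d - 6" if l: "l \<in> F" "l' \<in> F" "\<not> meets l l'" for l l'
    using pair_count[OF A F_def S_def l] val[OF l(1)] val[OF l(2)] big cA by linarith
  have leS: "int (card {L\<in>S. meets L l}) \<le> int (card S)" for l using card_mono[OF fin(2), of "{L\<in>S. meets L l}"] by auto
  have cS: "int (card {L\<in>S. \<not> meets L l}) = int (card S) - int (card {L\<in>S. meets L l})" for l
  proof -
    have "S = {L\<in>S. \<not> meets L l} \<union> {L\<in>S. meets L l}" by auto
    then have "card S = card {L\<in>S. \<not> meets L l} + card {L\<in>S. meets L l}"
      using card_Un_disjoint[of "{L\<in>S. \<not> meets L l}" "{L\<in>S. meets L l}"] fin(2) by auto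
    then show ?thesis by simp
  qed
  \<comment> \<open>Even if l' meets all of S, the line l misses at most card S - (5d - 6) lines,
    and card S is at most 6d - 19. In particular d is at least 13.\<close>
  have miss: "int (card {L\<in>S. \<not> meets L l}) \<le> int d - 13" if l: "l \<in> F" for l
  proof -
    obtain l' where "l' \<in> F" "\<not> meets l l'" using partner[OF l] by blast
    from pc[OF l this] show ?thesis using cS[of l] leS[of l'] S6 by linarith
  qed
  obtain l0 where l0: "l0 \<in> F" using ne unfolding F_def by blast
  have d13: "int d \<ge> 13" using miss[OF l0] by linarith
  have S5: "int (card S) \<ge> 5 * int d - 6"
  proof -
    obtain l' where "l' \<in> F" "\<not> meets l0 l'" using partner[OF l0] by blast
    from pc[OF l0 this] show ?thesis using leS[of l'] leS[of l0] by linarith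
  qed
  have d2: "13 * int d \<le> int d ^ 2" using d13 by (simp add: power2_eq_square)
  \<comment> \<open>A fifth is the threshold that works: the total number of misses is at most (d -
    13) card F, so at most 5d - 65 lines of S exceed it, while card S is at least 5d - 6.\<close>
  define T where "T = {s\<in>S. 5 * card {l\<in>F. \<not> meets l s} \<le> card F}"
  have dbl: "(\<Sum>s\<in>S. int (card {l\<in>F. \<not> meets l s})) \<le> int (card F) * (int d - 13)"
  proof -
    have "(\<Sum>s\<in>S. int (card {l\<in>F. \<not> meets l s})) = (\<Sum>s\<in>S. \<Sum>l\<in>F. of_bool (\<not> meets l s))"
      by (simp add: sum_of_bool_card[OF fin(1)])
    also have "\<dots> = (\<Sum>l\<in>F. \<Sum>s\<in>S. of_bool (\<not> meets l s))" by (rule sum.swap)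
    also have "\<dots> = (\<Sum>l\<in>F. int (card {s\<in>S. \<not> meets l s}))" by (simp add: sum_of_bool_card[OF fin(2)])
    also have "\<dots> \<le> (\<Sum>l\<in>F. int d - 13)"
    proof (rule sum_mono)
      fix l assume "l \<in> F"
      from miss[OF this] show "int (card {s\<in>S. \<not> meets l s}) \<le> int d - 13" by (simp add: meets_sym[of l])
    qed
    finally show ?thesis by simp
  qed
  have "card T \<ge> 3"
  proof (rule ccontr)
    assume "\<not> 3 \<le> card T"
    then have T2: "int (card T) \<le> 2" by simp
    have "(int (card S) - int (card T)) * int (card F) = (\<Sum>s\<in>S-T. int (card F))"
      using card_Diff_subset[of T S] card_mono[OF fin(2), of T] fin(2) finite_subset[OF _ fin(2), of T] unfolding T_def by (simp add: of_nat_diff)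
    also have "\<dots> \<le> (\<Sum>s\<in>S-T. 5 * int (card {l\<in>F. \<not> meets l s}))"
      by (rule sum_mono) (auto simp: T_def)
    also have "\<dots> \<le> (\<Sum>s\<in>S. 5 * int (card {l\<in>F. \<not> meets l s}))" by (rule sum_mono2) (use fin(2) in auto)
    also have "\<dots> = 5 * (\<Sum>s\<in>S. int (card {l\<in>F. \<not> meets l s}))" by (rule sum_distrib_left[symmetric])
    also have "\<dots> \<le> 5 * (int (card F) * (int d - 13))" using dbl by simp
    finally have "(int (card S) - int (card T)) * int (card F) \<le> (5 * int d - 65) * int (card F)" by (simp add: algebra_simps)
    moreover have "int (card F) > 0" using l0 fin(1) card_gt_0_iff by auto
    ultimately have "int (card S) - int (card T) \<le> 5 * int d - 65" by (simp only: mult_le_cancel_right_pos)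
    then show False using S5 T2 by linarith
  qed
  then obtain T' where "T' \<subseteq> T" "card T' = 3" using obtain_subset_with_card_n by metis
  then obtain s1 s2 s3 where s: "s1 \<in> T" "s2 \<in> T" "s3 \<in> T" "s1 \<noteq> s2" "s1 \<noteq> s3" "s2 \<noteq> s3" unfolding card_3_iff by auto
  have TS: "s \<in> lines_in d c" "5 * card {l\<in>F. \<not> meets l s} \<le> card F" if "s \<in> T" for s using that fin(4) unfolding T_def by auto
  \<comment> \<open>If two of them met, three fifths of F would be coplanar with both, hence at most
    d lines.\<close>
  have skew: "\<not> meets s s'" if "s \<in> T" "s' \<in> T" "s \<noteq> s'" for s s'
  proof
    assume m: "meets s s'"
    let ?C = "{l\<in>F. meets l s \<and> meets l s'}"
    have fC: "finite ?C" "?C \<subseteq> lines_in d c" using fin by auto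
    have "card (?C \<union> {s,s'}) \<le> d" by (rule plane_lines_bound[OF TS(1)[OF that(1)] TS(1)[OF that(2)] that(3) m fC]) auto
    moreover have "card ?C \<le> card (?C \<union> {s,s'})" by (rule card_mono) (use fC in auto)
    ultimately have "3 * card F \<le> 5 * d"
      using common_neighbours(2)[OF fin(1,3) TS(2)[OF that(1)] TS(2)[OF that(2)] TS(2)[OF that(2)]] by linarith
    then have "3 * int (card F) \<le> 5 * int d" by linarith
    then show False using Fbig d2 d13 by linarith
  qed
  let ?C = "{l\<in>F. meets l s1 \<and> meets l s2 \<and> meets l s3}"
  have "card ?C \<le> d + 1"
    by (rule three_skew[OF TS(1)[OF s(1)] TS(1)[OF s(2)] TS(1)[OF s(3)] skew[OF s(1,2,4)] skew[OF s(1,3,5)] skew[OF s(2,3,6)]]) (use fin in auto)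
  then have "5 * card ?C \<le> 5 * (d + 1)" by (rule mult_le_mono2)
  with common_neighbours(1)[OF fin(1,3) TS(2)[OF s(1)] TS(2)[OF s(2)] TS(2)[OF s(3)]]
  have "2 * card F \<le> 5 * (d + 1)" by (rule le_trans)
  then have "int (2 * card F) \<le> int (5 * (d + 1))" by (simp only: of_nat_le_iff)
  then have "2 * int (card F) \<le> 5 * int d + 5" by simp
  then show False using Fbig d2 d13 by linarith
qed

end

text \<open>Stated for finite sets of lines, so that finiteness of the set of all lines becomes a
  consequence.\<close>

theorem (in surf) line_count:
  assumes A: "finite A" "A \<subseteq> lines_in d c"
  shows "int (card A) \<le> 11 * int d ^ 2 - 30 * int d + 18"
proof (cases "\<exists>L\<in>A. \<not> second_kind d c L")
  case True
  obtain \<phi> where "supp4 (11*d-24) \<phi>" "\<And>x. Phi d c x = ev (11*d-24) \<phi> x"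
    using is_form_Phi[OF d3, of c] unfolding is_form_def by blast
  then interpret flec d c "11*d-24" \<phi> by unfold_locales auto
  show ?thesis by (rule count_with_first_kind[OF A True])
next
  case False
  show ?thesis
  proof (cases "d = 3")
    case True
    then have "A = {}" using False A(2) no_sec_cubic by blast
    then show ?thesis using True by simp
  next
    case d: False
    then have d4: "d \<ge> 4" using d3 by simp
    have "card A \<le> d * (8 * d - 14)" by (rule R_bound[OF d4 A]) (use False in blast)
    then have "int (card A) \<le> int (d * (8 * d - 14))" by (simp only: of_nat_le_iff)
    also have "\<dots> = 8 * int d ^ 2 - 14 * int d" using d4 by (simp add: power2_eq_square of_nat_diff algebra_simps)
    finally have 1: "int (card A) \<le> 8 * int d ^ 2 - 14 * int d" .
    \<comment> \<open>The product is 3d^2 - 16d + 16, which gives the needed 3d^2 - 16d + 18 >= 0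
      with 2 to spare.\<close>
    have "(int d - 4) * (3 * int d - 4) \<ge> 0" using d4 by simp
    then have "3 * int d ^ 2 - 16 * int d + 16 \<ge> 0" by (simp add: power2_eq_square algebra_simps)
    then show ?thesis using 1 by linarith
  qed
qed

section \<open>The theorem\<close>

definition vec_of :: "'a pt4 \<Rightarrow> 'a^4" where "vec_of x = (case x of (a,b,c,e) \<Rightarrow> v4 a b c e)"

lemma vec_of_inj: "inj vec_of"
proof (rule injI)
  fix x y :: "'a pt4" assume e: "vec_of x = vec_of y"
  obtain a b c d a' b' c' d' where xy: "x = (a,b,c,d)" "y = (a',b',c',d')" by (cases x, cases y) auto
  have "vec_of x $ i = vec_of y $ i" for i using e by simp
  from this[of 1] this[of 2] this[of 3] this[of 4] show "x = y" unfolding xy vec_of_def by simp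
qed
lemma ev_vec_of: "ev d c (vec_of x) = form_eval d c x" by (cases x) (simp add: ev_def vec_of_def)
lemma vec_of_lincomb: "vec_of (lincomb a u b v) = a *s vec_of u + b *s vec_of v"
  by (cases u, cases v, rule v4_eqI) (simp_all add: lincomb_def vec_of_def)
lemma vec_of_zero: "vec_of x = 0 \<longleftrightarrow> x = (0,0,0,0)"
proof -
  have "vec_of (0,0,0,0) = (0::'a^4)" by (rule v4_eqI) (simp_all add: vec_of_def)
  then show ?thesis using vec_of_inj by (metis injD)
qed
lemma vec_of_surj: obtains x where "vec_of x = y" using that[of "(y$1,y$2,y$3,y$4)"] by (simp add: vec_of_def v4_eta)

lemma form_eval_cong: "(\<And>m. m \<in> mons d \<Longrightarrow> c m = c' m) \<Longrightarrow> form_eval d c x = form_eval d c' x"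
  unfolding form_eval_def by (rule sum.cong) simp_all

lemma lines_on_LS:
  fixes c :: "'a::field form4"
  assumes "\<And>m. m \<in> mons d \<Longrightarrow> c m = c' m"
  shows "(\<lambda>L. vec_of ` L) ` lines_on d c \<subseteq> lines_in d c'"
proof
  fix K assume "K \<in> (\<lambda>L. vec_of ` L) ` lines_on d c"
  then obtain L where L: "K = vec_of ` L" "proj_line L" "\<And>x. x \<in> L \<Longrightarrow> form_eval d c x = 0" unfolding lines_on_def by blast
  obtain u v where uv: "\<And>a b. lincomb a u b v = (0,0,0,0) \<Longrightarrow> a = 0 \<and> b = 0" "L = {lincomb a u b v | a b. True}"
    using L(2) unfolding proj_line_def by blast
  have "indep2 (vec_of u) (vec_of v)" unfolding indep2_def vec_of_lincomb[symmetric] vec_of_zero using uv(1) by blast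
  moreover have "K = sp (vec_of u) (vec_of v)" unfolding L(1) uv(2) sp_def vec_of_lincomb[symmetric] by blast
  moreover have "ev d c' y = 0" if "y \<in> K" for y
    using that L(3) form_eval_cong[OF assms] unfolding L(1) by (auto simp: ev_vec_of)
  ultimately show "K \<in> lines_in d c'" unfolding lines_in_def is_line_def by blast
qed

lemma smooth_surface_smooth4:
  fixes c :: "'a::field form4"
  assumes "smooth_surface d c" and d: "d \<ge> 1" and c': "\<And>m. m \<in> mons d \<Longrightarrow> c m = c' m"
  shows "smooth4 d c'"
  unfolding smooth4_def
proof (intro allI impI, rule ccontr)
  fix y :: "'a^4" assume y: "y \<noteq> 0" "ev d c' y = 0" "\<nexists>v. D1 d c' y v \<noteq> 0"
  obtain x where x: "vec_of x = y" using vec_of_surj .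
  have "ev (d - 1) (pd i c') y = 0" for i
  proof -
    have "D1 d c' y (axis i 1) = 0" using y(3) by blast
    then show ?thesis unfolding D1_def axis_def by (simp add: if_distrib[of "\<lambda>a. a * _"] cong: if_cong)
  qed
  then have p: "form_eval (d - 1) (pd i c') x = 0" for i unfolding x[symmetric] ev_vec_of .
  have "form_eval (d-1) (pderiv0 d c) x = form_eval (d-1) (pd 1 c') x" "form_eval (d-1) (pderiv1 d c) x = form_eval (d-1) (pd 2 c') x"
    "form_eval (d-1) (pderiv2 d c) x = form_eval (d-1) (pd 3 c') x" "form_eval (d-1) (pderiv3 d c) x = form_eval (d-1) (pd 4 c') x"
    by (rule form_eval_cong; use d in \<open>auto simp: pd_def pderiv0_def pderiv1_def pderiv2_def pderiv3_def mons_def intro!: c'\<close>)+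
  moreover have "form_eval d c x = 0" using y(2) form_eval_cong[OF c'] unfolding x[symmetric] ev_vec_of by simp
  moreover have "x \<noteq> (0,0,0,0)" using y(1) x vec_of_zero by metis
  ultimately show False using assms(1) p unfolding smooth_surface_def by metis
qed

theorem theorem1p1:
  fixes c :: "'a::alg_closed_field form4" and d :: nat
  assumes "d \<ge> 3"
    and "CHAR('a) = 0 \<or> CHAR('a) > d"
    and "smooth_surface d c"
  shows "finite (lines_on d c) \<and>
         int (card (lines_on d c)) \<le> 11 * int d ^ 2 - 30 * int d + 18"
proof -
  \<comment> \<open>The given coefficients outside degree d are arbitrary; cutting them off changes
    neither the values of the form nor those of its derivatives.\<close>
  define c' where "c' m = (if m \<in> mons d then c m else 0)" for m
  have cc: "m \<in> mons d \<Longrightarrow> c m = c' m" for m by (simp add: c'_def)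
  interpret surf d c'
  proof
    show "supp4 d c'" by (simp add: supp4_def c'_def)
    show "good_char TYPE('a) d" using assms(2) by (simp add: good_char_def)
    show "smooth4 d c'" by (rule smooth_surface_smooth4[OF assms(3) _ cc]) (use assms(1) in simp)
  qed (rule assms(1))
  have inj: "inj_on (\<lambda>L. vec_of ` L) (lines_on d c)" by (rule inj_onI) (simp only: inj_image_eq_iff[OF vec_of_inj])
  have sub: "(\<lambda>L. vec_of ` L) ` lines_on d c \<subseteq> lines_in d c'" by (rule lines_on_LS[OF cc])
  \<comment> \<open>A uniform bound on all finite sets of lines also proves finiteness, since an
    infinite set has finite subsets of every size.\<close>
  have bound: "int (card B) \<le> 11 * int d ^ 2 - 30 * int d + 18" if B: "finite B" "B \<subseteq> lines_on d c" for B
  proof -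
    have "int (card ((\<lambda>L. vec_of ` L) ` B)) \<le> 11 * int d ^ 2 - 30 * int d + 18"
      by (rule line_count) (use B sub in auto)
    then show ?thesis using card_image[OF inj_on_subset[OF inj B(2)]] by simp
  qed
  have "finite (lines_on d c)"
  proof (rule ccontr)
    assume "infinite (lines_on d c)"
    then obtain B where B: "B \<subseteq> lines_on d c" "finite B" "card B = nat (11 * int d ^ 2 - 30 * int d + 18) + 1"
      using infinite_arbitrarily_large by blast
    then show False using bound[OF B(2,1)] by linarith
  qed
  then show ?thesis using bound by blast
qed

end
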